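(* Fix $p\ge2$ and $\boldsymbol\theta_0\in\mathcal S^{p-1}$. Let $(\mathbf V_{0n})$ be a sequence of shape matrices of the form $\mathbf V_{0n}=\lambda_{n1}\boldsymbol\theta_0\boldsymbol\theta_0'+\sum_{j=2}^p\lambda_{nj}\boldsymbol\theta_{nj}\boldsymbol\theta_{nj}'$, where $\boldsymbol\theta_{n2},\dots,\boldsymbol\theta_{np}$ form an orthonormal basis of the orthogonal complement of $\boldsymbol\theta_0$ and $\lambda_{n1}>\lambda_{n2}\ge\dots\ge\lambda_{np}>0$. Then, under $\mathrm P^{(n)}_{\mathbf V_{0n}}$, $T_n(\tilde{\mathbf V}_{0n})=T_n(\mathbf V_{0n})+o_{\mathrm P}(1)$ as $n\to\infty$.
   Context: $\mathcal S^{p-1}$ is the unit sphere of $\mathbb R^p$. A shape matrix is a symmetric positive definite $p\times p$ matrix with trace $p$. $\mathrm P^{(n)}_{\mathbf V}$ denotes the hypothesis under which $\mathbf U_{n1},\dots,\mathbf U_{nn}$ are i.i.d. with the angular Gaussian density $\mathbf u\mapsto \frac{\Gamma(p/2)}{2\pi^{p/2}(\det\mathbf V)^{1/2}}(\mathbf u'\mathbf V^{-1}\mathbf u)^{-p/2}$ on $\mathcal S^{p-1}$ (w.r.t. surface area measure). $\mathbf S_n(\mathbf V):=\frac1n\sum_{i=1}^n\frac{\mathbf V^{-1/2}\mathbf U_{ni}\mathbf U_{ni}'\mathbf V^{-1/2}}{\|\mathbf V^{-1/2}\mathbf U_{ni}\|^2}$ and $T_n(\mathbf V):=np(p+2)\|(\mathbf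 I_p-\boldsymbol\theta_0\boldsymbol\theta_0')\mathbf S_n(\mathbf V)\boldsymbol\theta_0\|^2$. Tyler's M-estimator $\hat{\mathbf V}_n$ is the shape matrix satisfying $\mathbf S_n(\hat{\mathbf V}_n)=\frac1p\mathbf I_p$; write its spectral decomposition $\hat{\mathbf V}_n=\sum_{j=1}^p\hat\lambda_{nj}\hat{\boldsymbol\theta}_{nj}\hat{\boldsymbol\theta}_{nj}'$ with $\hat\lambda_{n1}\ge\dots\ge\hat\lambda_{np}$. Define recursively, for $j=2,\dots,p$, $\tilde{\boldsymbol\theta}_{nj}:=\frac{(\mathbf I_p-\boldsymbol\theta_0\boldsymbol\theta_0'-\sum_{k=2}^{j-1}\tilde{\boldsymbol\theta}_{nk}\tilde{\boldsymbol\theta}_{nk}')\hat{\boldsymbol\theta}_{nj}}{\|(\mathbf I_p-\boldsymbol\theta_0\boldsymbol\theta_0'-\sum_{k=2}^{j-1}\tilde{\boldsymbol\theta}_{nk}\tilde{\boldsymbol\theta}_{nk}')\hat{\boldsymbol\theta}_{nj}\|}$ (Gram–Schmidt), and $\tilde{\mathbf V}_{0n}:=\hat\lambda_{n1}\boldsymbol\theta_0\boldsymbol\theta_0'+\sum_{j=2}^p\hat\lambda_{nj}\tilde{\boldsymbol\theta}_{nj}\tilde{\boldsymbol\theta}_{nj}'$. *)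

theory Defs
  imports "HOL-Probability.Probability"
begin

type_synonym 'p vec = "real ^ 'p"
type_synonym 'p mtx = "real ^ 'p ^ 'p"

definition outer :: "real^'p \<Rightarrow> real^'p \<Rightarrow> real^'p^'p" where
  "outer u v = (\<chi> i j. u $ i * v $ j)"

definition trace_m :: "real^'p^'p \<Rightarrow> real" where
  "trace_m A = (\<Sum>i\<in>UNIV. A $ i $ i)"

definition symmetric_m :: "real^'p^'p \<Rightarrow> bool" where
  "symmetric_m A \<longleftrightarrow> transpose A = A"

definition posdef_m :: "real^'p^'p \<Rightarrow> bool" where
  "posdef_m A \<longleftrightarrow> (\<forall>x. x \<noteq> 0 \<longrightarrow> x \<bullet> (A *v x) > 0)"

definition shape_matrix :: "real^'p^'p \<Rightarrow> bool" where
  "shape_matrix V \<longleftrightarrow> symmetric_m V \<and> posdef_m V \<and> trace_m V = real CARD('p)"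

definition msqrt_inv :: "real^'p^'p \<Rightarrow> real^'p^'p" where
  "msqrt_inv V = (THE R. symmetric_m R \<and> posdef_m R \<and> R ** R = matrix_inv V)"

text \<open>Surface area measure on the unit sphere S^{p-1} (cone-measure construction:
  sigma(A) = p * Lebesgue volume of {x : 0 < |x| <= 1, x/|x| in A}).\<close>
definition sphere_measure :: "(real^'p) measure" where
  "sphere_measure =
     distr (density lborel (\<lambda>x. ennreal (real CARD('p)) * indicator (cball 0 1 - {0}) x))
           borel (\<lambda>x. x /\<^sub>R norm x)"

definition ang_gauss_pdf :: "real^'p^'p \<Rightarrow> real^'p \<Rightarrow> real" where
  "ang_gauss_pdf V u =
     Gamma (real CARD('p) / 2) / (2 * pi powr (real CARD('p) / 2) * sqrt (det V))
     * (u \<bullet> (matrix_inv V *v u)) powr (- real CARD('p) / 2)"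

definition ang_gauss :: "real^'p^'p \<Rightarrow> (real^'p) measure" where
  "ang_gauss V = density sphere_measure (\<lambda>u. ennreal (ang_gauss_pdf V u))"

definition sample_law :: "nat \<Rightarrow> real^'p^'p \<Rightarrow> (nat \<Rightarrow> real^'p) measure" where
  "sample_law n V = PiM {..<n} (\<lambda>_. ang_gauss V)"

definition S_n :: "nat \<Rightarrow> (nat \<Rightarrow> real^'p) \<Rightarrow> real^'p^'p \<Rightarrow> real^'p^'p" where
  "S_n n \<omega> V = (1 / real n) *\<^sub>R
     (\<Sum>i<n. (1 / (norm (msqrt_inv V *v \<omega> i))\<^sup>2) *\<^sub>R
               (msqrt_inv V ** outer (\<omega> i) (\<omega> i) ** msqrt_inv V))"

definition T_n :: "nat \<Rightarrow> real^'p \<Rightarrow> (nat \<Rightarrow> real^'p) \<Rightarrow> real^'p^'p \<Rightarrow> real" where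
  "T_n n \<theta>0 \<omega> V = real n * real CARD('p) * (real CARD('p) + 2)
      * (norm ((mat 1 - outer \<theta>0 \<theta>0) *v (S_n n \<omega> V *v \<theta>0)))\<^sup>2"

definition tyler :: "nat \<Rightarrow> (nat \<Rightarrow> real^'p) \<Rightarrow> real^'p^'p" where
  "tyler n \<omega> = (THE V. shape_matrix V \<and> S_n n \<omega> V = (1 / real CARD('p)) *\<^sub>R mat 1)"

definition is_spectral_dec :: "real^'p^'p \<Rightarrow> (nat \<Rightarrow> real) \<Rightarrow> (nat \<Rightarrow> real^'p) \<Rightarrow> bool" where
  "is_spectral_dec V l t \<longleftrightarrow>
     (\<forall>j\<in>{1..CARD('p)}. \<forall>k\<in>{1..CARD('p)}. t j \<bullet> t k = (if j = k then 1 else 0)) \<and>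
     (\<forall>j\<in>{1..<CARD('p)}. l j \<ge> l (Suc j)) \<and>
     V = (\<Sum>j=1..CARD('p). l j *\<^sub>R outer (t j) (t j))"

definition spec_dec :: "real^'p^'p \<Rightarrow> (nat \<Rightarrow> real) \<times> (nat \<Rightarrow> real^'p)" where
  "spec_dec V = (SOME (l, t). is_spectral_dec V l t)"

text \<open>Gram--Schmidt: gs \<theta>0 t m k gives tilde-theta_k for 2 <= k <= m.\<close>
fun gs :: "real^'p \<Rightarrow> (nat \<Rightarrow> real^'p) \<Rightarrow> nat \<Rightarrow> (nat \<Rightarrow> real^'p)" where
  "gs \<theta>0 t 0 = (\<lambda>_. 0)"
| "gs \<theta>0 t (Suc m) =
     (let s = gs \<theta>0 t m;
          v = (mat 1 - outer \<theta>0 \<theta>0 - (\<Sum>k\<in>{2..<Suc m}. outer (s k) (s k))) *v t (Suc m)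
      in s(Suc m := v /\<^sub>R norm v))"

definition theta_tilde :: "real^'p \<Rightarrow> (nat \<Rightarrow> real^'p) \<Rightarrow> nat \<Rightarrow> real^'p" where
  "theta_tilde \<theta>0 t j = gs \<theta>0 t j j"

definition V_tilde :: "nat \<Rightarrow> real^'p \<Rightarrow> (nat \<Rightarrow> real^'p) \<Rightarrow> real^'p^'p" where
  "V_tilde n \<theta>0 \<omega> =
     (let (l, t) = spec_dec (tyler n \<omega>) in
        l 1 *\<^sub>R outer \<theta>0 \<theta>0 +
        (\<Sum>j=2..CARD('p). l j *\<^sub>R outer (theta_tilde \<theta>0 t j) (theta_tilde \<theta>0 t j)))"

text \<open>Outer probability (avoids measurability issues in o_P(1)).\<close>
definition outer_prob :: "'a measure \<Rightarrow> 'a set \<Rightarrow> real" where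
  "outer_prob M A = Inf {measure M B | B. B \<in> sets M \<and> A \<subseteq> B}"

end

theory Submission imports Defs "HOL-Real_Asymp.Real_Asymp" begin

text \<open>
  Let \<open>H\<close> be the symmetric square root of \<open>V0\<close>. The standardised observations \<open>W i\<close> are i.i.d. uniform on the sphere, so by
  Hoeffding's inequality their empirical second and fourth moments are isotropic up to an error of
  order \<open>1 / sqrt n\<close>, whatever \<open>V0\<close> is. In these coordinates Tyler's equation has (Brouwer) one and, up to
  scaling, only one solution, hence the estimator is proportional to \<open>H (I + E) H\<close> with \<open>E\<close> of order
  \<open>1 / sqrt n\<close> and equal to an explicit linear statistic up to order \<open>1/n\<close>.

  The Gram--Schmidt modification stays close to \<open>V0\<close>, relative to \<open>V0\<close>, unless the leading eigenvector
  of the estimator is nearly orthogonal to \<open>\<theta>0\<close>. In that case a linear statistic of the form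
  \<open>\<Sum>i. (\<theta>0 \<bullet> W i) (x \<bullet> W i)\<close> is much smaller than \<open>\<surd>n\<close>, for a direction \<open>x\<close> that is determined by
  quantities invariant under the sign flips \<open>\<theta>0 \<bullet> W i \<mapsto> - \<theta>0 \<bullet> W i\<close>; as the flips preserve the law of the
  sample, anticoncentration of Rademacher sums makes this improbable.
  Finally, a relative perturbation of size \<open>1 / sqrt n\<close> that has \<open>\<theta>0\<close> as an eigenvector changes the vector
  inside the norm of \<open>T\<^sub>n\<close> only by \<open>O(1/n)\<close>: its first-order effect cancels by isotropy of the fourth
  moments. As that vector is \<open>O(1 / sqrt n)\<close> itself, \<open>T\<^sub>n\<close> changes by a quantity that tends to zero.
\<close>

section \<open>Symmetric and positive definite matrices\<close>

text \<open>No limit of the shape matrices is assumed: the gap \<open>lam n 1 - lam n 2\<close> may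
  vanish and the eigenvalue ratios may blow up at any rate. When the gap itself is within the noise,
  the leading eigenvector of the estimator is inconsistent, and Gram-Schmidt divides by lengths that
  only its alignment with \<theta>0 controls. The threshold \<sigma> for this alignment does not
  depend on the sample size and is chosen after the other constants: misalignment confines a sum of
  n random signs to a window of order \<sigma> sqrt n, so a small \<sigma> makes it improbable. The
  direction of that sum should be the maximiser of a random quadratic form on a hyperplane. A
  maximiser over a finite net replaces it, which keeps the events measurable; the net may be as fine
  as desired because no union bound over it is taken.\<close>

lemma dot_transpose: "((A::real^'n^'n) *v x) \<bullet> y = x \<bullet> (transpose A *v y)"
  by (metis dot_lmul_matrix inner_commute transpose_matrix_vector transpose_transpose)

lemma sym_dot: "symmetric_m A \<Longrightarrow> (A *v x) \<bullet> y = x \<bullet> (A *v y)"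
  by (simp add: dot_transpose symmetric_m_def)

lemma matrix_eq_dot:
  fixes A B :: "real^'n^'n"
  assumes "\<And>x y. x \<bullet> (A *v y) = x \<bullet> (B *v y)"
  shows "A = B"
  by (metis assms matrix_eq vector_eq_rdot inner_commute)

lemma sym_from_dot:
  assumes "\<And>x y. (A *v x) \<bullet> y = x \<bullet> (A *v y)"
  shows "symmetric_m A"
  unfolding symmetric_m_def
  by (rule matrix_eq_dot) (metis assms dot_transpose)

lemma outer_mult: "outer u v *v x = (v \<bullet> x) *\<^sub>R u"
  by (simp add: vec_eq_iff outer_def matrix_vector_mult_def inner_vec_def sum_distrib_right sum_distrib_left mult_ac)

lemma sum_matrix_vector_mult: "(\<Sum>i\<in>I. f i) *v x = (\<Sum>i\<in>I. (f i :: real^'n^'m) *v x)"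
  by (induction I rule: infinite_finite_induct) (auto simp: matrix_vector_mult_add_rdistrib)

lemma scaleR_matrix_vector: "(c *\<^sub>R A) *v x = c *\<^sub>R ((A::real^'n^'m) *v x)"
  by (simp add: scaleR_matrix_vector_assoc)

lemma matrix_vector_scaleR: "(A::real^'n^'m) *v (c *\<^sub>R x) = c *\<^sub>R (A *v x)"
  by (simp add: matrix_vector_mult_scaleR)

lemma norm_matrix_vector_le: "norm ((A::real^'n^'m) *v x) \<le> norm A * norm x"
proof -
  have "(norm (A *v x))\<^sup>2 = (\<Sum>i\<in>UNIV. (A $ i \<bullet> x)\<^sup>2)"
    by (simp add: norm_vec_def L2_set_def sum_nonneg matrix_vector_mul_component)
  also have "\<dots> \<le> (\<Sum>i\<in>UNIV. (norm (A $ i))\<^sup>2 * (norm x)\<^sup>2)"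
    by (intro sum_mono) (metis Cauchy_Schwarz_ineq2 abs_le_square_iff abs_norm_cancel abs_mult power_mult_distrib)
  also have "\<dots> = (norm A * norm x)\<^sup>2"
    by (simp add: norm_vec_def L2_set_def power_mult_distrib sum_distrib_right sum_nonneg)
  finally show ?thesis by (rule power2_le_imp_le) simp
qed

lemma posdef_invertible: "posdef_m A \<Longrightarrow> invertible A"
proof -
  assume "posdef_m A"
  then have "\<forall>x. A *v x = 0 \<longrightarrow> x = 0"
    unfolding posdef_m_def by (metis inner_zero_right less_irrefl)
  then show ?thesis
    by (metis invertible_left_inverse matrix_left_invertible_ker)
qed

lemma matrix_inv_mult:
  assumes "invertible (A::real^'n^'n)"
  shows "A *v (matrix_inv A *v x) = x" "matrix_inv A *v (A *v x) = x"
proof -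
  have "A ** matrix_inv A = mat 1 \<and> matrix_inv A ** A = mat 1"
    unfolding matrix_inv_def using assms unfolding invertible_def by (rule someI_ex)
  then show "A *v (matrix_inv A *v x) = x" "matrix_inv A *v (A *v x) = x"
    by (simp_all add: matrix_vector_mul_assoc)
qed

lemma sym_matrix_inv:
  assumes "symmetric_m A" "invertible A"
  shows "symmetric_m (matrix_inv A)"
  by (rule sym_from_dot) (metis assms matrix_inv_mult sym_dot)

lemma posdef_matrix_inv:
  assumes "symmetric_m A" "posdef_m A"
  shows "posdef_m (matrix_inv A)"
  unfolding posdef_m_def
proof (intro allI impI)
  fix x :: "real^'a" assume "x \<noteq> 0"
  have inv: "invertible A" using assms posdef_invertible by blast
  define y where "y = matrix_inv A *v x"
  have x: "x = A *v y" by (simp add: y_def matrix_inv_mult inv)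
  with \<open>x \<noteq> 0\<close> have "y \<noteq> 0" by auto
  then have "y \<bullet> (A *v y) > 0" using assms by (simp add: posdef_m_def)
  then show "x \<bullet> (matrix_inv A *v x) > 0"
    by (metis x y_def inner_commute)
qed

text \<open>The polynomial a + 2 t b + t^2 c is nonnegative for all t, so its discriminant is not
  positive. The degenerate case c = 0 has no minimiser and is treated apart.\<close>

lemma psd_Cauchy_Schwarz:
  assumes "symmetric_m Q" and psd: "\<And>x. 0 \<le> x \<bullet> (Q *v x)"
  shows "(x \<bullet> (Q *v y))\<^sup>2 \<le> (x \<bullet> (Q *v x)) * (y \<bullet> (Q *v y))"
proof -
  define a b c where "a = x \<bullet> (Q *v x)" and "b = x \<bullet> (Q *v y)" and "c = y \<bullet> (Q *v y)"
  have b': "y \<bullet> (Q *v x) = b" using sym_dot[OF assms(1)] by (metis b_def inner_commute)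
  have exp: "0 \<le> a + 2 * t * b + t\<^sup>2 * c" for t
    using psd[of "x + t *\<^sub>R y"] b'
    by (simp add: a_def b_def c_def matrix_vector_right_distrib matrix_vector_scaleR inner_add_left inner_add_right power2_eq_square algebra_simps)
  have a0: "a \<ge> 0" "c \<ge> 0" using psd by (auto simp: a_def c_def)
  have "b\<^sup>2 \<le> a * c"
  proof (cases "c = 0")
    case True
    show ?thesis
    proof (cases "b = 0")
      case False
      \<comment> \<open>This t makes a + 2 t b equal to -1.\<close>
      then show ?thesis using exp[of "- (a + 1) / (2 * b)"] True a0 by (simp add: field_simps)
    qed (use a0 in auto)
  next
    case False
    then have "c > 0" using a0 by simp
    then show ?thesis using exp[of "- b / c"] by (simp add: field_simps power2_eq_square)
  qed
  then show ?thesis by (simp add: a_def b_def c_def)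
qed

lemma psd_null:
  assumes "symmetric_m Q" "\<And>x. 0 \<le> x \<bullet> (Q *v x)" "x \<bullet> (Q *v x) = 0"
  shows "Q *v x = 0"
proof -
  have "((Q *v x) \<bullet> (Q *v x))\<^sup>2 \<le> 0"
    using psd_Cauchy_Schwarz[OF assms(1,2), of "Q *v x" x] assms(3) by simp
  then show ?thesis by simp
qed

text \<open>For a symmetric matrix the quadratic form controls the bilinear form by polarisation and
  the parallelogram law; testing against the normalised image of x then gives the operator norm.
  This is how relative bounds on forms become bounds on matrices.\<close>

lemma sym_op_bound:
  assumes "symmetric_m A" and q: "\<And>x. \<bar>x \<bullet> (A *v x)\<bar> \<le> d * (norm x)\<^sup>2"
  shows "norm (A *v x) \<le> d * norm x"
proof -
  have d: "d \<ge> 0"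
  proof -
    have "0 \<le> d * (norm (axis undefined 1 :: real^'a))\<^sup>2" using q[of "axis undefined 1"] by linarith
    then show ?thesis by (simp add: norm_axis_1)
  qed
  have bil: "\<bar>y \<bullet> (A *v x)\<bar> \<le> d" if "norm x = 1" "norm y = 1" for x y
  proof -
    have s: "y \<bullet> (A *v x) = x \<bullet> (A *v y)" using sym_dot[OF assms(1)] by (metis inner_commute)
    have "4 * (y \<bullet> (A *v x)) = (x + y) \<bullet> (A *v (x + y)) - (x - y) \<bullet> (A *v (x - y))"
      using s by (simp add: matrix_vector_right_distrib matrix_vector_mult_diff_distrib inner_add_left inner_add_right inner_diff_left inner_diff_right)
    also have "\<bar>\<dots>\<bar> \<le> d * (norm (x + y))\<^sup>2 + d * (norm (x - y))\<^sup>2"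
      using q[of "x + y"] q[of "x - y"] by linarith
    also have "\<dots> = d * (2 * (norm x)\<^sup>2 + 2 * (norm y)\<^sup>2)"
      by (simp add: power2_norm_eq_inner inner_add_left inner_add_right inner_diff_left inner_diff_right inner_commute algebra_simps)
    finally show ?thesis using that by simp
  qed
  show ?thesis
  proof (cases "A *v x = 0")
    case True then show ?thesis using d by simp
  next
    case False
    then have x: "x \<noteq> 0" by auto
    define u v where "u = x /\<^sub>R norm x" and "v = (A *v x) /\<^sub>R norm (A *v x)"
    have "norm u = 1" "norm v = 1" using x False by (auto simp: u_def v_def)
    then have "\<bar>v \<bullet> (A *v u)\<bar> \<le> d" using bil by blast
    moreover have "v \<bullet> (A *v u) = norm (A *v x) / norm x"
      by (simp add: u_def v_def matrix_vector_scaleR divide_inverse power2_norm_eq_inner[symmetric] power2_eq_square False)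
    ultimately show ?thesis using x by (simp add: field_simps)
  qed
qed

section \<open>The spectral theorem by successive maximisation of the Rayleigh quotient\<close>

lemma sym_max_eigenvector:
  fixes A :: "real^'n^'n"
  assumes sym: "symmetric_m A" and S: "subspace S" "S \<noteq> {0}"
    and inv: "\<And>x. x \<in> S \<Longrightarrow> A *v x \<in> S"
  obtains t where "t \<in> S" "norm t = 1" "A *v t = (t \<bullet> (A *v t)) *\<^sub>R t"
    "\<And>x. x \<in> S \<Longrightarrow> x \<bullet> (A *v x) \<le> (t \<bullet> (A *v t)) * (norm x)\<^sup>2"
proof -
  define K where "K = S \<inter> sphere 0 1"
  have "compact K" unfolding K_def by (simp add: closed_Int_compact closed_subspace S(1))
  moreover obtain z where "z \<in> S" "z \<noteq> 0" using S subspace_0 by blast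
  then have "z /\<^sub>R norm z \<in> K" using S(1) by (simp add: K_def subspace_scale)
  then have "K \<noteq> {}" by auto
  moreover have "continuous_on K (\<lambda>x. x \<bullet> (A *v x))"
    by (intro continuous_intros)
  ultimately obtain t where t: "t \<in> K" "\<And>y. y \<in> K \<Longrightarrow> y \<bullet> (A *v y) \<le> t \<bullet> (A *v t)"
    using continuous_attains_sup by metis
  define m where "m = t \<bullet> (A *v t)"
  have le: "x \<bullet> (A *v x) \<le> m * (norm x)\<^sup>2" if "x \<in> S" for x
  proof (cases "x = 0")
    case False
    then have "x /\<^sub>R norm x \<in> K" using S(1) that by (simp add: K_def subspace_scale)
    from t(2)[OF this] False show ?thesis
      by (simp add: m_def matrix_vector_scaleR field_simps power2_eq_square)
  qed simp
  \<comment> \<open>The residual of the eigenvalue equation at the maximiser. It is orthogonal to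
    \<open>t\<close> and lies in \<open>S\<close>, and if it were nonzero then moving from
    \<open>t\<close> to t - c w with small c > 0 would raise the Rayleigh quotient to first order in
    c.\<close>
  define w where "w = m *\<^sub>R t - A *v t"
  have tS: "t \<in> S" and t1: "norm t = 1" using t(1) by (auto simp: K_def)
  have wS: "w \<in> S" unfolding w_def using S(1) tS inv by (simp add: subspace_diff subspace_scale)
  have tt: "t \<bullet> t = 1" using t1 by (simp add: norm_eq_1)
  have mt: "t \<bullet> (A *v t) = m" by (simp add: m_def)
  have wt: "t \<bullet> w = 0" by (simp add: w_def inner_diff_right tt mt)
  have key: "2 * c * (w \<bullet> w) \<le> c\<^sup>2 * (m * (w \<bullet> w) - w \<bullet> (A *v w))" for c
  proof -
    have a: "t + (- c) *\<^sub>R w \<in> S" using S(1) tS wS by (metis subspace_add subspace_scale)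
    have s: "w \<bullet> (A *v t) = t \<bullet> (A *v w)" using sym_dot[OF sym] by (metis inner_commute)
    have wAt: "w \<bullet> (A *v t) = - (w \<bullet> w)"
    proof -
      have "A *v t = m *\<^sub>R t - w" by (simp add: w_def)
      then show ?thesis using wt by (simp add: inner_diff_right inner_commute)
    qed
    have e1: "(t + (- c) *\<^sub>R w) \<bullet> (A *v (t + (- c) *\<^sub>R w)) = m + 2 * c * (w \<bullet> w) + c\<^sup>2 * (w \<bullet> (A *v w))"
    proof -
      have "(t + (- c) *\<^sub>R w) \<bullet> (A *v (t + (- c) *\<^sub>R w))
          = t \<bullet> (A *v t) - c * (t \<bullet> (A *v w)) - c * (w \<bullet> (A *v t)) + c * c * (w \<bullet> (A *v w))"
        by (simp only: matrix_vector_right_distrib matrix_vector_scaleR inner_add_left inner_add_right inner_scaleR_left inner_scaleR_right) (simp add: algebra_simps)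
      then show ?thesis unfolding s[symmetric] wAt mt by (simp add: power2_eq_square algebra_simps)
    qed
    have e2: "(norm (t + (- c) *\<^sub>R w))\<^sup>2 = 1 + c\<^sup>2 * (w \<bullet> w)"
    proof -
      have "(norm (t + (- c) *\<^sub>R w))\<^sup>2 = t \<bullet> t - 2 * c * (t \<bullet> w) + c\<^sup>2 * (w \<bullet> w)"
        unfolding power2_norm_eq_inner
        by (simp only: inner_add_left inner_add_right inner_scaleR_left inner_scaleR_right inner_commute[of w t]) (simp add: algebra_simps power2_eq_square)
      then show ?thesis using tt wt by simp
    qed
    show ?thesis using le[OF a] unfolding e1 e2 by (simp add: algebra_simps)
  qed
  have "w \<bullet> w = 0"
  proof (rule ccontr)
    assume ne: "w \<bullet> w \<noteq> 0"
    define a b where "a = w \<bullet> w" and "b = m * (w \<bullet> w) - w \<bullet> (A *v w)"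
    have a: "a > 0" using ne by (simp add: a_def)
    have k: "2 * c * a \<le> c\<^sup>2 * b" for c using key[of c] by (simp add: a_def b_def)
    show False
    proof (cases "b \<le> 0")
      case True then show False using k[of 1] a by simp
    next
      case False then show False using k[of "a / b"] a by (simp add: field_simps power2_eq_square)
    qed
  qed
  then have "A *v t = m *\<^sub>R t" by (simp add: w_def)
  then show ?thesis using that tS t1 le by (simp add: m_def)
qed

lemma orthonormal_inj_on:
  fixes t :: "nat \<Rightarrow> real^'n"
  assumes "\<forall>j\<in>I. \<forall>k\<in>I. t j \<bullet> t k = (if j = k then 1 else 0)"
  shows "inj_on t I"
  by (rule inj_onI) (metis assms zero_neq_one)

lemma orthonormal_expansion:
  fixes t :: "nat \<Rightarrow> real^'n"
  assumes I: "finite I" "card I = CARD('n)"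
    and on: "\<forall>j\<in>I. \<forall>k\<in>I. t j \<bullet> t k = (if j = k then 1 else 0)"
  shows "x = (\<Sum>j\<in>I. (t j \<bullet> x) *\<^sub>R t j)"
proof -
  define y where "y = x - (\<Sum>j\<in>I. (t j \<bullet> x) *\<^sub>R t j)"
  have yt: "t k \<bullet> y = 0" if "k \<in> I" for k
  proof -
    have "t k \<bullet> (\<Sum>j\<in>I. (t j \<bullet> x) *\<^sub>R t j) = (\<Sum>j\<in>I. if j = k then t j \<bullet> x else 0)"
      unfolding inner_sum_right using on that by (intro sum.cong) auto
    then show ?thesis using I that by (simp add: y_def inner_diff_right sum.delta)
  qed
  have inj: "inj_on t I" using on by (rule orthonormal_inj_on)
  have "t j \<noteq> 0" if "j \<in> I" for j using on that by fastforce
  then have ind: "independent (t ` I)"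
    by (intro pairwise_orthogonal_independent)
      (use on in \<open>auto simp: pairwise_def orthogonal_def\<close>)
  have "UNIV \<subseteq> span (t ` I)"
    using card_eq_dim[of "t ` I" UNIV] ind inj I by (simp add: card_image)
  then have "y \<in> span (t ` I)" by blast
  then have "orthogonal y y"
    by (rule orthogonal_to_span) (use yt in \<open>auto simp: orthogonal_def inner_commute\<close>)
  then show ?thesis by (simp add: y_def orthogonal_def)
qed

lemma orthonormal_complement_nonzero:
  fixes t :: "nat \<Rightarrow> real^'n"
  assumes "k < CARD('n)"
  obtains x where "x \<noteq> 0" "\<forall>j\<in>{1..k}. t j \<bullet> x = 0"
proof -
  have "dim (t ` {1..k}) \<le> k"
    by (metis card_atLeastAtMost card_image_le diff_Suc_1 dim_le_card' finite_atLeastAtMost finite_imageI le_trans)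
  then have "dim (t ` {1..k}) < DIM(real^'n)" using assms by simp
  then obtain x where "x \<noteq> 0" "\<And>y. y \<in> span (t ` {1..k}) \<Longrightarrow> orthogonal x y"
    using orthogonal_to_subspace_exists by metis
  then have "\<forall>j\<in>{1..k}. t j \<bullet> x = 0" by (metis imageI inner_commute orthogonal_def span_base)
  then show ?thesis using that \<open>x \<noteq> 0\<close> by blast
qed

text \<open>Induction on the number of eigenvectors found. The last clause, that the newest
  eigenvalue dominates the form on the complement of its predecessors, is carried along because it
  gives the decreasing order at the next step.\<close>

lemma spectral_partial:
  fixes A :: "real^'n^'n"
  assumes sym: "symmetric_m A" and "k \<le> CARD('n)"
  shows "\<exists>l t. (\<forall>i\<in>{1..k}. \<forall>j\<in>{1..k}. t i \<bullet> t j = (if i = j then 1 else 0))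
     \<and> (\<forall>j\<in>{1..<k}. l j \<ge> l (Suc j)) \<and> (\<forall>j\<in>{1..k}. A *v t j = l j *\<^sub>R t j)
     \<and> (k \<ge> 1 \<longrightarrow> (\<forall>x. (\<forall>j\<in>{1..<k}. t j \<bullet> x = 0) \<longrightarrow> x \<bullet> (A *v x) \<le> l k * (norm x)\<^sup>2))"
  using assms(2)
proof (induction k)
  case 0
  show ?case by simp
next
  case (Suc k)
  then obtain l t where on: "\<forall>i\<in>{1..k}. \<forall>j\<in>{1..k}. t i \<bullet> t j = (if i = j then 1 else 0)"
    and dec: "\<forall>j\<in>{1..<k}. l j \<ge> l (Suc j)" and eig: "\<forall>j\<in>{1..k}. A *v t j = l j *\<^sub>R t j"
    and mx: "k \<ge> 1 \<longrightarrow> (\<forall>x. (\<forall>j\<in>{1..<k}. t j \<bullet> x = 0) \<longrightarrow> x \<bullet> (A *v x) \<le> l k * (norm x)\<^sup>2)"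
    by auto
  define S where "S = {x. \<forall>j\<in>{1..k}. t j \<bullet> x = 0}"
  have sub: "subspace S"
    by (auto simp: S_def subspace_def inner_add_right)
  have ne: "S \<noteq> {0}"
    using orthonormal_complement_nonzero[of k t] Suc.prems by (auto simp: S_def)
  have inv: "A *v x \<in> S" if "x \<in> S" for x
    unfolding S_def
  proof (safe)
    fix j assume j: "j \<in> {1..k}"
    have "t j \<bullet> (A *v x) = (A *v t j) \<bullet> x" by (simp add: sym_dot[OF sym])
    also have "\<dots> = l j * (t j \<bullet> x)" using eig j by simp
    also have "\<dots> = 0" using that j by (simp add: S_def)
    finally show "t j \<bullet> (A *v x) = 0" .
  qed
  obtain u where u: "u \<in> S" "norm u = 1" "A *v u = (u \<bullet> (A *v u)) *\<^sub>R u"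
    "\<And>x. x \<in> S \<Longrightarrow> x \<bullet> (A *v x) \<le> (u \<bullet> (A *v u)) * (norm x)\<^sup>2"
    using sym_max_eigenvector[OF sym sub ne inv] by metis
  define t' where "t' = t(Suc k := u)"
  define l' where "l' = l(Suc k := u \<bullet> (A *v u))"
  have tu: "t j \<bullet> u = 0" "u \<bullet> t j = 0" if "j \<in> {1..k}" for j
    using u(1) that by (auto simp: S_def inner_commute)
  have uu: "u \<bullet> u = 1" using u(2) by (simp add: norm_eq_1)
  have "\<forall>i\<in>{1..Suc k}. \<forall>j\<in>{1..Suc k}. t' i \<bullet> t' j = (if i = j then 1 else 0)"
    using on tu uu by (auto simp: t'_def le_Suc_eq)
  moreover have "\<forall>j\<in>{1..<Suc k}. l' j \<ge> l' (Suc j)"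
  proof
    fix j assume j: "j \<in> {1..<Suc k}"
    show "l' j \<ge> l' (Suc j)"
    proof (cases "j = k")
      case True
      then have "k \<ge> 1" using j by simp
      moreover have "\<forall>j\<in>{1..<k}. t j \<bullet> u = 0" using u(1) by (auto simp: S_def)
      ultimately have "u \<bullet> (A *v u) \<le> l k * (norm u)\<^sup>2" using mx by blast
      then have "u \<bullet> (A *v u) \<le> l k" using u(2) by simp
      then show ?thesis using True by (simp add: l'_def)
    qed (use j dec in \<open>auto simp: l'_def\<close>)
  qed
  moreover have "\<forall>j\<in>{1..Suc k}. A *v t' j = l' j *\<^sub>R t' j"
    using eig u(3) by (auto simp: t'_def l'_def le_Suc_eq)
  moreover have "Suc k \<ge> 1 \<longrightarrow> (\<forall>x. (\<forall>j\<in>{1..<Suc k}. t' j \<bullet> x = 0) \<longrightarrow> x \<bullet> (A *v x) \<le> l' (Suc k) * (norm x)\<^sup>2)"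
  proof (intro impI allI)
    fix x assume x: "\<forall>j\<in>{1..<Suc k}. t' j \<bullet> x = 0"
    have "t j \<bullet> x = 0" if "j \<in> {1..k}" for j
    proof -
      have "t' j \<bullet> x = 0" "t' j = t j" using that x by (auto simp: t'_def)
      then show ?thesis by simp
    qed
    then have "x \<in> S" by (auto simp: S_def)
    then show "x \<bullet> (A *v x) \<le> l' (Suc k) * (norm x)\<^sup>2" using u(4) by (simp add: l'_def)
  qed
  ultimately show ?case by blast
qed

lemma matrix_from_eigenbasis:
  fixes A :: "real^'n^'n" and t :: "nat \<Rightarrow> real^'n"
  assumes I: "finite I" "card I = CARD('n)"
    and on: "\<forall>j\<in>I. \<forall>k\<in>I. t j \<bullet> t k = (if j = k then 1 else 0)"
    and eig: "\<forall>j\<in>I. A *v t j = l j *\<^sub>R t j"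
  shows "A = (\<Sum>j\<in>I. l j *\<^sub>R outer (t j) (t j))"
proof (subst matrix_eq, rule)
  fix x
  have "A *v x = A *v (\<Sum>j\<in>I. (t j \<bullet> x) *\<^sub>R t j)"
    using orthonormal_expansion[OF I on, of x] by simp
  also have "\<dots> = (\<Sum>j\<in>I. (t j \<bullet> x) *\<^sub>R (l j *\<^sub>R t j))"
    using eig by (simp add: linear_sum[OF matrix_vector_mul_linear] matrix_vector_scaleR)
  also have "\<dots> = (\<Sum>j\<in>I. l j *\<^sub>R outer (t j) (t j)) *v x"
    by (simp add: sum_matrix_vector_mult scaleR_matrix_vector outer_mult mult.commute)
  finally show "A *v x = \<dots>" .
qed

lemma spectral_eigen:
  fixes t :: "nat \<Rightarrow> real^'n"
  assumes I: "finite I" and on: "\<forall>j\<in>I. \<forall>k\<in>I. t j \<bullet> t k = (if j = k then 1 else 0)" and j: "j \<in> I"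
  shows "(\<Sum>j\<in>I. l j *\<^sub>R outer (t j) (t j)) *v t j = l j *\<^sub>R t j"
proof -
  have "(\<Sum>j\<in>I. l j *\<^sub>R outer (t j) (t j)) *v t j = (\<Sum>k\<in>I. if k = j then l j *\<^sub>R t j else 0)"
    unfolding sum_matrix_vector_mult scaleR_matrix_vector outer_mult
    by (intro sum.cong refl) (use on j in auto)
  then show ?thesis using I j by simp
qed

lemma symmetric_outer: "symmetric_m (\<Sum>j\<in>I. l j *\<^sub>R outer (t j) (t j))"
  by (rule sym_from_dot)
    (simp add: sum_matrix_vector_mult scaleR_matrix_vector outer_mult inner_sum_left inner_sum_right inner_commute mult_ac)

lemma spectral_dec_exists:
  fixes A :: "real^'n^'n"
  assumes "symmetric_m A"
  shows "\<exists>l t. is_spectral_dec A l t"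
proof -
  obtain l and t :: "nat \<Rightarrow> real^'n" where
    on: "\<forall>i\<in>{1..CARD('n)}. \<forall>j\<in>{1..CARD('n)}. t i \<bullet> t j = (if i = j then 1 else 0)"
    and dec: "\<forall>j\<in>{1..<CARD('n)}. l j \<ge> l (Suc j)" and eig: "\<forall>j\<in>{1..CARD('n)}. A *v t j = l j *\<^sub>R t j"
    using spectral_partial[OF assms, of "CARD('n)"] by auto
  have "A = (\<Sum>j=1..CARD('n). l j *\<^sub>R outer (t j) (t j))"
    by (rule matrix_from_eigenbasis) (use on eig in auto)
  then show ?thesis unfolding is_spectral_dec_def using on dec by blast
qed

lemma spectral_quadratic:
  fixes t :: "nat \<Rightarrow> real^'n"
  shows "x \<bullet> ((\<Sum>j\<in>I. l j *\<^sub>R outer (t j) (t j)) *v x) = (\<Sum>j\<in>I. l j * (t j \<bullet> x)\<^sup>2)"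
  by (simp add: sum_matrix_vector_mult scaleR_matrix_vector outer_mult inner_sum_right power2_eq_square inner_commute mult_ac)

lemma orthonormal_norm:
  fixes t :: "nat \<Rightarrow> real^'n"
  assumes I: "finite I" "card I = CARD('n)"
    and on: "\<forall>j\<in>I. \<forall>k\<in>I. t j \<bullet> t k = (if j = k then 1 else 0)"
  shows "x \<bullet> y = (\<Sum>j\<in>I. (t j \<bullet> x) * (t j \<bullet> y))"
proof -
  have "x \<bullet> y = x \<bullet> (\<Sum>j\<in>I. (t j \<bullet> y) *\<^sub>R t j)"
    using orthonormal_expansion[OF I on, of y] by simp
  then show ?thesis by (simp add: inner_sum_right inner_commute mult.commute)
qed

section \<open>Square roots of positive definite matrices\<close>

lemma posdef_sqrt_unique:
  fixes R Q :: "real^'n^'n"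
  assumes R: "symmetric_m R" "posdef_m R" and Q: "symmetric_m Q" "posdef_m Q" and eq: "R ** R = Q ** Q"
  shows "R = Q"
proof -
  define D where "D = R - Q"
  have D: "symmetric_m D"
    by (rule sym_from_dot) (simp add: D_def matrix_vector_mult_diff_rdistrib inner_diff_left inner_diff_right sym_dot R Q)
  have e2: "R *v (R *v x) = Q *v (Q *v x)" for x
    by (simp add: eq matrix_vector_mul_assoc)
  have DR: "D *v (R *v x) = - (Q *v (D *v x))" for x
    by (simp add: D_def matrix_vector_mult_diff_rdistrib matrix_vector_mult_diff_distrib e2)
  \<comment> \<open>D R = - Q D follows from R^2 = Q^2. Evaluating t . D R t in both ways at an
    eigenvector t of D with eigenvalue m gives m (t . R t + t . Q t) = 0, where the bracket is
    positive.\<close>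
  have z: "m = 0" if t: "D *v t = m *\<^sub>R t" "norm t = 1" for m t
  proof -
    have "t \<bullet> (D *v (R *v t)) = m * (t \<bullet> (R *v t))"
      by (metis D sym_dot t(1) inner_scaleR_left)
    moreover have "t \<bullet> (D *v (R *v t)) = - m * (t \<bullet> (Q *v t))"
      by (simp add: DR t matrix_vector_scaleR)
    ultimately have "m * (t \<bullet> (R *v t) + t \<bullet> (Q *v t)) = 0" by (simp add: algebra_simps)
    moreover have "t \<noteq> 0" using t(2) by auto
    then have "t \<bullet> (R *v t) > 0" "t \<bullet> (Q *v t) > 0" using R Q by (auto simp: posdef_m_def)
    ultimately show ?thesis by auto
  qed
  obtain l and t :: "nat \<Rightarrow> real^'n" where
    on: "\<forall>i\<in>{1..CARD('n)}. \<forall>j\<in>{1..CARD('n)}. t i \<bullet> t j = (if i = j then 1 else 0)"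
    and D_eq: "D = (\<Sum>j=1..CARD('n). l j *\<^sub>R outer (t j) (t j))"
    using spectral_dec_exists[OF D] unfolding is_spectral_dec_def by blast
  have "l j = 0" if "j \<in> {1..CARD('n)}" for j
  proof (rule z)
    show "D *v t j = l j *\<^sub>R t j" unfolding D_eq by (rule spectral_eigen) (use on that in auto)
    have "t j \<bullet> t j = 1" using on that by auto
    then show "norm (t j) = 1" by (simp add: norm_eq_1)
  qed
  then have "D = 0" unfolding D_eq by simp
  then show ?thesis by (simp add: D_def)
qed

lemma posdef_sqrt_exists:
  fixes A :: "real^'n^'n"
  assumes A: "symmetric_m A" "posdef_m A"
  shows "\<exists>R. symmetric_m R \<and> posdef_m R \<and> R ** R = A"
proof -
  obtain l and t :: "nat \<Rightarrow> real^'n" where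
    on: "\<forall>i\<in>{1..CARD('n)}. \<forall>j\<in>{1..CARD('n)}. t i \<bullet> t j = (if i = j then 1 else 0)"
    and A_eq: "A = (\<Sum>j=1..CARD('n). l j *\<^sub>R outer (t j) (t j))"
    using spectral_dec_exists[OF A(1)] unfolding is_spectral_dec_def by blast
  have tt: "t j \<bullet> t j = 1" if "j \<in> {1..CARD('n)}" for j using on that by auto
  have Aj: "A *v t j = l j *\<^sub>R t j" if "j \<in> {1..CARD('n)}" for j
    unfolding A_eq by (rule spectral_eigen) (use on that in auto)
  have lp: "l j > 0" if "j \<in> {1..CARD('n)}" for j
  proof -
    have "t j \<noteq> 0" using tt[OF that] by auto
    then have "t j \<bullet> (A *v t j) > 0" using A(2) by (simp add: posdef_m_def)
    then show ?thesis using tt[OF that] Aj[OF that] by simp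
  qed
  define R where "R = (\<Sum>j=1..CARD('n). sqrt (l j) *\<^sub>R outer (t j) (t j))"
  have Rj: "R *v t j = sqrt (l j) *\<^sub>R t j" if "j \<in> {1..CARD('n)}" for j
    unfolding R_def by (rule spectral_eigen) (use on that in auto)
  have "symmetric_m R" unfolding R_def by (rule symmetric_outer)
  moreover have "posdef_m R"
    unfolding posdef_m_def
  proof (intro allI impI)
    fix x :: "real^'n" assume "x \<noteq> 0"
    have nn: "x \<bullet> x = (\<Sum>j=1..CARD('n). (t j \<bullet> x) * (t j \<bullet> x))"
      by (rule orthonormal_norm) (use on in auto)
    have "\<exists>j\<in>{1..CARD('n)}. t j \<bullet> x \<noteq> 0"
    proof (rule ccontr)
      assume "\<not> ?thesis"
      then have "x \<bullet> x = 0" unfolding nn by simp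
      then show False using \<open>x \<noteq> 0\<close> by simp
    qed
    then obtain j where j: "j \<in> {1..CARD('n)}" "t j \<bullet> x \<noteq> 0" by blast
    have "0 < sqrt (l j) * (t j \<bullet> x)\<^sup>2" using j lp by simp
    also have "\<dots> \<le> (\<Sum>j=1..CARD('n). sqrt (l j) * (t j \<bullet> x)\<^sup>2)"
      by (rule member_le_sum) (use j lp in \<open>auto simp: less_imp_le\<close>)
    finally show "0 < x \<bullet> (R *v x)" unfolding R_def spectral_quadratic .
  qed
  moreover have "R ** R = A"
    unfolding A_eq
  proof (rule matrix_from_eigenbasis)
    show "\<forall>j\<in>{1..CARD('n)}. (R ** R) *v t j = l j *\<^sub>R t j"
      by (auto simp: matrix_vector_mul_assoc[symmetric] Rj matrix_vector_scaleR lp less_imp_le)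
  qed (use on in auto)
  ultimately show ?thesis by blast
qed

text \<open>Existence and uniqueness of the positive root give meaning to the definite description
  behind \<open>msqrt_inv\<close>.\<close>

lemma msqrt_inv_props:
  fixes V :: "real^'n^'n"
  assumes V: "symmetric_m V" "posdef_m V"
  shows "symmetric_m (msqrt_inv V)" "posdef_m (msqrt_inv V)" "msqrt_inv V ** msqrt_inv V = matrix_inv V"
proof -
  have "symmetric_m (matrix_inv V)" "posdef_m (matrix_inv V)"
    using V sym_matrix_inv posdef_matrix_inv posdef_invertible by auto
  then have "\<exists>!R. symmetric_m R \<and> posdef_m R \<and> R ** R = matrix_inv V"
    using posdef_sqrt_exists[of "matrix_inv V"] posdef_sqrt_unique by (metis (no_types, lifting))
  from theI'[OF this] show "symmetric_m (msqrt_inv V)" "posdef_m (msqrt_inv V)" "msqrt_inv V ** msqrt_inv V = matrix_inv V"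
    unfolding msqrt_inv_def by auto
qed

section \<open>The angular Gaussian law\<close>

lemma measurable_matrix_vector[measurable]: "(\<lambda>x. (A::real^'n^'m) *v x) \<in> borel_measurable borel"
  by (intro borel_measurable_continuous_onI continuous_intros)

section \<open>Linear changes of variables for the Lebesgue integral\<close>

lemma nn_integral_lborel_translate:
  fixes f :: "'a::euclidean_space \<Rightarrow> ennreal"
  assumes [measurable]: "f \<in> borel_measurable borel"
  shows "(\<integral>\<^sup>+x. f (a + x) \<partial>lborel) = (\<integral>\<^sup>+x. f x \<partial>lborel)"
proof -
  have "(\<integral>\<^sup>+x. f x \<partial>lborel) = (\<integral>\<^sup>+x. f x \<partial>(distr lborel borel ((+) a)))"
    using lborel_distr_plus[of a] by simp
  then show ?thesis by (simp add: nn_integral_distr)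
qed

lemma invertible_inverse_mult:
  assumes "invertible (A::real^'n^'n)"
  obtains B where "A ** B = mat 1" "B ** A = mat 1" "invertible B" "\<And>x. A *v (B *v x) = x" "\<And>x. B *v (A *v x) = x"
proof -
  obtain B where "A ** B = mat 1" "B ** A = mat 1" using assms unfolding invertible_def by blast
  moreover then have "invertible B" unfolding invertible_def by blast
  ultimately show ?thesis using that by (simp add: matrix_vector_mul_assoc)
qed

text \<open>Up to a constant, Lebesgue measure is the only translation-invariant measure; Fubini applied
  to the pushforward under A, tested against the ball, identifies that constant.\<close>
lemma nn_integral_linear_ball:
  fixes A :: "real^'n^'n"
  assumes A: "invertible A" and [measurable]: "f \<in> borel_measurable borel"
  shows "(\<integral>\<^sup>+x. f (A *v x) \<partial>lborel) * emeasure lborel (cball (0::real^'n) 1)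
     = (\<integral>\<^sup>+x. f x \<partial>lborel) * emeasure lborel {x. norm (A *v x) \<le> 1}"
proof -
  obtain B where B: "\<And>x. A *v (B *v x) = x" "\<And>x. B *v (A *v x) = x"
    using A invertible_inverse_mult by metis
  define g :: "real^'n \<Rightarrow> ennreal" where "g = indicator (cball 0 1)"
  have [measurable]: "g \<in> borel_measurable borel" unfolding g_def by (intro borel_measurable_indicator) simp
  have gm: "g (- x) = g x" for x by (simp add: g_def indicator_def)
  have inv: "(\<integral>\<^sup>+x. h (A *v x + y) \<partial>lborel) = (\<integral>\<^sup>+x. h (A *v x) \<partial>lborel)"
    if [measurable]: "h \<in> borel_measurable borel" for h :: "real^'n \<Rightarrow> ennreal" and y
  proof -
    have "(\<integral>\<^sup>+x. h (A *v x + y) \<partial>lborel) = (\<integral>\<^sup>+x. h (A *v (B *v y + x)) \<partial>lborel)"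
      by (simp add: matrix_vector_right_distrib B add.commute)
    also have "\<dots> = (\<integral>\<^sup>+x. h (A *v x) \<partial>lborel)"
      by (rule nn_integral_lborel_translate) simp
    finally show ?thesis .
  qed
  have [measurable]: "(\<lambda>(x, y). f (A *v x + y) * g y) \<in> borel_measurable (borel \<Otimes>\<^sub>M borel)"
    by (simp add: split_beta)
  have [measurable]: "(\<lambda>(x, y). f y * g (y - A *v x)) \<in> borel_measurable (borel \<Otimes>\<^sub>M borel)"
    by (simp add: split_beta)
  have "(\<integral>\<^sup>+x. f (A *v x) \<partial>lborel) * (\<integral>\<^sup>+y. g y \<partial>lborel) = (\<integral>\<^sup>+y. (\<integral>\<^sup>+x. f (A *v x + y) * g y \<partial>lborel) \<partial>lborel)"
    by (simp add: inv nn_integral_cmult nn_integral_multc mult.commute)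
  also have "\<dots> = (\<integral>\<^sup>+x. (\<integral>\<^sup>+y. f (A *v x + y) * g y \<partial>lborel) \<partial>lborel)"
    by (rule lborel_pair.Fubini'[symmetric]) simp
  also have "\<dots> = (\<integral>\<^sup>+x. (\<integral>\<^sup>+y. f y * g (y - A *v x) \<partial>lborel) \<partial>lborel)"
  proof (rule nn_integral_cong)
    fix x
    show "(\<integral>\<^sup>+y. f (A *v x + y) * g y \<partial>lborel) = (\<integral>\<^sup>+y. f y * g (y - A *v x) \<partial>lborel)"
      using nn_integral_lborel_translate[of "\<lambda>y. f y * g (y - A *v x)" "A *v x"] by simp
  qed
  also have "\<dots> = (\<integral>\<^sup>+y. (\<integral>\<^sup>+x. f y * g (y - A *v x) \<partial>lborel) \<partial>lborel)"
    by (rule lborel_pair.Fubini') simp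
  also have "\<dots> = (\<integral>\<^sup>+y. f y * (\<integral>\<^sup>+x. g (A *v x) \<partial>lborel) \<partial>lborel)"
  proof (rule nn_integral_cong)
    fix y
    have "(\<integral>\<^sup>+x. f y * g (y - A *v x) \<partial>lborel) = f y * (\<integral>\<^sup>+x. g (y - A *v x) \<partial>lborel)"
      by (simp add: nn_integral_cmult)
    also have "(\<integral>\<^sup>+x. g (y - A *v x) \<partial>lborel) = (\<integral>\<^sup>+x. g (A *v x + (- y)) \<partial>lborel)"
      by (subst gm[symmetric]) (simp add: algebra_simps)
    finally show "(\<integral>\<^sup>+x. f y * g (y - A *v x) \<partial>lborel) = f y * (\<integral>\<^sup>+x. g (A *v x) \<partial>lborel)"
      using inv[of g "- y"] by simp
  qed
  also have "\<dots> = (\<integral>\<^sup>+y. f y \<partial>lborel) * (\<integral>\<^sup>+x. g (A *v x) \<partial>lborel)"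
    by (simp add: nn_integral_multc)
  also have "(\<integral>\<^sup>+x. g (A *v x) \<partial>lborel) = emeasure lborel {x. norm (A *v x) \<le> 1}"
  proof -
    have "(\<lambda>x. g (A *v x)) = indicator {x. norm (A *v x) \<le> 1}" by (auto simp: g_def indicator_def)
    then show ?thesis by simp
  qed
  also have "(\<integral>\<^sup>+y. g y \<partial>lborel) = emeasure lborel (cball (0::real^'n) 1)" by (simp add: g_def)
  finally show ?thesis .
qed

text \<open>The factor is the volume of the preimage of the unit ball divided by the volume of the
  ball. It is finite because the inverse map is bounded, and it is 1 for an isometry because the
  preimage is then the ball itself. The link with the determinant is established later, one type of
  matrix at a time.\<close>

lemma nn_integral_linear_const:
  fixes A :: "real^'n^'n"
  assumes A: "invertible A"
  obtains c where "c \<ge> 0"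
    "\<And>f. f \<in> borel_measurable borel \<Longrightarrow> (\<integral>\<^sup>+x. f (A *v x) \<partial>lborel) = ennreal c * (\<integral>\<^sup>+x. f x \<partial>lborel)"
    "(\<And>x. norm (A *v x) = norm x) \<Longrightarrow> c = 1"
proof -
  define v where "v = unit_ball_vol (DIM(real^'n))"
  have v: "v > 0" by (simp add: v_def)
  have e: "emeasure lborel (cball (0::real^'n) 1) = ennreal v"
    using emeasure_cball[of 1 "0::real^'n"] by (simp add: v_def)
  obtain B where B: "\<And>x. A *v (B *v x) = x" "\<And>x. B *v (A *v x) = x"
    using A invertible_inverse_mult by metis
  have "{x. norm (A *v x) \<le> 1} \<subseteq> (\<lambda>x. B *v x) ` cball 0 1"
  proof
    fix x assume "x \<in> {x. norm (A *v x) \<le> 1}"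
    then show "x \<in> (\<lambda>x. B *v x) ` cball 0 1" by (intro image_eqI[of _ _ "A *v x"]) (auto simp: B)
  qed
  moreover have "bounded ((\<lambda>x. B *v x) ` cball 0 1)"
    by (intro bounded_linear_image) auto
  ultimately have "bounded {x. norm (A *v x) \<le> 1}" using bounded_subset by blast
  then have fin: "emeasure lborel {x. norm (A *v x) \<le> 1} < \<infinity>" by (rule emeasure_bounded_finite)
  define m where "m = measure lborel {x. norm (A *v x) \<le> 1}"
  have m: "emeasure lborel {x. norm (A *v x) \<le> 1} = ennreal m"
    using fin by (simp add: m_def emeasure_eq_ennreal_measure less_top)
  have m0: "m \<ge> 0" by (simp add: m_def)
  show ?thesis
  proof (rule that[of "m / v"])
    show "m / v \<ge> 0" using m0 v by simp
    fix f :: "real^'n \<Rightarrow> ennreal" assume f: "f \<in> borel_measurable borel"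
    have "(\<integral>\<^sup>+x. f (A *v x) \<partial>lborel) * ennreal v * ennreal (1 / v) = (\<integral>\<^sup>+x. f x \<partial>lborel) * ennreal m * ennreal (1 / v)"
      using nn_integral_linear_ball[OF A f] by (simp add: e m)
    then show "(\<integral>\<^sup>+x. f (A *v x) \<partial>lborel) = ennreal (m / v) * (\<integral>\<^sup>+x. f x \<partial>lborel)"
    proof -
      assume a: "(\<integral>\<^sup>+x. f (A *v x) \<partial>lborel) * ennreal v * ennreal (1 / v) = (\<integral>\<^sup>+x. f x \<partial>lborel) * ennreal m * ennreal (1 / v)"
      have "ennreal v * ennreal (1 / v) = 1" "ennreal m * ennreal (1 / v) = ennreal (m / v)"
        using v m0 by (simp_all add: ennreal_mult[symmetric])
      then show ?thesis using a by (simp add: mult.assoc) (simp add: mult.commute)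
    qed
  next
    assume n: "\<And>x. norm (A *v x) = norm x"
    have "{x. norm (A *v x) \<le> 1} = cball 0 1" by (auto simp: n)
    then have "ennreal m = ennreal v" using m e by simp
    then show "m / v = 1" using v m0 by (simp add: ennreal_inj)
  qed
qed

lemma nn_integral_orthogonal:
  fixes A :: "real^'n^'n"
  assumes "\<And>x. norm (A *v x) = norm x" and f: "f \<in> borel_measurable borel"
  shows "(\<integral>\<^sup>+x. f (A *v x) \<partial>lborel) = (\<integral>\<^sup>+x. f x \<partial>lborel)"
proof -
  have "\<forall>x. A *v x = 0 \<longrightarrow> x = 0" using assms(1) by (metis norm_eq_zero)
  then have "invertible A" by (metis invertible_left_inverse matrix_left_invertible_ker)
  from nn_integral_linear_const[OF this] assms show ?thesis by (metis ennreal_1 mult_1)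
qed

lemma nn_integral_diagonal:
  fixes A :: "real^'n^'n"
  assumes dg: "\<And>i j. i \<noteq> j \<Longrightarrow> A $ i $ j = 0" and inv: "invertible A" and [measurable]: "f \<in> borel_measurable borel"
  shows "(\<integral>\<^sup>+x. f x \<partial>lborel) = ennreal \<bar>det A\<bar> * (\<integral>\<^sup>+x. f (A *v x) \<partial>lborel)"
proof -
  \<comment> \<open>\<open>lborel_affine_euclidean\<close> scales along the elements of
    \<open>Basis\<close>. A basis vector has entries 0 and 1, so the squares single out the diagonal
    entry belonging to it.\<close>
  define c where "c j = (\<Sum>i\<in>UNIV. (j $ i)\<^sup>2 * A $ i $ i)" for j :: "real^'n"
  have ca: "c (axis k 1) = A $ k $ k" for k
    by (simp add: c_def axis_def if_distrib[of "\<lambda>x. x\<^sup>2 * _"] cong: if_cong)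
  have det: "det A = (\<Prod>i\<in>UNIV. A $ i $ i)" by (rule det_diagonal) (use dg in auto)
  have nz: "A $ k $ k \<noteq> 0" for k
    using inv invertible_det_nz[of A] unfolding det by auto
  have inj: "inj (\<lambda>k::'n. axis k (1::real))" by (auto simp: inj_on_def axis_eq_axis)
  have Basis: "Basis = (\<lambda>k::'n. axis k (1::real)) ` UNIV" by (auto simp: Basis_vec_def)
  have T: "0 + (\<Sum>j\<in>Basis. (c j * (x \<bullet> j)) *\<^sub>R j) = A *v x" for x
  proof -
    have "(\<Sum>j\<in>Basis. (c j * (x \<bullet> j)) *\<^sub>R j) = (\<Sum>k\<in>UNIV. (A $ k $ k * x $ k) *\<^sub>R axis k 1)"
      unfolding Basis by (subst sum.reindex[OF inj]) (simp add: ca inner_axis)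
    also have "\<dots> = A *v x"
    proof (subst vec_eq_iff, rule)
      fix i
      have "(A *v x) $ i = (\<Sum>k\<in>UNIV. if k = i then A $ i $ i * x $ i else 0)"
        unfolding matrix_vector_mul_component inner_vec_def by (intro sum.cong refl) (use dg in auto)
      then show "(\<Sum>k\<in>UNIV. (A $ k $ k * x $ k) *\<^sub>R axis k 1) $ i = (A *v x) $ i"
        by (simp add: axis_def if_distrib[of "\<lambda>y. _ * y"] cong: if_cong)
    qed
    finally show ?thesis by simp
  qed
  have "(\<Prod>j\<in>Basis. \<bar>c j\<bar>) = \<bar>det A\<bar>"
    unfolding Basis by (subst prod.reindex[OF inj]) (simp add: ca det abs_prod)
  moreover have "lborel = density (distr lborel borel (\<lambda>x. 0 + (\<Sum>j\<in>Basis. (c j * (x \<bullet> j)) *\<^sub>R j))) (\<lambda>_. (\<Prod>j\<in>Basis. \<bar>c j\<bar>))"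
    by (rule lborel_affine_euclidean) (auto simp: Basis ca nz)
  ultimately have "lborel = density (distr lborel borel (\<lambda>x. A *v x)) (\<lambda>_. ennreal \<bar>det A\<bar>)"
    unfolding T by simp
  then have "(\<integral>\<^sup>+x. f x \<partial>lborel) = (\<integral>\<^sup>+x. f x \<partial>density (distr lborel borel (\<lambda>x. A *v x)) (\<lambda>_. ennreal \<bar>det A\<bar>))"
    by simp
  also have "\<dots> = ennreal \<bar>det A\<bar> * (\<integral>\<^sup>+x. f (A *v x) \<partial>lborel)"
    by (simp add: nn_integral_density nn_integral_distr nn_integral_cmult)
  finally show ?thesis .
qed

text \<open>Both sides behave multiplicatively in \<open>A\<close>, so elementary matrices suffice.
  Diagonal matrices are known, a transposition is an isometry with determinant of modulus 1, a zero
  row contradicts invertibility, and shears are treated by conjugation.\<close>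

lemma nn_integral_linear:
  fixes A :: "real^'n^'n"
  assumes "invertible A" "f \<in> borel_measurable borel"
  shows "(\<integral>\<^sup>+x. f x \<partial>lborel) = ennreal \<bar>det A\<bar> * (\<integral>\<^sup>+x. f (A *v x) \<partial>lborel)"
proof -
  have "invertible A \<longrightarrow> (\<forall>f\<in>borel_measurable borel.
      (\<integral>\<^sup>+x. f x \<partial>lborel) = ennreal \<bar>det A\<bar> * (\<integral>\<^sup>+x. f (A *v x) \<partial>lborel))" for A :: "real^'n^'n"
  proof (rule induct_matrix_elementary)
    fix A B :: "real^'n^'n"
    assume IA: "invertible A \<longrightarrow> (\<forall>f\<in>borel_measurable borel. (\<integral>\<^sup>+x. f x \<partial>lborel) = ennreal \<bar>det A\<bar> * (\<integral>\<^sup>+x. f (A *v x) \<partial>lborel))"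
      and IB: "invertible B \<longrightarrow> (\<forall>f\<in>borel_measurable borel. (\<integral>\<^sup>+x. f x \<partial>lborel) = ennreal \<bar>det B\<bar> * (\<integral>\<^sup>+x. f (B *v x) \<partial>lborel))"
    show "invertible (A ** B) \<longrightarrow> (\<forall>f\<in>borel_measurable borel. (\<integral>\<^sup>+x. f x \<partial>lborel) = ennreal \<bar>det (A ** B)\<bar> * (\<integral>\<^sup>+x. f ((A ** B) *v x) \<partial>lborel))"
    proof (intro impI ballI)
      fix f :: "real^'n \<Rightarrow> ennreal" assume "invertible (A ** B)" and [measurable]: "f \<in> borel_measurable borel"
      then have "invertible A" "invertible B" by (simp_all add: invertible_det_nz det_mul)
      have "(\<integral>\<^sup>+x. f x \<partial>lborel) = ennreal \<bar>det A\<bar> * (\<integral>\<^sup>+x. f (A *v x) \<partial>lborel)"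
        by (rule bspec[OF mp[OF IA \<open>invertible A\<close>]]) simp
      also have "(\<integral>\<^sup>+x. f (A *v x) \<partial>lborel) = ennreal \<bar>det B\<bar> * (\<integral>\<^sup>+x. f (A *v (B *v x)) \<partial>lborel)"
        by (rule bspec[OF mp[OF IB \<open>invertible B\<close>], of "\<lambda>x. f (A *v x)"]) simp
      finally show "(\<integral>\<^sup>+x. f x \<partial>lborel) = ennreal \<bar>det (A ** B)\<bar> * (\<integral>\<^sup>+x. f ((A ** B) *v x) \<partial>lborel)"
        by (simp add: det_mul abs_mult ennreal_mult matrix_vector_mul_assoc mult.assoc)
    qed
  next
    fix A :: "real^'n^'n" and i
    assume "row i A = 0"
    then have "\<not> invertible A" using det_zero_row[of i A] by (simp add: invertible_det_nz)
    then show "invertible A \<longrightarrow> (\<forall>f\<in>borel_measurable borel. (\<integral>\<^sup>+x. f x \<partial>lborel) = ennreal \<bar>det A\<bar> * (\<integral>\<^sup>+x. f (A *v x) \<partial>lborel))"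
      by simp
  next
    fix A :: "real^'n^'n"
    assume "\<And>i j. i \<noteq> j \<Longrightarrow> A $ i $ j = 0"
    then show "invertible A \<longrightarrow> (\<forall>f\<in>borel_measurable borel. (\<integral>\<^sup>+x. f x \<partial>lborel) = ennreal \<bar>det A\<bar> * (\<integral>\<^sup>+x. f (A *v x) \<partial>lborel))"
      using nn_integral_diagonal by blast
  next
    fix m n :: 'n assume "m \<noteq> n"
    define A :: "real^'n^'n" where "A = (\<chi> i j. mat 1 $ i $ Transposition.transpose m n j)"
    have Ax: "(A *v x) $ i = x $ Transposition.transpose m n i" for x i
    proof -
      have "(A *v x) $ i = (\<Sum>j\<in>UNIV. if j = Transposition.transpose m n i then x $ j else 0)"
        unfolding matrix_vector_mul_component inner_vec_def A_def
        by (intro sum.cong refl) (auto simp: mat_def Transposition.transpose_def)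
      then show ?thesis by simp
    qed
    have nx: "norm (A *v x) = norm x" for x
    proof -
      have "(\<Sum>i\<in>UNIV. (x $ Transposition.transpose m n i)\<^sup>2) = (\<Sum>i\<in>UNIV. (x $ i)\<^sup>2)"
        using sum.reindex_bij_betw[of "Transposition.transpose m n" UNIV UNIV "\<lambda>i. (x $ i)\<^sup>2"]
        by (simp add: bij_betw_transpose_iff)
      then show ?thesis by (simp add: norm_vec_def L2_set_def Ax)
    qed
    have "orthogonal_transformation ((*v) A)" by (simp add: orthogonal_transformation nx)
    then have "\<bar>det A\<bar> = 1"
      using det_orthogonal_matrix[of A] orthogonal_transformation_matrix[of "(*v) A"] by auto
    then have "\<forall>f\<in>borel_measurable borel. (\<integral>\<^sup>+x. f x \<partial>lborel) = ennreal \<bar>det A\<bar> * (\<integral>\<^sup>+x. f (A *v x) \<partial>lborel)"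
      using nn_integral_orthogonal[OF nx] by simp
    then show "invertible (\<chi> i j. mat 1 $ i $ Transposition.transpose m n j :: real^'n^'n) \<longrightarrow> (\<forall>f\<in>borel_measurable borel. (\<integral>\<^sup>+x. f x \<partial>lborel) = ennreal \<bar>det (\<chi> i j. mat 1 $ i $ Transposition.transpose m n j :: real^'n^'n)\<bar> * (\<integral>\<^sup>+x. f ((\<chi> i j. mat 1 $ i $ Transposition.transpose m n j :: real^'n^'n) *v x) \<partial>lborel))"
      unfolding A_def by blast
  next
    fix m n :: 'n and c :: real assume mn: "m \<noteq> n"
    define S :: "real \<Rightarrow> real^'n^'n" where "S c = (\<chi> i j. if i = m \<and> j = n then c else of_bool (i = j))" for c
    have Sx: "S c *v x = x + (c * x $ n) *\<^sub>R axis m 1" for c x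
    proof (subst vec_eq_iff, rule)
      fix i
      have "(S c *v x) $ i = (\<Sum>j\<in>UNIV. (if j = i then x $ i else 0) + (if j = n then (if i = m then c * x $ n else 0) else 0))"
        unfolding matrix_vector_mul_component inner_vec_def S_def
        by (intro sum.cong refl) (use mn in auto)
      then show "(S c *v x) $ i = (x + (c * x $ n) *\<^sub>R axis m 1) $ i"
        by (simp add: sum.distrib axis_def)
    qed
    have SS: "S a *v (S b *v x) = S (a + b) *v x" for a b x
      using mn by (simp add: Sx algebra_simps) (simp add: axis_def)
    have S0: "S 0 *v x = x" for x by (simp add: Sx)
    have inv: "invertible (S a)" for a
      by (metis S0 SS add.right_inverse invertible_left_inverse matrix_eq matrix_vector_mul_assoc matrix_vector_mul_lid add.left_inverse)
    have det1: "det (S c) = 1"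
    proof -
      have "S c = (\<chi> k. if k = m then row m (mat 1) + c *s row n (mat 1) else row k (mat 1))"
        using mn by (auto simp: S_def vec_eq_iff row_def mat_def)
      then show ?thesis using det_row_operation[OF mn, of "mat 1" c] by simp
    qed
    \<comment> \<open>Doubling coordinate \<open>m\<close> conjugates the shear \<open>S c\<close>
      into \<open>S (c + c)\<close>, which is the square of \<open>S c\<close>. The volume factor k
      of the shear thus satisfies k = k^2, and k > 0 because the opposite shear undoes it; hence k =
      1 = det.\<close>
    define D :: "real^'n^'n" where "D = (\<chi> i j. if i = j then (if i = m then 2 else 1) else 0)"
    have Dx: "D *v x = x + (x $ m) *\<^sub>R axis m 1" for x
    proof (subst vec_eq_iff, rule)
      fix i
      have "(D *v x) $ i = (\<Sum>j\<in>UNIV. (if j = i then (if i = m then 2 else 1) * x $ i else 0))"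
        unfolding matrix_vector_mul_component inner_vec_def D_def by (intro sum.cong refl) auto
      then show "(D *v x) $ i = (x + (x $ m) *\<^sub>R axis m 1) $ i" by (simp add: axis_def)
    qed
    have DS: "D *v (S c *v x) = S (c + c) *v (D *v x)" for x
      using mn by (simp add: Sx Dx vec_eq_iff axis_def algebra_simps)
    have detD: "det D = (\<Prod>i\<in>UNIV. D $ i $ i)" by (rule det_diagonal) (simp add: D_def)
    have "det D \<noteq> 0" unfolding detD by (simp add: D_def)
    then have invD: "invertible D" by (simp add: invertible_det_nz)
    obtain d where d: "\<And>f. f \<in> borel_measurable borel \<Longrightarrow> (\<integral>\<^sup>+x. f (D *v x) \<partial>lborel) = ennreal d * (\<integral>\<^sup>+x. f x \<partial>lborel)"
      using nn_integral_linear_const[OF invD] by metis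
    obtain k where k0: "k \<ge> 0" and k: "\<And>f. f \<in> borel_measurable borel \<Longrightarrow> (\<integral>\<^sup>+x. f (S c *v x) \<partial>lborel) = ennreal k * (\<integral>\<^sup>+x. f x \<partial>lborel)"
      using nn_integral_linear_const[OF inv[of c]] by metis
    obtain k' where k': "\<And>f. f \<in> borel_measurable borel \<Longrightarrow> (\<integral>\<^sup>+x. f (S (-c) *v x) \<partial>lborel) = ennreal k' * (\<integral>\<^sup>+x. f x \<partial>lborel)"
      using nn_integral_linear_const[OF inv[of "-c"]] by metis
    obtain E where E: "\<And>x. D *v (E *v x) = x" "\<And>x. E *v (D *v x) = x"
      using invD invertible_inverse_mult by metis
    define g :: "real^'n \<Rightarrow> ennreal" where "g = indicator (cball 0 1)"
    have [measurable]: "g \<in> borel_measurable borel" unfolding g_def by (intro borel_measurable_indicator) simp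
    have g1: "(\<integral>\<^sup>+x. g x \<partial>lborel) = ennreal (unit_ball_vol (DIM(real^'n)))"
      using emeasure_cball[of 1 "0::real^'n"] by (simp add: g_def)
    have "ennreal k * (\<integral>\<^sup>+x. g (D *v x) \<partial>lborel) = (\<integral>\<^sup>+x. g (D *v (S c *v x)) \<partial>lborel)"
      using k[of "\<lambda>x. g (D *v x)"] by simp
    also have "\<dots> = (\<integral>\<^sup>+x. g (S c *v (S c *v (D *v x))) \<partial>lborel)"
      by (simp add: DS SS)
    also have "\<dots> = ennreal d * (ennreal k * (ennreal k * (\<integral>\<^sup>+x. g x \<partial>lborel)))"
      using d[of "\<lambda>x. g (S c *v (S c *v x))"] k[of "\<lambda>x. g (S c *v x)"] k[of g] by simp
    also have "\<dots> = ennreal k * (ennreal k * (\<integral>\<^sup>+x. g (D *v x) \<partial>lborel))"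
      using d[of g] by (simp add: mult_ac)
    finally have e1: "ennreal k * (\<integral>\<^sup>+x. g (D *v x) \<partial>lborel) = ennreal k * (ennreal k * (\<integral>\<^sup>+x. g (D *v x) \<partial>lborel))" .
    have kk: "ennreal k' * (ennreal k * (\<integral>\<^sup>+x. f x \<partial>lborel)) = (\<integral>\<^sup>+x. f x \<partial>lborel)" if [measurable]: "f \<in> borel_measurable borel" for f :: "real^'n \<Rightarrow> ennreal"
      using k'[of "\<lambda>x. f (S c *v x)"] k[of f] by (simp add: SS S0)
    have kpos: "k > 0"
      using kk[of g] g1 k0 unit_ball_vol_pos[of "real CARD('n)"] by (cases "k = 0") auto
    have "ennreal k' * (ennreal k * (\<integral>\<^sup>+x. g (D *v x) \<partial>lborel)) = ennreal k' * (ennreal k * (ennreal k * (\<integral>\<^sup>+x. g (D *v x) \<partial>lborel)))"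
      using e1 by simp
    then have "(\<integral>\<^sup>+x. g (D *v x) \<partial>lborel) = ennreal k * (\<integral>\<^sup>+x. g (D *v x) \<partial>lborel)"
      using kk[of "\<lambda>x. g (D *v x)"] k[of "\<lambda>x. g (D *v x)"] kk[of "\<lambda>x. g (D *v (S c *v x))"] by simp
    then have "ennreal \<bar>det D\<bar> * (\<integral>\<^sup>+x. g (D *v x) \<partial>lborel) = ennreal \<bar>det D\<bar> * (ennreal k * (\<integral>\<^sup>+x. g (D *v x) \<partial>lborel))"
      by simp
    then have "(\<integral>\<^sup>+x. g x \<partial>lborel) = ennreal k * (\<integral>\<^sup>+x. g x \<partial>lborel)"
      using nn_integral_diagonal[of D g] invD by (simp add: D_def mult.left_commute)
    moreover have "unit_ball_vol (real CARD('n)) \<noteq> 0" by (metis less_irrefl of_nat_0_le_iff unit_ball_vol_pos)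
    ultimately have "k = 1" using k0 unfolding g1 by (simp add: ennreal_mult[symmetric])
    then have "\<forall>f\<in>borel_measurable borel. (\<integral>\<^sup>+x. f x \<partial>lborel) = ennreal \<bar>det (S c)\<bar> * (\<integral>\<^sup>+x. f (S c *v x) \<partial>lborel)"
      using k by (simp add: det1)
    then show "invertible (\<chi> i j. if i = m \<and> j = n then c else of_bool (i = j)) \<longrightarrow> (\<forall>f\<in>borel_measurable borel. (\<integral>\<^sup>+x. f x \<partial>lborel) = ennreal \<bar>det (\<chi> i j. if i = m \<and> j = n then c else of_bool (i = j))\<bar> * (\<integral>\<^sup>+x. f ((\<chi> i j. if i = m \<and> j = n then c else of_bool (i = j)) *v x) \<partial>lborel))"
      unfolding S_def by blast
  qed
  then show ?thesis using assms by blast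
qed

section \<open>Radial integration without polar coordinates\<close>

lemma nn_integral_scale:
  fixes f :: "real^'n \<Rightarrow> ennreal"
  assumes "c > 0" and [measurable]: "f \<in> borel_measurable borel"
  shows "(\<integral>\<^sup>+x. f x \<partial>lborel) = ennreal (c ^ CARD('n)) * (\<integral>\<^sup>+x. f (c *\<^sub>R x) \<partial>lborel)"
proof -
  have "(\<integral>\<^sup>+x. f x \<partial>lborel) = (\<integral>\<^sup>+x. f x \<partial>density (distr lborel borel (\<lambda>x. 0 + c *\<^sub>R x)) (\<lambda>_. \<bar>c\<bar> ^ DIM(real^'n)))"
    using lborel_affine[of c "0::real^'n"] assms(1) by simp
  also have "\<dots> = ennreal (c ^ CARD('n)) * (\<integral>\<^sup>+x. f (c *\<^sub>R x) \<partial>lborel)"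
    using assms(1) by (simp add: nn_integral_density nn_integral_distr nn_integral_cmult)
  finally show ?thesis .
qed

lemma nn_integral_power_Icc:
  assumes "a > 0" "p \<ge> 1"
  shows "(\<integral>\<^sup>+r. ennreal (r ^ (p - 1)) * indicator {r. 0 < r \<and> r * a \<le> 1} r \<partial>lborel) = ennreal (1 / (real p * a ^ p))"
proof -
  have "(\<integral>\<^sup>+r. ennreal (r ^ (p - 1)) * indicator {r. 0 < r \<and> r * a \<le> 1} r \<partial>lborel)
     = (\<integral>\<^sup>+r. ennreal (r ^ (p - 1)) * indicator {0..1/a} r \<partial>lborel)"
  proof (rule nn_integral_cong_AE)
    have "AE r in lborel. r \<noteq> (0::real)" by (rule AE_lborel_singleton)
    then show "AE r in lborel. ennreal (r ^ (p - 1)) * indicator {r. 0 < r \<and> r * a \<le> 1} r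
       = ennreal (r ^ (p - 1)) * indicator {0..1/a} r"
      by eventually_elim (use assms in \<open>auto simp: indicator_def field_simps\<close>)
  qed
  also have "\<dots> = ennreal ((1/a) ^ p / real p - 0 ^ p / real p)"
  proof (rule nn_integral_FTC_Icc)
    show "((\<lambda>r. r ^ p / real p) has_real_derivative x ^ (p - 1)) (at x)" for x
      using assms(2) by (auto intro!: derivative_eq_intros)
  qed (use assms in auto)
  also have "\<dots> = ennreal (1 / (real p * a ^ p))"
  proof -
    obtain q where q: "p = Suc q" using assms(2) by (cases p) auto
    show ?thesis unfolding q by (simp add: power_divide mult.commute)
  qed
  finally show ?thesis .
qed

lemma nn_integral_inverse_power:
  assumes "a > 0" "p \<ge> 1"
  shows "(\<integral>\<^sup>+r. ennreal (1 / r ^ (p + 1)) * indicator {a..} r \<partial>lborel) = ennreal (1 / (real p * a ^ p))"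
proof -
  have "(\<integral>\<^sup>+r. ennreal (1 / r ^ (p + 1)) * indicator {a..} r \<partial>lborel) = ennreal (0 - (- 1 / (real p * a ^ p)))"
  proof (rule nn_integral_FTC_atLeast)
    show "((\<lambda>r. - 1 / (real p * r ^ p)) has_real_derivative 1 / x ^ (p + 1)) (at x)" if "a \<le> x" for x
    proof -
      have x: "x > 0" using that assms by simp
      obtain q where q: "p = Suc q" using assms(2) by (cases p) auto
      have "((\<lambda>r. - (inverse r ^ p) / real p) has_real_derivative - (real p * (- (inverse x * 1 * inverse x)) * inverse x ^ (p - 1)) / real p) (at x)"
        using x by (auto intro!: derivative_eq_intros)
      moreover have "- (real p * (- (inverse x * 1 * inverse x)) * inverse x ^ (p - 1)) / real p = 1 / x ^ (p + 1)"
        unfolding q using x by (simp add: power_inverse[symmetric] field_simps del: of_nat_Suc)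
      moreover have "(\<lambda>r. - (inverse r ^ p) / real p) = (\<lambda>r. - 1 / (real p * r ^ p))"
        by (auto simp: field_simps)
      ultimately show ?thesis by simp
    qed
    show "((\<lambda>r. - 1 / (real p * r ^ p)) \<longlongrightarrow> 0) at_top"
      using assms(2) by (intro tendsto_divide_0[OF tendsto_const] filterlim_at_top_imp_at_infinity
         filterlim_tendsto_pos_mult_at_top[OF tendsto_const] filterlim_pow_at_top filterlim_ident) auto
  qed (use assms in auto)
  then show ?thesis by simp
qed

text \<open>For a function constant on rays, passing from the Euclidean ball to the unit ball of a
  homogeneous gauge \<open>N\<close> changes the volume of each thin cone by the p-th power of the
  ratio of radii. An auxiliary radius, Fubini and a scaling replace the polar decomposition.\<close>

lemma radial_change:
  fixes f :: "real^'n \<Rightarrow> ennreal" and N :: "real^'n \<Rightarrow> real"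
  assumes [measurable]: "f \<in> borel_measurable borel" "N \<in> borel_measurable borel"
    and f: "\<And>c x. c > 0 \<Longrightarrow> f (c *\<^sub>R x) = f x"
    and N: "\<And>c x. c > 0 \<Longrightarrow> N (c *\<^sub>R x) = c * N x" "\<And>x. x \<noteq> 0 \<Longrightarrow> N x > 0"
  shows "(\<integral>\<^sup>+x. f x * indicator (cball 0 1) x * ennreal ((norm x / N x) ^ CARD('n)) \<partial>lborel)
     = (\<integral>\<^sup>+x. f x * indicator {x. N x \<le> 1} x \<partial>lborel)"
proof -
  let ?p = "CARD('n)"
  have p1: "?p \<ge> 1" by simp
  have [simp]: "ennreal (real ?p) * ennreal (1 / real ?p) = 1"
    by (simp add: ennreal_mult[symmetric])
  \<comment> \<open>The integral over r of this function gives the weight (|x| / N x)^p / p on the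
    Euclidean ball. After the scaling x to x / r the two constraints trade places: |x| \<le> 1
    becomes |x| \<le> r, and r N x \<le> 1 becomes N x \<le> 1. The integral over r is then that of
    r^(-p-1) from |x| on, namely 1 / (p |x|^p), which cancels the factor |x|^p.\<close>
  define h where "h r x = f x * indicator (cball 0 1) x * ennreal (norm x ^ ?p) * (ennreal (r ^ (?p - 1)) * indicator {r. 0 < r \<and> r * N x \<le> 1} r)" for r and x :: "real^'n"
  have [measurable]: "(\<lambda>(r, x). h r x) \<in> borel_measurable (borel \<Otimes>\<^sub>M borel)"
    unfolding h_def indicator_def by (auto simp: split_beta)
  have ne: "AE x in lborel. x \<noteq> (0::real^'n)" by (rule AE_lborel_singleton)
  have J1: "(\<integral>\<^sup>+x. \<integral>\<^sup>+r. h r x \<partial>lborel \<partial>lborel)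
     = (\<integral>\<^sup>+x. ennreal (1 / real ?p) * (f x * indicator (cball 0 1) x * ennreal ((norm x / N x) ^ ?p)) \<partial>lborel)"
  proof (rule nn_integral_cong_AE, use ne in eventually_elim)
    fix x :: "real^'n" assume x: "x \<noteq> 0"
    have "(\<integral>\<^sup>+r. h r x \<partial>lborel) = f x * indicator (cball 0 1) x * ennreal (norm x ^ ?p) * ennreal (1 / (real ?p * N x ^ ?p))"
      unfolding h_def using nn_integral_power_Icc[OF N(2)[OF x] p1]
      by (subst nn_integral_cmult) auto
    also have "\<dots> = f x * indicator (cball 0 1) x * (ennreal (norm x ^ ?p) * ennreal (1 / (real ?p * N x ^ ?p)))"
      by (simp add: mult_ac)
    also have "ennreal (norm x ^ ?p) * ennreal (1 / (real ?p * N x ^ ?p)) = ennreal (1 / real ?p) * ennreal ((norm x / N x) ^ ?p)"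
      using N(2)[OF x] by (simp add: ennreal_mult[symmetric] power_divide field_simps)
    finally show "(\<integral>\<^sup>+r. h r x \<partial>lborel) = ennreal (1 / real ?p) * (f x * indicator (cball 0 1) x * ennreal ((norm x / N x) ^ ?p))"
      by (simp add: mult_ac)
  qed
  have J2: "(\<integral>\<^sup>+x. h r x \<partial>lborel) = (\<integral>\<^sup>+x. f x * indicator {x. N x \<le> 1} x * ennreal (norm x ^ ?p) * (ennreal (1 / r ^ (?p + 1)) * indicator {norm x..} r * indicator {0<..} r) \<partial>lborel)" for r
  proof (cases "r > 0")
    case False
    then show ?thesis by (auto simp: h_def indicator_def)
  next
    case True
    have [measurable]: "h r \<in> borel_measurable borel"
      using measurable_compose[of "\<lambda>x. (r, x)" borel "borel \<Otimes>\<^sub>M borel" "\<lambda>(r, x). h r x"] by simp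
    have "(\<integral>\<^sup>+x. h r x \<partial>lborel) = ennreal ((1/r) ^ ?p) * (\<integral>\<^sup>+x. h r ((1/r) *\<^sub>R x) \<partial>lborel)"
      by (rule nn_integral_scale) (use True in simp_all)
    also have "\<dots> = (\<integral>\<^sup>+x. ennreal ((1/r) ^ ?p) * h r ((1/r) *\<^sub>R x) \<partial>lborel)"
      by (subst nn_integral_cmult) simp_all
    also have "\<dots> = (\<integral>\<^sup>+x. f x * indicator {x. N x \<le> 1} x * ennreal (norm x ^ ?p) * (ennreal (1 / r ^ (?p + 1)) * indicator {norm x..} r * indicator {0<..} r) \<partial>lborel)"
    proof (rule nn_integral_cong)
      fix x :: "real^'n"
      have i1: "indicator (cball 0 1) ((1/r) *\<^sub>R x) = (indicator {norm x..} r :: ennreal)"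
        using True by (auto simp: indicator_def field_simps)
      have i2: "indicator {ra. 0 < ra \<and> ra * N ((1/r) *\<^sub>R x) \<le> 1} r = (indicator {x. N x \<le> 1} x :: ennreal)"
        using True N(1)[of "1/r" x] by (auto simp: indicator_def)
      have e: "ennreal ((1/r) ^ ?p) * (ennreal (norm ((1/r) *\<^sub>R x) ^ ?p) * ennreal (r ^ (?p - 1))) = ennreal (norm x ^ ?p) * ennreal (1 / r ^ (?p + 1))"
      proof -
        obtain q where q: "?p = Suc q" using p1 by (cases ?p) auto
        show ?thesis unfolding q using True
          by (simp add: ennreal_mult[symmetric] power_divide power_mult_distrib field_simps)
      qed
      have "ennreal ((1/r) ^ ?p) * h r ((1/r) *\<^sub>R x) = f x * indicator {norm x..} r * indicator {x. N x \<le> 1} x * (ennreal ((1/r) ^ ?p) * (ennreal (norm ((1/r) *\<^sub>R x) ^ ?p) * ennreal (r ^ (?p - 1))))"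
        unfolding h_def i1 i2 using f[of "1/r" x] True by (simp only: mult_ac divide_pos_pos zero_less_one)
      also have "\<dots> = f x * indicator {x. N x \<le> 1} x * ennreal (norm x ^ ?p) * (ennreal (1 / r ^ (?p + 1)) * indicator {norm x..} r * indicator {0<..} r)"
        unfolding e using True by (simp add: mult_ac)
      finally show "ennreal ((1/r) ^ ?p) * h r ((1/r) *\<^sub>R x) = \<dots>" .
    qed
    finally show ?thesis .
  qed
  have "(\<integral>\<^sup>+x. \<integral>\<^sup>+r. h r x \<partial>lborel \<partial>lborel) = (\<integral>\<^sup>+r. \<integral>\<^sup>+x. h r x \<partial>lborel \<partial>lborel)"
    by (rule lborel_pair.Fubini') simp
  also have "\<dots> = (\<integral>\<^sup>+x. \<integral>\<^sup>+r. f x * indicator {x. N x \<le> 1} x * ennreal (norm x ^ ?p) * (ennreal (1 / r ^ (?p + 1)) * indicator {norm x..} r * indicator {0<..} r) \<partial>lborel \<partial>lborel)"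
    unfolding J2
    by (rule lborel_pair.Fubini'[symmetric]) (simp add: indicator_def split_beta)
  also have "\<dots> = (\<integral>\<^sup>+x. ennreal (1 / real ?p) * (f x * indicator {x. N x \<le> 1} x) \<partial>lborel)"
  proof (rule nn_integral_cong_AE, use ne in eventually_elim)
    fix x :: "real^'n" assume x: "x \<noteq> 0"
    have "(\<integral>\<^sup>+r. f x * indicator {x. N x \<le> 1} x * ennreal (norm x ^ ?p) * (ennreal (1 / r ^ (?p + 1)) * indicator {norm x..} r * indicator {0<..} r) \<partial>lborel)
      = (\<integral>\<^sup>+r. f x * indicator {x. N x \<le> 1} x * ennreal (norm x ^ ?p) * (ennreal (1 / r ^ (?p + 1)) * indicator {norm x..} r) \<partial>lborel)"
    proof -
      have "0 < norm x" using x by simp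
      then have "(indicator {norm x..} r * indicator {0<..} r :: ennreal) = indicator {norm x..} r" for r
        by (auto simp: indicator_def simp del: zero_less_norm_iff)
      then show ?thesis by (simp only: mult.assoc)
    qed
    also have "\<dots> = f x * indicator {x. N x \<le> 1} x * ennreal (norm x ^ ?p) * ennreal (1 / (real ?p * norm x ^ ?p))"
      using nn_integral_inverse_power[of "norm x", OF _ p1] x by (subst nn_integral_cmult) auto
    also have "\<dots> = f x * indicator {x. N x \<le> 1} x * ennreal (1 / real ?p)"
      using x by (simp add: mult.assoc ennreal_mult[symmetric])
    finally show "(\<integral>\<^sup>+r. f x * indicator {x. N x \<le> 1} x * ennreal (norm x ^ ?p) * (ennreal (1 / r ^ (?p + 1)) * indicator {norm x..} r * indicator {0<..} r) \<partial>lborel)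
      = ennreal (1 / real ?p) * (f x * indicator {x. N x \<le> 1} x)" by (simp add: mult_ac)
  qed
  also have "\<dots> = ennreal (1 / real ?p) * (\<integral>\<^sup>+x. f x * indicator {x. N x \<le> 1} x \<partial>lborel)"
    by (rule nn_integral_cmult) simp
  finally have "ennreal (1 / real ?p) * (\<integral>\<^sup>+x. f x * indicator (cball 0 1) x * ennreal ((norm x / N x) ^ ?p) \<partial>lborel)
     = ennreal (1 / real ?p) * (\<integral>\<^sup>+x. f x * indicator {x. N x \<le> 1} x \<partial>lborel)"
    unfolding J1
    by (subst nn_integral_cmult[symmetric]) (auto intro!: borel_measurable_times_ennreal borel_measurable_indicator)
  then have "ennreal (real ?p) * (ennreal (1 / real ?p) * (\<integral>\<^sup>+x. f x * indicator (cball 0 1) x * ennreal ((norm x / N x) ^ ?p) \<partial>lborel))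
     = ennreal (real ?p) * (ennreal (1 / real ?p) * (\<integral>\<^sup>+x. f x * indicator {x. N x \<le> 1} x \<partial>lborel))" by simp
  then show ?thesis by (simp add: mult.assoc[symmetric])
qed

section \<open>The uniform law on the sphere and the standardisation of angular Gaussian
  vectors\<close>

definition unif_sphere :: "(real^'p) measure" where
  "unif_sphere = distr (density lborel (\<lambda>x. ennreal (1 / unit_ball_vol (real CARD('p))) * indicator (cball 0 1) x))
     borel (\<lambda>x. x /\<^sub>R norm x)"

lemma indicator_ball_measurable[measurable]:
  "(indicator (cball (0::'a::euclidean_space) 1) :: 'a \<Rightarrow> ennreal) \<in> borel_measurable borel"
  "(indicator (cball (0::'a::euclidean_space) 1 - {0}) :: 'a \<Rightarrow> ennreal) \<in> borel_measurable borel"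
  by (auto intro!: borel_measurable_indicator)

lemma nn_integral_unif_sphere:
  assumes [measurable]: "f \<in> borel_measurable borel"
  shows "(\<integral>\<^sup>+x. f x \<partial>(unif_sphere :: (real^'p) measure))
    = ennreal (1 / unit_ball_vol (real CARD('p))) * (\<integral>\<^sup>+x. f (x /\<^sub>R norm x) * indicator (cball 0 1) (x::real^'p) \<partial>lborel)"
  unfolding unif_sphere_def
  by (simp add: nn_integral_distr nn_integral_density mult_ac)
     (subst nn_integral_cmult[symmetric], auto simp: mult_ac)

lemma sets_unif_sphere[simp, measurable_cong]: "sets unif_sphere = sets borel"
  and space_unif_sphere[simp]: "space unif_sphere = UNIV"
  by (simp_all add: unif_sphere_def)

lemma prob_space_unif_sphere: "prob_space (unif_sphere :: (real^'p) measure)"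
proof
  have "emeasure (unif_sphere :: (real^'p) measure) (space unif_sphere) = (\<integral>\<^sup>+x. 1 \<partial>(unif_sphere :: (real^'p) measure))"
    by simp
  also have "\<dots> = ennreal (1 / unit_ball_vol (real CARD('p))) * emeasure lborel (cball (0::real^'p) 1)"
    by (subst nn_integral_unif_sphere) simp_all
  also have "\<dots> = 1"
    using unit_ball_vol_pos[of "real CARD('p)"] by (simp add: emeasure_cball ennreal_mult[symmetric] del: unit_ball_vol_pos)
  finally show "emeasure (unif_sphere :: (real^'p) measure) (space unif_sphere) = 1" .
qed

lemma powr_sqr_neg_half: "a > 0 \<Longrightarrow> (a\<^sup>2) powr (- real n / 2) = (1 / a) ^ n"
proof -
  assume a: "a > 0"
  have "(a\<^sup>2) powr (- real n / 2) = (a powr 2) powr (- real n / 2)" using a by simp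
  also have "\<dots> = a powr (- real n)" by (simp add: powr_powr)
  also have "\<dots> = (1 / a) ^ n" using a by (simp add: powr_minus powr_realpow power_one_over inverse_eq_divide)
  finally show ?thesis .
qed

text \<open>The factor p of the cone measure turns the Gamma constant of the angular Gaussian
  density into the reciprocal volume of the ball, which normalises
  \<open>unif_sphere\<close>.\<close>

lemma unit_ball_vol_Gamma: "p \<ge> 1 \<Longrightarrow> real p * (Gamma (real p / 2) / (2 * pi powr (real p / 2))) = 1 / unit_ball_vol (real p)"
proof -
  assume "p \<ge> 1"
  then have "Gamma (real p / 2 + 1) = real p / 2 * Gamma (real p / 2)"
    by (intro Gamma_plus1) auto
  then show ?thesis by (simp add: unit_ball_vol_def field_simps)
qed

lemma sets_ang_gauss[simp, measurable_cong]: "sets (ang_gauss V) = sets borel"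
  and space_ang_gauss[simp]: "space (ang_gauss V) = UNIV"
  by (simp_all add: ang_gauss_def sphere_measure_def)

text \<open>Write R for the inverse root of V. For a function constant on rays the density
  contributes |det R| (|x| / |R x|)^p up to the constant, which is the weight that trades the unit
  ball for the ellipsoid |R x| \<le> 1. Substituting y = R x absorbs |det R| and restores the ball,
  so the normalised R u is uniform.\<close>

lemma nn_integral_ang_gauss:
  fixes V :: "real^'p^'p"
  assumes V: "symmetric_m V" "posdef_m V" and [measurable]: "f \<in> borel_measurable borel"
  shows "(\<integral>\<^sup>+u. f (msqrt_inv V *v u /\<^sub>R norm (msqrt_inv V *v u)) \<partial>ang_gauss V) = (\<integral>\<^sup>+u. f u \<partial>unif_sphere)"
proof -
  define R where "R = msqrt_inv V"
  let ?p = "CARD('p)"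
  note R = msqrt_inv_props[OF V, folded R_def]
  have invR: "invertible R" by (rule posdef_invertible[OF R(2)])
  have Rnz: "norm (R *v x) > 0" if "x \<noteq> 0" for x
    using that R(2) unfolding posdef_m_def by (metis inner_zero_right less_irrefl zero_less_norm_iff)
  have detV: "det V * (det R)\<^sup>2 = 1"
  proof -
    have "V ** matrix_inv V = mat 1"
      by (metis V(2) posdef_invertible matrix_eq matrix_inv_mult(1) matrix_vector_mul_assoc matrix_vector_mul_lid)
    then have "det V * det (R ** R) = 1" by (metis R(3) det_I det_mul)
    then show ?thesis by (simp add: det_mul power2_eq_square)
  qed
  then have detR: "det R \<noteq> 0" by auto
  have "det V = 1 / (det R)\<^sup>2" using detV detR by (simp add: field_simps)
  then have sd: "1 / sqrt (det V) = \<bar>det R\<bar>" by (simp add: real_sqrt_divide)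
  define g where "g u = f (R *v u /\<^sub>R norm (R *v u))" for u
  have [measurable]: "g \<in> borel_measurable borel" unfolding g_def by measurable
  have gs: "g (c *\<^sub>R x) = g x" if "c > 0" for c x
    using that by (simp only: g_def matrix_vector_scaleR sgn_div_norm[symmetric] sgn_scaleR) simp
  define c where "c = Gamma (real ?p / 2) / (2 * pi powr (real ?p / 2))"
  have c0: "c \<ge> 0" unfolding c_def by (intro divide_nonneg_nonneg Gamma_real_nonneg) auto
  have pdf: "ang_gauss_pdf V (x /\<^sub>R norm x) = c * \<bar>det R\<bar> * (norm x / norm (R *v x)) ^ ?p" if "x \<noteq> 0" for x
  proof -
    define u where "u = x /\<^sub>R norm x"
    have "u \<bullet> (matrix_inv V *v u) = (norm (R *v u))\<^sup>2"
      by (simp add: R(3)[symmetric] matrix_vector_mul_assoc[symmetric] power2_norm_eq_inner sym_dot[OF R(1)])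
    moreover have u0: "u \<noteq> 0" using that by (simp add: u_def)
    ultimately have "(u \<bullet> (matrix_inv V *v u)) powr (- real ?p / 2) = (1 / norm (R *v u)) ^ ?p"
      using powr_sqr_neg_half[OF Rnz[OF u0], of ?p] by simp
    moreover have "norm (R *v u) = norm (R *v x) / norm x"
      by (simp add: u_def matrix_vector_scaleR divide_inverse mult.commute)
    ultimately show ?thesis
      unfolding ang_gauss_pdf_def u_def[symmetric] c_def sd[symmetric] by (simp add: field_simps)
  qed
  have [measurable]: "ang_gauss_pdf V \<in> borel_measurable borel"
    unfolding ang_gauss_pdf_def by measurable
  have pdf0: "0 \<le> c * \<bar>det R\<bar>" using c0 by simp
  have "(\<integral>\<^sup>+u. f (R *v u /\<^sub>R norm (R *v u)) \<partial>ang_gauss V) = (\<integral>\<^sup>+u. ennreal (ang_gauss_pdf V u) * g u \<partial>sphere_measure)"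
    unfolding ang_gauss_def g_def[symmetric]
    by (rule nn_integral_density) (simp_all add: sphere_measure_def)
  also have "\<dots> = (\<integral>\<^sup>+x. ennreal (real ?p) * indicator (cball 0 1 - {0}) x * (ennreal (ang_gauss_pdf V (x /\<^sub>R norm x)) * g (x /\<^sub>R norm x)) \<partial>lborel)"
    unfolding sphere_measure_def by (simp add: nn_integral_distr nn_integral_density)
  also have "\<dots> = (\<integral>\<^sup>+x. ennreal (real ?p * (c * \<bar>det R\<bar>)) * (g x * indicator (cball 0 1) x * ennreal ((norm x / norm (R *v x)) ^ ?p)) \<partial>lborel)"
  proof (rule nn_integral_cong_AE)
    have "AE x in lborel. x \<noteq> (0::real^'p)" by (rule AE_lborel_singleton)
    then show "AE x in lborel. ennreal (real ?p) * indicator (cball 0 1 - {0}) x * (ennreal (ang_gauss_pdf V (x /\<^sub>R norm x)) * g (x /\<^sub>R norm x))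
      = ennreal (real ?p * (c * \<bar>det R\<bar>)) * (g x * indicator (cball 0 1) x * ennreal ((norm x / norm (R *v x)) ^ ?p))"
    proof eventually_elim
      fix x :: "real^'p" assume x: "x \<noteq> 0"
      have "ennreal (ang_gauss_pdf V (x /\<^sub>R norm x)) = ennreal (c * \<bar>det R\<bar>) * ennreal ((norm x / norm (R *v x)) ^ ?p)"
        unfolding pdf[OF x] using pdf0 by (intro ennreal_mult) auto
      moreover have "g (x /\<^sub>R norm x) = g x" using x by (intro gs) simp
      moreover have "indicator (cball 0 1 - {0}) x = (indicator (cball 0 1) x :: ennreal)" using x by (simp add: indicator_def)
      moreover have "ennreal (real ?p * (c * \<bar>det R\<bar>)) = ennreal (real ?p) * ennreal (c * \<bar>det R\<bar>)"
        using pdf0 by (intro ennreal_mult) auto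
      ultimately show "ennreal (real ?p) * indicator (cball 0 1 - {0}) x * (ennreal (ang_gauss_pdf V (x /\<^sub>R norm x)) * g (x /\<^sub>R norm x))
      = ennreal (real ?p * (c * \<bar>det R\<bar>)) * (g x * indicator (cball 0 1) x * ennreal ((norm x / norm (R *v x)) ^ ?p))"
        by (simp only: mult_ac)
    qed
  qed
  also have "\<dots> = ennreal (real ?p * (c * \<bar>det R\<bar>)) * (\<integral>\<^sup>+x. g x * indicator (cball 0 1) x * ennreal ((norm x / norm (R *v x)) ^ ?p) \<partial>lborel)"
    by (rule nn_integral_cmult) simp
  also have "(\<integral>\<^sup>+x. g x * indicator (cball 0 1) x * ennreal ((norm x / norm (R *v x)) ^ ?p) \<partial>lborel)
    = (\<integral>\<^sup>+x. g x * indicator {x. norm (R *v x) \<le> 1} x \<partial>lborel)"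
    by (rule radial_change) (use Rnz in \<open>simp_all add: gs matrix_vector_scaleR\<close>)
  also have "\<dots> = (\<integral>\<^sup>+x. (\<lambda>y. f (y /\<^sub>R norm y) * indicator (cball 0 1) y) (R *v x) \<partial>lborel)"
    by (intro nn_integral_cong) (simp add: g_def indicator_def)
  also have "ennreal (real ?p * (c * \<bar>det R\<bar>)) * \<dots> = ennreal (real ?p * c) * (ennreal \<bar>det R\<bar> * \<dots>)"
    using c0 by (simp add: mult.assoc[symmetric] ennreal_mult[symmetric])
  also have "ennreal \<bar>det R\<bar> * (\<integral>\<^sup>+x. (\<lambda>y. f (y /\<^sub>R norm y) * indicator (cball 0 1) y) (R *v x) \<partial>lborel)
     = (\<integral>\<^sup>+y. f (y /\<^sub>R norm y) * indicator (cball 0 1) y \<partial>lborel)"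
    by (rule nn_integral_linear[OF invR, symmetric]) simp
  also have "ennreal (real ?p * c) * \<dots> = (\<integral>\<^sup>+u. f u \<partial>unif_sphere)"
    using unit_ball_vol_Gamma[of ?p] by (simp add: nn_integral_unif_sphere c_def)
  finally show ?thesis by (simp add: R_def)
qed

lemma distr_ang_gauss:
  fixes V :: "real^'p^'p"
  assumes V: "symmetric_m V" "posdef_m V"
  shows "distr (ang_gauss V) borel (\<lambda>u. msqrt_inv V *v u /\<^sub>R norm (msqrt_inv V *v u)) = unif_sphere"
proof (rule measure_eqI)
  fix A assume "A \<in> sets (distr (ang_gauss V) borel (\<lambda>u. msqrt_inv V *v u /\<^sub>R norm (msqrt_inv V *v u)))"
  then have A[measurable]: "A \<in> sets borel" by simp
  have "emeasure (distr (ang_gauss V) borel (\<lambda>u. msqrt_inv V *v u /\<^sub>R norm (msqrt_inv V *v u))) A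
     = (\<integral>\<^sup>+x. indicator A x \<partial>distr (ang_gauss V) borel (\<lambda>u. msqrt_inv V *v u /\<^sub>R norm (msqrt_inv V *v u)))"
    by simp
  also have "\<dots> = (\<integral>\<^sup>+u. indicator A (msqrt_inv V *v u /\<^sub>R norm (msqrt_inv V *v u)) \<partial>ang_gauss V)"
    by (rule nn_integral_distr) simp_all
  also have "\<dots> = emeasure unif_sphere A"
    by (subst nn_integral_ang_gauss[OF V, of "indicator A"]) simp_all
  finally show "emeasure (distr (ang_gauss V) borel (\<lambda>u. msqrt_inv V *v u /\<^sub>R norm (msqrt_inv V *v u))) A = emeasure unif_sphere A" .
qed simp

lemma prob_space_ang_gauss:
  fixes V :: "real^'p^'p"
  assumes V: "symmetric_m V" "posdef_m V"
  shows "prob_space (ang_gauss V)"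
proof
  have "emeasure (ang_gauss V) (space (ang_gauss V)) = (\<integral>\<^sup>+u. 1 \<partial>ang_gauss V)" by simp
  also have "\<dots> = (\<integral>\<^sup>+u. 1 \<partial>(unif_sphere :: (real^'p) measure))"
    by (rule nn_integral_ang_gauss[OF V]) simp
  also have "\<dots> = 1" using prob_space.emeasure_space_1[OF prob_space_unif_sphere] by simp
  finally show "emeasure (ang_gauss V) (space (ang_gauss V)) = 1" .
qed

lemma unif_sphere_orthogonal:
  fixes Q :: "real^'p^'p"
  assumes n: "\<And>x. norm (Q *v x) = norm x"
  shows "distr unif_sphere borel (\<lambda>x. Q *v x) = unif_sphere"
proof (rule measure_eqI)
  fix A assume "A \<in> sets (distr unif_sphere borel (\<lambda>x. Q *v x))"
  then have A[measurable]: "A \<in> sets borel" by simp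
  have "emeasure (distr unif_sphere borel (\<lambda>x. Q *v x)) A = (\<integral>\<^sup>+x. indicator A (Q *v x) \<partial>unif_sphere)"
  proof -
    have "(\<integral>\<^sup>+x. indicator A x \<partial>distr unif_sphere borel ((*v) Q)) = (\<integral>\<^sup>+x. indicator A (Q *v x) \<partial>unif_sphere)"
      by (rule nn_integral_distr) simp_all
    then show ?thesis by simp
  qed
  also have "\<dots> = ennreal (1 / unit_ball_vol (real CARD('p))) * (\<integral>\<^sup>+x. (\<lambda>x. indicator A (x /\<^sub>R norm x) * indicator (cball 0 1) x) (Q *v x) \<partial>lborel)"
    by (subst nn_integral_unif_sphere) (simp_all add: n matrix_vector_scaleR indicator_def)
  also have "\<dots> = ennreal (1 / unit_ball_vol (real CARD('p))) * (\<integral>\<^sup>+x. indicator A (x /\<^sub>R norm x) * indicator (cball 0 1) (x::real^'p) \<partial>lborel)"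
    by (subst nn_integral_orthogonal[OF n]) simp_all
  also have "\<dots> = emeasure unif_sphere A"
    by (subst nn_integral_unif_sphere[symmetric]) simp_all
  finally show "emeasure (distr unif_sphere borel (\<lambda>x. Q *v x)) A = emeasure unif_sphere A" .
qed simp

lemma AE_unif_sphere_norm: "AE x in (unif_sphere :: (real^'p) measure). norm x = 1"
proof -
  have "(\<integral>\<^sup>+x. indicator {x. norm x \<noteq> 1} x \<partial>(unif_sphere :: (real^'p) measure))
     = ennreal (1 / unit_ball_vol (real CARD('p))) * (\<integral>\<^sup>+x. indicator {x. norm x \<noteq> 1} (x /\<^sub>R norm x) * indicator (cball 0 1) (x::real^'p) \<partial>lborel)"
    by (rule nn_integral_unif_sphere) simp
  also have "(\<integral>\<^sup>+x. indicator {x. norm x \<noteq> 1} (x /\<^sub>R norm x) * indicator (cball 0 1) (x::real^'p) \<partial>lborel) = (\<integral>\<^sup>+x. 0 \<partial>(lborel::(real^'p) measure))"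
  proof (rule nn_integral_cong_AE)
    have "AE x in lborel. x \<noteq> (0::real^'p)" by (rule AE_lborel_singleton)
    then show "AE x in lborel. indicator {x. norm x \<noteq> 1} (x /\<^sub>R norm x) * indicator (cball 0 1) (x::real^'p) = (0::ennreal)"
      by eventually_elim (simp add: indicator_def)
  qed
  finally have "(\<integral>\<^sup>+x. indicator {x. norm x \<noteq> 1} x \<partial>(unif_sphere :: (real^'p) measure)) = 0" by simp
  then have "emeasure (unif_sphere :: (real^'p) measure) {x. norm x \<noteq> 1} = 0" by simp
  then show ?thesis
    by (intro AE_I[of _ _ "{x. norm x \<noteq> 1}"]) auto
qed

section \<open>Moments of uniform samples on the sphere\<close>

lemma integral_unif_sphere_orthogonal:
  fixes Q :: "real^'p \<Rightarrow> real^'p"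
  assumes lin: "linear Q" and n: "\<And>x. norm (Q x) = norm x" and [measurable]: "f \<in> borel_measurable borel"
  shows "(\<integral>x. f (Q x) \<partial>unif_sphere) = (\<integral>x. (f x :: real) \<partial>unif_sphere)"
proof -
  have Q: "matrix Q *v x = Q x" for x using lin by (simp add: matrix_works)
  have "distr unif_sphere borel (\<lambda>x. matrix Q *v x) = unif_sphere"
    by (rule unif_sphere_orthogonal) (simp add: Q n)
  then have "(\<integral>x. f x \<partial>unif_sphere) = (\<integral>x. f x \<partial>distr unif_sphere borel (\<lambda>x. matrix Q *v x))" by simp
  also have "\<dots> = (\<integral>x. f (Q x) \<partial>unif_sphere)" by (subst integral_distr) (simp_all add: Q)
  finally show ?thesis by simp
qed

definition kd :: "'a \<Rightarrow> 'a \<Rightarrow> real" where "kd a b = (if a = b then 1 else 0)"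

definition iso4 :: "'p::finite \<Rightarrow> 'p \<Rightarrow> 'p \<Rightarrow> 'p \<Rightarrow> real" where
  "iso4 a b c d = (kd a b * kd c d + kd a c * kd b d + kd a d * kd b c) / (real CARD('p) * (real CARD('p) + 2))"

lemma integrable_unif_sphere_bounded:
  fixes f :: "real^'p \<Rightarrow> real"
  assumes [measurable]: "f \<in> borel_measurable borel" and b: "\<And>x. norm x = 1 \<Longrightarrow> \<bar>f x\<bar> \<le> B"
  shows "integrable unif_sphere f"
proof -
  interpret prob_space "unif_sphere :: (real^'p) measure" by (rule prob_space_unif_sphere)
  show ?thesis
    by (rule integrable_const_bound[of _ B]) (use AE_unif_sphere_norm[where 'p='p] b in \<open>auto elim!: eventually_mono\<close>)
qed

lemma abs_prod4_le:
  fixes a b c d :: real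
  assumes "\<bar>a\<bar> \<le> A" "\<bar>b\<bar> \<le> B" "\<bar>c\<bar> \<le> C" "\<bar>d\<bar> \<le> D"
  shows "\<bar>a * b * c * d\<bar> \<le> A * B * C * D"
proof -
  have "0 \<le> A" "0 \<le> B" "0 \<le> C" using assms by linarith+
  then show ?thesis using assms unfolding abs_mult by (intro mult_mono) auto
qed

lemma component_le_1: "norm (x::real^'p) = 1 \<Longrightarrow> \<bar>x $ i\<bar> \<le> 1"
  using component_le_norm_cart[of x i] by simp

text \<open>Symmetries determine everything but one number: sign flips of a coordinate kill the
  moments in which it has odd multiplicity, permutations identify the rest, and a rotation by 45
  degrees in a coordinate plane relates the two remaining types. The identity |x|^4 = 1 fixes the
  scale.\<close>

lemma fourth_moment:
  "(\<integral>x. x $ a * x $ b * x $ c * x $ d \<partial>(unif_sphere :: (real^'p) measure)) = iso4 a b c d"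
proof -
  interpret prob_space "unif_sphere :: (real^'p) measure" by (rule prob_space_unif_sphere)
  define m where "m a b c d = (\<integral>x. x $ a * x $ b * x $ c * x $ d \<partial>(unif_sphere :: (real^'p) measure))" for a b c d
  have int: "integrable unif_sphere (\<lambda>x::real^'p. x $ a * x $ b * x $ c * x $ d)" for a b c d
    by (rule integrable_unif_sphere_bounded[of _ "1*1*1*1"]) (simp, rule abs_prod4_le, auto intro!: component_le_1 simp del: mult_1_right)
  have flip: "m a b c d = (if a = k then -1 else 1) * (if b = k then -1 else 1) * (if c = k then -1 else 1) * (if d = k then -1 else 1) * m a b c d" for k a b c d
  proof -
    define Q :: "real^'p \<Rightarrow> real^'p" where "Q x = (\<chi> i. (if i = k then -1 else 1) * x $ i)" for x
    have "linear Q" by (rule linearI) (auto simp: Q_def vec_eq_iff algebra_simps)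
    moreover have "norm (Q x) = norm x" for x
      by (auto simp: norm_vec_def L2_set_def Q_def intro!: sum.cong)
    ultimately have "m a b c d = (\<integral>x. Q x $ a * Q x $ b * Q x $ c * Q x $ d \<partial>unif_sphere)"
      unfolding m_def by (intro integral_unif_sphere_orthogonal[symmetric]) auto
    also have "\<dots> = (\<integral>x. ((if a = k then -1 else 1) * (if b = k then -1 else 1) * (if c = k then -1 else 1) * (if d = k then -1 else 1)) * (x $ a * x $ b * x $ c * x $ d) \<partial>unif_sphere)"
      by (intro Bochner_Integration.integral_cong) (auto simp: Q_def)
    also have "\<dots> = ((if a = k then -1 else 1) * (if b = k then -1 else 1) * (if c = k then -1 else 1) * (if d = k then -1 else 1)) * m a b c d"
      unfolding m_def by (rule integral_mult_right_zero)
    finally show ?thesis .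
  qed
  have zero: "m a b c d = 0"
    if "(if a = k then -1 else 1) * (if b = k then -1 else 1) * (if c = k then -1 else 1) * (if d = k then -1 else 1) = (-1 :: real)" for a b c d k
    using flip[of a b c d k] unfolding that by linarith
  have swap: "m a a a a = m b b b b" "c \<noteq> a \<Longrightarrow> c \<noteq> b \<Longrightarrow> m a a c c = m b b c c" for a b c
  proof -
    define Q :: "real^'p \<Rightarrow> real^'p" where "Q x = (\<chi> i. x $ Transposition.transpose a b i)" for x
    have l: "linear Q" by (rule linearI) (auto simp: Q_def vec_eq_iff)
    have n: "norm (Q x) = norm x" for x
      using sum.reindex_bij_betw[of "Transposition.transpose a b" UNIV UNIV "\<lambda>i. (x $ i)\<^sup>2"]
      by (simp add: norm_vec_def L2_set_def Q_def bij_betw_transpose_iff)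
    have "m b b b b = (\<integral>x. Q x $ b * Q x $ b * Q x $ b * Q x $ b \<partial>unif_sphere)"
      unfolding m_def by (intro integral_unif_sphere_orthogonal[OF l n, symmetric]) auto
    then show "m a a a a = m b b b b" by (simp add: Q_def m_def)
    assume "c \<noteq> a" "c \<noteq> b"
    have "m b b c c = (\<integral>x. Q x $ b * Q x $ b * Q x $ c * Q x $ c \<partial>unif_sphere)"
      unfolding m_def by (intro integral_unif_sphere_orthogonal[OF l n, symmetric]) auto
    then show "m a a c c = m b b c c" using \<open>c \<noteq> a\<close> \<open>c \<noteq> b\<close> by (simp add: Q_def m_def Transposition.transpose_def)
  qed
  have msym: "m a b c d = m b a c d" "m a b c d = m a c b d" "m a b c d = m a b d c" "m a b c d = m c d a b" for a b c d
    unfolding m_def by (simp_all add: mult_ac)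
  \<comment> \<open>The orthogonal map replaces the coordinates by (x_a + x_b) / sqrt 2 and (x_a -
    x_b) / sqrt 2. Expanding the product of their squares gives 4 m_aabb = 2 m_aaaa - 2
    m_aabb.\<close>
  have rot: "m a a a a = 3 * m a a b b" if "a \<noteq> b" for a b
  proof -
    define Q :: "real^'p \<Rightarrow> real^'p" where
      "Q x = (\<chi> i. if i = a then (x $ a + x $ b) / sqrt 2 else if i = b then (x $ a - x $ b) / sqrt 2 else x $ i)" for x
    have l: "linear Q" by (rule linearI) (auto simp: Q_def vec_eq_iff field_simps)
    have n: "norm (Q x) = norm x" for x
    proof -
      have "(\<Sum>i\<in>UNIV. (Q x $ i)\<^sup>2) = (Q x $ a)\<^sup>2 + ((Q x $ b)\<^sup>2 + (\<Sum>i\<in>UNIV - {a} - {b}. (Q x $ i)\<^sup>2))"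
        using that by (subst sum.remove[of _ a], simp, simp, subst sum.remove[of _ b]) auto
      also have "(\<Sum>i\<in>UNIV - {a} - {b}. (Q x $ i)\<^sup>2) = (\<Sum>i\<in>UNIV - {a} - {b}. (x $ i)\<^sup>2)"
        by (intro sum.cong) (auto simp: Q_def)
      also have "(Q x $ a)\<^sup>2 + ((Q x $ b)\<^sup>2 + (\<Sum>i\<in>UNIV - {a} - {b}. (x $ i)\<^sup>2)) = (x $ a)\<^sup>2 + ((x $ b)\<^sup>2 + (\<Sum>i\<in>UNIV - {a} - {b}. (x $ i)\<^sup>2))"
        using that by (simp add: Q_def power_divide power2_sum power2_diff field_simps)
      also have "\<dots> = (\<Sum>i\<in>UNIV. (x $ i)\<^sup>2)"
        using that by (subst (2) sum.remove[of _ a], simp, simp, subst (2) sum.remove[of _ b]) auto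
      finally show ?thesis by (simp add: norm_vec_def L2_set_def)
    qed
    have "m a a b b = (\<integral>x. Q x $ a * Q x $ a * Q x $ b * Q x $ b \<partial>unif_sphere)"
      unfolding m_def by (intro integral_unif_sphere_orthogonal[OF l n, symmetric]) auto
    also have "\<dots> = (\<integral>x. (1/4) * ((x $ a * x $ a * x $ a * x $ a + x $ b * x $ b * x $ b * x $ b) - 2 * (x $ a * x $ a * x $ b * x $ b)) \<partial>unif_sphere)"
      using that by (intro Bochner_Integration.integral_cong) (auto simp: Q_def field_simps)
    also have "\<dots> = (1/4) * ((m a a a a + m b b b b) - 2 * m a a b b)"
      unfolding m_def by (simp add: int)
    finally show ?thesis using swap(1)[of a b] by simp
  qed
  define \<beta> where "\<beta> = 1 / (real CARD('p) * (real CARD('p) + 2))"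
  have diag: "m a a a a = 3 * \<beta> \<and> (\<forall>b. a \<noteq> b \<longrightarrow> m a a b b = \<beta>)" for a
  proof -
    define \<alpha> where "\<alpha> = m a a a a"
    have all: "m i i j j = (if i = j then \<alpha> else \<alpha> / 3)" for i j
      using rot[of i j] swap(1)[of i a] by (auto simp: \<alpha>_def)
    have "(1::real) = (\<integral>x. 1 \<partial>(unif_sphere :: (real^'p) measure))" using prob_space by simp
    also have "\<dots> = (\<integral>x. (\<Sum>i\<in>UNIV. \<Sum>j\<in>UNIV. x $ i * x $ i * x $ j * x $ j) \<partial>(unif_sphere :: (real^'p) measure))"
    proof (rule integral_cong_AE)
      show "AE x in (unif_sphere :: (real^'p) measure). 1 = (\<Sum>i\<in>UNIV. \<Sum>j\<in>UNIV. x $ i * x $ i * x $ j * x $ j)"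
        using AE_unif_sphere_norm[where 'p='p]
      proof eventually_elim
        fix x :: "real^'p" assume "norm x = 1"
        then have "x \<bullet> x = 1" by (simp add: norm_eq_1)
        then have "(\<Sum>i\<in>UNIV. x $ i * x $ i) * (\<Sum>i\<in>UNIV. x $ i * x $ i) = 1" by (simp add: inner_vec_def)
        then show "1 = (\<Sum>i\<in>UNIV. \<Sum>j\<in>UNIV. x $ i * x $ i * x $ j * x $ j)" by (simp add: sum_product mult.assoc)
      qed
    qed auto
    also have "\<dots> = (\<Sum>i\<in>UNIV. \<Sum>j\<in>UNIV. m i i j j)"
      unfolding m_def by (subst Bochner_Integration.integral_sum; (intro sum.cong refl Bochner_Integration.integral_sum)?; (intro Bochner_Integration.integrable_sum int)?; (rule int)?)
    also have "\<dots> = (\<Sum>i\<in>(UNIV::'p set). \<Sum>j\<in>(UNIV::'p set). \<alpha> / 3 + (if i = j then 2 * \<alpha> / 3 else 0))"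
      by (intro sum.cong) (auto simp: all)
    also have "\<dots> = real CARD('p) * (real CARD('p) * (\<alpha> / 3) + 2 * \<alpha> / 3)"
      by (simp add: sum.distrib)
    finally have "\<alpha> * (real CARD('p) * (real CARD('p) + 2)) = 3" by (simp add: field_simps)
    then have "\<alpha> = 3 / (real CARD('p) * (real CARD('p) + 2))"
      by (rule eq_divide_imp[rotated]) (simp add: add_eq_0_iff)
    then have "\<alpha> = 3 * \<beta>" by (simp add: \<beta>_def)
    then have "m a a a a = 3 * \<beta>" "m a a b b = \<beta>" if "a \<noteq> b" for b
      using all[of a a] all[of a b] that by simp_all
    moreover have "m a a a a = 3 * \<beta>" using all[of a a] \<open>\<alpha> = 3 * \<beta>\<close> by simp
    ultimately show ?thesis by blast
  qed
  have "m a b c d = (kd a b * kd c d + kd a c * kd b d + kd a d * kd b c) * \<beta>"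
  proof (cases "a = b")
    case True
    show ?thesis
    proof (cases "c = d")
      case c: True
      show ?thesis
      proof (cases "a = c")
        case True then show ?thesis using diag[of a] \<open>a = b\<close> c by (simp add: kd_def)
      next
        case False then show ?thesis using diag[of a] \<open>a = b\<close> c by (auto simp: kd_def)
      qed
    next
      case False
      have "m a b c d = 0"
        using zero[of a d b c d] zero[of a c b c d] True False by (cases "d = a") auto
      then show ?thesis using True False by (auto simp: kd_def)
    qed
  next
    case ab: False
    show ?thesis
    proof (cases "a = c")
      case True
      show ?thesis
      proof (cases "b = d")
        case b: True
        have "m a b c d = m a a b b" using msym(2) True b by metis
        then show ?thesis using diag[of a] ab True b by (auto simp: kd_def)
      next
        case False
        have "m a b c d = 0"
          using zero[of a b b c d] ab True False by auto
        then show ?thesis using ab True False by (auto simp: kd_def)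
      qed
    next
      case ac: False
      show ?thesis
      proof (cases "a = d")
        case True
        show ?thesis
        proof (cases "b = c")
          case b: True
          have "m a b c d = m a a b b" using msym True b by metis
          then show ?thesis using diag[of a] ab True b by (auto simp: kd_def)
        next
          case False
          have "m a b c d = 0"
            using zero[of a b b c d] ab True False by auto
          then show ?thesis using ab True False by (auto simp: kd_def)
        qed
      next
        case False
        have "m a b c d = 0"
          using zero[of a a b c d] ab ac False by auto
        then show ?thesis using ab ac False by (auto simp: kd_def)
      qed
    qed
  qed
  then show ?thesis by (simp add: m_def iso4_def \<beta>_def)
qed

section \<open>The uniform sample and its concentration\<close>

definition unif_sample :: "nat \<Rightarrow> (nat \<Rightarrow> real^'p) measure" where
  "unif_sample n = PiM {..<n} (\<lambda>_. unif_sphere)"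

lemma space_unif_sample: "space (unif_sample n) = ({..<n} \<rightarrow>\<^sub>E UNIV)"
  by (simp add: unif_sample_def space_PiM)

lemma measurable_unif_sample_component[measurable]:
  "i < n \<Longrightarrow> (\<lambda>\<omega>. \<omega> i) \<in> borel_measurable (unif_sample n)"
  unfolding unif_sample_def using measurable_component_singleton[of i "{..<n}" "\<lambda>_. unif_sphere"]
  by simp

lemma prob_space_unif_sample: "prob_space (unif_sample n)"
  unfolding unif_sample_def by (intro prob_space_PiM prob_space_unif_sphere)

lemma distr_unif_sample_component:
  assumes "i < n"
  shows "distr (unif_sample n) borel (\<lambda>\<omega>. \<omega> i) = (unif_sphere :: (real^'p) measure)"
proof -
  have "distr (unif_sample n) borel (\<lambda>\<omega>. \<omega> i) = distr (PiM {..<n} (\<lambda>_. unif_sphere)) (unif_sphere :: (real^'p) measure) (\<lambda>\<omega>. \<omega> i)"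
    unfolding unif_sample_def by (rule distr_cong) auto
  also have "\<dots> = unif_sphere"
    by (rule distr_PiM_component) (use assms in \<open>auto intro: prob_space_unif_sphere\<close>)
  finally show ?thesis .
qed

lemma AE_unif_sample_norm: "AE \<omega> in (unif_sample n :: (nat \<Rightarrow> real^'p) measure). \<forall>i<n. norm (\<omega> i) = 1"
proof -
  have "AE \<omega> in (unif_sample n :: (nat \<Rightarrow> real^'p) measure). norm (\<omega> i) = 1" if "i < n" for i
  proof -
    have "AE x in distr (unif_sample n :: (nat \<Rightarrow> real^'p) measure) borel (\<lambda>\<omega>. \<omega> i). norm x = 1"
      unfolding distr_unif_sample_component[OF that, where 'p='p] by (rule AE_unif_sphere_norm)
    then show ?thesis by (subst (asm) AE_distr_iff) (use that in auto)
  qed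
  then have "AE \<omega> in (unif_sample n :: (nat \<Rightarrow> real^'p) measure). \<forall>i\<in>{..<n}. norm (\<omega> i) = 1"
    by (intro AE_finite_allI) auto
  then show ?thesis by (auto elim!: eventually_mono)
qed

text \<open>Hoeffding's inequality for variables in [-1, 1]: the squared lengths of the ranges add
  up to 4 n, whence the exponent. The bound on \<open>h\<close> is needed on the sphere alone, where
  the law is concentrated.\<close>

lemma unif_sample_concentration:
  fixes h :: "real^'p \<Rightarrow> real"
  assumes [measurable]: "h \<in> borel_measurable borel" and b: "\<And>x. norm x = 1 \<Longrightarrow> \<bar>h x\<bar> \<le> 1"
    and n: "n \<ge> 1" and M: "M \<ge> 0"
  shows "measure (unif_sample n) {\<omega>\<in>space (unif_sample n). \<bar>(\<Sum>i<n. h (\<omega> i)) - real n * (\<integral>x. h x \<partial>unif_sphere)\<bar> \<ge> M * sqrt (real n)} \<le> 2 * exp (- M\<^sup>2 / 2)"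
proof -
  let ?M = "unif_sample n :: (nat \<Rightarrow> real^'p) measure"
  interpret prob_space ?M by (rule prob_space_unif_sample)
  define X where "X i \<omega> = h (\<omega> i)" for i and \<omega> :: "nat \<Rightarrow> real^'p"
  have [measurable]: "X i \<in> borel_measurable ?M" if "i < n" for i
    unfolding X_def using that by measurable
  have hm: "h \<in> borel_measurable unif_sphere"
    by (rule measurable_cong_sets[OF sets_unif_sphere refl, THEN equalityD2, THEN subsetD]) fact
  have dX: "distr ?M borel (X i) = distr unif_sphere borel h" if "i < n" for i
  proof -
    have "distr unif_sphere borel h = distr (distr ?M borel (\<lambda>\<omega>. \<omega> i)) borel h"
      using distr_unif_sample_component[OF that, where 'p='p] by simp
    also have "\<dots> = distr ?M borel (X i)"
      by (subst distr_distr) (use that in \<open>auto simp: comp_def X_def[abs_def]\<close>)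
    finally show ?thesis by simp
  qed
  have "indep_vars (\<lambda>_. borel) X {..<n}"
  proof (subst indep_vars_iff_distr_eq_PiM')
    show "{..<n} \<noteq> {}" using n lessThan_iff[of 0 n] by (metis One_nat_def Suc_le_lessD empty_iff)
    have "distr ?M (\<Pi>\<^sub>M i\<in>{..<n}. borel) (\<lambda>x. \<lambda>i\<in>{..<n}. X i x) = distr (PiM {..<n} (\<lambda>_. unif_sphere)) (\<Pi>\<^sub>M i\<in>{..<n}. distr unif_sphere borel h) (compose {..<n} h)"
      unfolding unif_sample_def X_def compose_def by (rule distr_cong) (auto intro!: sets_PiM_cong)
    also have "\<dots> = (\<Pi>\<^sub>M i\<in>{..<n}. distr unif_sphere (distr unif_sphere borel h) h)"
      by (intro distr_PiM_finite_prob_space') (auto intro!: prob_space_unif_sphere prob_space.prob_space_distr hm)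
    also have "\<dots> = (\<Pi>\<^sub>M i\<in>{..<n}. distr ?M borel (X i))"
      by (intro PiM_cong refl) (auto simp: dX intro!: distr_cong)
    finally show "distr ?M (\<Pi>\<^sub>M i\<in>{..<n}. borel) (\<lambda>x. \<lambda>i\<in>{..<n}. X i x) = (\<Pi>\<^sub>M i\<in>{..<n}. distr ?M borel (X i))" .
  qed auto
  moreover have "AE \<omega> in ?M. X i \<omega> \<in> {-1..1}" if "i < n" for i
    using AE_unif_sample_norm[of n, where 'p='p]
  proof eventually_elim
    fix \<omega> :: "nat \<Rightarrow> real^'p" assume "\<forall>i<n. norm (\<omega> i) = 1"
    then show "X i \<omega> \<in> {-1..1}" using b[of "\<omega> i"] that by (auto simp: X_def abs_le_iff)
  qed
  moreover have ex: "expectation (X i) = (\<integral>x. h x \<partial>unif_sphere)" if "i < n" for i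
  proof -
    have "(\<integral>x. h x \<partial>unif_sphere) = (\<integral>x. x \<partial>distr unif_sphere borel h)"
      by (subst integral_distr) (auto simp: hm)
    also have "\<dots> = expectation (X i)"
      unfolding dX[OF that, symmetric] by (subst integral_distr) (use that in auto)
    finally show ?thesis by simp
  qed
  ultimately interpret Hoeffding_ineq ?M "{..<n}" X "\<lambda>_. -1" "\<lambda>_. 1" "\<Sum>i<n. expectation (X i)"
    by unfold_locales auto
  have "prob {\<omega>\<in>space ?M. \<bar>(\<Sum>i<n. X i \<omega>) - (\<Sum>i<n. expectation (X i))\<bar> \<ge> M * sqrt (real n)}
     \<le> 2 * exp (- 2 * (M * sqrt (real n))\<^sup>2 / (\<Sum>i<n. (1 - (-1))\<^sup>2))"
    by (rule Hoeffding_ineq_abs_ge) (use M n in auto)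
  also have "- 2 * (M * sqrt (real n))\<^sup>2 / (\<Sum>i<n. (1 - (-1))\<^sup>2) = - M\<^sup>2 / 2"
    using n by (simp add: power_mult_distrib field_simps)
  also have "(\<Sum>i<n. expectation (X i)) = real n * (\<integral>x. h x \<partial>unif_sphere)"
    by (simp add: ex)
  finally show ?thesis by (simp add: X_def)
qed

section \<open>Anticoncentration of Rademacher sums\<close>

text \<open>The identity cos (v + a) + cos (v - a) = 2 cos v cos a removes one sign at a time; the
  phase \<open>v\<close> is there to absorb the removed summand in the induction.\<close>

lemma sum_cos_signs:
  fixes a :: "nat \<Rightarrow> real"
  shows "(\<Sum>J\<in>Pow {..<n}. cos (v + (\<Sum>i<n. (if i \<in> J then - a i else a i)))) = 2 ^ n * cos v * (\<Prod>i<(n::nat). cos (a i))"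
proof (induction n arbitrary: v)
  case (Suc n)
  define f where "f v J = cos (v + (\<Sum>i<n. (if i \<in> J then - a i else a i)))" for v J
  have P: "Pow {..<Suc n} = Pow {..<n} \<union> insert n ` Pow {..<n}"
    by (simp add: lessThan_Suc Pow_insert)
  have d: "Pow {..<n} \<inter> insert n ` Pow {..<n} = {}" by auto
  have inj: "inj_on (insert n) (Pow {..<n})"
    by (rule inj_onI) (metis PowD insert_ident lessThan_iff less_irrefl subsetD)
  have "(\<Sum>J\<in>Pow {..<Suc n}. cos (v + (\<Sum>i<Suc n. (if i \<in> J then - a i else a i))))
    = (\<Sum>J\<in>Pow {..<n}. cos (v + (\<Sum>i<Suc n. (if i \<in> J then - a i else a i))))
    + (\<Sum>J\<in>Pow {..<n}. cos (v + (\<Sum>i<Suc n. (if i \<in> insert n J then - a i else a i))))"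
    unfolding P by (subst sum.union_disjoint[OF _ _ d]) (auto simp: sum.reindex[OF inj])
  also have "\<dots> = (\<Sum>J\<in>Pow {..<n}. f (v + a n) J) + (\<Sum>J\<in>Pow {..<n}. f (v - a n) J)"
  proof (intro arg_cong2[where f="(+)"] sum.cong refl)
    fix J assume J: "J \<in> Pow {..<n}"
    then have "n \<notin> J" by auto
    then show "cos (v + (\<Sum>i<Suc n. (if i \<in> J then - a i else a i))) = f (v + a n) J"
      by (simp add: f_def algebra_simps)
    have "(\<Sum>i<n. (if i \<in> insert n J then - a i else a i)) = (\<Sum>i<n. (if i \<in> J then - a i else a i))"
      by (intro sum.cong) auto
    then show "cos (v + (\<Sum>i<Suc n. (if i \<in> insert n J then - a i else a i))) = f (v - a n) J"
      by (simp add: f_def algebra_simps)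
  qed
  also have "\<dots> = 2 ^ n * (cos (v + a n) + cos (v - a n)) * (\<Prod>i<n. cos (a i))"
    unfolding f_def Suc.IH by (simp add: algebra_simps)
  also have "\<dots> = 2 ^ Suc n * cos v * (\<Prod>i<Suc n. cos (a i))"
    by (simp add: cos_add cos_diff algebra_simps)
  finally show ?case .
qed simp

lemma std_normal_cos:
  "integrable std_normal_distribution (\<lambda>x. cos (s * x))"
  "(\<integral>x. cos (s * x) \<partial>std_normal_distribution) = exp (- s\<^sup>2 / 2)"
proof -
  interpret real_distribution std_normal_distribution by (rule real_dist_normal_dist)
  have int: "complex_integrable std_normal_distribution (\<lambda>x. iexp (s * x))"
    by (rule integrable_iexp) auto
  have "(\<integral>x. cos (s * x) \<partial>std_normal_distribution) = Re (char std_normal_distribution s)"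
    unfolding char_def using int by (subst integral_Re[symmetric]) (auto simp: Re_exp)
  then show "(\<integral>x. cos (s * x) \<partial>std_normal_distribution) = exp (- s\<^sup>2 / 2)"
    by (simp add: char_std_normal_distribution)
  show "integrable std_normal_distribution (\<lambda>x. cos (s * x))"
    by (rule integrable_const_bound[of _ 1]) auto
qed

text \<open>The density is at most 1/2 because sqrt (2 pi) \<ge> 2.\<close>

lemma std_normal_small_ball:
  assumes "\<delta> \<ge> 0"
  shows "measure std_normal_distribution {-\<delta>..\<delta>} \<le> \<delta>"
proof -
  interpret real_distribution std_normal_distribution by (rule real_dist_normal_dist)
  have d: "std_normal_density x \<le> 1/2" for x
  proof -
    have "2 \<le> sqrt (2 * pi)" using pi_ge_two by (intro real_le_rsqrt) simp
    then have "1 / sqrt (2 * pi) \<le> 1/2" by (simp add: field_simps)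
    moreover have "exp (- x\<^sup>2 / 2) \<le> 1" by simp
    ultimately have "1 / sqrt (2 * pi) * exp (- x\<^sup>2 / 2) \<le> 1/2 * 1" by (intro mult_mono) auto
    then show ?thesis by (simp add: std_normal_density_def)
  qed
  have "emeasure std_normal_distribution {-\<delta>..\<delta>} = (\<integral>\<^sup>+x. ennreal (std_normal_density x) * indicator {-\<delta>..\<delta>} x \<partial>lborel)"
    by (rule emeasure_density) auto
  also have "\<dots> \<le> (\<integral>\<^sup>+x. ennreal (1/2) * indicator {-\<delta>..\<delta>} x \<partial>lborel)"
    by (intro nn_integral_mono mult_right_mono ennreal_leI d) auto
  also have "\<dots> = ennreal (1/2) * ennreal (2 * \<delta>)"
    using assms by (simp add: nn_integral_cmult_indicator)
  also have "\<dots> = ennreal \<delta>" using assms by (subst ennreal_mult[symmetric]) auto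
  finally show ?thesis using assms by (simp add: emeasure_eq_measure)
qed

text \<open>By cos y = 1 - 2 sin^2 (y/2) it suffices that sin (|y|/2) is at least |y| / (2 sqrt 2),
  which leaves 1 - y^2/4.\<close>

lemma abs_cos_le_exp:
  fixes y :: real
  assumes "\<bar>y\<bar> \<le> 1"
  shows "\<bar>cos y\<bar> \<le> exp (- (y\<^sup>2) / 4)"
proof -
  have "\<bar>y\<bar> \<le> pi / 2" using assms pi_ge_two by linarith
  then have c: "cos y \<ge> 0" by (intro cos_ge_zero) auto
  have "cos y = 1 - 2 * (sin (y/2))\<^sup>2" using cos_double_sin[of "y/2"] by simp
  moreover have "(y\<^sup>2) / 8 \<le> (sin (y/2))\<^sup>2"
  proof -
    have *: "\<bar>y\<bar> / 2 / sqrt 2 \<le> sin (\<bar>y\<bar>/2)"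
    proof -
      have "sin (\<bar>y\<bar>/2) \<ge> \<bar>y\<bar>/2 - (\<bar>y\<bar>/2) ^ 3 / 6"
      proof -
        have "\<bar>sin (\<bar>y\<bar>/2) - \<bar>y\<bar>/2\<bar> \<le> (\<bar>y\<bar>/2) ^ 3 / 6"
          using Maclaurin_sin_bound[of "\<bar>y\<bar>/2" 3] by (simp add: sin_coeff_def numeral_eq_Suc)
        then show ?thesis by linarith
      qed
      moreover have "(\<bar>y\<bar>/2) ^ 3 \<le> (\<bar>y\<bar>/2) * (1/4)"
      proof -
        have "(\<bar>y\<bar>/2) ^ 2 \<le> (1/2) ^ 2" using assms by (intro power_mono) auto
        then have "(\<bar>y\<bar>/2) * (\<bar>y\<bar>/2) ^ 2 \<le> (\<bar>y\<bar>/2) * (1/4)" by (intro mult_left_mono) (auto simp: power2_eq_square)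
        then show ?thesis by (simp add: power3_eq_cube power2_eq_square)
      qed
      \<comment> \<open>Third-order Taylor bound: 1 - (y/2)^2 / 6 \<ge> 1 - 1/24 on |y| \<le>
        1.\<close>
      ultimately have "\<bar>y\<bar>/2 * (23/24) \<le> sin (\<bar>y\<bar>/2)" by simp
      moreover have "1 / sqrt 2 \<le> 23/24"
      proof -
        have "24/23 \<le> sqrt 2" by (rule real_le_rsqrt) (simp add: power2_eq_square)
        then show ?thesis by (simp add: field_simps)
      qed
      then have "\<bar>y\<bar>/2 * (1 / sqrt 2) \<le> \<bar>y\<bar>/2 * (23/24)" by (intro mult_left_mono) auto
      ultimately show ?thesis by simp
    qed
    have "(\<bar>y\<bar> / 2 / sqrt 2)\<^sup>2 \<le> (sin (\<bar>y\<bar>/2))\<^sup>2" using * by (intro power_mono) auto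
    moreover have "(sin (\<bar>y\<bar>/2))\<^sup>2 = (sin (y/2))\<^sup>2" by (cases "y \<ge> 0") (auto simp: abs_if)
    ultimately show ?thesis by (simp add: power_divide)
  qed
  ultimately have "cos y \<le> 1 + (- (y\<^sup>2) / 4)" by simp
  also have "\<dots> \<le> exp (- (y\<^sup>2) / 4)" by (rule exp_ge_add_one_self)
  finally show ?thesis using c by simp
qed

text \<open>The indicator of a small interval is dominated by a Gaussian, whose Fourier transform turns
  the average over signs into a product of cosines.\<close>
lemma rademacher_small_ball:
  fixes a :: "nat \<Rightarrow> real"
  assumes a: "\<And>i. i < n \<Longrightarrow> \<bar>a i\<bar> \<le> 1" and T: "T > 0" and A: "A > 0" "A * T\<^sup>2 \<le> (\<Sum>i<n. (a i)\<^sup>2)" and \<delta>: "\<delta> > 0"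
  shows "real (card {J\<in>Pow {..<n}. \<bar>\<Sum>i<n. (if i \<in> J then - a i else a i)\<bar> \<le> T})
    \<le> 2 ^ n * (2 * (\<delta> + 4 / (\<delta>\<^sup>2 * A) + 1 / T\<^sup>2))"
proof -
  interpret real_distribution std_normal_distribution by (rule real_dist_normal_dist)
  have ind: "integrable std_normal_distribution (indicator {-\<delta>..\<delta>} :: real \<Rightarrow> real)"
    by (rule integrable_const_bound[of _ 1]) auto
  define s where "s J = (\<Sum>i<n. (if i \<in> J then - a i else a i))" for J
  \<comment> \<open>Because sqrt e \<le> 2, the indicator of |s| \<le> T is at most 2 exp (-(s/T)^2
    / 2).\<close>
  have e: "exp (1/2 :: real) \<le> 2"
  proof -
    have "exp (1/2 :: real) \<le> 1 + 1/2 + (1/2)\<^sup>2" by (rule exp_bound) auto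
    then show ?thesis by (simp add: power2_eq_square)
  qed
  have "real (card {J\<in>Pow {..<n}. \<bar>s J\<bar> \<le> T}) = (\<Sum>J\<in>Pow {..<n}. if \<bar>s J\<bar> \<le> T then 1 else 0)"
    by (simp add: sum.If_cases Int_def)
  also have "\<dots> \<le> (\<Sum>J\<in>Pow {..<n}. 2 * exp (- (s J / T)\<^sup>2 / 2))"
  proof (rule sum_mono)
    fix J
    show "(if \<bar>s J\<bar> \<le> T then 1 else 0) \<le> 2 * exp (- (s J / T)\<^sup>2 / 2)"
    proof (cases "\<bar>s J\<bar> \<le> T")
      case True
      then have "(s J / T)\<^sup>2 \<le> 1" using T by (simp add: power_divide abs_le_square_iff[symmetric])
      then have "exp 0 \<le> exp (1/2 - (s J / T)\<^sup>2 / 2)" by simp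
      also have "\<dots> = exp (1/2) * exp (- (s J / T)\<^sup>2 / 2)" by (simp add: exp_add[symmetric])
      also have "\<dots> \<le> 2 * exp (- (s J / T)\<^sup>2 / 2)" using e by (intro mult_right_mono) auto
      finally show ?thesis using True by simp
    qed simp
  qed
  also have "\<dots> = 2 * (\<Sum>J\<in>Pow {..<n}. \<integral>x. cos (s J / T * x) \<partial>std_normal_distribution)"
    unfolding std_normal_cos(2) sum_distrib_left ..
  also have "(\<Sum>J\<in>Pow {..<n}. \<integral>x. cos (s J / T * x) \<partial>std_normal_distribution) = (\<integral>x. (\<Sum>J\<in>Pow {..<n}. cos (s J / T * x)) \<partial>std_normal_distribution)"
    by (rule Bochner_Integration.integral_sum[symmetric]) (rule std_normal_cos)
  also have "\<dots> = (\<integral>x. 2 ^ n * (\<Prod>i<n. cos (a i * x / T)) \<partial>std_normal_distribution)"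
  proof (intro Bochner_Integration.integral_cong refl)
    fix x
    have "s J / T * x = 0 + (\<Sum>i<n. (if i \<in> J then - (a i * x / T) else a i * x / T))" for J
      unfolding s_def by (simp add: sum_distrib_right sum_divide_distrib) (intro sum.cong refl, auto)
    then show "(\<Sum>J\<in>Pow {..<n}. cos (s J / T * x)) = 2 ^ n * (\<Prod>i<n. cos (a i * x / T))"
      using sum_cos_signs[of 0 "\<lambda>i. a i * x / T" n] by simp
  qed
  also have "\<dots> \<le> (\<integral>x. 2 ^ n * (indicator {-\<delta>..\<delta>} x + 4 / (\<delta>\<^sup>2 * A) + x\<^sup>2 / T\<^sup>2) \<partial>std_normal_distribution)"
  proof (rule integral_mono)
    have "\<bar>\<Prod>i<n. cos (a i * x / T)\<bar> \<le> 1" for x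
      unfolding abs_prod by (intro prod_le_1) auto
    then show "integrable std_normal_distribution (\<lambda>x. 2 ^ n * (\<Prod>i<n. cos (a i * x / T)))"
      by (intro integrable_mult_right integrable_const_bound[of _ 1]) auto
    show "integrable std_normal_distribution (\<lambda>x. 2 ^ n * (indicator {-\<delta>..\<delta>} x + 4 / (\<delta>\<^sup>2 * A) + x\<^sup>2 / T\<^sup>2))"
      using std_normal_distribution_even_moments(2)[of 1] ind by (intro integrable_mult_right Bochner_Integration.integrable_add) auto
    fix x :: real
    have "(\<Prod>i<n. cos (a i * x / T)) \<le> indicator {-\<delta>..\<delta>} x + 4 / (\<delta>\<^sup>2 * A) + x\<^sup>2 / T\<^sup>2"
    proof (cases "\<bar>x\<bar> \<le> T")
      case False
      then have "T\<^sup>2 \<le> x\<^sup>2" using T by (simp add: abs_le_square_iff[symmetric])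
      then have "1 \<le> x\<^sup>2 / T\<^sup>2" using T by simp
      moreover have "\<bar>\<Prod>i<n. cos (a i * x / T)\<bar> \<le> 1"
        unfolding abs_prod by (intro prod_le_1) auto
      moreover have "0 \<le> 4 / (\<delta>\<^sup>2 * A)" "0 \<le> (indicator {-\<delta>..\<delta>} x :: real)" using A \<delta> by auto
      ultimately show ?thesis by linarith
    next
      case True
      have "(\<Prod>i<n. cos (a i * x / T)) \<le> (\<Prod>i<n. \<bar>cos (a i * x / T)\<bar>)"
        unfolding abs_prod[symmetric] by simp
      also have "\<dots> \<le> (\<Prod>i<n. exp (- ((a i * x / T)\<^sup>2) / 4))"
      proof (intro prod_mono conjI abs_cos_le_exp)
        fix i assume "i \<in> {..<n}"
        then have "\<bar>a i\<bar> * \<bar>x\<bar> \<le> 1 * T" using a True T by (intro mult_mono) auto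
        then show "\<bar>a i * x / T\<bar> \<le> 1" using T by (simp add: abs_mult)
      qed auto
      also have "\<dots> = exp (- (x\<^sup>2 / (4 * T\<^sup>2)) * (\<Sum>i<n. (a i)\<^sup>2))"
        by (simp add: exp_sum[symmetric] sum_distrib_left sum_divide_distrib power_divide power_mult_distrib sum_negf mult_ac)
      also have "\<dots> \<le> exp (- (x\<^sup>2 / (4 * T\<^sup>2)) * (A * T\<^sup>2))"
        using mult_left_mono[OF A(2), of "x\<^sup>2 / (4 * T\<^sup>2)"] by simp
      also have "\<dots> = exp (- (x\<^sup>2 * A / 4))" using T by (simp add: field_simps)
      also have "\<dots> \<le> indicator {-\<delta>..\<delta>} x + 4 / (\<delta>\<^sup>2 * A)"
      proof (cases "\<bar>x\<bar> \<le> \<delta>")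
        case True
        then have "(indicator {-\<delta>..\<delta>} x :: real) = 1" by (auto simp: indicator_def)
        moreover have "exp (- (x\<^sup>2 * A / 4)) \<le> 1" using A by simp
        moreover have "0 \<le> 4 / (\<delta>\<^sup>2 * A)" using A by simp
        ultimately show ?thesis by linarith
      next
        case False
        then have d: "\<delta>\<^sup>2 \<le> x\<^sup>2" using \<delta> by (simp add: abs_le_square_iff[symmetric])
        define y where "y = \<delta>\<^sup>2 * A / 4"
        have y: "y > 0" using \<delta> A by (simp add: y_def)
        have "y \<le> x\<^sup>2 * A / 4" using d A by (simp add: y_def)
        then have "exp (- (x\<^sup>2 * A / 4)) \<le> exp (- y)" by simp
        also have "\<dots> = 1 / exp y" by (simp add: exp_minus inverse_eq_divide)
        also have "\<dots> \<le> 1 / y"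
        proof -
          have "y \<le> exp y" using exp_ge_add_one_self[of y] by linarith
          then show ?thesis using y by (intro divide_left_mono) auto
        qed
        finally show ?thesis by (simp add: y_def indicator_def)
      qed
      finally show ?thesis by (smt (verit) zero_le_divide_iff zero_le_power2)
    qed
    then show "2 ^ n * (\<Prod>i<n. cos (a i * x / T)) \<le> 2 ^ n * (indicator {-\<delta>..\<delta>} x + 4 / (\<delta>\<^sup>2 * A) + x\<^sup>2 / T\<^sup>2)"
      by (intro mult_left_mono) auto
  qed
  also have "\<dots> = 2 ^ n * (measure std_normal_distribution {-\<delta>..\<delta>} + 4 / (\<delta>\<^sup>2 * A) + 1 / T\<^sup>2)"
  proof -
    have m2: "(\<integral>x. x\<^sup>2 \<partial>std_normal_distribution) = 1" "integrable std_normal_distribution (\<lambda>x. x\<^sup>2)"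
      using std_normal_distribution_even_moments[of 1] by (simp_all add: fact_numeral)
    have "(\<integral>x. (indicator {-\<delta>..\<delta>} x + 4 / (\<delta>\<^sup>2 * A) + x\<^sup>2 / T\<^sup>2) \<partial>std_normal_distribution)
      = (\<integral>x. (indicator {-\<delta>..\<delta>} x + 4 / (\<delta>\<^sup>2 * A)) \<partial>std_normal_distribution) + (\<integral>x. x\<^sup>2 / T\<^sup>2 \<partial>std_normal_distribution)"
      using m2 ind by (intro Bochner_Integration.integral_add Bochner_Integration.integrable_add) auto
    also have "(\<integral>x. (indicator {-\<delta>..\<delta>} x + 4 / (\<delta>\<^sup>2 * A)) \<partial>std_normal_distribution) = (\<integral>x. indicator {-\<delta>..\<delta>} x \<partial>std_normal_distribution) + (\<integral>x. 4 / (\<delta>\<^sup>2 * A) \<partial>std_normal_distribution)"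
      using ind by (intro Bochner_Integration.integral_add) auto
    also have "(\<integral>x. 4 / (\<delta>\<^sup>2 * A) \<partial>std_normal_distribution) = 4 / (\<delta>\<^sup>2 * A)"
      using prob_space by simp
    finally show ?thesis using m2 by simp
  qed
  also have "\<dots> \<le> 2 ^ n * (\<delta> + 4 / (\<delta>\<^sup>2 * A) + 1 / T\<^sup>2)"
    using std_normal_small_ball[of \<delta>] \<delta> by (intro mult_left_mono) auto
  finally have "real (card {J\<in>Pow {..<n}. \<bar>s J\<bar> \<le> T}) \<le> 2 * (2 ^ n * (\<delta> + 4 / (\<delta>\<^sup>2 * A) + 1 / T\<^sup>2))" by simp
  then show ?thesis unfolding s_def by (simp only: mult.left_commute)
qed

section \<open>Invariance of the sample under reflections of single observations\<close>

definition reflect :: "real^'p \<Rightarrow> real^'p \<Rightarrow> real^'p" where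
  "reflect \<theta> x = x - (2 * (\<theta> \<bullet> x)) *\<^sub>R \<theta>"

text \<open>The restriction to the first n indices keeps the flipped sample extensional, so that it
  lies again in the product space.\<close>

definition flip :: "nat \<Rightarrow> real^'p \<Rightarrow> nat set \<Rightarrow> (nat \<Rightarrow> real^'p) \<Rightarrow> (nat \<Rightarrow> real^'p)" where
  "flip n \<theta> J \<omega> = (\<lambda>i\<in>{..<n}. if i \<in> J then reflect \<theta> (\<omega> i) else \<omega> i)"

lemma reflect_inner:
  assumes "norm \<theta> = 1"
  shows "\<theta> \<bullet> reflect \<theta> x = - (\<theta> \<bullet> x)" "y \<bullet> \<theta> = 0 \<Longrightarrow> y \<bullet> reflect \<theta> x = y \<bullet> x" "norm (reflect \<theta> x) = norm x"
proof -
  have t: "\<theta> \<bullet> \<theta> = 1" using assms by (simp add: norm_eq_1)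
  show "\<theta> \<bullet> reflect \<theta> x = - (\<theta> \<bullet> x)" by (simp add: reflect_def inner_diff_right t)
  show "y \<bullet> \<theta> = 0 \<Longrightarrow> y \<bullet> reflect \<theta> x = y \<bullet> x" by (simp add: reflect_def inner_diff_right)
  have "reflect \<theta> x \<bullet> reflect \<theta> x = x \<bullet> x"
    by (simp add: reflect_def inner_diff_right inner_diff_left t inner_commute algebra_simps)
  then show "norm (reflect \<theta> x) = norm x" by (simp add: norm_eq_sqrt_inner)
qed

lemma measurable_reflect[measurable]: "reflect \<theta> \<in> borel_measurable borel"
  unfolding reflect_def by measurable

lemma unif_sphere_reflect:
  assumes "norm \<theta> = 1"
  shows "distr unif_sphere borel (reflect \<theta>) = unif_sphere"
proof -
  have l: "linear (reflect \<theta>)" by (rule linearI) (auto simp: reflect_def algebra_simps inner_add_right)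
  then have "matrix (reflect \<theta>) *v x = reflect \<theta> x" for x by (simp add: matrix_works)
  then show ?thesis
    using unif_sphere_orthogonal[of "matrix (reflect \<theta>)"] reflect_inner(3)[OF assms] by simp
qed

lemma measurable_flip[measurable]: "flip n \<theta> J \<in> measurable (unif_sample n) (unif_sample n)"
proof -
  have "(\<lambda>\<omega>. if i \<in> J then reflect \<theta> (\<omega> i) else \<omega> i) \<in> measurable (unif_sample n) unif_sphere" if "i < n" for i
    using that by (cases "i \<in> J") (simp_all add: measurable_cong_sets[OF refl sets_unif_sphere])
  then show ?thesis
    unfolding flip_def by (subst (2) unif_sample_def) (rule measurable_restrict, simp)
qed

lemma unif_sample_flip:
  assumes "norm \<theta> = 1"
  shows "distr (unif_sample n) (unif_sample n) (flip n \<theta> J) = (unif_sample n :: (nat \<Rightarrow> real^'p) measure)"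
proof -
  interpret P: product_prob_space "\<lambda>_. unif_sphere :: (real^'p) measure" "{..<n}"
    by (simp add: product_prob_space_def product_prob_space_axioms_def product_sigma_finite_def
        prob_space_unif_sphere prob_space_imp_sigma_finite)
  have fc: "flip n \<theta> J \<omega> i = (if i \<in> J then reflect \<theta> (\<omega> i) else \<omega> i)" if "i < n" for \<omega> :: "nat \<Rightarrow> real^'p" and i
    using that by (simp add: flip_def)
  have fe: "flip n \<theta> J \<omega> \<in> extensional {..<n}" for \<omega> :: "nat \<Rightarrow> real^'p"
    by (simp add: flip_def)
  have "distr (unif_sample n) (unif_sample n) (flip n \<theta> J) = PiM {..<n} (\<lambda>_. unif_sphere :: (real^'p) measure)"
  proof (rule P.PiM_eqI)
    show "finite {..<n}" by simp
    show "sets (distr (unif_sample n) (unif_sample n) (flip n \<theta> J)) = sets (PiM {..<n} (\<lambda>_. unif_sphere :: (real^'p) measure))"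
      by (simp add: unif_sample_def)
    fix A :: "nat \<Rightarrow> (real^'p) set" assume A: "\<And>i. i \<in> {..<n} \<Longrightarrow> A i \<in> sets unif_sphere"
    define B where "B i = (if i \<in> J then reflect \<theta> -` A i else A i)" for i
    have AS: "Pi\<^sub>E {..<n} A \<in> sets (unif_sample n)" unfolding unif_sample_def using A by (intro sets_PiM_I_finite) auto
    have Bs: "B i \<in> sets unif_sphere" if "i < n" for i
      using A[of i] that measurable_sets_borel[OF measurable_reflect, of "A i" \<theta>] by (auto simp: B_def)
    have "emeasure (distr (unif_sample n) (unif_sample n) (flip n \<theta> J)) (Pi\<^sub>E {..<n} A) = emeasure (unif_sample n) (flip n \<theta> J -` Pi\<^sub>E {..<n} A \<inter> space (unif_sample n))"
      by (rule emeasure_distr) (use AS in auto)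
    also have "flip n \<theta> J -` Pi\<^sub>E {..<n} A \<inter> space (unif_sample n) = Pi\<^sub>E {..<n} B"
    proof (intro set_eqI iffI)
      fix \<omega> :: "nat \<Rightarrow> real^'p"
      assume "\<omega> \<in> flip n \<theta> J -` Pi\<^sub>E {..<n} A \<inter> space (unif_sample n)"
      then have w: "\<And>i. i < n \<Longrightarrow> flip n \<theta> J \<omega> i \<in> A i" "\<omega> \<in> extensional {..<n}"
        by (auto simp: space_unif_sample PiE_iff)
      have "\<omega> i \<in> B i" if "i < n" for i
        using w(1)[OF that] unfolding fc[OF that] B_def by auto
      then show "\<omega> \<in> Pi\<^sub>E {..<n} B" using w(2) by (auto simp: PiE_iff)
    next
      fix \<omega> :: "nat \<Rightarrow> real^'p"
      assume w: "\<omega> \<in> Pi\<^sub>E {..<n} B"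
      have "flip n \<theta> J \<omega> i \<in> A i" if "i < n" for i
        using w that unfolding fc[OF that] by (auto simp: PiE_iff B_def split: if_splits)
      then show "\<omega> \<in> flip n \<theta> J -` Pi\<^sub>E {..<n} A \<inter> space (unif_sample n)"
        using w fe[of \<omega>] by (simp add: space_unif_sample PiE_iff)
    qed
    also have "emeasure (unif_sample n) (Pi\<^sub>E {..<n} B) = (\<Prod>i<n. emeasure unif_sphere (B i))"
      unfolding unif_sample_def using Bs by (intro P.emeasure_PiM) auto
    also have "\<dots> = (\<Prod>i<n. emeasure unif_sphere (A i))"
    proof (intro prod.cong refl)
      fix i assume "i \<in> {..<n}"
      then have Ai: "A i \<in> sets borel" using A by auto
      have "emeasure unif_sphere (A i) = emeasure (distr unif_sphere borel (reflect \<theta>)) (A i)"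
        using unif_sphere_reflect[OF assms] by simp
      also have "\<dots> = emeasure unif_sphere (reflect \<theta> -` A i)"
        by (subst emeasure_distr) (use Ai in \<open>auto simp: measurable_cong_sets[OF sets_unif_sphere refl]\<close>)
      finally show "emeasure unif_sphere (B i) = emeasure unif_sphere (A i)" by (simp add: B_def)
    qed
    finally show "emeasure (distr (unif_sample n) (unif_sample n) (flip n \<theta> J)) (Pi\<^sub>E {..<n} A) = (\<Prod>i\<in>{..<n}. emeasure unif_sphere (A i))" .
  qed
  then show ?thesis by (simp add: unif_sample_def)
qed

text \<open>Every flip preserves the law, so the probability of \<open>B\<close> is the mean over
  all 2^n flips of the probability that the flipped sample lies in \<open>B\<close>. Exchanging sum
  and integral reduces the claim to a count within one orbit.\<close>

lemma unif_sample_flip_average: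
  fixes \<theta> :: "real^'p"
  assumes \<theta>: "norm \<theta> = 1" and B[measurable]: "B \<in> sets (unif_sample n)"
    and \<beta>: "\<beta> \<ge> 0" "\<And>\<omega>. \<omega> \<in> space (unif_sample n) \<Longrightarrow> real (card {J\<in>Pow {..<n}. flip n \<theta> J \<omega> \<in> B}) \<le> 2 ^ n * \<beta>"
  shows "measure (unif_sample n) B \<le> \<beta>"
proof -
  let ?M = "unif_sample n :: (nat \<Rightarrow> real^'p) measure"
  interpret prob_space ?M by (rule prob_space_unif_sample)
  have eq: "(\<integral>\<omega>. indicator B (flip n \<theta> J \<omega>) \<partial>?M) = prob B" for J
  proof -
    have "prob B = (\<integral>\<omega>. indicator B \<omega> \<partial>distr ?M ?M (flip n \<theta> J))"
      unfolding unif_sample_flip[OF \<theta>] by simp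
    also have "\<dots> = (\<integral>\<omega>. indicator B (flip n \<theta> J \<omega>) \<partial>?M)"
      by (rule integral_distr) auto
    finally show ?thesis by simp
  qed
  have int: "integrable ?M (\<lambda>\<omega>. indicator B (flip n \<theta> J \<omega>) :: real)" for J
    by (rule integrable_const_bound[of _ 1]) (auto simp: indicator_def)
  have "2 ^ n * prob B = (\<Sum>J\<in>Pow {..<n}. \<integral>\<omega>. indicator B (flip n \<theta> J \<omega>) \<partial>?M)"
    by (simp add: eq card_Pow)
  also have "\<dots> = (\<integral>\<omega>. (\<Sum>J\<in>Pow {..<n}. indicator B (flip n \<theta> J \<omega>)) \<partial>?M)"
    by (rule Bochner_Integration.integral_sum[symmetric]) (rule int)
  also have "\<dots> \<le> (\<integral>\<omega>. 2 ^ n * \<beta> \<partial>?M)"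
  proof (rule integral_mono)
    fix \<omega> assume "\<omega> \<in> space ?M"
    have "(\<Sum>J\<in>Pow {..<n}. indicator B (flip n \<theta> J \<omega>) :: real) = real (card {J\<in>Pow {..<n}. flip n \<theta> J \<omega> \<in> B})"
      by (simp add: indicator_def sum.If_cases Int_def)
    then show "(\<Sum>J\<in>Pow {..<n}. indicator B (flip n \<theta> J \<omega>)) \<le> 2 ^ n * \<beta>" using \<beta>(2)[OF \<open>\<omega> \<in> space ?M\<close>] by simp
  qed (use int in auto)
  also have "\<dots> = 2 ^ n * \<beta>" using prob_space by simp
  finally show ?thesis by simp
qed

text \<open>The Rademacher coefficients may depend on the sample, as long as they do so only through
  quantities unaffected by the flips.\<close>
lemma unif_sample_anticoncentration:
  fixes \<theta> :: "real^'p"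
  assumes \<theta>: "norm \<theta> = 1" and B: "B \<in> sets (unif_sample n)"
    and T: "T > 0" and A: "A > 0" and \<delta>: "\<delta> > 0"
    and x: "\<And>\<omega>. \<omega> \<in> space (unif_sample n) \<Longrightarrow> \<exists>x. x \<bullet> \<theta> = 0 \<and> norm x \<le> 1 \<and>
        (\<forall>J. flip n \<theta> J \<omega> \<in> B \<longrightarrow> (\<forall>i<n. norm (flip n \<theta> J \<omega> i) = 1) \<and>
           A * T\<^sup>2 \<le> (\<Sum>i<n. ((\<theta> \<bullet> flip n \<theta> J \<omega> i) * (x \<bullet> flip n \<theta> J \<omega> i))\<^sup>2) \<and>
           \<bar>\<Sum>i<n. (\<theta> \<bullet> flip n \<theta> J \<omega> i) * (x \<bullet> flip n \<theta> J \<omega> i)\<bar> \<le> T)"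
  shows "measure (unif_sample n) B \<le> 2 * (\<delta> + 4 / (\<delta>\<^sup>2 * A) + 1 / T\<^sup>2)"
proof (rule unif_sample_flip_average[OF \<theta> B])
  show b0: "0 \<le> 2 * (\<delta> + 4 / (\<delta>\<^sup>2 * A) + 1 / T\<^sup>2)" using T A \<delta> by simp
  fix \<omega> :: "nat \<Rightarrow> real^'p" assume "\<omega> \<in> space (unif_sample n)"
  from x[OF this] obtain x where x0: "x \<bullet> \<theta> = 0" "norm x \<le> 1" and
    imp: "\<And>J. flip n \<theta> J \<omega> \<in> B \<Longrightarrow> (\<forall>i<n. norm (flip n \<theta> J \<omega> i) = 1) \<and>
           A * T\<^sup>2 \<le> (\<Sum>i<n. ((\<theta> \<bullet> flip n \<theta> J \<omega> i) * (x \<bullet> flip n \<theta> J \<omega> i))\<^sup>2) \<and>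
           \<bar>\<Sum>i<n. (\<theta> \<bullet> flip n \<theta> J \<omega> i) * (x \<bullet> flip n \<theta> J \<omega> i)\<bar> \<le> T" by blast
  define a where "a i = (\<theta> \<bullet> \<omega> i) * (x \<bullet> \<omega> i)" for i
  have fl: "(\<theta> \<bullet> flip n \<theta> J \<omega> i) * (x \<bullet> flip n \<theta> J \<omega> i) = (if i \<in> J then - a i else a i)"
    "norm (flip n \<theta> J \<omega> i) = norm (\<omega> i)" if "i < n" for i J
    using that reflect_inner[OF \<theta>] x0(1) by (auto simp: flip_def a_def)
  show "real (card {J\<in>Pow {..<n}. flip n \<theta> J \<omega> \<in> B}) \<le> 2 ^ n * (2 * (\<delta> + 4 / (\<delta>\<^sup>2 * A) + 1 / T\<^sup>2))"
  proof (cases "\<exists>J. flip n \<theta> J \<omega> \<in> B")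
    case False
    then have "{J\<in>Pow {..<n}. flip n \<theta> J \<omega> \<in> B} = {}" by auto
    then show ?thesis using b0 by (simp only: card.empty) simp
  next
    case True
    then obtain J where J: "flip n \<theta> J \<omega> \<in> B" by blast
    \<comment> \<open>Norms and squared coefficients are constant along the orbit, so one orbit
      member in \<open>B\<close> supplies the bounds on the coefficients for all of them.\<close>
    have n1: "norm (\<omega> i) = 1" if "i < n" for i using imp[OF J] fl(2)[OF that, of J] that by metis
    have a1: "\<bar>a i\<bar> \<le> 1" if "i < n" for i
    proof -
      have "\<bar>\<theta> \<bullet> \<omega> i\<bar> \<le> 1" using Cauchy_Schwarz_ineq2[of \<theta> "\<omega> i"] \<theta> n1[OF that] by simp
      moreover have "\<bar>x \<bullet> \<omega> i\<bar> \<le> 1" using Cauchy_Schwarz_ineq2[of x "\<omega> i"] x0 n1[OF that] by simp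
      ultimately have "\<bar>\<theta> \<bullet> \<omega> i\<bar> * \<bar>x \<bullet> \<omega> i\<bar> \<le> 1 * 1" by (intro mult_mono) auto
      then show ?thesis by (simp add: a_def abs_mult)
    qed
    have "(\<Sum>i<n. ((\<theta> \<bullet> flip n \<theta> J \<omega> i) * (x \<bullet> flip n \<theta> J \<omega> i))\<^sup>2) = (\<Sum>i<n. (a i)\<^sup>2)"
      by (intro sum.cong refl) (auto simp: fl)
    then have a2: "A * T\<^sup>2 \<le> (\<Sum>i<n. (a i)\<^sup>2)" using imp[OF J] by simp
    have "{J\<in>Pow {..<n}. flip n \<theta> J \<omega> \<in> B} \<subseteq> {J\<in>Pow {..<n}. \<bar>\<Sum>i<n. (if i \<in> J then - a i else a i)\<bar> \<le> T}"
    proof safe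
      fix J assume "flip n \<theta> J \<omega> \<in> B"
      then have "\<bar>\<Sum>i<n. (\<theta> \<bullet> flip n \<theta> J \<omega> i) * (x \<bullet> flip n \<theta> J \<omega> i)\<bar> \<le> T" using imp by blast
      moreover have "(\<Sum>i<n. (\<theta> \<bullet> flip n \<theta> J \<omega> i) * (x \<bullet> flip n \<theta> J \<omega> i)) = (\<Sum>i<n. (if i \<in> J then - a i else a i))"
        by (intro sum.cong refl) (auto simp: fl)
      ultimately show "\<bar>\<Sum>i<n. (if i \<in> J then - a i else a i)\<bar> \<le> T" by simp
    qed
    then have "card {J\<in>Pow {..<n}. flip n \<theta> J \<omega> \<in> B} \<le> card {J\<in>Pow {..<n}. \<bar>\<Sum>i<n. (if i \<in> J then - a i else a i)\<bar> \<le> T}"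
      by (intro card_mono) auto
    then show ?thesis using rademacher_small_ball[OF a1 T A a2 \<delta>] by linarith
  qed
qed

section \<open>Tyler's estimating equation\<close>

definition emean :: "nat \<Rightarrow> (nat \<Rightarrow> real) \<Rightarrow> real" where
  "emean n f = (1 / real n) * (\<Sum>i<n. f i)"

lemma emean_add: "emean n (\<lambda>i. f i + g i) = emean n f + emean n g"
  by (simp add: emean_def sum.distrib algebra_simps)

lemma emean_diff: "emean n (\<lambda>i. f i - g i) = emean n f - emean n g"
  by (simp add: emean_def sum_subtractf algebra_simps)

lemma emean_cmult: "emean n (\<lambda>i. c * f i) = c * emean n f"
  by (simp add: emean_def sum_distrib_left mult.left_commute)

lemma emean_sum: "emean n (\<lambda>i. \<Sum>k\<in>K. f k i) = (\<Sum>k\<in>K. emean n (f k))"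
  unfolding emean_def by (subst sum.swap) (simp add: sum_distrib_left)

lemma emean_cong: "(\<And>i. i < n \<Longrightarrow> f i = g i) \<Longrightarrow> emean n f = emean n g"
  by (simp add: emean_def)

lemma emean_const: "n \<ge> 1 \<Longrightarrow> emean n (\<lambda>_. c) = c"
  by (simp add: emean_def)

lemma emean_mono: "(\<And>i. i < n \<Longrightarrow> f i \<le> g i) \<Longrightarrow> emean n f \<le> emean n g"
  unfolding emean_def by (intro mult_left_mono sum_mono) auto

lemma emean_abs_le:
  assumes "n \<ge> 1" "\<And>i. i < n \<Longrightarrow> \<bar>f i\<bar> \<le> c"
  shows "\<bar>emean n f\<bar> \<le> c"
proof -
  have "emean n f \<le> emean n (\<lambda>_. c)" by (rule emean_mono) (use assms(2) abs_le_iff in blast)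
  moreover have "emean n (\<lambda>_. - c) \<le> emean n f" by (rule emean_mono) (use assms(2) abs_le_iff in \<open>smt (verit)\<close>)
  ultimately show ?thesis using assms(1) by (simp add: emean_const abs_le_iff)
qed

text \<open>The contraction of the uniform fourth-moment tensor \<open>iso4\<close> with four
  vectors.\<close>

definition iso_form :: "real^'p \<Rightarrow> real^'p \<Rightarrow> real^'p \<Rightarrow> real^'p \<Rightarrow> real" where
  "iso_form x y z u = ((x \<bullet> y) * (z \<bullet> u) + (x \<bullet> z) * (y \<bullet> u) + (x \<bullet> u) * (y \<bullet> z)) / (real CARD('p) * (real CARD('p) + 2))"

text \<open>The interface between probability and analysis: estimates on the sample are
  deterministic consequences of this property. It is stated for all vectors rather than for
  coordinates so that it can be tested in any orthonormal frame.\<close>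

definition near_iso :: "nat \<Rightarrow> (nat \<Rightarrow> real^'p) \<Rightarrow> real \<Rightarrow> bool" where
  "near_iso n W G \<longleftrightarrow> n \<ge> 1 \<and> (\<forall>i<n. norm (W i) = 1) \<and> (\<forall>x y z u.
     \<bar>emean n (\<lambda>i. (x \<bullet> W i) * (y \<bullet> W i) * (z \<bullet> W i) * (u \<bullet> W i)) - iso_form x y z u\<bar>
       \<le> G * norm x * norm y * norm z * norm u)"

lemma near_isoD:
  assumes "near_iso n W G"
  shows "n \<ge> 1" "\<And>i. i < n \<Longrightarrow> norm (W i) = 1"
    "\<bar>emean n (\<lambda>i. (x \<bullet> W i) * (y \<bullet> W i) * (z \<bullet> W i) * (u \<bullet> W i)) - iso_form x y z u\<bar>
       \<le> G * norm x * norm y * norm z * norm u"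
  using assms unfolding near_iso_def by blast+

lemma near_iso_nonneg: "near_iso n (W :: nat \<Rightarrow> real^'p) G \<Longrightarrow> G \<ge> 0"
  using near_isoD(3)[of n W G "axis undefined 1" "axis undefined 1" "axis undefined 1" "axis undefined 1"]
  by (simp add: norm_axis_1)

lemma sum_abs_components_le: "(\<Sum>a\<in>UNIV. \<bar>x $ a\<bar>) \<le> real CARD('p) * norm (x :: real^'p)"
  using sum_bounded_above[of UNIV "\<lambda>a. \<bar>x $ a\<bar>" "norm x"] component_le_norm_cart[of x] by simp

text \<open>Expand all four inner products in coordinates. Each sum of |x_a| is at most p |x|,
  whence the factor p^4.\<close>

lemma near_iso_of_components:
  fixes W :: "nat \<Rightarrow> real^'p"
  assumes n: "n \<ge> 1" "\<forall>i<n. norm (W i) = 1" and g0: "g \<ge> 0"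
    and g: "\<And>a b c d. \<bar>emean n (\<lambda>i. W i $ a * W i $ b * W i $ c * W i $ d) - iso4 a b c d\<bar> \<le> g"
  shows "near_iso n W (g * real CARD('p) ^ 4)"
  unfolding near_iso_def
proof (intro conjI n allI)
  fix x y z u :: "real^'p"
  let ?P = "real CARD('p)"
  have prod4: "(\<Sum>a\<in>UNIV. f1 a) * (\<Sum>b\<in>UNIV. f2 b) * (\<Sum>c\<in>UNIV. f3 c) * (\<Sum>d\<in>UNIV. f4 d)
    = (\<Sum>a\<in>UNIV. \<Sum>b\<in>UNIV. \<Sum>c\<in>UNIV. \<Sum>d\<in>UNIV. f1 a * f2 b * f3 c * f4 d)" for f1 f2 f3 f4 :: "'p \<Rightarrow> real"
    by (simp add: sum_distrib_left sum_distrib_right mult_ac)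
       (subst sum.swap, rule sum.cong, rule refl, simp add: sum_distrib_left sum_distrib_right mult_ac)
  have m: "emean n (\<lambda>i. (x \<bullet> W i) * (y \<bullet> W i) * (z \<bullet> W i) * (u \<bullet> W i))
     = (\<Sum>a\<in>UNIV. \<Sum>b\<in>UNIV. \<Sum>c\<in>UNIV. \<Sum>d\<in>UNIV. (x $ a * y $ b * z $ c * u $ d) * emean n (\<lambda>i. W i $ a * W i $ b * W i $ c * W i $ d))"
  proof -
    have "(x \<bullet> w) * (y \<bullet> w) * (z \<bullet> w) * (u \<bullet> w)
      = (\<Sum>a\<in>UNIV. \<Sum>b\<in>UNIV. \<Sum>c\<in>UNIV. \<Sum>d\<in>UNIV. (x $ a * y $ b * z $ c * u $ d) * (w $ a * w $ b * w $ c * w $ d))" for w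
      unfolding inner_vec_def inner_real_def prod4 by (simp add: mult_ac)
    then show ?thesis by (simp add: emean_sum emean_cmult)
  qed
  have kd: "(\<Sum>b\<in>UNIV. f b * kd a b) = f a" "(\<Sum>b\<in>UNIV. kd a b * f b) = f a"  for f :: "'p \<Rightarrow> real" and a
    by (simp_all add: kd_def if_distrib[of "\<lambda>t. _ * t"] if_distrib[of "\<lambda>t. t * _"] cong: if_cong)
  have i: "iso_form x y z u = (\<Sum>a\<in>UNIV. \<Sum>b\<in>UNIV. \<Sum>c\<in>UNIV. \<Sum>d\<in>UNIV. (x $ a * y $ b * z $ c * u $ d) * iso4 a b c d)"
  proof -
    define k where "k = 1 / (?P * (?P + 2))"
    have "(\<Sum>a\<in>UNIV. \<Sum>b\<in>UNIV. \<Sum>c\<in>UNIV. \<Sum>d\<in>UNIV. (x $ a * y $ b * z $ c * u $ d) * iso4 a b c d)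
      = (\<Sum>a\<in>UNIV. \<Sum>b\<in>UNIV. \<Sum>c\<in>UNIV. \<Sum>d\<in>UNIV. k * ((z $ c * (u $ d * kd c d)) * (x $ a * (y $ b * kd a b))))
      + (\<Sum>a\<in>UNIV. \<Sum>b\<in>UNIV. \<Sum>c\<in>UNIV. \<Sum>d\<in>UNIV. k * (x $ a * y $ b * (z $ c * kd a c) * (u $ d * kd b d)))
      + (\<Sum>a\<in>UNIV. \<Sum>b\<in>UNIV. \<Sum>c\<in>UNIV. \<Sum>d\<in>UNIV. k * (x $ a * y $ b * (z $ c * kd b c) * (u $ d * kd a d)))"
    proof -
      have "iso4 a b c d = k * (kd a b * kd c d + kd a c * kd b d + kd a d * kd b c)" for a b c d :: 'p
        by (simp add: iso4_def k_def)
      then show ?thesis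
        by (simp only: sum.distrib[symmetric]) (intro sum.cong refl, simp add: algebra_simps)
    qed
    also have "(\<Sum>a\<in>UNIV. \<Sum>b\<in>UNIV. \<Sum>c\<in>UNIV. \<Sum>d\<in>UNIV. k * ((z $ c * (u $ d * kd c d)) * (x $ a * (y $ b * kd a b)))) = k * ((x \<bullet> y) * (z \<bullet> u))"
      by (simp only: sum_distrib_left[symmetric] sum_distrib_right[symmetric] kd) (simp add: inner_vec_def mult_ac)
    also have "(\<Sum>a\<in>UNIV. \<Sum>b\<in>UNIV. \<Sum>c\<in>UNIV. \<Sum>d\<in>UNIV. k * (x $ a * y $ b * (z $ c * kd a c) * (u $ d * kd b d))) = k * ((x \<bullet> z) * (y \<bullet> u))"
      by (simp only: sum_distrib_left[symmetric] sum_distrib_right[symmetric] kd) (simp add: inner_vec_def sum_product sum_distrib_left mult_ac)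
    also have "(\<Sum>a\<in>UNIV. \<Sum>b\<in>UNIV. \<Sum>c\<in>UNIV. \<Sum>d\<in>UNIV. k * (x $ a * y $ b * (z $ c * kd b c) * (u $ d * kd a d))) = k * ((x \<bullet> u) * (y \<bullet> z))"
      by ((simp only: sum_distrib_left[symmetric] sum_distrib_right[symmetric] kd), (simp add: inner_vec_def sum_product sum_distrib_left mult_ac), rule sum.swap)
    finally show ?thesis unfolding iso_form_def k_def by (simp only: add_divide_distrib mult_1_left times_divide_eq_left)
  qed
  have "\<bar>emean n (\<lambda>i. (x \<bullet> W i) * (y \<bullet> W i) * (z \<bullet> W i) * (u \<bullet> W i)) - iso_form x y z u\<bar>
     = \<bar>\<Sum>a\<in>UNIV. \<Sum>b\<in>UNIV. \<Sum>c\<in>UNIV. \<Sum>d\<in>UNIV. (x $ a * y $ b * z $ c * u $ d) * (emean n (\<lambda>i. W i $ a * W i $ b * W i $ c * W i $ d) - iso4 a b c d)\<bar>"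
    unfolding m i by (simp only: sum_subtractf[symmetric] right_diff_distrib)
  also have "\<dots> \<le> (\<Sum>a\<in>UNIV. \<Sum>b\<in>UNIV. \<Sum>c\<in>UNIV. \<Sum>d\<in>UNIV. (\<bar>x $ a\<bar> * \<bar>y $ b\<bar> * \<bar>z $ c\<bar> * \<bar>u $ d\<bar>) * g)"
    by (intro order_trans[OF sum_abs] sum_mono) (auto simp: abs_mult intro!: mult_left_mono g)
  also have "\<dots> = g * ((\<Sum>a\<in>UNIV. \<bar>x $ a\<bar>) * (\<Sum>b\<in>UNIV. \<bar>y $ b\<bar>) * (\<Sum>c\<in>UNIV. \<bar>z $ c\<bar>) * (\<Sum>d\<in>UNIV. \<bar>u $ d\<bar>))"
    unfolding prod4 by (simp only: sum_distrib_right[symmetric] mult.commute[of g])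
  also have "\<dots> \<le> g * ((?P * norm x) * (?P * norm y) * (?P * norm z) * (?P * norm u))"
    by (intro mult_left_mono mult_mono sum_abs_components_le g0 mult_nonneg_nonneg sum_nonneg) auto
  finally show "\<bar>emean n (\<lambda>i. (x \<bullet> W i) * (y \<bullet> W i) * (z \<bullet> W i) * (u \<bullet> W i)) - iso_form x y z u\<bar>
       \<le> g * ?P ^ 4 * norm x * norm y * norm z * norm u"
    by (simp add: power4_eq_xxxx mult_ac)
qed

lemma sum_axis_inner: "(\<Sum>k\<in>UNIV. (axis k 1 \<bullet> x) * (axis k 1 \<bullet> y)) = (x :: real^'p) \<bullet> y"
  by (simp only: inner_axis' inner_vec_def[of x y]) simp

text \<open>Insert 1 = |W_i|^2 as a sum of p squared coordinates. The isotropic values add up to (p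
  + 2) / (p (p + 2)) times x . y, and the p errors add up to the factor p.\<close>

lemma near_iso_second_moment:
  fixes W :: "nat \<Rightarrow> real^'p"
  assumes "near_iso n W G"
  shows "\<bar>emean n (\<lambda>i. (x \<bullet> W i) * (y \<bullet> W i)) - (x \<bullet> y) / real CARD('p)\<bar> \<le> real CARD('p) * G * norm x * norm y"
proof -
  let ?P = "real CARD('p)"
  let ?e = "\<lambda>k::'p. axis k (1::real)"
  have "emean n (\<lambda>i. (x \<bullet> W i) * (y \<bullet> W i)) = emean n (\<lambda>i. \<Sum>k\<in>UNIV. (x \<bullet> W i) * (y \<bullet> W i) * (?e k \<bullet> W i) * (?e k \<bullet> W i))"
  proof (rule emean_cong)
    fix i assume "i < n"
    then have "W i \<bullet> W i = 1" using near_isoD(2)[OF assms] by (simp add: norm_eq_1)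
    then have "(\<Sum>k\<in>UNIV. (?e k \<bullet> W i) * (?e k \<bullet> W i)) = 1" by (simp only: sum_axis_inner)
    then show "(x \<bullet> W i) * (y \<bullet> W i) = (\<Sum>k\<in>UNIV. (x \<bullet> W i) * (y \<bullet> W i) * (?e k \<bullet> W i) * (?e k \<bullet> W i))"
      by (simp only: mult.assoc sum_distrib_left[symmetric] mult_1_right)
  qed
  then have e: "emean n (\<lambda>i. (x \<bullet> W i) * (y \<bullet> W i)) = (\<Sum>k\<in>UNIV. emean n (\<lambda>i. (x \<bullet> W i) * (y \<bullet> W i) * (?e k \<bullet> W i) * (?e k \<bullet> W i)))"
    by (simp only: emean_sum)
  have "(\<Sum>k\<in>UNIV. iso_form x y (?e k) (?e k)) = (?P * (x \<bullet> y) + 2 * (x \<bullet> y)) / (?P * (?P + 2))"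
  proof -
    have "(\<Sum>k\<in>UNIV. iso_form x y (?e k) (?e k)) = (\<Sum>k\<in>UNIV. ((x \<bullet> y) + 2 * ((?e k \<bullet> x) * (?e k \<bullet> y))) / (?P * (?P + 2)))"
      by (intro sum.cong refl) (simp add: iso_form_def inner_axis_axis inner_commute mult_ac)
    also have "\<dots> = ((\<Sum>k\<in>(UNIV::'p set). (x \<bullet> y)) + 2 * (\<Sum>k\<in>UNIV. (?e k \<bullet> x) * (?e k \<bullet> y))) / (?P * (?P + 2))"
      by (simp only: sum_divide_distrib[symmetric] sum.distrib sum_distrib_left)
    finally show ?thesis by (simp add: sum_axis_inner)
  qed
  also have "\<dots> = (x \<bullet> y) / ?P"
  proof -
    have "?P * (x \<bullet> y) + 2 * (x \<bullet> y) = (?P + 2) * (x \<bullet> y)" by (simp add: algebra_simps)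
    moreover have "?P + 2 \<noteq> 0" by (smt (verit) of_nat_0_le_iff)
    ultimately show ?thesis by simp
  qed
  finally have i: "(x \<bullet> y) / ?P = (\<Sum>k\<in>UNIV. iso_form x y (?e k) (?e k))" by simp
  have "\<bar>emean n (\<lambda>i. (x \<bullet> W i) * (y \<bullet> W i)) - (x \<bullet> y) / ?P\<bar> \<le> (\<Sum>k\<in>(UNIV::'p set). G * norm x * norm y)"
    unfolding e i sum_subtractf[symmetric]
  proof (rule order_trans[OF sum_abs sum_mono])
    fix k :: 'p
    show "\<bar>emean n (\<lambda>i. (x \<bullet> W i) * (y \<bullet> W i) * (?e k \<bullet> W i) * (?e k \<bullet> W i)) - iso_form x y (?e k) (?e k)\<bar> \<le> G * norm x * norm y"
      using near_isoD(3)[OF assms, of x y "?e k" "?e k"] by (simp add: norm_axis_1)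
  qed
  then show ?thesis by (simp add: mult_ac)
qed

definition opb :: "real^'p^'p \<Rightarrow> real \<Rightarrow> bool" where
  "opb A b \<longleftrightarrow> (\<forall>x. norm (A *v x) \<le> b * norm x)"

lemma opb_inner: "opb A b \<Longrightarrow> \<bar>x \<bullet> (A *v y)\<bar> \<le> b * norm x * norm y"
  unfolding opb_def using Cauchy_Schwarz_ineq2[of x "A *v y"]
  by (smt (verit) mult.assoc mult.left_commute mult_left_mono norm_ge_zero)

lemma opb_nonneg: "opb (A :: real^'p^'p) b \<Longrightarrow> 0 \<le> b"
  unfolding opb_def by (metis mult.right_neutral norm_axis_1 norm_ge_zero order_trans)

lemma quadratic_axis_sum:
  assumes "symmetric_m N"
  shows "w \<bullet> (N *v w) = (\<Sum>k\<in>UNIV. (axis k 1 \<bullet> w) * ((N *v axis k 1) \<bullet> (w :: real^'p)))"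
  using sum_axis_inner[of w "N *v w"] by (simp add: sym_dot[OF assms])

text \<open>Contracting two slots of the isotropic form with N leaves a trace term and twice N
  itself. The trace term disappears for trace-free N; both disappear when x and y are orthogonal and
  y is an eigenvector of N. These are the two ways in which the lemma is used.\<close>

lemma near_iso_quadratic:
  fixes W :: "nat \<Rightarrow> real^'p"
  assumes W: "near_iso n W G" and N: "symmetric_m N" "opb N \<eta>"
  shows "\<bar>emean n (\<lambda>i. (x \<bullet> W i) * (y \<bullet> W i) * (W i \<bullet> (N *v W i)))
     - ((x \<bullet> y) * trace_m N + 2 * (x \<bullet> (N *v y))) / (real CARD('p) * (real CARD('p) + 2))\<bar> \<le> real CARD('p) * G * \<eta> * norm x * norm y"
proof -
  let ?P = "real CARD('p)"
  let ?e = "\<lambda>k::'p. axis k (1::real)"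
  have G0: "G \<ge> 0" using near_iso_nonneg[OF W] .
  have e: "emean n (\<lambda>i. (x \<bullet> W i) * (y \<bullet> W i) * (W i \<bullet> (N *v W i))) = (\<Sum>k\<in>UNIV. emean n (\<lambda>i. (x \<bullet> W i) * (y \<bullet> W i) * (?e k \<bullet> W i) * ((N *v ?e k) \<bullet> W i)))"
    unfolding quadratic_axis_sum[OF N(1)] by (simp only: emean_sum[symmetric] sum_distrib_left mult.assoc)
  have i: "((x \<bullet> y) * trace_m N + 2 * (x \<bullet> (N *v y))) / (?P * (?P + 2)) = (\<Sum>k\<in>UNIV. iso_form x y (?e k) (N *v ?e k))"
  proof -
    have "(\<Sum>k\<in>UNIV. iso_form x y (?e k) (N *v ?e k)) = (\<Sum>k\<in>UNIV. ((x \<bullet> y) * (N $ k $ k) + (?e k \<bullet> x) * (?e k \<bullet> (N *v y)) + (?e k \<bullet> (N *v x)) * (?e k \<bullet> y)) / (?P * (?P + 2)))"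
    proof (intro sum.cong refl)
      fix k
      have "?e k \<bullet> (N *v ?e k) = N $ k $ k" by (simp add: inner_axis' matrix_vector_mult_basis column_def)
      moreover have "y \<bullet> (N *v ?e k) = ?e k \<bullet> (N *v y)" "x \<bullet> (N *v ?e k) = ?e k \<bullet> (N *v x)"
        using sym_dot[OF N(1)] by (metis inner_commute)+
      ultimately show "iso_form x y (?e k) (N *v ?e k) = ((x \<bullet> y) * (N $ k $ k) + (?e k \<bullet> x) * (?e k \<bullet> (N *v y)) + (?e k \<bullet> (N *v x)) * (?e k \<bullet> y)) / (?P * (?P + 2))"
        by (simp add: iso_form_def inner_commute)
    qed
    also have "\<dots> = ((x \<bullet> y) * trace_m N + x \<bullet> (N *v y) + (N *v x) \<bullet> y) / (?P * (?P + 2))"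
      by (simp only: sum_divide_distrib[symmetric] sum.distrib sum_distrib_left[symmetric] sum_axis_inner trace_m_def)
    finally show ?thesis by (simp add: sym_dot[OF N(1)])
  qed
  have "\<bar>emean n (\<lambda>i. (x \<bullet> W i) * (y \<bullet> W i) * (W i \<bullet> (N *v W i)))
     - ((x \<bullet> y) * trace_m N + 2 * (x \<bullet> (N *v y))) / (?P * (?P + 2))\<bar> \<le> (\<Sum>k\<in>(UNIV::'p set). G * norm x * norm y * \<eta>)"
    unfolding e i sum_subtractf[symmetric]
  proof (rule order_trans[OF sum_abs sum_mono])
    fix k :: 'p
    have "\<bar>emean n (\<lambda>i. (x \<bullet> W i) * (y \<bullet> W i) * (?e k \<bullet> W i) * ((N *v ?e k) \<bullet> W i)) - iso_form x y (?e k) (N *v ?e k)\<bar>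
      \<le> G * norm x * norm y * norm (N *v ?e k)"
      using near_isoD(3)[OF W, of x y "?e k" "N *v ?e k"] by (simp add: norm_axis_1)
    also have "\<dots> \<le> G * norm x * norm y * \<eta>"
      using N(2)[unfolded opb_def, rule_format, of "?e k"] G0 by (intro mult_left_mono) auto
    finally show "\<bar>emean n (\<lambda>i. (x \<bullet> W i) * (y \<bullet> W i) * (?e k \<bullet> W i) * ((N *v ?e k) \<bullet> W i)) - iso_form x y (?e k) (N *v ?e k)\<bar>
      \<le> G * norm x * norm y * \<eta>" .
  qed
  then show ?thesis by (simp add: mult_ac)
qed

section \<open>Linearisation and solution of the estimating equation in standardised
  coordinates\<close>

definition Smat :: "nat \<Rightarrow> (nat \<Rightarrow> real^'p) \<Rightarrow> real^'p^'p \<Rightarrow> real^'p^'p" where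
  "Smat n W A = (1 / real n) *\<^sub>R (\<Sum>i<n. (1 / (norm (A *v W i))\<^sup>2) *\<^sub>R outer (A *v W i) (A *v W i))"

lemma Smat_form:
  "x \<bullet> (Smat n W A *v y) = emean n (\<lambda>i. (x \<bullet> (A *v W i)) * (y \<bullet> (A *v W i)) / (norm (A *v W i))\<^sup>2)"
  by (simp add: Smat_def emean_def scaleR_matrix_vector sum_matrix_vector_mult outer_mult inner_sum_right inner_commute mult_ac)

lemma symmetric_Smat: "symmetric_m (Smat n W A)"
  by (rule sym_from_dot) (simp add: inner_commute[of "Smat n W A *v _"] Smat_form mult.commute)

lemma trace_outer: "trace_m (outer x x) = (norm (x :: real^'p))\<^sup>2"
  by (simp add: trace_m_def outer_def power2_norm_eq_inner inner_vec_def)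

lemma trace_scaleR: "trace_m (c *\<^sub>R A) = c * trace_m A"
  by (simp add: trace_m_def sum_distrib_left)

lemma trace_diff: "trace_m (A - B) = trace_m A - trace_m B"
  by (simp add: trace_m_def sum_subtractf)

lemma trace_add: "trace_m (A + B) = trace_m A + trace_m B"
  by (simp add: trace_m_def sum.distrib)

lemma trace_sum: "trace_m (\<Sum>i\<in>I. f i) = (\<Sum>i\<in>I. trace_m (f i))"
  by (simp add: trace_m_def) (subst sum.swap, simp)

lemma trace_mat1: "trace_m (mat 1 :: real^'p^'p) = real CARD('p)"
  by (simp add: trace_m_def mat_def)

lemma trace_Smat:
  assumes "n \<ge> 1" "\<And>i. i < n \<Longrightarrow> A *v W i \<noteq> 0"
  shows "trace_m (Smat n W A) = 1"
  using assms by (simp add: Smat_def trace_scaleR trace_sum trace_outer)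

text \<open>After multiplication by the denominator D the error is a' b' - r a b - (2 q + r) \<tau>,
  whose terms are at most t^2, t^2 and (9/4 t) (4 t) = 9 t^2 times X Y. Since D \<ge> 1/2, the total
  11 doubles to 22.\<close>

lemma quotient_expansion:
  fixes a b a' b' q r t X Y :: real
  assumes "\<bar>a\<bar> \<le> X" "\<bar>b\<bar> \<le> Y" "\<bar>a'\<bar> \<le> t * X" "\<bar>b'\<bar> \<le> t * Y" "\<bar>q\<bar> \<le> t" "0 \<le> r" "r \<le> t\<^sup>2" "0 \<le> t" "t \<le> 1/4"
  shows "\<bar>(a + a') * (b + b') / (1 + 2 * q + r) - (a * b + (a * b' + a' * b) - 2 * (q * a * b))\<bar> \<le> 22 * t\<^sup>2 * (X * Y)"
proof -
  define \<tau> T D where "\<tau> = a * b' + a' * b - 2 * (q * a * b)" and "T = a * b + \<tau>" and "D = 1 + 2 * q + r"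
  have X: "0 \<le> X" "0 \<le> Y" using assms by linarith+
  have D: "D \<ge> 1/2" using assms by (simp add: D_def)
  have ab: "\<bar>a * b\<bar> \<le> X * Y" unfolding abs_mult using assms X by (intro mult_mono) auto
  have "\<bar>a * b'\<bar> \<le> X * (t * Y)" unfolding abs_mult using assms X by (intro mult_mono) auto
  moreover have "\<bar>a' * b\<bar> \<le> (t * X) * Y" unfolding abs_mult using assms X by (intro mult_mono) auto
  moreover have "\<bar>q * (a * b)\<bar> \<le> t * (X * Y)" unfolding abs_mult[of q] using assms ab X by (intro mult_mono) auto
  ultimately have tau: "\<bar>\<tau>\<bar> \<le> 4 * t * (X * Y)" unfolding \<tau>_def by (simp add: abs_le_iff algebra_simps)
  have e: "(a + a') * (b + b') - D * T = a' * b' - r * (a * b) - (2 * q + r) * \<tau>"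
    unfolding D_def T_def \<tau>_def by (simp add: algebra_simps)
  have "\<bar>a' * b'\<bar> \<le> (t * X) * (t * Y)" unfolding abs_mult using assms X by (intro mult_mono) auto
  moreover have "\<bar>r * (a * b)\<bar> \<le> t\<^sup>2 * (X * Y)" unfolding abs_mult[of r] using assms ab X by (intro mult_mono) auto
  moreover have "\<bar>(2 * q + r) * \<tau>\<bar> \<le> (9/4 * t) * (4 * t * (X * Y))" unfolding abs_mult[of _ \<tau>]
  proof (intro mult_mono tau)
    have "t\<^sup>2 \<le> t * (1/4)" using assms(8,9) unfolding power2_eq_square by (intro mult_left_mono) auto
    then show "\<bar>2 * q + r\<bar> \<le> 9/4 * t" using assms by linarith
  qed (use assms in auto)
  ultimately have "\<bar>(a + a') * (b + b') - D * T\<bar> \<le> 11 * t\<^sup>2 * (X * Y)" unfolding e by (simp add: power2_eq_square abs_le_iff algebra_simps)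
  moreover have "(a + a') * (b + b') / D - T = ((a + a') * (b + b') - D * T) / D" using D by (simp add: field_simps)
  ultimately have "\<bar>(a + a') * (b + b') / D - T\<bar> \<le> 11 * t\<^sup>2 * (X * Y) / D"
    using D by (simp add: abs_divide divide_right_mono)
  also have "\<dots> \<le> 11 * t\<^sup>2 * (X * Y) / (1/2)" using D X by (intro divide_left_mono) auto
  finally show ?thesis unfolding D_def T_def \<tau>_def by (simp add: algebra_simps)
qed

text \<open>First-order expansion in B, then replacement of the first-order averages by their
  isotropic values. The numerator gives 2/p and the denominator takes away 4 / (p (p + 2)), which
  after multiplication by p leaves the slope 2 p / (p + 2). The replacements cost four errors of
  size p G t, each multiplied by p.\<close>

lemma Smat_expansion:
  fixes W :: "nat \<Rightarrow> real^'p"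
  assumes W: "near_iso n W G" and B: "symmetric_m B" "trace_m B = 0" "opb B t" "t \<le> 1/4"
  defines "p \<equiv> real CARD('p)"
  shows "\<bar>p * (x \<bullet> (Smat n W (mat 1 + B) *v y)) - x \<bullet> y
      - ((p * emean n (\<lambda>i. (x \<bullet> W i) * (y \<bullet> W i)) - x \<bullet> y) + 2 * p / (p + 2) * (x \<bullet> (B *v y)))\<bar>
      \<le> (4 * p\<^sup>2 * G * t + 22 * p * t\<^sup>2) * (norm x * norm y)"
proof -
  note n = near_isoD(1)[OF W] and Wn = near_isoD(2)[OF W]
  have p: "p \<ge> 1" by (simp add: p_def)
  have t0: "t \<ge> 0" using opb_nonneg[OF B(3)] .
  note G0 = near_iso_nonneg[OF W]
  define f where "f i = (x \<bullet> ((mat 1 + B) *v W i)) * (y \<bullet> ((mat 1 + B) *v W i)) / (norm ((mat 1 + B) *v W i))\<^sup>2" for i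
  define g where "g i = (x \<bullet> W i) * (y \<bullet> W i) + ((x \<bullet> W i) * ((B *v y) \<bullet> W i) + ((B *v x) \<bullet> W i) * (y \<bullet> W i)) - 2 * ((W i \<bullet> (B *v W i)) * (x \<bullet> W i) * (y \<bullet> W i))" for i
  have fg: "\<bar>f i - g i\<bar> \<le> 22 * t\<^sup>2 * (norm x * norm y)" if i: "i < n" for i
  proof -
    have ww: "W i \<bullet> W i = 1" using Wn[OF i] by (simp add: norm_eq_1)
    have RW: "(mat 1 + B) *v W i = W i + B *v W i" by (simp add: matrix_vector_mult_add_rdistrib)
    have "(norm ((mat 1 + B) *v W i))\<^sup>2 = 1 + 2 * (W i \<bullet> (B *v W i)) + (norm (B *v W i))\<^sup>2"
      unfolding RW power2_norm_eq_inner by (simp add: inner_add_left inner_add_right ww inner_commute)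
    moreover have "x \<bullet> (B *v W i) = (B *v x) \<bullet> W i" "y \<bullet> (B *v W i) = (B *v y) \<bullet> W i" for x y
      by (simp_all add: sym_dot[OF B(1)])
    ultimately have f: "f i = (x \<bullet> W i + (B *v x) \<bullet> W i) * (y \<bullet> W i + (B *v y) \<bullet> W i) / (1 + 2 * (W i \<bullet> (B *v W i)) + (norm (B *v W i))\<^sup>2)"
      unfolding f_def RW by (simp add: inner_add_right)
    have CS: "\<bar>u \<bullet> W i\<bar> \<le> norm u" for u using Cauchy_Schwarz_ineq2[of u "W i"] Wn[OF i] by simp
    have Bx: "norm (B *v u) \<le> t * norm u" for u using B(3) by (simp add: opb_def)
    have BW: "norm (B *v W i) \<le> t" using Bx[of "W i"] Wn[OF i] by simp
    show ?thesis unfolding f g_def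
      by (rule quotient_expansion)
        (use CS Bx BW t0 B(4) order_trans[OF CS Bx] opb_inner[OF B(3), of "W i" "W i"] Wn[OF i] in \<open>auto intro: power_mono\<close>)
  qed
  have fg': "\<bar>emean n f - emean n g\<bar> \<le> 22 * t\<^sup>2 * (norm x * norm y)"
    unfolding emean_diff[symmetric] by (rule emean_abs_le[OF n fg])
  define m0 m1 m2 m3 where "m0 = emean n (\<lambda>i. (x \<bullet> W i) * (y \<bullet> W i))" and "m1 = emean n (\<lambda>i. (x \<bullet> W i) * ((B *v y) \<bullet> W i))"
    and "m2 = emean n (\<lambda>i. ((B *v x) \<bullet> W i) * (y \<bullet> W i))" and "m3 = emean n (\<lambda>i. (x \<bullet> W i) * (y \<bullet> W i) * (W i \<bullet> (B *v W i)))"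
  have g: "emean n g = m0 + (m1 + m2) - 2 * m3"
    unfolding g_def m0_def m1_def m2_def m3_def emean_cmult[symmetric] emean_add[symmetric] emean_diff[symmetric]
    by (intro emean_cong) (simp add: mult_ac)
  define e where "e = p * G * t * (norm x * norm y)"
  have e1: "\<bar>m1 - (x \<bullet> (B *v y)) / p\<bar> \<le> e"
  proof -
    have "\<bar>m1 - (x \<bullet> (B *v y)) / p\<bar> \<le> p * G * norm x * norm (B *v y)"
      unfolding m1_def p_def by (rule near_iso_second_moment[OF W])
    also have "\<dots> \<le> p * G * norm x * (t * norm y)"
      using B(3) p G0 by (intro mult_left_mono) (auto simp: opb_def)
    finally show ?thesis by (simp add: e_def mult_ac)
  qed
  have e2: "\<bar>m2 - (x \<bullet> (B *v y)) / p\<bar> \<le> e"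
  proof -
    have "\<bar>m2 - ((B *v x) \<bullet> y) / p\<bar> \<le> p * G * norm (B *v x) * norm y"
      unfolding m2_def p_def by (rule near_iso_second_moment[OF W])
    also have "\<dots> \<le> p * G * (t * norm x) * norm y"
      using B(3) p G0 by (intro mult_left_mono mult_right_mono) (auto simp: opb_def)
    finally show ?thesis by (simp add: e_def mult_ac sym_dot[OF B(1)])
  qed
  have e3: "\<bar>m3 - 2 * (x \<bullet> (B *v y)) / (p * (p + 2))\<bar> \<le> e"
    using near_iso_quadratic[OF W B(1,3), of x y] by (simp add: m3_def B(2) e_def p_def mult_ac)
  define z where "z = x \<bullet> (B *v y)"
  have F: "x \<bullet> (Smat n W (mat 1 + B) *v y) = emean n f" by (simp only: Smat_form f_def[abs_def])
  define d where "d = 22 * t\<^sup>2 * (norm x * norm y)"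
  have "\<bar>emean n f - m0 - (2 * z / p - 2 * (2 * z / (p * (p + 2))))\<bar> \<le> d + 4 * e"
    using fg' e1 e2 e3 unfolding g d_def[symmetric] z_def[symmetric] by (auto simp: abs_le_iff)
  then have "p * \<bar>emean n f - m0 - (2 * z / p - 2 * (2 * z / (p * (p + 2))))\<bar> \<le> p * (d + 4 * e)"
    using p by (intro mult_left_mono) auto
  also have "p * \<bar>emean n f - m0 - (2 * z / p - 2 * (2 * z / (p * (p + 2))))\<bar>
     = \<bar>p * (emean n f - m0 - (2 * z / p - 2 * (2 * z / (p * (p + 2)))))\<bar>"
    using p by (simp add: abs_mult)
  also have "p * (emean n f - m0 - (2 * z / p - 2 * (2 * z / (p * (p + 2))))) = p * emean n f - p * m0 - 2 * p / (p + 2) * z"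
  proof -
    have "p * (2 * z / p) = 2 * z" "p * (2 * (2 * z / (p * (p + 2)))) = 4 * z / (p + 2)" using p by auto
    moreover have "2 * z - 4 * z / (p + 2) = 2 * p / (p + 2) * z" using p by (simp add: field_simps)
    ultimately show ?thesis by (simp add: right_diff_distrib)
  qed
  finally show ?thesis unfolding F m0_def[symmetric] z_def[symmetric]
    by (simp add: d_def e_def algebra_simps power2_eq_square)
qed

lemma norm_le_entries:
  fixes A :: "real^'p^'p"
  assumes "\<And>i j. \<bar>axis i 1 \<bullet> (A *v axis j 1)\<bar> \<le> m"
  shows "norm A \<le> (real CARD('p))\<^sup>2 * m"
proof -
  have e: "\<bar>A $ i $ j\<bar> \<le> m" for i j
    using assms[of i j] by (simp add: inner_axis' matrix_vector_mult_basis column_def)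
  have "norm A \<le> (\<Sum>i\<in>UNIV. norm (A $ i))"
    using L2_set_le_sum[of UNIV "\<lambda>i. norm (A $ i)"] by (simp add: norm_vec_def)
  also have "\<dots> \<le> (\<Sum>i\<in>(UNIV::'p set). real CARD('p) * m)"
  proof (rule sum_mono)
    fix i
    have "norm (A $ i) \<le> (\<Sum>j\<in>UNIV. \<bar>A $ i $ j\<bar>)" by (rule norm_le_l1_cart)
    also have "\<dots> \<le> (\<Sum>j\<in>(UNIV::'p set). m)" by (intro sum_mono e)
    finally show "norm (A $ i) \<le> real CARD('p) * m" by simp
  qed
  finally show ?thesis by (simp add: power2_eq_square mult.assoc)
qed

lemma opb_norm: "norm (A :: real^'p^'p) \<le> b \<Longrightarrow> opb A b"
  unfolding opb_def using norm_matrix_vector_le[of A] by (meson mult_right_mono norm_ge_zero order_trans)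

lemma opb_perturb_norm:
  assumes "opb B t"
  shows "(1 - t) * norm x \<le> norm ((mat 1 + B) *v x)"
proof -
  have "norm (B *v x) \<le> t * norm x" using assms by (simp add: opb_def)
  moreover have "norm x \<le> norm (x + B *v x) + norm (B *v x)" by (metis add_diff_cancel_right' norm_triangle_ineq4)
  ultimately show ?thesis by (simp add: matrix_vector_mult_add_rdistrib algebra_simps)
qed

text \<open>Brouwer's theorem for the Newton-type map given by the linearisation of the estimating equation.\<close>
lemma tyler_equation_solution:
  fixes W :: "nat \<Rightarrow> real^'p"
  assumes W: "near_iso n W G" and p2: "CARD('p) \<ge> 2"
  defines "p \<equiv> real CARD('p)"
  defines "r \<equiv> 4 * p ^ 4 * G"
  assumes G: "200 * p ^ 7 * G \<le> 1"
  obtains B where "symmetric_m B" "opb B r" "Smat n W (mat 1 + B) = (1 / p) *\<^sub>R mat 1"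
    "\<And>x y. \<bar>x \<bullet> (B *v y) + (p + 2) / (2 * p) * (p * emean n (\<lambda>i. (x \<bullet> W i) * (y \<bullet> W i)) - x \<bullet> y)\<bar> \<le> 23 * p * r\<^sup>2 * (norm x * norm y)"
proof -
  note n = near_isoD(1)[OF W] and Wn = near_isoD(2)[OF W] and G0 = near_iso_nonneg[OF W]
  have p: "p \<ge> 2" using p2 by (simp add: p_def)
  have r0: "0 \<le> r" using G0 p by (simp add: r_def)
  have r1: "50 * p ^ 3 * r \<le> 1" using G by (simp add: r_def power_add[symmetric] algebra_simps)
  have p3: "8 \<le> p ^ 3" using power_mono[OF p, of 3] by simp
  have r4: "r \<le> 1/4"
  proof -
    have "50 * 8 * r \<le> 50 * p ^ 3 * r" using p3 r0 by (intro mult_right_mono) auto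
    then show ?thesis using r1 by linarith
  qed
  \<comment> \<open>The inverse of the slope 2 p / (p + 2). It cancels the linear term in B, so that
    \<phi> is nearly constant on the small ball \<open>K\<close>.\<close>
  define k where "k = (p + 2) / (2 * p)"
  have k: "0 < k" "k \<le> 1" using p by (auto simp: k_def field_simps)
  define E0 where "E0 x y = p * emean n (\<lambda>i. (x \<bullet> W i) * (y \<bullet> W i)) - x \<bullet> y" for x y
  define \<phi> where "\<phi> B = B - k *\<^sub>R (p *\<^sub>R Smat n W (mat 1 + B) - mat 1)" for B
  \<comment> \<open>Trace zero removes the scale ambiguity of the equation. The map \<phi> preserves
    it because \<open>Smat\<close> always has trace 1.\<close>
  define K where "K = {B :: real^'p^'p. symmetric_m B \<and> trace_m B = 0 \<and> norm B \<le> r}"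
  have est: "\<bar>x \<bullet> (\<phi> B *v y) + k * E0 x y\<bar> \<le> (4 * p\<^sup>2 * G * r + 22 * p * r\<^sup>2) * (norm x * norm y)"
    if "B \<in> K" for B x y
  proof -
    have B: "symmetric_m B" "trace_m B = 0" "opb B r" using that by (auto simp: K_def opb_norm)
    have "k * (2 * p / (p + 2)) = 1"
    proof -
      have "p \<noteq> 0" "p + 2 \<noteq> 0" using p by auto
      then show ?thesis by (simp add: k_def)
    qed
    then have kz: "k * (2 * p / (p + 2) * z) = z" for z by (metis mult.assoc mult_1_left)
    have "x \<bullet> (\<phi> B *v y) + k * E0 x y = - (k * (p * (x \<bullet> (Smat n W (mat 1 + B) *v y)) - x \<bullet> y
      - (E0 x y + 2 * p / (p + 2) * (x \<bullet> (B *v y)))))"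
      using kz[of "x \<bullet> (B *v y)"]
      by (simp add: \<phi>_def matrix_vector_mult_diff_rdistrib scaleR_matrix_vector inner_diff_right algebra_simps)
    also have "\<bar>\<dots>\<bar> = k * \<bar>p * (x \<bullet> (Smat n W (mat 1 + B) *v y)) - x \<bullet> y - (E0 x y + 2 * p / (p + 2) * (x \<bullet> (B *v y)))\<bar>"
      using k by (simp add: abs_mult)
    also have "\<dots> \<le> 1 * ((4 * p\<^sup>2 * G * r + 22 * p * r\<^sup>2) * (norm x * norm y))"
      using k Smat_expansion[OF W B r4, of x y] unfolding E0_def p_def by (intro mult_mono) auto
    finally show ?thesis by simp
  qed
  have nz: "(mat 1 + B) *v W i \<noteq> 0" if "B \<in> K" "i < n" for B i
  proof -
    have "opb B r" using that by (auto simp: K_def opb_norm)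
    then have "(1 - r) * 1 \<le> norm ((mat 1 + B) *v W i)" using opb_perturb_norm[of B r "W i"] Wn[OF that(2)] by simp
    then show ?thesis using r4 by auto
  qed
  \<comment> \<open>The radius is chosen so that p^4 G = r/4. The other terms are r^2 \<le> r/4 and
    22 p^3 r^2 \<le> r/2, so the total is at most r.\<close>
  have small: "p\<^sup>2 * (p\<^sup>2 * G + (4 * p\<^sup>2 * G * r + 22 * p * r\<^sup>2)) \<le> r"
  proof -
    have "p\<^sup>2 * (4 * p\<^sup>2 * G * r) = r * r" by (simp add: r_def power4_eq_xxxx power2_eq_square)
    moreover have "p\<^sup>2 * (p\<^sup>2 * G) = r / 4" by (simp add: r_def power4_eq_xxxx power2_eq_square)
    moreover have "p\<^sup>2 * (22 * p * r\<^sup>2) = 22 * p ^ 3 * r * r" by (simp add: power3_eq_cube power2_eq_square)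
    moreover have "22 * p ^ 3 * r * r \<le> 1/2 * r" using r1 r0 by (intro mult_right_mono) auto
    moreover have "r * r \<le> 1/4 * r" using r4 r0 by (intro mult_right_mono) auto
    ultimately show ?thesis unfolding distrib_left by linarith
  qed
  have maps: "\<phi> B \<in> K" if B: "B \<in> K" for B
  proof -
    have "symmetric_m (\<phi> B)"
    proof (rule sym_from_dot)
      fix x y
      have "symmetric_m B" using B by (simp add: K_def)
      then show "(\<phi> B *v x) \<bullet> y = x \<bullet> (\<phi> B *v y)"
        using sym_dot[OF symmetric_Smat, of n W "mat 1 + B" x y]
        by (simp add: \<phi>_def matrix_vector_mult_diff_rdistrib scaleR_matrix_vector inner_diff_left inner_diff_right sym_dot)
    qed
    moreover have "trace_m (\<phi> B) = 0"
      using B trace_Smat[OF n nz[OF B]] by (simp add: \<phi>_def trace_diff trace_scaleR trace_mat1 K_def p_def)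
    moreover have "norm (\<phi> B) \<le> r"
    proof -
      have "norm (\<phi> B) \<le> (real CARD('p))\<^sup>2 * (p\<^sup>2 * G + (4 * p\<^sup>2 * G * r + 22 * p * r\<^sup>2))"
      proof (rule norm_le_entries)
        fix i j :: 'p
        let ?x = "axis i 1 :: real^'p" and ?y = "axis j 1 :: real^'p"
        have "\<bar>E0 ?x ?y\<bar> \<le> p\<^sup>2 * G"
        proof -
          have "\<bar>emean n (\<lambda>i. (?x \<bullet> W i) * (?y \<bullet> W i)) - (?x \<bullet> ?y) / p\<bar> \<le> p * G"
            using near_iso_second_moment[OF W, of ?x ?y] by (simp add: p_def norm_axis_1)
          then have "p * \<bar>emean n (\<lambda>i. (?x \<bullet> W i) * (?y \<bullet> W i)) - (?x \<bullet> ?y) / p\<bar> \<le> p * (p * G)"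
            using p by (intro mult_left_mono) auto
          also have "p * \<bar>emean n (\<lambda>i. (?x \<bullet> W i) * (?y \<bullet> W i)) - (?x \<bullet> ?y) / p\<bar> = \<bar>p * (emean n (\<lambda>i. (?x \<bullet> W i) * (?y \<bullet> W i)) - (?x \<bullet> ?y) / p)\<bar>"
            using p by (simp add: abs_mult)
          also have "p * (emean n (\<lambda>i. (?x \<bullet> W i) * (?y \<bullet> W i)) - (?x \<bullet> ?y) / p) = E0 ?x ?y"
            using p by (simp add: E0_def right_diff_distrib)
          finally show ?thesis by (simp add: power2_eq_square)
        qed
        then have "\<bar>k * E0 ?x ?y\<bar> \<le> 1 * (p\<^sup>2 * G)" unfolding abs_mult using k by (intro mult_mono) auto
        then show "\<bar>?x \<bullet> (\<phi> B *v ?y)\<bar> \<le> p\<^sup>2 * G + (4 * p\<^sup>2 * G * r + 22 * p * r\<^sup>2)"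
          using est[OF B, of ?x ?y] by (simp add: norm_axis_1)
      qed
      then show ?thesis using small by (simp add: p_def)
    qed
    ultimately show ?thesis by (simp add: K_def)
  qed
  have Keq: "K = {B. symmetric_m B} \<inter> {B. trace_m B = 0} \<inter> cball 0 r" by (auto simp: K_def)
  have "subspace {B :: real^'p^'p. symmetric_m B}"
    by (auto simp: subspace_def symmetric_m_def transpose_def vec_eq_iff)
  moreover have "subspace {B :: real^'p^'p. trace_m B = 0}"
    by (auto simp: subspace_def trace_add trace_scaleR) (simp add: trace_m_def)
  ultimately have "convex K" unfolding Keq by (intro convex_Int convex_cball subspace_imp_convex)
  moreover have "compact K"
  proof -
    have "closed {B :: real^'p^'p. symmetric_m B}"
      unfolding symmetric_m_def transpose_def by (intro closed_Collect_eq continuous_intros)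
    moreover have "closed {B :: real^'p^'p. trace_m B = 0}"
      unfolding trace_m_def by (intro closed_Collect_eq continuous_intros)
    ultimately show ?thesis unfolding Keq by (intro closed_Int_compact closed_Int compact_cball)
  qed
  moreover have "0 \<in> K" using r0 by (auto simp: K_def symmetric_m_def transpose_def trace_m_def vec_eq_iff)
  then have "K \<noteq> {}" by blast
  moreover have "continuous_on K \<phi>"
  proof -
    have c: "continuous_on K (\<lambda>B. (mat 1 + B) *v w)" for w :: "real^'p"
      unfolding matrix_vector_mult_def by (intro continuous_intros)
    show ?thesis
      unfolding \<phi>_def Smat_def outer_def
      by (intro continuous_intros c) (use nz in auto)
  qed
  moreover have "\<phi> ` K \<subseteq> K" using maps by blast
  ultimately obtain B where B: "B \<in> K" "\<phi> B = B"
    using brouwer[of K \<phi>] by blast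
  show ?thesis
  proof (rule that[of B])
    show "symmetric_m B" "opb B r" using B by (auto simp: K_def opb_norm)
    have "p *\<^sub>R Smat n W (mat 1 + B) = mat 1" using B(2) k by (simp add: \<phi>_def)
    then show "Smat n W (mat 1 + B) = (1 / p) *\<^sub>R mat 1"
    proof -
      assume a: "p *\<^sub>R Smat n W (mat 1 + B) = mat 1"
      have "Smat n W (mat 1 + B) = (1 / p) *\<^sub>R (p *\<^sub>R Smat n W (mat 1 + B))" using p by simp
      then show ?thesis unfolding a .
    qed
    fix x y :: "real^'p"
    have "4 * p\<^sup>2 * G * r \<le> 1 * p * r\<^sup>2"
    proof -
      have "4 * p\<^sup>2 * G * 1 \<le> 4 * p\<^sup>2 * G * p\<^sup>2" using p G0 by (intro mult_left_mono) auto
      then have "4 * p\<^sup>2 * G \<le> r" by (simp add: r_def power4_eq_xxxx power2_eq_square mult_ac)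
      then have "4 * p\<^sup>2 * G * r \<le> r * r" using r0 by (intro mult_right_mono) auto
      also have "r * r \<le> p * (r * r)" using p r0 by (simp add: mult_le_cancel_right1)
      finally show ?thesis by (simp add: power2_eq_square)
    qed
    then have "(4 * p\<^sup>2 * G * r + 22 * p * r\<^sup>2) * (norm x * norm y) \<le> 23 * p * r\<^sup>2 * (norm x * norm y)"
      by (intro mult_right_mono) auto
    then show "\<bar>x \<bullet> (B *v y) + (p + 2) / (2 * p) * (p * emean n (\<lambda>i. (x \<bullet> W i) * (y \<bullet> W i)) - x \<bullet> y)\<bar> \<le> 23 * p * r\<^sup>2 * (norm x * norm y)"
      using est[OF B(1), of x y] unfolding B(2) k_def E0_def by linarith
  qed
qed

section \<open>Uniqueness of the solution up to scale\<close>

lemma gram_matrix: "x \<bullet> ((transpose A ** A) *v y) = (A *v x) \<bullet> ((A::real^'p^'p) *v y)"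
  by (simp add: matrix_vector_mul_assoc[symmetric] dot_transpose)

lemma symmetric_gram: "symmetric_m (transpose A ** (A::real^'p^'p))"
  by (rule sym_from_dot) (metis gram_matrix inner_commute)

lemma subspace_UNIV_nontrivial: "(UNIV :: (real^'p) set) \<noteq> {0}"
  by (metis UNIV_I norm_axis_1 norm_zero singletonD zero_neq_one)

lemma sym_extremal_eigenvectors:
  fixes D :: "real^'p^'p"
  assumes D: "symmetric_m D"
  obtains s t a b where "norm s = 1" "norm t = 1" "D *v s = a *\<^sub>R s" "D *v t = b *\<^sub>R t"
    "\<And>x. x \<bullet> (D *v x) \<le> a * (norm x)\<^sup>2" "\<And>x. b * (norm x)\<^sup>2 \<le> x \<bullet> (D *v x)"
proof -
  have mD: "symmetric_m (- D)" using D by (simp add: symmetric_m_def transpose_def vec_eq_iff)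
  have neg: "(- D) *v x = - (D *v x)" for x
    using matrix_vector_mult_diff_rdistrib[of 0 D x] by simp
  obtain s where s: "norm s = 1" "D *v s = (s \<bullet> (D *v s)) *\<^sub>R s" "\<And>x. x \<bullet> (D *v x) \<le> (s \<bullet> (D *v s)) * (norm x)\<^sup>2"
    using sym_max_eigenvector[OF D subspace_UNIV subspace_UNIV_nontrivial] by (metis UNIV_I)
  obtain t where t: "norm t = 1" "(- D) *v t = (t \<bullet> ((- D) *v t)) *\<^sub>R t" "\<And>x. x \<bullet> ((- D) *v x) \<le> (t \<bullet> ((- D) *v t)) * (norm x)\<^sup>2"
    using sym_max_eigenvector[OF mD subspace_UNIV subspace_UNIV_nontrivial] by (metis UNIV_I)
  show ?thesis
  proof (rule that[OF s(1) t(1) s(2) _ s(3)])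
    show "D *v t = (t \<bullet> (D *v t)) *\<^sub>R t" using t(2) unfolding neg by simp
    show "(t \<bullet> (D *v t)) * (norm x)\<^sup>2 \<le> x \<bullet> (D *v x)" for x using t(3)[of x] unfolding neg by simp
  qed
qed

lemma emean_nonneg_zero:
  assumes "emean n f = 0" "\<And>i. i < n \<Longrightarrow> 0 \<le> f i" "i < n"
  shows "f i = 0"
proof -
  have "n > 0" using assms(3) by simp
  then have "(\<Sum>i<n. f i) = 0" using assms(1) by (simp add: emean_def)
  then show ?thesis using assms(2,3) sum_nonneg_eq_0_iff[of "{..<n}" f] by auto
qed

text \<open>Compare the two solutions along the top eigenvector of the Gram matrix of their quotient:
  equality of the averages forces every observation to be orthogonal either to the top or to the
  bottom eigenvector.\<close>
lemma tyler_equation_unique: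
  fixes W :: "nat \<Rightarrow> real^'p"
  assumes W: "near_iso n W G" and G: "G * (real CARD('p) * (real CARD('p) + 2)) < 1"
    and R: "symmetric_m R" "posdef_m R" and SR: "Smat n W R = (1 / real CARD('p)) *\<^sub>R mat 1"
    and A: "invertible A" and SA: "Smat n W A = (1 / real CARD('p)) *\<^sub>R mat 1"
  obtains d where "d > 0" "\<And>x y. (A *v x) \<bullet> (A *v y) = d * ((R *v x) \<bullet> (R *v y))"
proof -
  let ?p = "real CARD('p)"
  note Wn = near_isoD(2)[OF W]
  obtain Ri where Ri: "R ** Ri = mat 1" "Ri ** R = mat 1" "\<And>x. R *v (Ri *v x) = x" "\<And>x. Ri *v (R *v x) = x"
    using invertible_inverse_mult[OF posdef_invertible[OF R(2)]] by metis
  obtain Ai where Ai: "\<And>x. A *v (Ai *v x) = x" "\<And>x. Ai *v (A *v x) = x"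
    using invertible_inverse_mult[OF A] by metis
  \<comment> \<open>The quotient of the two solutions, A = Q R. In the coordinates Y = R W the
    solution R becomes the identity and A becomes Q, whose Gram matrix is D.\<close>
  define Q where "Q = A ** Ri"
  define D where "D = transpose Q ** Q"
  define Y where "Y i = R *v W i" for i
  have Qx: "Q *v x = A *v (Ri *v x)" for x by (simp add: Q_def matrix_vector_mul_assoc[symmetric])
  have QY: "Q *v Y i = A *v W i" for i by (simp add: Qx Y_def Ri)
  have D: "symmetric_m D" unfolding D_def by (rule symmetric_gram)
  have Df: "x \<bullet> (D *v y) = (Q *v x) \<bullet> (Q *v y)" for x y unfolding D_def by (rule gram_matrix)
  have Q0: "Q *v x \<noteq> 0" if "x \<noteq> 0" for x
    using that unfolding Qx by (metis Ai(2) Ri(3) matrix_vector_mult_0_right)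
  have Dpos: "x \<bullet> (D *v x) > 0" if "x \<noteq> 0" for x using Q0[OF that] by (simp add: Df)
  have Y0: "Y i \<noteq> 0" if "i < n" for i
    using Wn[OF that] unfolding Y_def by (metis Ri(4) matrix_vector_mult_0_right norm_zero zero_neq_one)
  obtain s t a b where st: "norm s = 1" "norm t = 1" "D *v s = a *\<^sub>R s" "D *v t = b *\<^sub>R t"
    "\<And>x. x \<bullet> (D *v x) \<le> a * (norm x)\<^sup>2" "\<And>x. b * (norm x)\<^sup>2 \<le> x \<bullet> (D *v x)"
    using sym_extremal_eigenvectors[OF D] by metis
  have ss: "s \<bullet> s = 1" using st by (simp add: norm_eq_1)
  have s0: "s \<noteq> 0" "t \<noteq> 0" using st by auto
  have a: "a > 0" using Dpos[OF s0(1)] st(3) ss by simp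
  have "a = b"
  proof (rule ccontr)
    assume ab: "a \<noteq> b"
    have m1: "emean n (\<lambda>i. (s \<bullet> Y i) * (s \<bullet> Y i) / (norm (Y i))\<^sup>2) = 1 / ?p"
      using Smat_form[of s n W R s] unfolding SR by (simp add: scaleR_matrix_vector ss Y_def)
    have m2: "emean n (\<lambda>i. (s \<bullet> Y i) * (s \<bullet> Y i) * a / (Y i \<bullet> (D *v Y i))) = 1 / ?p"
    proof -
      have QsY: "(Q *v s) \<bullet> (Q *v Y i) = a * (s \<bullet> Y i)" for i
        unfolding Df[symmetric] using sym_dot[OF D, of s "Y i"] st(3) by (metis inner_scaleR_left)
      have "emean n (\<lambda>i. a * ((s \<bullet> Y i) * (s \<bullet> Y i) * a / (Y i \<bullet> (D *v Y i)))) = (Q *v s) \<bullet> (Smat n W A *v (Q *v s))"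
        unfolding Smat_form QY[symmetric] QsY
        by (intro emean_cong) (simp add: power2_norm_eq_inner Df mult_ac)
      also have "\<dots> = a / ?p"
        unfolding SA scaleR_matrix_vector using Df[of s s, symmetric] st(3) ss by simp
      finally have "a * emean n (\<lambda>i. (s \<bullet> Y i) * (s \<bullet> Y i) * a / (Y i \<bullet> (D *v Y i))) = a * (1 / ?p)"
        unfolding emean_cmult by simp
      then show ?thesis by (rule mult_left_cancel[THEN iffD1, rotated]) (use a in simp)
    qed
    \<comment> \<open>Since D is bounded above by its top eigenvalue a, each summand for A is at
      least the corresponding summand for R. Both averages equal 1/p, so no inequality can be
      strict.\<close>
    have termwise: "(s \<bullet> Y i) * (s \<bullet> Y i) * a / (Y i \<bullet> (D *v Y i)) - (s \<bullet> Y i) * (s \<bullet> Y i) / (norm (Y i))\<^sup>2 = 0" if "i < n" for i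
    proof (rule emean_nonneg_zero[OF _ _ that])
      show "emean n (\<lambda>i. (s \<bullet> Y i) * (s \<bullet> Y i) * a / (Y i \<bullet> (D *v Y i)) - (s \<bullet> Y i) * (s \<bullet> Y i) / (norm (Y i))\<^sup>2) = 0"
        unfolding emean_diff m1 m2 by simp
      fix i assume i: "i < n"
      have "1 / (norm (Y i))\<^sup>2 \<le> a / (Y i \<bullet> (D *v Y i))"
        using st(5)[of "Y i"] Dpos[OF Y0[OF i]] Y0[OF i] by (simp add: field_simps)
      then have "((s \<bullet> Y i) * (s \<bullet> Y i)) * (1 / (norm (Y i))\<^sup>2) \<le> ((s \<bullet> Y i) * (s \<bullet> Y i)) * (a / (Y i \<bullet> (D *v Y i)))"
        by (rule mult_left_mono) simp
      then show "0 \<le> (s \<bullet> Y i) * (s \<bullet> Y i) * a / (Y i \<bullet> (D *v Y i)) - (s \<bullet> Y i) * (s \<bullet> Y i) / (norm (Y i))\<^sup>2"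
        by simp
    qed
    \<comment> \<open>If s . Y is nonzero, equality forces Y to attain the maximum of the form of D,
      hence to lie in the top eigenspace, hence to be orthogonal to \<open>t\<close>, whose
      eigenvalue differs.\<close>
    have zero: "(s \<bullet> Y i) * (t \<bullet> Y i) = 0" if i: "i < n" for i
    proof (cases "s \<bullet> Y i = 0")
      case False
      have "(s \<bullet> Y i) * (s \<bullet> Y i) * (a / (Y i \<bullet> (D *v Y i)) - 1 / (norm (Y i))\<^sup>2) = 0"
        using termwise[OF i] by (simp add: algebra_simps)
      then have "a / (Y i \<bullet> (D *v Y i)) = 1 / (norm (Y i))\<^sup>2" using False by simp
      then have e: "Y i \<bullet> (D *v Y i) = a * (norm (Y i))\<^sup>2"
        using Dpos[OF Y0[OF i]] Y0[OF i] by (simp add: field_simps)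
      define C where "C = a *\<^sub>R mat 1 - D"
      have Cx: "C *v x = a *\<^sub>R x - D *v x" for x
        by (simp add: C_def matrix_vector_mult_diff_rdistrib scaleR_matrix_vector)
      have "symmetric_m C"
        by (rule sym_from_dot) (simp add: Cx inner_diff_left inner_diff_right sym_dot[OF D])
      moreover have "0 \<le> x \<bullet> (C *v x)" for x
        using st(5)[of x] by (simp add: Cx inner_diff_right power2_norm_eq_inner)
      moreover have "Y i \<bullet> (C *v Y i) = 0" using e by (simp add: Cx inner_diff_right power2_norm_eq_inner)
      ultimately have "C *v Y i = 0" by (rule psd_null)
      then have "D *v Y i = a *\<^sub>R Y i" by (simp add: Cx)
      then have "a * (t \<bullet> Y i) = b * (t \<bullet> Y i)"
        using sym_dot[OF D, of t "Y i"] st(4) by (metis inner_scaleR_left inner_scaleR_right)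
      then show ?thesis using ab by simp
    qed simp
    \<comment> \<open>In the original coordinates the product (x . W) (y . W) vanishes for every
      observation, whereas the isotropic mean of its square is at least |x|^2 |y|^2 / (p (p + 2)).
      This exceeds the error allowed by the condition on G.\<close>
    define x y where "x = R *v s" and "y = R *v t"
    have xy: "x \<noteq> 0" "y \<noteq> 0" using s0 unfolding x_def y_def by (metis Ri(4) matrix_vector_mult_0_right)+
    have "emean n (\<lambda>i. (x \<bullet> W i) * (x \<bullet> W i) * (y \<bullet> W i) * (y \<bullet> W i)) = emean n (\<lambda>i. 0)"
    proof (rule emean_cong)
      fix i assume "i < n"
      then have "(x \<bullet> W i) * (y \<bullet> W i) = 0" using zero by (simp add: x_def y_def Y_def sym_dot[OF R(1)])
      then show "(x \<bullet> W i) * (x \<bullet> W i) * (y \<bullet> W i) * (y \<bullet> W i) = 0" by auto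
    qed
    also have "\<dots> = 0" by (simp add: emean_def)
    finally have "\<bar>iso_form x x y y\<bar> \<le> G * norm x * norm x * norm y * norm y"
      using near_isoD(3)[OF W, of x x y y] by simp
    then have le: "iso_form x x y y \<le> G * ((x \<bullet> x) * (y \<bullet> y))"
      by (simp add: power2_norm_eq_inner[symmetric] power2_eq_square mult_ac)
    have pos: "(x \<bullet> x) * (y \<bullet> y) > 0" using xy by simp
    have pp: "?p * (?p + 2) > 0" by (intro mult_pos_pos) auto
    have "((x \<bullet> x) * (y \<bullet> y)) / (?p * (?p + 2)) \<le> iso_form x x y y"
      unfolding iso_form_def using pp by (intro divide_right_mono) auto
    then have "(x \<bullet> x) * (y \<bullet> y) \<le> iso_form x x y y * (?p * (?p + 2))"
      using pp by (simp add: pos_divide_le_eq)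
    also have "\<dots> \<le> G * ((x \<bullet> x) * (y \<bullet> y)) * (?p * (?p + 2))"
      using le pp by (intro mult_right_mono) auto
    also have "\<dots> = (G * (?p * (?p + 2))) * ((x \<bullet> x) * (y \<bullet> y))" by (simp only: mult_ac)
    also have "\<dots> < 1 * ((x \<bullet> x) * (y \<bullet> y))" using G pos by (intro mult_strict_right_mono) auto
    finally show False by simp
  qed
  define C where "C = D - a *\<^sub>R mat 1"
  have Cx: "C *v x = D *v x - a *\<^sub>R x" for x
    by (simp add: C_def matrix_vector_mult_diff_rdistrib scaleR_matrix_vector)
  have "symmetric_m C"
    by (rule sym_from_dot) (simp add: Cx inner_diff_left inner_diff_right sym_dot[OF D])
  moreover have "\<bar>x \<bullet> (C *v x)\<bar> \<le> 0 * (norm x)\<^sup>2" for x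
    using st(5)[of x] st(6)[of x] \<open>a = b\<close> by (simp add: Cx inner_diff_right power2_norm_eq_inner)
  ultimately have C0: "norm (C *v x) \<le> 0 * norm x" for x by (rule sym_op_bound)
  have Da: "D *v x = a *\<^sub>R x" for x using C0[of x] by (simp add: Cx)
  show ?thesis
  proof (rule that[OF a])
    fix x y
    have "A *v z = Q *v (R *v z)" for z by (simp add: Qx Ri)
    then show "(A *v x) \<bullet> (A *v y) = a * ((R *v x) \<bullet> (R *v y))"
      by (simp add: Df[symmetric] Da)
  qed
qed

section \<open>Transfer of the solution to Tyler's estimator\<close>

lemma outer_conjugate:
  assumes "symmetric_m M"
  shows "M ** outer u u ** M = outer (M *v u) (M *v u)"
  by (rule matrix_eq_dot)
    (simp add: matrix_vector_mul_assoc[symmetric] outer_mult matrix_vector_scaleR sym_dot[OF assms])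

lemma outer_scaleR: "outer (c *\<^sub>R x) (c *\<^sub>R x) = c\<^sup>2 *\<^sub>R outer x x"
  by (simp add: outer_def vec_eq_iff power2_eq_square)

text \<open>The factors \<open>k i\<close> cancel between numerator and denominator, since only
  directions matter. The candidate V enters through V^(-1/2) H, which need not be symmetric.\<close>

lemma S_n_Smat:
  assumes "symmetric_m (msqrt_inv V)" and U: "\<And>i. i < n \<Longrightarrow> U i = k i *\<^sub>R (H *v W i) \<and> k i \<noteq> 0"
  shows "S_n n U V = Smat n W (msqrt_inv V ** H)"
proof -
  define M where "M = msqrt_inv V"
  have "(1 / (norm (M *v U i))\<^sup>2) *\<^sub>R (M ** outer (U i) (U i) ** M) = (1 / (norm ((M ** H) *v W i))\<^sup>2) *\<^sub>R outer ((M ** H) *v W i) ((M ** H) *v W i)" if "i < n" for i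
  proof -
    have "M *v U i = k i *\<^sub>R ((M ** H) *v W i)"
      using U[OF that] by (simp add: matrix_vector_scaleR matrix_vector_mul_assoc)
    then show ?thesis
      using U[OF that] unfolding outer_conjugate[OF assms(1)[folded M_def]]
      by (simp add: outer_scaleR power_mult_distrib)
  qed
  then show ?thesis unfolding S_n_def Smat_def M_def[symmetric] by simp
qed

lemma gram_msqrt_inv:
  assumes V: "symmetric_m V" "posdef_m V" and H: "symmetric_m H"
  shows "((msqrt_inv V ** H) *v x) \<bullet> ((msqrt_inv V ** H) *v y) = (H *v x) \<bullet> (matrix_inv V *v (H *v y))"
  unfolding msqrt_inv_props(3)[OF V, symmetric]
  by (simp add: matrix_vector_mul_assoc[symmetric] sym_dot[OF msqrt_inv_props(1)[OF V]])

text \<open>For V = c H (R R)^(-1) H the Gram matrix of V^(-1/2) H is R^2 / c, and equality of Gram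
  matrices up to scale is all that the equation sees. The trace condition determines c, and
  uniqueness up to scale makes the definite description in \<open>tyler\<close> denote this
  matrix.\<close>

lemma tyler_representation:
  fixes W :: "nat \<Rightarrow> real^'p"
  assumes W: "near_iso n W G" and G: "G * (real CARD('p) * (real CARD('p) + 2)) < 1"
    and R: "symmetric_m R" "posdef_m R" and SR: "Smat n W R = (1 / real CARD('p)) *\<^sub>R mat 1"
    and H: "symmetric_m H" "posdef_m H" and U: "\<And>i. i < n \<Longrightarrow> U i = k i *\<^sub>R (H *v W i) \<and> k i \<noteq> 0"
  obtains c where "c > 0" "tyler n U = c *\<^sub>R (H ** matrix_inv (R ** R) ** H)"
proof -
  let ?p = "real CARD('p)"
  define J where "J = matrix_inv (R ** R)"
  have RR: "symmetric_m (R ** R)" "posdef_m (R ** R)"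
  proof -
    have tR: "transpose R = R" using R(1) by (simp add: symmetric_m_def)
    show "symmetric_m (R ** R)" using symmetric_gram[of R] by (simp add: tR)
    have "R *v x \<noteq> 0" if "x \<noteq> 0" for x using R(2) that unfolding posdef_m_def by (metis inner_zero_right less_irrefl)
    then show "posdef_m (R ** R)" using gram_matrix[of _ R] unfolding posdef_m_def tR by simp
  qed
  have J: "symmetric_m J" "posdef_m J" unfolding J_def
    using RR sym_matrix_inv posdef_matrix_inv posdef_invertible by auto
  have JR: "J *v (R *v (R *v x)) = x" "R *v (R *v (J *v x)) = x" for x
    using matrix_inv_mult[OF posdef_invertible[OF RR(2)], of x] by (simp_all add: J_def matrix_vector_mul_assoc[symmetric])
  define K where "K = H ** J ** H"
  have Kx: "K *v x = H *v (J *v (H *v x))" for x by (simp add: K_def matrix_vector_mul_assoc[symmetric])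
  have H0: "H *v x \<noteq> 0" if "x \<noteq> 0" for x using H(2) that unfolding posdef_m_def by (metis inner_zero_right less_irrefl)
  obtain Hi where Hi: "\<And>x. H *v (Hi *v x) = x" "\<And>x. Hi *v (H *v x) = x"
    using invertible_inverse_mult[OF posdef_invertible[OF H(2)]] by metis
  have K: "symmetric_m K" "posdef_m K"
  proof -
    show "symmetric_m K" by (rule sym_from_dot) (simp add: Kx sym_dot[OF H(1)] sym_dot[OF J(1)])
    have "x \<bullet> (K *v x) = (H *v x) \<bullet> (J *v (H *v x))" for x by (simp add: Kx sym_dot[OF H(1)])
    then show "posdef_m K" using J(2) H0 unfolding posdef_m_def by simp
  qed
  have "N $ i $ i > 0" if "posdef_m N" for N :: "real^'p^'p" and i
  proof -
    have "(axis i 1 :: real^'p) \<noteq> 0" by (metis norm_axis_1 norm_zero zero_neq_one)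
    then have "axis i 1 \<bullet> (N *v axis i 1) > 0" using that by (simp add: posdef_m_def)
    then show ?thesis by (simp add: inner_axis' matrix_vector_mult_basis column_def)
  qed
  then have tK: "trace_m K > 0" unfolding trace_m_def using K by (intro sum_pos) auto
  define c where "c = ?p / trace_m K"
  have c: "c > 0" using tK by (simp add: c_def)
  define V where "V = c *\<^sub>R K"
  have Vx: "V *v x = c *\<^sub>R (K *v x)" for x by (simp add: V_def scaleR_matrix_vector)
  have V: "symmetric_m V" "posdef_m V"
  proof -
    show "symmetric_m V" by (rule sym_from_dot) (simp add: Vx sym_dot[OF K(1)])
    show "posdef_m V" using K(2) c by (simp add: posdef_m_def Vx)
  qed
  have shV: "shape_matrix V" unfolding shape_matrix_def using V tK by (simp add: V_def trace_scaleR c_def)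
  have SV: "S_n n U V = (1 / ?p) *\<^sub>R mat 1"
  proof -
    define A where "A = msqrt_inv V ** H"
    have A: "(A *v x) \<bullet> (A *v y) = ((R *v x) \<bullet> (R *v y)) / c" for x y
    proof -
      define z where "z = matrix_inv V *v (H *v y)"
      have "V *v z = H *v y" unfolding z_def by (rule matrix_inv_mult(1)[OF posdef_invertible[OF V(2)]])
      then have "H *v (c *\<^sub>R (J *v (H *v z))) = H *v y" by (simp add: Vx Kx matrix_vector_scaleR)
      then have "c *\<^sub>R (J *v (H *v z)) = y" by (metis Hi(2))
      then have "c *\<^sub>R (H *v z) = R *v (R *v y)" using JR(2)[of "H *v z"] by (metis matrix_vector_scaleR)
      then have "c * (x \<bullet> (H *v z)) = x \<bullet> (R *v (R *v y))" by (metis inner_scaleR_right)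
      moreover have "(A *v x) \<bullet> (A *v y) = x \<bullet> (H *v z)"
        unfolding A_def gram_msqrt_inv[OF V H(1)] z_def[symmetric] by (rule sym_dot[OF H(1)])
      ultimately show ?thesis using c by (simp add: sym_dot[OF R(1)] field_simps)
    qed
    have Ainv: "invertible A"
    proof -
      have "\<forall>x. A *v x = 0 \<longrightarrow> x = 0"
      proof (intro allI impI)
        fix x assume "A *v x = 0"
        then have "(R *v x) \<bullet> (R *v x) = 0" using A[of x x] c by simp
        then show "x = 0" using JR(1)[of x] by simp
      qed
      then show ?thesis by (metis invertible_left_inverse matrix_left_invertible_ker)
    qed
    obtain Ai where Ai: "\<And>x. A *v (Ai *v x) = x" using invertible_inverse_mult[OF Ainv] by metis
    \<comment> \<open>Writing the test vectors as images under A expresses every term through the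
      Gram matrix of A, hence through that of R; the orthogonal factor between the two maps drops
      out.\<close>
    have "Smat n W A = (1 / ?p) *\<^sub>R mat 1"
    proof (rule matrix_eq_dot)
      fix x y
      define x' y' where "x' = Ai *v x" and "y' = Ai *v y"
      have xy: "x = A *v x'" "y = A *v y'" by (simp_all add: x'_def y'_def Ai)
      have "x \<bullet> (Smat n W A *v y) = emean n (\<lambda>i. (1 / c) * (((R *v x') \<bullet> (R *v W i)) * ((R *v y') \<bullet> (R *v W i)) / (norm (R *v W i))\<^sup>2))"
        unfolding Smat_form xy A power2_norm_eq_inner using c by (intro emean_cong) (simp add: field_simps)
      also have "\<dots> = (1 / c) * ((R *v x') \<bullet> (Smat n W R *v (R *v y')))"
        unfolding emean_cmult Smat_form ..
      also have "\<dots> = (1 / ?p) * (x \<bullet> y)"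
        unfolding SR xy A by (simp add: scaleR_matrix_vector)
      finally show "x \<bullet> (Smat n W A *v y) = x \<bullet> ((1 / ?p) *\<^sub>R mat 1 *v y)" by (simp add: scaleR_matrix_vector)
    qed
    then show ?thesis using S_n_Smat[OF msqrt_inv_props(1)[OF V] U] by (simp add: A_def)
  qed
  have uniq: "V' = V" if V': "shape_matrix V'" "S_n n U V' = (1 / ?p) *\<^sub>R mat 1" for V'
  proof -
    have sV: "symmetric_m V'" "posdef_m V'" and tr: "trace_m V' = ?p" using V'(1) by (auto simp: shape_matrix_def)
    define A where "A = msqrt_inv V' ** H"
    have SA: "Smat n W A = (1 / ?p) *\<^sub>R mat 1"
      using V'(2) S_n_Smat[OF msqrt_inv_props(1)[OF sV] U] by (simp add: A_def)
    have "invertible A" unfolding A_def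
      by (intro invertible_mult posdef_invertible msqrt_inv_props(2)[OF sV] H(2))
    then obtain d where d: "d > 0" "\<And>x y. (A *v x) \<bullet> (A *v y) = d * ((R *v x) \<bullet> (R *v y))"
      using tyler_equation_unique[OF W G R SR _ SA] by metis
    \<comment> \<open>The Gram matrix of V'^(-1/2) H is a multiple of R^2. Inverting this relation
      shows V' to be a multiple of \<open>K\<close>, and the trace then fixes the multiple.\<close>
    have Vd: "V' = (1 / d) *\<^sub>R K"
    proof (subst matrix_eq, rule)
      fix z
      define y where "y = Hi *v (V' *v z)"
      have z: "z = matrix_inv V' *v (H *v y)"
        by (simp add: y_def Hi matrix_inv_mult(2)[OF posdef_invertible[OF sV(2)]])
      have "x \<bullet> (H *v z) = x \<bullet> (d *\<^sub>R (R *v (R *v y)))" for x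
        using d(2)[of x y] unfolding A_def gram_msqrt_inv[OF sV H(1)] z[symmetric]
        by (simp add: sym_dot[OF H(1)] sym_dot[OF R(1)])
      then have "H *v z = d *\<^sub>R (R *v (R *v y))" using vector_eq_ldot by blast
      then have "J *v (H *v z) = d *\<^sub>R y" by (simp add: matrix_vector_scaleR JR)
      then have "K *v z = d *\<^sub>R (V' *v z)" by (simp add: Kx matrix_vector_scaleR y_def Hi)
      then show "V' *v z = (1 / d) *\<^sub>R K *v z" using d(1) by (simp add: scaleR_matrix_vector)
    qed
    then have "(1 / d) * trace_m K = ?p" using tr by (simp add: trace_scaleR)
    then have "1 / d = c" using tK by (simp add: c_def field_simps)
    then show ?thesis by (simp add: Vd V_def)
  qed
  have "tyler n U = V"
    unfolding tyler_def
  proof (rule the_equality)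
    show "shape_matrix V \<and> S_n n U V = (1 / ?p) *\<^sub>R mat 1" by (rule conjI[OF shV SV])
    show "V' = V" if "shape_matrix V' \<and> S_n n U V' = (1 / ?p) *\<^sub>R mat 1" for V'
      using that uniq by blast
  qed
  then show ?thesis using that[OF c] by (simp add: V_def K_def J_def)
qed

section \<open>The Gram--Schmidt modification\<close>

text \<open>Closed form of the Gram--Schmidt vectors: after processing the indices 2..j, the residual of
  \<open>\<theta>0\<close> is \<open>r j\<close>, of squared length \<open>s2 j\<close>.\<close>
locale frame =
  fixes \<theta>0 :: "real^'p" and t :: "nat \<Rightarrow> real^'p"
  assumes th0: "norm \<theta>0 = 1"
    and on: "\<forall>j\<in>{1..CARD('p)}. \<forall>k\<in>{1..CARD('p)}. t j \<bullet> t k = (if j = k then 1 else 0)"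
    and t1: "t 1 \<bullet> \<theta>0 \<noteq> 0"
begin

definition "q j = t j \<bullet> \<theta>0"
definition "s2 j = 1 - (\<Sum>k\<in>{2..j}. (q k)\<^sup>2)"
definition "r j = \<theta>0 - (\<Sum>k\<in>{2..j}. q k *\<^sub>R t k)"
definition "f j = (1 / (sqrt (s2 j) * sqrt (s2 (j - 1)))) *\<^sub>R (s2 (j - 1) *\<^sub>R t j - q j *\<^sub>R r (j - 1))"

lemma th00: "\<theta>0 \<bullet> \<theta>0 = 1" using th0 by (simp add: norm_eq_1)

lemma tt: "j \<in> {1..CARD('p)} \<Longrightarrow> k \<in> {1..CARD('p)} \<Longrightarrow> t j \<bullet> t k = (if j = k then 1 else 0)"
  using on by blast

lemma sum_q: "(\<Sum>k\<in>{1..CARD('p)}. (q k)\<^sup>2) = 1"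
  using orthonormal_norm[OF _ _ on, of \<theta>0 \<theta>0] th00 by (simp add: q_def power2_eq_square)

text \<open>By Parseval the residual of \<theta>0 keeps at least its component along
  \<open>t 1\<close>. Through this bound the alignment of the leading eigenvector controls all
  Gram-Schmidt denominators.\<close>

lemma s2_ge:
  assumes "j \<le> CARD('p)"
  shows "(q 1)\<^sup>2 \<le> s2 j"
proof -
  have "(\<Sum>k\<in>{1..CARD('p)}. (q k)\<^sup>2) \<ge> (\<Sum>k\<in>insert 1 {2..j}. (q k)\<^sup>2)"
    using assms by (intro sum_mono2) auto
  then show ?thesis unfolding sum_q by (simp add: s2_def)
qed

lemma s2_pos: "j \<le> CARD('p) \<Longrightarrow> s2 j > 0"
  using s2_ge[of j] t1 by (smt (verit) q_def zero_less_power2)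

lemma s2_1: "s2 1 = 1" and r_1: "r 1 = \<theta>0"
  by (simp_all add: s2_def r_def)

lemma s2_Suc: "j \<ge> 1 \<Longrightarrow> s2 (Suc j) = s2 j - (q (Suc j))\<^sup>2"
  by (simp add: s2_def)

lemma r_Suc: "j \<ge> 1 \<Longrightarrow> r (Suc j) = r j - q (Suc j) *\<^sub>R t (Suc j)"
  by (simp add: r_def)

lemma r_t:
  assumes "j \<le> CARD('p)" "k \<in> {1..CARD('p)}"
  shows "r j \<bullet> t k = (if 2 \<le> k \<and> k \<le> j then 0 else q k)"
proof -
  have "(\<Sum>l\<in>{2..j}. q l * (t l \<bullet> t k)) = (\<Sum>l\<in>{2..j}. if l = k then q k else 0)"
    using assms by (intro sum.cong refl) (auto simp: tt)
  moreover have "\<theta>0 \<bullet> t k = q k" by (simp add: q_def inner_commute)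
  ultimately show ?thesis
    by (simp add: r_def inner_diff_left inner_sum_left)
qed

lemma r_th0: "r j \<bullet> \<theta>0 = s2 j"
  by (simp add: r_def s2_def inner_diff_left inner_sum_left th00 q_def power2_eq_square)

lemma r_r:
  assumes "j \<le> k" "k \<le> CARD('p)"
  shows "r j \<bullet> r k = s2 k"
proof -
  have "r j \<bullet> r k = \<theta>0 \<bullet> r k - (\<Sum>l\<in>{2..j}. q l * (t l \<bullet> r k))"
    by (simp add: r_def[of j] inner_diff_left inner_sum_left)
  also have "(\<Sum>l\<in>{2..j}. q l * (t l \<bullet> r k)) = 0"
    using assms r_t[of k] by (intro sum.neutral) (auto simp: inner_commute)
  finally show ?thesis using r_th0[of k] by (simp add: inner_commute)
qed

text \<open>On the indices from 2 on, the new frame is triangular relative to the old one, because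
  \<open>r (j - 1)\<close> is orthogonal to the vectors already processed. The off-diagonal
  coefficients are products of two components of \<theta>0.\<close>

lemma f_t:
  assumes "j \<in> {2..CARD('p)}" "l \<in> {2..CARD('p)}"
  shows "f j \<bullet> t l = (if l = j then sqrt (s2 j) / sqrt (s2 (j - 1)) else if j < l then - (q j * q l) / (sqrt (s2 j) * sqrt (s2 (j - 1))) else 0)"
proof -
  have rl: "r (j - 1) \<bullet> t l = (if l < j then 0 else q l)"
    using assms by (subst r_t) auto
  have tl: "t j \<bullet> t l = (if j = l then 1 else 0)" using assms by (subst tt) auto
  have s: "s2 j = s2 (j - 1) - (q j)\<^sup>2" using assms s2_Suc[of "j - 1"] by auto
  have p: "s2 j > 0" "s2 (j - 1) > 0" using assms by (auto intro: s2_pos)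
  have e: "f j \<bullet> t l = (s2 (j - 1) * (t j \<bullet> t l) - q j * (r (j - 1) \<bullet> t l)) / (sqrt (s2 j) * sqrt (s2 (j - 1)))"
    by (simp add: f_def inner_diff_left)
  show ?thesis
  proof (cases "l = j")
    case True
    have "f j \<bullet> t l = s2 j / (sqrt (s2 j) * sqrt (s2 (j - 1)))"
      unfolding e rl tl using True s by (simp add: power2_eq_square)
    also have "\<dots> = sqrt (s2 j) / sqrt (s2 (j - 1))" using p by (simp add: real_div_sqrt divide_divide_eq_left[symmetric])
    finally show ?thesis using True by simp
  next
    case False
    then show ?thesis unfolding e rl tl by auto
  qed
qed

lemma f_th0:
  assumes "j \<in> {2..CARD('p)}"
  shows "f j \<bullet> \<theta>0 = 0"
  by (simp add: f_def inner_diff_left r_th0 q_def[symmetric])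

lemma f_f:
  assumes "j \<in> {2..CARD('p)}" "k \<in> {2..CARD('p)}"
  shows "f j \<bullet> f k = (if j = k then 1 else 0)"
proof -
  have less: "f j \<bullet> f k = 0" if "j < k" "j \<in> {2..CARD('p)}" "k \<in> {2..CARD('p)}" for j k
  proof -
    have "(s2 (j - 1) *\<^sub>R t j - q j *\<^sub>R r (j - 1)) \<bullet> (s2 (k - 1) *\<^sub>R t k - q k *\<^sub>R r (k - 1))
      = s2 (j - 1) * s2 (k - 1) * (t j \<bullet> t k) - s2 (j - 1) * q k * (r (k - 1) \<bullet> t j) - q j * s2 (k - 1) * (r (j - 1) \<bullet> t k) + q j * q k * (r (j - 1) \<bullet> r (k - 1))"
      by (simp add: inner_diff_left inner_diff_right inner_commute algebra_simps)
    also have "t j \<bullet> t k = 0" using that by (subst tt) auto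
    also have "r (k - 1) \<bullet> t j = 0" using that by (subst r_t) auto
    also have "r (j - 1) \<bullet> t k = q k" using that by (subst r_t) auto
    also have "r (j - 1) \<bullet> r (k - 1) = s2 (k - 1)" using that by (intro r_r) auto
    finally show ?thesis by (simp add: f_def)
  qed
  show ?thesis
  proof (cases "j = k")
    case True
    have s: "s2 j = s2 (j - 1) - (q j)\<^sup>2" using assms s2_Suc[of "j - 1"] by auto
    have p: "s2 j > 0" "s2 (j - 1) > 0" using assms by (auto intro: s2_pos)
    have "(s2 (j - 1) *\<^sub>R t j - q j *\<^sub>R r (j - 1)) \<bullet> (s2 (j - 1) *\<^sub>R t j - q j *\<^sub>R r (j - 1))
      = s2 (j - 1) * s2 (j - 1) * (t j \<bullet> t j) - 2 * s2 (j - 1) * q j * (r (j - 1) \<bullet> t j) + q j * q j * (r (j - 1) \<bullet> r (j - 1))"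
      by (simp add: inner_diff_left inner_diff_right inner_commute algebra_simps)
    also have "t j \<bullet> t j = 1" using assms by (subst tt) auto
    also have "r (j - 1) \<bullet> t j = q j" using assms by (subst r_t) auto
    also have "r (j - 1) \<bullet> r (j - 1) = s2 (j - 1)" using assms by (intro r_r) auto
    also have "s2 (j - 1) * s2 (j - 1) * 1 - 2 * s2 (j - 1) * q j * q j + q j * q j * s2 (j - 1) = s2 (j - 1) * s2 j"
      by (simp add: s power2_eq_square algebra_simps)
    finally have e: "(s2 (j - 1) *\<^sub>R t j - q j *\<^sub>R r (j - 1)) \<bullet> (s2 (j - 1) *\<^sub>R t j - q j *\<^sub>R r (j - 1)) = s2 (j - 1) * s2 j" .
    have "f j \<bullet> f j = (1 / (sqrt (s2 j) * sqrt (s2 (j - 1))))\<^sup>2 * (s2 (j - 1) * s2 j)"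
      unfolding f_def inner_scaleR_left inner_scaleR_right e by (simp add: power2_eq_square)
    also have "\<dots> = 1" using p by (simp add: power_divide power_mult_distrib)
    finally show ?thesis using True by simp
  next
    case False
    then show ?thesis using less[of j k] less[of k j] assms by (cases "j < k") (auto simp: inner_commute)
  qed
qed

text \<open>The next Gram-Schmidt step subtracts \<open>q j\<close> times this vector from
  \<open>t j\<close>. Being a multiple of the residual of \<theta>0, it gives the closed form of the
  next frame vector.\<close>

lemma residual_expansion:
  assumes "1 \<le> m" "m \<le> CARD('p)"
  shows "\<theta>0 - (\<Sum>k\<in>{2..m}. (q k / (sqrt (s2 k) * sqrt (s2 (k - 1)))) *\<^sub>R f k) = (1 / s2 m) *\<^sub>R r m"
  using assms
proof (induction m rule: dec_induct)
  case base
  show ?case using s2_1 r_1 by simp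
next
  case (step m)
  have p: "s2 m > 0" "s2 (Suc m) > 0" using step.prems by (auto intro: s2_pos)
  have ff: "(q (Suc m) / (sqrt (s2 (Suc m)) * sqrt (s2 m))) *\<^sub>R f (Suc m)
    = (q (Suc m) / (s2 (Suc m) * s2 m)) *\<^sub>R (s2 m *\<^sub>R t (Suc m) - q (Suc m) *\<^sub>R r m)"
  proof -
    have "(q (Suc m) / (sqrt (s2 (Suc m)) * sqrt (s2 m))) * (1 / (sqrt (s2 (Suc m)) * sqrt (s2 m))) = q (Suc m) / (s2 (Suc m) * s2 m)"
    proof -
      have "(sqrt (s2 (Suc m)) * sqrt (s2 m)) * (sqrt (s2 (Suc m)) * sqrt (s2 m)) = s2 (Suc m) * s2 m"
        using p by (simp add: real_sqrt_mult[symmetric])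
      then show ?thesis by simp
    qed
    then show ?thesis by (simp add: f_def del: times_divide_eq_right times_divide_eq_left)
  qed
  have "\<theta>0 - (\<Sum>k\<in>{2..Suc m}. (q k / (sqrt (s2 k) * sqrt (s2 (k - 1)))) *\<^sub>R f k)
    = (1 / s2 m) *\<^sub>R r m - (q (Suc m) / (sqrt (s2 (Suc m)) * sqrt (s2 m))) *\<^sub>R f (Suc m)"
    using step.IH step.prems step.hyps by (simp add: algebra_simps)
  also have "\<dots> = (1 / s2 m + (q (Suc m) / (s2 (Suc m) * s2 m)) * q (Suc m)) *\<^sub>R r m - (q (Suc m) / (s2 (Suc m) * s2 m) * s2 m) *\<^sub>R t (Suc m)"
    unfolding ff by (simp add: algebra_simps)
  \<comment> \<open>Telescoping: the squared residual length drops by exactly the square of the new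
    component.\<close>
  also have "1 / s2 m + (q (Suc m) / (s2 (Suc m) * s2 m)) * q (Suc m) = 1 / s2 (Suc m)"
  proof -
    have "s2 (Suc m) + q (Suc m) * q (Suc m) = s2 m" using s2_Suc[OF step.hyps(1)] by (simp add: power2_eq_square)
    then show ?thesis using p by (simp add: field_simps)
  qed
  also have "q (Suc m) / (s2 (Suc m) * s2 m) * s2 m = 1 / s2 (Suc m) * q (Suc m)" using p by simp
  also have "(1 / s2 (Suc m)) *\<^sub>R r m - (1 / s2 (Suc m) * q (Suc m)) *\<^sub>R t (Suc m) = (1 / s2 (Suc m)) *\<^sub>R r (Suc m)"
    unfolding r_Suc[OF step.hyps(1)] scaleR_diff_right by simp
  finally show ?case .
qed

text \<open>Each stage of the recursion writes its own index only, so earlier entries are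
  stable.\<close>

lemma gs_eq_theta_tilde: "k \<le> m \<Longrightarrow> gs \<theta>0 t m k = theta_tilde \<theta>0 t k"
proof (induction m)
  case 0
  then show ?case by (simp add: theta_tilde_def)
next
  case (Suc m)
  then show ?case by (cases "k = Suc m") (auto simp: theta_tilde_def Let_def)
qed

lemma theta_tilde_eq:
  assumes "j \<in> {2..CARD('p)}"
  shows "theta_tilde \<theta>0 t j = f j"
  using assms
proof (induction j rule: less_induct)
  case (less j)
  obtain m where m: "j = Suc m" "1 \<le> m" "m \<le> CARD('p)" "Suc m \<le> CARD('p)" using less.prems by (cases j) auto
  define v where "v = (mat 1 - outer \<theta>0 \<theta>0 - (\<Sum>k\<in>{2..<Suc m}. outer (gs \<theta>0 t m k) (gs \<theta>0 t m k))) *v t j"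
  have "theta_tilde \<theta>0 t j = v /\<^sub>R norm v"
    by (simp add: theta_tilde_def m(1) Let_def v_def)
  have IH: "gs \<theta>0 t m k = f k" if "k \<in> {2..m}" for k
    using that less.IH[of k] m gs_eq_theta_tilde[of k m] by auto
  have "v = t j - q j *\<^sub>R \<theta>0 - (\<Sum>k\<in>{2..m}. (f k \<bullet> t j) *\<^sub>R f k)"
    using IH
    by (simp add: v_def matrix_vector_mult_diff_rdistrib outer_mult sum_matrix_vector_mult q_def inner_commute atLeastLessThanSuc_atLeastAtMost)
  also have "(\<Sum>k\<in>{2..m}. (f k \<bullet> t j) *\<^sub>R f k) = - q j *\<^sub>R (\<Sum>k\<in>{2..m}. (q k / (sqrt (s2 k) * sqrt (s2 (k - 1)))) *\<^sub>R f k)"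
    unfolding scaleR_sum_right
    by (intro sum.cong refl) (use m in \<open>auto simp: f_t mult.commute\<close>)
  also have "t j - q j *\<^sub>R \<theta>0 - - q j *\<^sub>R (\<Sum>k\<in>{2..m}. (q k / (sqrt (s2 k) * sqrt (s2 (k - 1)))) *\<^sub>R f k)
     = t j - q j *\<^sub>R (\<theta>0 - (\<Sum>k\<in>{2..m}. (q k / (sqrt (s2 k) * sqrt (s2 (k - 1)))) *\<^sub>R f k))"
    by (simp add: algebra_simps)
  also have "\<dots> = t j - q j *\<^sub>R ((1 / s2 m) *\<^sub>R r m)" using residual_expansion[OF m(2,3)] by simp
  finally have v: "v = t j - q j *\<^sub>R ((1 / s2 m) *\<^sub>R r m)" .
  have p: "s2 m > 0" "s2 j > 0" using m by (auto intro: s2_pos)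
  have v2: "v = (sqrt (s2 j) / sqrt (s2 m)) *\<^sub>R f j"
  proof -
    have "(sqrt (s2 j) / sqrt (s2 m)) *\<^sub>R f j = ((sqrt (s2 j) / sqrt (s2 m)) * (1 / (sqrt (s2 j) * sqrt (s2 m)))) *\<^sub>R (s2 m *\<^sub>R t j - q j *\<^sub>R r m)"
      by (simp add: f_def m(1))
    also have "(sqrt (s2 j) / sqrt (s2 m)) * (1 / (sqrt (s2 j) * sqrt (s2 m))) = 1 / s2 m"
      using p by (simp add: field_simps)
    finally show ?thesis unfolding v using p by (simp add: algebra_simps)
  qed
  have "norm (f j) = 1" using f_f[OF less.prems less.prems] by (simp add: norm_eq_1)
  then have "norm v = sqrt (s2 j) / sqrt (s2 m)" using p by (simp add: v2)
  then show ?case using \<open>theta_tilde \<theta>0 t j = v /\<^sub>R norm v\<close> p by (simp add: v2)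
qed

definition "g j = (if j = (1::nat) then \<theta>0 else f j)"

lemma g_orthonormal: "\<forall>j\<in>{1..CARD('p)}. \<forall>k\<in>{1..CARD('p)}. g j \<bullet> g k = (if j = k then 1 else 0)"
proof (intro ballI)
  fix j k assume jk: "j \<in> {1..CARD('p)}" "k \<in> {1..CARD('p)}"
  show "g j \<bullet> g k = (if j = k then 1 else 0)"
    using jk th00 f_th0[of j] f_th0[of k] f_f[of j k] by (auto simp: g_def inner_commute)
qed

lemma sum_split_first:
  "(\<Sum>j=1..CARD('p). F j) = F 1 + (\<Sum>j=2..CARD('p). F j :: 'b :: comm_monoid_add)"
proof -
  have "CARD('p) \<ge> 1" by simp
  then have "{1..CARD('p)} = insert 1 {2..CARD('p)}" by auto
  then show ?thesis by simp
qed

end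

section \<open>Effect of Gram-Schmidt on a matrix of the form H (I + E) H\<close>

locale frame_perturbed = frame \<theta>0 t for \<theta>0 :: "real^'p" and t +
  fixes H E V :: "real^'p^'p" and l :: "nat \<Rightarrow> real" and h e s0 :: real
  assumes H: "symmetric_m H" "posdef_m H" and Hth: "H *v \<theta>0 = h *\<^sub>R \<theta>0" and h: "h > 0"
    and Hle: "\<And>x. norm (H *v x) \<le> h * norm x"
    and E: "opb E e" and e: "e \<le> 1/8"
    and V: "V = (\<Sum>j=1..CARD('p). l j *\<^sub>R outer (t j) (t j))"
    and VE: "\<And>x y. x \<bullet> (V *v y) = (H *v x) \<bullet> (H *v y) + (H *v x) \<bullet> (E *v (H *v y))"
    and l: "\<forall>j\<in>{1..<CARD('p)}. l j \<ge> l (Suc j)"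
    and s0: "0 < s0" "s0 \<le> \<bar>t 1 \<bullet> \<theta>0\<bar>"
begin

text \<open>The gap to the leading eigenvalue. It has no positive lower bound; it occurs only
  multiplied by components of \<theta>0.\<close>

definition "D j = l 1 - l j"

lemma e0: "e \<ge> 0" using opb_nonneg[OF E] .

lemma V_quad: "\<bar>x \<bullet> (V *v x) - (norm (H *v x))\<^sup>2\<bar> \<le> e * (norm (H *v x))\<^sup>2"
  using opb_inner[OF E, of "H *v x" "H *v x"] by (simp add: VE power2_norm_eq_inner[symmetric] power2_eq_square mult_ac)

lemma V_t: "j \<in> {1..CARD('p)} \<Longrightarrow> V *v t j = l j *\<^sub>R t j"
  unfolding V by (rule spectral_eigen) (use on in auto)

lemma V_sym: "symmetric_m V"
  unfolding V by (rule symmetric_outer)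

lemma l_quad: "j \<in> {1..CARD('p)} \<Longrightarrow> t j \<bullet> (V *v t j) = l j"
  by (simp add: V_t tt)

lemma H_nonzero: "x \<noteq> 0 \<Longrightarrow> norm (H *v x) > 0"
  using H(2) unfolding posdef_m_def by (metis inner_zero_right less_irrefl zero_less_norm_iff)

lemma l_bounds:
  assumes j: "j \<in> {1..CARD('p)}"
  shows "(norm (H *v t j))\<^sup>2 \<le> 2 * l j" "l j > 0"
proof -
  have nt: "norm (t j) = 1" using j by (simp add: norm_eq_1 tt)
  then have "t j \<noteq> 0" by auto
  then have p: "(norm (H *v t j))\<^sup>2 > 0" using H_nonzero[of "t j"] by simp
  have q: "\<bar>l j - (norm (H *v t j))\<^sup>2\<bar> \<le> e * (norm (H *v t j))\<^sup>2" using V_quad[of "t j"] unfolding l_quad[OF j] .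
  have "e * (norm (H *v t j))\<^sup>2 \<le> 1/8 * (norm (H *v t j))\<^sup>2" using e p by (intro mult_right_mono) auto
  then show "(norm (H *v t j))\<^sup>2 \<le> 2 * l j" "l j > 0" using q p unfolding abs_le_iff by linarith+
qed

lemma l1_max: "j \<in> {1..CARD('p)} \<Longrightarrow> l j \<le> l 1"
proof (induction j)
  case (Suc j)
  show ?case
  proof (cases "j = 0")
    case False
    then have "l (Suc j) \<le> l j" using l Suc.prems by auto
    then show ?thesis using Suc False by auto
  qed simp
qed simp

lemma D_nonneg: "j \<in> {1..CARD('p)} \<Longrightarrow> D j \<ge> 0"
  using l1_max by (simp add: D_def)

lemma one_mem: "1 \<in> {1..CARD('p)}"
proof -
  have "CARD('p) \<ge> 1" by simp
  then show ?thesis by simp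
qed

text \<open>Both \<theta>0 and \<open>t 1\<close> nearly maximise the Rayleigh quotient: the value
  at \<theta>0 is at least (1 - e) h^2 and the maximum \<open>l 1\<close> is at most (1 + e) h^2.
  Their difference is exactly the weighted sum of gaps.\<close>

lemma Dq_sum: "(\<Sum>j=2..CARD('p). D j * (q j)\<^sup>2) \<le> 2 * e * h\<^sup>2"
  and l1_approx: "\<bar>l 1 - h\<^sup>2\<bar> \<le> e * h\<^sup>2"
proof -
  have Hn: "norm (H *v \<theta>0) = h" using Hth h th0 by simp
  have a: "\<bar>\<theta>0 \<bullet> (V *v \<theta>0) - h\<^sup>2\<bar> \<le> e * h\<^sup>2" using V_quad[of \<theta>0] Hn by simp
  have "\<theta>0 \<bullet> (V *v \<theta>0) = (\<Sum>j=1..CARD('p). l j * (q j)\<^sup>2)"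
    unfolding V spectral_quadratic q_def ..
  also have "\<dots> = (\<Sum>j=1..CARD('p). l 1 * (q j)\<^sup>2 - D j * (q j)\<^sup>2)"
    by (intro sum.cong refl) (simp add: D_def algebra_simps)
  also have "\<dots> = l 1 * (\<Sum>j=1..CARD('p). (q j)\<^sup>2) - (\<Sum>j=1..CARD('p). D j * (q j)\<^sup>2)"
    by (simp only: sum_subtractf sum_distrib_left)
  also have "\<dots> = l 1 - (\<Sum>j=2..CARD('p). D j * (q j)\<^sup>2)"
    unfolding sum_q sum_split_first[of "\<lambda>j. D j * (q j)\<^sup>2"] by (simp add: D_def)
  finally have b: "\<theta>0 \<bullet> (V *v \<theta>0) = l 1 - (\<Sum>j=2..CARD('p). D j * (q j)\<^sup>2)" .
  have nn: "(\<Sum>j=2..CARD('p). D j * (q j)\<^sup>2) \<ge> 0" by (intro sum_nonneg mult_nonneg_nonneg D_nonneg) auto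
  have "norm (t 1) = 1" using one_mem by (simp add: norm_eq_1 tt)
  then have "norm (H *v t 1) \<le> h" using Hle[of "t 1"] by simp
  then have n1: "(norm (H *v t 1))\<^sup>2 \<le> h\<^sup>2" by (intro power_mono) auto
  have "l 1 \<le> (1 + e) * (norm (H *v t 1))\<^sup>2"
    using V_quad[of "t 1"] unfolding l_quad[OF one_mem] by (simp add: abs_le_iff algebra_simps)
  also have "\<dots> \<le> (1 + e) * h\<^sup>2" using n1 e0 by (intro mult_left_mono) auto
  finally have u: "l 1 \<le> h\<^sup>2 + e * h\<^sup>2" by (simp add: algebra_simps)
  show "(\<Sum>j=2..CARD('p). D j * (q j)\<^sup>2) \<le> 2 * e * h\<^sup>2" using a b u by (simp add: abs_le_iff)
  show "\<bar>l 1 - h\<^sup>2\<bar> \<le> e * h\<^sup>2" using a b u nn by (simp add: abs_le_iff)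
qed

text \<open>The first bound moves H from \<theta>0 to \<open>t j\<close>, where its length is
  comparable to \<open>sqrt (l j)\<close>. For the second, evaluate t_j . V \<theta>0 spectrally and
  through E: the main parts agree, and what remains is e h times the same length, with 2 sqrt 2
  \<le> 3. Thus a component of \<theta>0 is small or its gap is.\<close>

lemma q_bound:
  assumes j: "j \<in> {1..CARD('p)}"
  shows "h * \<bar>q j\<bar> \<le> sqrt 2 * sqrt (l j)" "D j * \<bar>q j\<bar> \<le> 3 * e * h * sqrt (l j)"
proof -
  have Hn: "norm (H *v t j) \<le> sqrt 2 * sqrt (l j)"
    using l_bounds(1)[OF j] by (simp add: real_sqrt_mult[symmetric] real_le_rsqrt)
  have hq: "h * q j = (H *v t j) \<bullet> \<theta>0"
    by (simp add: q_def sym_dot[OF H(1)] Hth)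
  have "h * \<bar>q j\<bar> = \<bar>h * q j\<bar>" using h by (simp add: abs_mult)
  also have "\<dots> = \<bar>(H *v t j) \<bullet> \<theta>0\<bar>" by (simp only: hq)
  also have "\<dots> \<le> norm (H *v t j)" using Cauchy_Schwarz_ineq2[of "H *v t j" \<theta>0] th0 by simp
  finally show 1: "h * \<bar>q j\<bar> \<le> sqrt 2 * sqrt (l j)" using Hn by linarith
  have "l j * q j = t j \<bullet> (V *v \<theta>0)"
    using V_t[OF j] sym_dot[OF V_sym, of "t j" \<theta>0] by (simp add: q_def)
  also have "\<dots> = h * (h * q j) + h * ((H *v t j) \<bullet> (E *v \<theta>0))"
    unfolding VE Hth by (simp add: matrix_vector_scaleR hq)
  finally have "D j * q j = (l 1 - h\<^sup>2) * q j - h * ((H *v t j) \<bullet> (E *v \<theta>0))"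
    by (simp add: D_def algebra_simps power2_eq_square)
  then have "\<bar>D j * q j\<bar> \<le> \<bar>(l 1 - h\<^sup>2) * q j\<bar> + \<bar>h * ((H *v t j) \<bullet> (E *v \<theta>0))\<bar>"
    by (simp only: abs_triangle_ineq4)
  also have "\<dots> = \<bar>l 1 - h\<^sup>2\<bar> * \<bar>q j\<bar> + h * \<bar>(H *v t j) \<bullet> (E *v \<theta>0)\<bar>"
    using h by (simp only: abs_mult abs_of_pos)
  also have "\<dots> \<le> e * h\<^sup>2 * \<bar>q j\<bar> + h * (e * (sqrt 2 * sqrt (l j)))"
  proof (intro add_mono mult_right_mono mult_left_mono l1_approx)
    show "\<bar>(H *v t j) \<bullet> (E *v \<theta>0)\<bar> \<le> e * (sqrt 2 * sqrt (l j))"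
      using opb_inner[OF E, of "H *v t j" \<theta>0] th0 mult_left_mono[OF Hn e0] by simp
  qed (use h in auto)
  also have "e * h\<^sup>2 * \<bar>q j\<bar> = e * h * (h * \<bar>q j\<bar>)" by (simp add: power2_eq_square)
  also have "\<dots> \<le> e * h * (sqrt 2 * sqrt (l j))" using 1 e0 h by (intro mult_left_mono) auto
  also have "e * h * (sqrt 2 * sqrt (l j)) + h * (e * (sqrt 2 * sqrt (l j))) = (2 * sqrt 2) * (e * h * sqrt (l j))" by simp
  also have "\<dots> \<le> 3 * (e * h * sqrt (l j))"
  proof (intro mult_right_mono)
    have "sqrt 2 \<le> 3/2" by (rule real_le_lsqrt) (auto simp: power2_eq_square)
    then show "2 * sqrt 2 \<le> 3" by simp
  qed (use e0 h l_bounds(2)[OF j] in auto)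
  finally show "D j * \<bar>q j\<bar> \<le> 3 * e * h * sqrt (l j)" using D_nonneg[OF j] by (simp add: abs_mult mult_ac)
qed

text \<open>The product of the two bounds of \<open>q_bound\<close> gives 3 sqrt 2 \<le> 5, and the
  square of the first one gives 4; together 9. The unknown h cancels in both.\<close>

lemma qq_bounds:
  assumes "j \<in> {2..CARD('p)}" "k \<in> {2..CARD('p)}"
  shows "\<bar>q j\<bar> * \<bar>q k\<bar> * D k + \<bar>q j\<bar> * \<bar>q k\<bar> * (2 * e * h\<^sup>2) \<le> 9 * e * (sqrt (l j) * sqrt (l k))"
proof -
  have j: "j \<in> {1..CARD('p)}" and k: "k \<in> {1..CARD('p)}" using assms by auto
  have p: "l j > 0" "l k > 0" using l_bounds j k by auto
  have qj: "\<bar>q j\<bar> \<le> sqrt 2 * sqrt (l j) / h" "\<bar>q k\<bar> \<le> sqrt 2 * sqrt (l k) / h"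
    using q_bound(1)[OF j] q_bound(1)[OF k] h by (simp_all add: field_simps)
  have "\<bar>q j\<bar> * (D k * \<bar>q k\<bar>) \<le> (sqrt 2 * sqrt (l j) / h) * (3 * e * h * sqrt (l k))"
    by (rule mult_mono[OF qj(1) q_bound(2)[OF k]]) (use D_nonneg[OF k] p h in auto)
  also have "\<dots> = (3 * sqrt 2) * (e * (sqrt (l j) * sqrt (l k)))" using h by simp
  also have "\<dots> \<le> 5 * (e * (sqrt (l j) * sqrt (l k)))"
  proof (intro mult_right_mono)
    have "sqrt 2 \<le> 3/2" by (rule real_le_lsqrt) (auto simp: power2_eq_square)
    then show "3 * sqrt 2 \<le> 5" by simp
  qed (use e0 p in auto)
  finally have 1: "\<bar>q j\<bar> * (D k * \<bar>q k\<bar>) \<le> 5 * (e * (sqrt (l j) * sqrt (l k)))" .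
  have "(\<bar>q j\<bar> * \<bar>q k\<bar>) * (2 * e * h\<^sup>2) \<le> ((sqrt 2 * sqrt (l j) / h) * (sqrt 2 * sqrt (l k) / h)) * (2 * e * h\<^sup>2)"
    using qj p h e0 by (intro mult_right_mono mult_mono) auto
  also have "\<dots> = 4 * (e * (sqrt (l j) * sqrt (l k)))"
    using h by (simp add: power2_eq_square field_simps)
  finally show ?thesis using 1 by (simp add: mult_ac)
qed

lemma s2_ge_s0: "j \<le> CARD('p) \<Longrightarrow> s0\<^sup>2 \<le> s2 j"
proof -
  assume "j \<le> CARD('p)"
  have "s0\<^sup>2 \<le> \<bar>t 1 \<bullet> \<theta>0\<bar>\<^sup>2" using s0 by (intro power_mono) auto
  then show ?thesis using s2_ge[OF \<open>j \<le> CARD('p)\<close>] by (simp add: q_def)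
qed

lemma s0_le_1: "s0 \<le> 1"
proof -
  have "norm (t 1) = 1" using one_mem by (simp add: norm_eq_1 tt)
  then show ?thesis using s0 Cauchy_Schwarz_ineq2[of "t 1" \<theta>0] th0 by simp
qed

lemma f_t_bound:
  assumes "j \<in> {2..CARD('p)}" "m \<in> {2..CARD('p)}" "j < m"
  shows "\<bar>f j \<bullet> t m\<bar> \<le> \<bar>q j\<bar> * \<bar>q m\<bar> / s0\<^sup>2"
proof -
  have s2p: "s2 j > 0" "s2 (j - 1) > 0" using assms by (auto intro: s2_pos)
  have "s0 \<le> sqrt (s2 j)" "s0 \<le> sqrt (s2 (j - 1))"
    using assms s2_ge_s0[of j] s2_ge_s0[of "j - 1"] by (auto intro!: real_le_rsqrt)
  then have "s0 * s0 \<le> sqrt (s2 j) * sqrt (s2 (j - 1))" using s0 s2p by (intro mult_mono) (auto simp: less_imp_le)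
  then have "\<bar>q j\<bar> * \<bar>q m\<bar> / (sqrt (s2 j) * sqrt (s2 (j - 1))) \<le> \<bar>q j\<bar> * \<bar>q m\<bar> / (s0 * s0)"
    using s0 by (intro frac_le) auto
  moreover have "\<bar>f j \<bullet> t m\<bar> = \<bar>q j\<bar> * \<bar>q m\<bar> / (sqrt (s2 j) * sqrt (s2 (j - 1)))"
    using assms s2p by (simp add: f_t abs_mult abs_divide)
  ultimately show ?thesis by (simp add: power2_eq_square)
qed

text \<open>All terms share the prefactor formed by components j and k, and the remaining weights
  are part of the sum bounded in \<open>Dq_sum\<close>.\<close>

lemma tail_bound:
  assumes "j \<in> {2..CARD('p)}" "k \<in> {2..CARD('p)}" "j \<le> k"
  shows "\<bar>\<Sum>m\<in>{k<..CARD('p)}. D m * (f j \<bullet> t m) * (f k \<bullet> t m)\<bar> \<le> \<bar>q j\<bar> * \<bar>q k\<bar> * (2 * e * h\<^sup>2) / s0 ^ 4"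
proof -
  have "\<bar>\<Sum>m\<in>{k<..CARD('p)}. D m * (f j \<bullet> t m) * (f k \<bullet> t m)\<bar> \<le> (\<Sum>m\<in>{k<..CARD('p)}. (\<bar>q j\<bar> * \<bar>q k\<bar> / s0 ^ 4) * (D m * (q m)\<^sup>2))"
  proof (rule order_trans[OF sum_abs sum_mono])
    fix m assume m: "m \<in> {k<..CARD('p)}"
    have m2: "m \<in> {2..CARD('p)}" using m assms by auto
    have "\<bar>D m * (f j \<bullet> t m) * (f k \<bullet> t m)\<bar> = D m * (\<bar>f j \<bullet> t m\<bar> * \<bar>f k \<bullet> t m\<bar>)"
      using D_nonneg[of m] m2 by (simp add: abs_mult)
    also have "\<dots> \<le> D m * ((\<bar>q j\<bar> * \<bar>q m\<bar> / s0\<^sup>2) * (\<bar>q k\<bar> * \<bar>q m\<bar> / s0\<^sup>2))"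
      using D_nonneg[of m] m2 m assms by (intro mult_left_mono mult_mono f_t_bound) auto
    also have "\<dots> = (\<bar>q j\<bar> * \<bar>q k\<bar> / s0 ^ 4) * (D m * (q m)\<^sup>2)"
      by (simp add: power4_eq_xxxx power2_eq_square field_simps)
    finally show "\<bar>D m * (f j \<bullet> t m) * (f k \<bullet> t m)\<bar> \<le> (\<bar>q j\<bar> * \<bar>q k\<bar> / s0 ^ 4) * (D m * (q m)\<^sup>2)" .
  qed
  also have "\<dots> = (\<bar>q j\<bar> * \<bar>q k\<bar> / s0 ^ 4) * (\<Sum>m\<in>{k<..CARD('p)}. D m * (q m)\<^sup>2)"
    by (simp only: sum_distrib_left)
  also have "\<dots> \<le> (\<bar>q j\<bar> * \<bar>q k\<bar> / s0 ^ 4) * (2 * e * h\<^sup>2)"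
  proof (intro mult_left_mono order_trans[OF sum_mono2 Dq_sum])
    show "{k<..CARD('p)} \<subseteq> {2..CARD('p)}" using assms by auto
    show "0 \<le> D b * (q b)\<^sup>2" if "b \<in> {2..CARD('p)} - {k<..CARD('p)}" for b
      using D_nonneg[of b] that by simp
  qed (use s0 in auto)
  finally show ?thesis by simp
qed

text \<open>Write V as \<open>l 1\<close> times the identity minus the sum of gaps times
  projections. The first gap is zero and triangularity removes the indices from 2 up to k - 1, so
  the term at k and a tail remain. The bound is relative to \<open>sqrt (l j) * sqrt (l k)\<close>,
  which is what makes it useful for arbitrarily small eigenvalues.\<close>

lemma f_V_f:
  assumes "j \<in> {2..CARD('p)}" "k \<in> {2..CARD('p)}" "j \<le> k"
  shows "\<bar>f j \<bullet> (V *v f k) - (if j = k then l j else 0)\<bar> \<le> 9 * e / s0 ^ 4 * (sqrt (l j) * sqrt (l k))"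
proof -
  let ?\<delta> = "if j = k then 1 else 0 :: real"
  have s04: "s0 ^ 4 > 0" using s0 by simp
  have "f j \<bullet> (V *v f k) = (\<Sum>m=1..CARD('p). l m * ((f j \<bullet> t m) * (f k \<bullet> t m)))"
    unfolding V by (simp add: sum_matrix_vector_mult scaleR_matrix_vector outer_mult inner_sum_right inner_commute mult_ac)
  moreover have "?\<delta> = (\<Sum>m=1..CARD('p). (f j \<bullet> t m) * (f k \<bullet> t m))"
    using orthonormal_norm[OF _ _ on, of "f j" "f k"] f_f[OF assms(1,2)] by (simp add: inner_commute)
  ultimately have "l 1 * ?\<delta> - f j \<bullet> (V *v f k) = (\<Sum>m=1..CARD('p). l 1 * ((f j \<bullet> t m) * (f k \<bullet> t m)) - l m * ((f j \<bullet> t m) * (f k \<bullet> t m)))"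
    by (simp only: sum_subtractf sum_distrib_left)
  also have "\<dots> = (\<Sum>m=1..CARD('p). D m * (f j \<bullet> t m) * (f k \<bullet> t m))"
    by (intro sum.cong refl) (simp add: D_def algebra_simps)
  also have "\<dots> = (\<Sum>m\<in>{k..CARD('p)}. D m * (f j \<bullet> t m) * (f k \<bullet> t m))"
  proof (rule sum.mono_neutral_right)
    show "\<forall>m\<in>{1..CARD('p)} - {k..CARD('p)}. D m * (f j \<bullet> t m) * (f k \<bullet> t m) = 0"
    proof
      fix m assume m: "m \<in> {1..CARD('p)} - {k..CARD('p)}"
      show "D m * (f j \<bullet> t m) * (f k \<bullet> t m) = 0"
      proof (cases "m = 1")
        case False
        then have "f k \<bullet> t m = 0" using m assms by (subst f_t) auto
        then show ?thesis by simp
      qed (simp add: D_def)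
    qed
  qed (use assms in auto)
  also have "{k..CARD('p)} = insert k {k<..CARD('p)}" using assms by auto
  also have "(\<Sum>m\<in>insert k {k<..CARD('p)}. D m * (f j \<bullet> t m) * (f k \<bullet> t m)) = D k * (f j \<bullet> t k) * (f k \<bullet> t k) + (\<Sum>m\<in>{k<..CARD('p)}. D m * (f j \<bullet> t m) * (f k \<bullet> t m))"
    by simp
  finally have X: "f j \<bullet> (V *v f k) - (if j = k then l j else 0) = - (D k * ((f j \<bullet> t k) * (f k \<bullet> t k) - ?\<delta>)) - (\<Sum>m\<in>{k<..CARD('p)}. D m * (f j \<bullet> t m) * (f k \<bullet> t m))"
    by (simp add: D_def algebra_simps split: if_splits)
  have Dk: "D k \<ge> 0" using assms by (intro D_nonneg) auto
  have s: "s2 k = s2 (k - 1) - (q k)\<^sup>2" using assms s2_Suc[of "k - 1"] by auto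
  have p: "s2 k > 0" "s2 (k - 1) > 0" using assms by (auto intro: s2_pos)
  have pw: "s0 ^ 4 \<le> s0\<^sup>2" using s0 s0_le_1 by (intro power_decreasing) auto
  have head: "\<bar>(f j \<bullet> t k) * (f k \<bullet> t k) - ?\<delta>\<bar> \<le> \<bar>q j\<bar> * \<bar>q k\<bar> / s0\<^sup>2"
  proof (cases "j = k")
    case True
    have "(f j \<bullet> t k) * (f k \<bullet> t k) - ?\<delta> = s2 k / s2 (k - 1) - 1"
      using True assms p by (simp add: f_t)
    also have "\<dots> = - ((q k)\<^sup>2 / s2 (k - 1))" using p by (simp add: s field_simps)
    finally have "\<bar>(f j \<bullet> t k) * (f k \<bullet> t k) - ?\<delta>\<bar> = (q k)\<^sup>2 / s2 (k - 1)" using p by simp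
    also have "\<dots> \<le> (q k)\<^sup>2 / s0\<^sup>2" using assms s0 s2_ge_s0[of "k - 1"] p by (intro divide_left_mono mult_pos_pos) auto
    finally show ?thesis using True by (simp add: power2_eq_square abs_mult[symmetric])
  next
    case False
    have "\<bar>f k \<bullet> t k\<bar> \<le> 1"
    proof -
      have "f k \<bullet> t k = sqrt (s2 k / s2 (k - 1))" using assms by (simp add: f_t real_sqrt_divide)
      moreover have "0 \<le> s2 k / s2 (k - 1)" "s2 k / s2 (k - 1) \<le> 1" using s p by auto
      ultimately show ?thesis by simp
    qed
    moreover have "\<bar>f j \<bullet> t k\<bar> \<le> \<bar>q j\<bar> * \<bar>q k\<bar> / s0\<^sup>2" using assms False by (intro f_t_bound) auto
    ultimately have "\<bar>f j \<bullet> t k\<bar> * \<bar>f k \<bullet> t k\<bar> \<le> (\<bar>q j\<bar> * \<bar>q k\<bar> / s0\<^sup>2) * 1" by (intro mult_mono) auto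
    then show ?thesis using False by (simp add: abs_mult)
  qed
  have "\<bar>f j \<bullet> (V *v f k) - (if j = k then l j else 0)\<bar> \<le> D k * (\<bar>q j\<bar> * \<bar>q k\<bar> / s0\<^sup>2) + \<bar>q j\<bar> * \<bar>q k\<bar> * (2 * e * h\<^sup>2) / s0 ^ 4"
  proof -
    have "\<bar>D k * ((f j \<bullet> t k) * (f k \<bullet> t k) - ?\<delta>)\<bar> \<le> D k * (\<bar>q j\<bar> * \<bar>q k\<bar> / s0\<^sup>2)"
      unfolding abs_mult[of "D k"] using Dk head by (intro mult_mono) auto
    then show ?thesis unfolding X using tail_bound[OF assms] by linarith
  qed
  also have "D k * (\<bar>q j\<bar> * \<bar>q k\<bar> / s0\<^sup>2) \<le> D k * (\<bar>q j\<bar> * \<bar>q k\<bar> / s0 ^ 4)"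
    using Dk pw s0 by (intro mult_left_mono divide_left_mono) auto
  also have "D k * (\<bar>q j\<bar> * \<bar>q k\<bar> / s0 ^ 4) + \<bar>q j\<bar> * \<bar>q k\<bar> * (2 * e * h\<^sup>2) / s0 ^ 4 = (\<bar>q j\<bar> * \<bar>q k\<bar> * D k + \<bar>q j\<bar> * \<bar>q k\<bar> * (2 * e * h\<^sup>2)) / s0 ^ 4"
    by (simp add: add_divide_distrib mult_ac)
  also have "\<dots> \<le> 9 * e * (sqrt (l j) * sqrt (l k)) / s0 ^ 4"
    using qq_bounds[OF assms(1,2)] s04 by (intro divide_right_mono) auto
  finally show ?thesis by simp
qed

definition "Vt = l 1 *\<^sub>R outer \<theta>0 \<theta>0 + (\<Sum>j=2..CARD('p). l j *\<^sub>R outer (f j) (f j))"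

lemma Vt_g: "Vt = (\<Sum>j=1..CARD('p). l j *\<^sub>R outer (g j) (g j))"
  unfolding sum_split_first Vt_def g_def by simp

lemma Vt_symmetric: "symmetric_m Vt"
  unfolding Vt_g by (rule symmetric_outer)

lemma Vt_th0: "Vt *v \<theta>0 = l 1 *\<^sub>R \<theta>0"
  using spectral_eigen[OF _ g_orthonormal one_mem] by (simp add: Vt_g g_def)

lemma Vt_posdef: "posdef_m Vt"
  unfolding posdef_m_def
proof (intro allI impI)
  fix x :: "real^'p" assume "x \<noteq> 0"
  have nn: "x \<bullet> x = (\<Sum>j=1..CARD('p). (g j \<bullet> x) * (g j \<bullet> x))"
    by (rule orthonormal_norm) (use g_orthonormal in auto)
  have "\<exists>j\<in>{1..CARD('p)}. g j \<bullet> x \<noteq> 0"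
  proof (rule ccontr)
    assume "\<not> ?thesis"
    then have "x \<bullet> x = 0" unfolding nn by simp
    then show False using \<open>x \<noteq> 0\<close> by simp
  qed
  then obtain j where j: "j \<in> {1..CARD('p)}" "g j \<bullet> x \<noteq> 0" by blast
  have "0 < l j * (g j \<bullet> x)\<^sup>2" using j l_bounds(2) by simp
  also have "\<dots> \<le> (\<Sum>j=1..CARD('p). l j * (g j \<bullet> x)\<^sup>2)"
    by (rule member_le_sum) (use j l_bounds(2) in \<open>auto simp: less_imp_le\<close>)
  finally show "0 < x \<bullet> (Vt *v x)" unfolding Vt_g spectral_quadratic .
qed

text \<open>Since \<theta>0 is an eigenvector of both \<open>H\<close> and \<open>Vt\<close>, the
  two forms split into a \<theta>0 part and a complement part. The first compares \<open>l 1\<close>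
  with h^2; on the complement \<open>Vt\<close> is the diagonal of V in the new frame, so only the
  entries bounded in \<open>f_V_f\<close> and the error E intervene.\<close>

lemma Vt_close:
  defines "\<rho> \<equiv> 9 * real CARD('p) * e / s0 ^ 4"
  assumes \<rho>: "\<rho> \<le> 1/2"
  shows "\<bar>x \<bullet> (Vt *v x) - (norm (H *v x))\<^sup>2\<bar> \<le> 4 * \<rho> * (norm (H *v x))\<^sup>2"
proof -
  let ?I = "{2..CARD('p)}"
  define c where "c = 9 * e / s0 ^ 4"
  have c0: "c \<ge> 0" using e0 s0 by (simp add: c_def)
  define x1 where "x1 = \<theta>0 \<bullet> x"
  define x2 where "x2 = x - x1 *\<^sub>R \<theta>0"
  define A where "A = (\<Sum>j\<in>?I. l j * (f j \<bullet> x)\<^sup>2)"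
  have lp: "l j > 0" if "j \<in> ?I" for j using l_bounds(2)[of j] that by auto
  define y where "y j = \<bar>f j \<bullet> x\<bar> * sqrt (l j)" for j
  have A0: "A \<ge> 0" unfolding A_def using lp by (intro sum_nonneg) (auto simp: less_imp_le)
  have Vx: "x \<bullet> (Vt *v x) = l 1 * x1\<^sup>2 + A"
  proof -
    have "(\<Sum>j=2..CARD('p). l j * (g j \<bullet> x)\<^sup>2) = A" unfolding A_def by (intro sum.cong) (auto simp: g_def)
    then show ?thesis
      unfolding Vt_g spectral_quadratic sum_split_first[of "\<lambda>j. l j * (g j \<bullet> x)\<^sup>2"] by (simp add: g_def x1_def)
  qed
  have x2: "x2 = (\<Sum>j\<in>?I. (f j \<bullet> x) *\<^sub>R f j)"
  proof -
    have "x = (\<Sum>j=1..CARD('p). (g j \<bullet> x) *\<^sub>R g j)"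
      by (rule orthonormal_expansion) (use g_orthonormal in auto)
    also have "\<dots> = x1 *\<^sub>R \<theta>0 + (\<Sum>j\<in>?I. (g j \<bullet> x) *\<^sub>R g j)"
      unfolding sum_split_first by (simp add: g_def x1_def)
    also have "(\<Sum>j\<in>?I. (g j \<bullet> x) *\<^sub>R g j) = (\<Sum>j\<in>?I. (f j \<bullet> x) *\<^sub>R f j)" by (intro sum.cong) (auto simp: g_def)
    finally have xs: "x = x1 *\<^sub>R \<theta>0 + (\<Sum>j\<in>?I. (f j \<bullet> x) *\<^sub>R f j)" .
    from arg_cong[OF xs, of "\<lambda>y. y - x1 *\<^sub>R \<theta>0"] show ?thesis
      unfolding x2_def by (simp only: add_diff_cancel_left')
  qed
  have "x2 \<bullet> (V *v x2) = (\<Sum>j\<in>?I. \<Sum>k\<in>?I. (f j \<bullet> x) * (f k \<bullet> x) * (f j \<bullet> (V *v f k)))"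
    unfolding x2
    by ((simp add: linear_sum[OF matrix_vector_mul_linear] matrix_vector_scaleR inner_sum_left inner_sum_right sum_distrib_left mult_ac), subst sum.swap, simp add: mult_ac)
  moreover have "A = (\<Sum>j\<in>?I. \<Sum>k\<in>?I. (f j \<bullet> x) * (f k \<bullet> x) * (if j = k then l j else 0))"
    unfolding A_def
  proof (intro sum.cong refl)
    fix j assume j: "j \<in> ?I"
    have "(\<Sum>k\<in>?I. (f j \<bullet> x) * (f k \<bullet> x) * (if j = k then l j else 0)) = (\<Sum>k\<in>?I. if k = j then l j * (f j \<bullet> x)\<^sup>2 else 0)"
      by (intro sum.cong) (auto simp: power2_eq_square)
    then show "l j * (f j \<bullet> x)\<^sup>2 = (\<Sum>k\<in>?I. (f j \<bullet> x) * (f k \<bullet> x) * (if j = k then l j else 0))" using j by simp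
  qed
  ultimately have "x2 \<bullet> (V *v x2) - A = (\<Sum>j\<in>?I. \<Sum>k\<in>?I. (f j \<bullet> x) * (f k \<bullet> x) * (f j \<bullet> (V *v f k) - (if j = k then l j else 0)))"
    by (simp only: sum_subtractf right_diff_distrib)
  also have "\<bar>\<dots>\<bar> \<le> (\<Sum>j\<in>?I. \<Sum>k\<in>?I. c * (y j * y k))"
  proof (rule order_trans[OF sum_abs sum_mono], rule order_trans[OF sum_abs sum_mono])
    fix j k assume j: "j \<in> ?I" and k: "k \<in> ?I"
    have "\<bar>f j \<bullet> (V *v f k) - (if j = k then l j else 0)\<bar> \<le> c * (sqrt (l j) * sqrt (l k))"
    proof (cases "j \<le> k")
      case True
      then show ?thesis using f_V_f[OF j k True] by (simp add: c_def)
    next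
      case False
      have "f j \<bullet> (V *v f k) = f k \<bullet> (V *v f j)"
        using sym_dot[OF V_sym, of "f j" "f k"] by (simp add: inner_commute)
      then show ?thesis using f_V_f[OF k j] False by (simp add: c_def mult_ac)
    qed
    then have "\<bar>(f j \<bullet> x) * (f k \<bullet> x)\<bar> * \<bar>f j \<bullet> (V *v f k) - (if j = k then l j else 0)\<bar> \<le> \<bar>(f j \<bullet> x) * (f k \<bullet> x)\<bar> * (c * (sqrt (l j) * sqrt (l k)))"
      by (rule mult_left_mono) simp
    then show "\<bar>(f j \<bullet> x) * (f k \<bullet> x) * (f j \<bullet> (V *v f k) - (if j = k then l j else 0))\<bar> \<le> c * (y j * y k)"
      by (simp add: abs_mult mult_ac y_def)
  qed
  finally have d0: "\<bar>x2 \<bullet> (V *v x2) - A\<bar> \<le> (\<Sum>j\<in>?I. \<Sum>k\<in>?I. c * (y j * y k))" .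
  \<comment> \<open>The double sum is the square of a sum of at most p terms. Cauchy-Schwarz bounds
    it by p times the sum of squares, which explains the factor p in \<rho>.\<close>
  have "(\<Sum>j\<in>?I. \<Sum>k\<in>?I. c * (y j * y k)) = c * (\<Sum>j\<in>?I. y j)\<^sup>2"
    unfolding power2_eq_square sum_product by (simp only: sum_distrib_left)
  also have "\<dots> \<le> c * (real (card ?I) * (\<Sum>j\<in>?I. (y j)\<^sup>2))"
    using sum_squared_le_sum_of_squares[of y ?I] by (intro mult_left_mono c0) (simp only: mult.commute)
  also have "(\<Sum>j\<in>?I. (y j)\<^sup>2) = A"
    unfolding A_def y_def using lp by (intro sum.cong) (auto simp: power_mult_distrib less_imp_le mult.commute)
  also have "c * (real (card ?I) * A) \<le> c * (real CARD('p) * A)"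
    using A0 c0 by (intro mult_left_mono mult_right_mono) auto
  also have "\<dots> = \<rho> * A" by (simp add: c_def \<rho>_def)
  finally have d1: "\<bar>x2 \<bullet> (V *v x2) - A\<bar> \<le> \<rho> * A" using d0 by linarith
  have \<rho>e: "e \<le> \<rho>"
  proof -
    have "s0 ^ 4 \<le> 1" using s0 s0_le_1 by (simp add: power_le_one)
    moreover have "real CARD('p) \<ge> 1" by simp
    ultimately have "s0 ^ 4 \<le> 9 * real CARD('p)" by linarith
    then have "s0 ^ 4 * e \<le> 9 * real CARD('p) * e" using e0 by (intro mult_right_mono)
    then show ?thesis using s0 by (simp add: \<rho>_def field_simps)
  qed
  then have \<rho>0: "0 \<le> \<rho>" using e0 by linarith
  define N where "N = (norm (H *v x2))\<^sup>2"
  have N0: "N \<ge> 0" by (simp add: N_def)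
  define B where "B = x2 \<bullet> (V *v x2)"
  have d2: "\<bar>B - N\<bar> \<le> e * N" using V_quad[of x2] by (simp add: B_def N_def)
  have nH: "(norm (H *v x))\<^sup>2 = h\<^sup>2 * x1\<^sup>2 + N"
  proof -
    have "\<theta>0 \<bullet> x2 = 0" by (simp add: x2_def inner_diff_right x1_def th00)
    then have o: "\<theta>0 \<bullet> (H *v x2) = 0" using sym_dot[OF H(1), of \<theta>0 x2] by (simp add: Hth)
    have "H *v x = (x1 * h) *\<^sub>R \<theta>0 + H *v x2"
      by (simp add: x2_def matrix_vector_mult_diff_distrib matrix_vector_scaleR Hth)
    then show ?thesis
      unfolding N_def power2_norm_eq_inner
      by (simp add: inner_add_left inner_add_right o o[unfolded inner_commute[of \<theta>0]] th00 power2_eq_square mult_ac)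
  qed
  have "\<rho> * A \<le> 1/2 * A" using \<rho> A0 by (rule mult_right_mono)
  then have "A \<le> 2 * B" using d1 by (simp add: B_def abs_le_iff)
  moreover have "e * N \<le> 1/8 * N" using e N0 by (rule mult_right_mono)
  then have "B \<le> 9/8 * N" using d2 by (simp add: abs_le_iff)
  ultimately have "A \<le> 9/4 * N" by simp
  then have "\<rho> * A \<le> \<rho> * (9/4 * N)" using \<rho>0 by (rule mult_left_mono)
  moreover have "e * N \<le> \<rho> * N" using \<rho>e N0 by (rule mult_right_mono)
  \<comment> \<open>From A \<le> 2 B and B \<le> 9/8 N the passage from A to B costs 9/4 \<rho> N,
    and the passage from B to N costs e N \<le> \<rho> N; 13/4 is rounded up to 4.\<close>
  ultimately have AN: "\<bar>A - N\<bar> \<le> 4 * (\<rho> * N)"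
    using d1 d2 \<rho>0 N0 mult_nonneg_nonneg[OF \<rho>0 N0] by (simp add: B_def[symmetric] abs_le_iff)
  have "\<bar>l 1 - h\<^sup>2\<bar> * x1\<^sup>2 \<le> (e * h\<^sup>2) * x1\<^sup>2" using l1_approx by (intro mult_right_mono) auto
  also have "\<dots> \<le> \<rho> * (h\<^sup>2 * x1\<^sup>2)" using \<rho>e by (simp add: mult.assoc mult_right_mono)
  finally have "\<bar>l 1 - h\<^sup>2\<bar> * x1\<^sup>2 \<le> \<rho> * (h\<^sup>2 * x1\<^sup>2)" .
  moreover have "0 \<le> \<rho> * (h\<^sup>2 * x1\<^sup>2)" using \<rho>0 by simp
  ultimately have "\<bar>l 1 - h\<^sup>2\<bar> * x1\<^sup>2 \<le> 4 * (\<rho> * (h\<^sup>2 * x1\<^sup>2))" by linarith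
  then have "\<bar>l 1 * x1\<^sup>2 - h\<^sup>2 * x1\<^sup>2\<bar> \<le> 4 * (\<rho> * (h\<^sup>2 * x1\<^sup>2))"
    by (simp add: left_diff_distrib[symmetric] abs_mult)
  then show ?thesis using AN unfolding Vx nH by (simp add: abs_le_iff algebra_simps)
qed

end

section \<open>The test statistic\<close>

lemma matrix_inv_eigen:
  assumes "invertible V" "V *v x = v *\<^sub>R x" "v \<noteq> 0"
  shows "matrix_inv V *v x = (1 / v) *\<^sub>R (x :: real^'p)"
  using matrix_inv_mult(2)[OF assms(1), of "(1 / v) *\<^sub>R x"] assms(2,3) by (simp add: matrix_vector_scaleR)

text \<open>The vector R x - m x would be an eigenvector of R for the negative eigenvalue -m, so it
  is zero.\<close>

lemma sqrt_eigen:
  assumes R: "symmetric_m R" "posdef_m R" and x: "R *v (R *v x) = (m\<^sup>2) *\<^sub>R x" and m: "m > 0"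
  shows "R *v x = m *\<^sub>R (x :: real^'p)"
proof -
  define y where "y = R *v x - m *\<^sub>R x"
  have "R *v y = - (m *\<^sub>R y)"
    using x by (simp add: y_def matrix_vector_mult_diff_distrib matrix_vector_scaleR scaleR_diff_right power2_eq_square)
  then have "y \<bullet> (R *v y) = - m * (y \<bullet> y)" by simp
  moreover have "y \<noteq> 0 \<Longrightarrow> y \<bullet> (R *v y) > 0" using R(2) by (simp add: posdef_m_def)
  ultimately have "y = 0" using m by (smt (verit) inner_ge_zero mult_nonneg_nonneg mult_minus_left)
  then show ?thesis by (simp add: y_def)
qed

definition proj :: "real^'p \<Rightarrow> real^'p \<Rightarrow> real^'p" where
  "proj \<theta> x = x - (\<theta> \<bullet> x) *\<^sub>R \<theta>"

lemma proj_matrix: "(mat 1 - outer \<theta> \<theta>) *v x = proj \<theta> x"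
  by (simp add: proj_def matrix_vector_mult_diff_rdistrib outer_mult)

lemma proj_inner:
  assumes "norm \<theta> = 1"
  shows "\<theta> \<bullet> proj \<theta> x = 0" "u \<bullet> \<theta> = 0 \<Longrightarrow> u \<bullet> proj \<theta> x = u \<bullet> x"
proof -
  have "\<theta> \<bullet> \<theta> = 1" using assms by (simp add: norm_eq_1)
  then show "\<theta> \<bullet> proj \<theta> x = 0" by (simp add: proj_def inner_diff_right)
  show "u \<bullet> \<theta> = 0 \<Longrightarrow> u \<bullet> proj \<theta> x = u \<bullet> x" by (simp add: proj_def inner_diff_right)
qed

text \<open>The vector S_n(V) \<theta> in standardised coordinates, up to a scalar and the linear
  map V^(-1/2) H; the denominators are the squared lengths of the images of the observations under
  that map.\<close>

definition zvec :: "nat \<Rightarrow> (nat \<Rightarrow> real^'p) \<Rightarrow> real^'p \<Rightarrow> real^'p^'p \<Rightarrow> real^'p" where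
  "zvec n W \<theta> M = (1 / real n) *\<^sub>R (\<Sum>i<n. ((\<theta> \<bullet> W i) / (W i \<bullet> (M *v W i))) *\<^sub>R W i)"

lemma zvec_inner: "u \<bullet> zvec n W \<theta> M = emean n (\<lambda>i. (u \<bullet> W i) * (\<theta> \<bullet> W i) / (W i \<bullet> (M *v W i)))"
  by (simp add: zvec_def emean_def inner_sum_right mult_ac)

text \<open>As \<theta> is an eigenvector of H and of V, the map V^(-1/2) H commutes with the
  projection off \<theta>. The projection can then be applied in standardised coordinates, where
  only the Gram matrix M of the map is left.\<close>

lemma T_n_formula:
  fixes \<theta> :: "real^'p"
  assumes \<theta>: "norm \<theta> = 1" and U: "\<And>i. i < n \<Longrightarrow> U i = k i *\<^sub>R (H *v W i) \<and> k i \<noteq> 0"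
    and H: "symmetric_m H" "H *v \<theta> = h *\<^sub>R \<theta>"
    and V: "symmetric_m V" "posdef_m V" "V *v \<theta> = v *\<^sub>R \<theta>" "v > 0"
  defines "M \<equiv> H ** matrix_inv V ** H"
  shows "T_n n \<theta> U V = real n * real CARD('p) * (real CARD('p) + 2) * ((h\<^sup>2 / v) * (proj \<theta> (zvec n W \<theta> M) \<bullet> (M *v proj \<theta> (zvec n W \<theta> M))))"
proof -
  define R where "R = msqrt_inv V"
  note R = msqrt_inv_props[OF V(1,2), folded R_def]
  have RR: "R *v (R *v x) = matrix_inv V *v x" for x by (simp add: R(3)[symmetric] matrix_vector_mul_assoc)
  define c where "c = 1 / sqrt v"
  have c2: "c\<^sup>2 = 1 / v" using V(4) by (simp add: c_def power_divide)
  have R\<theta>: "R *v \<theta> = c *\<^sub>R \<theta>"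
  proof (rule sqrt_eigen[OF R(1,2)])
    show "R *v (R *v \<theta>) = (c\<^sup>2) *\<^sub>R \<theta>"
      unfolding RR c2 using matrix_inv_eigen[OF posdef_invertible[OF V(2)] V(3)] V(4) by simp
    show "c > 0" using V(4) by (simp add: c_def)
  qed
  define A where "A = R ** H"
  have Ax: "A *v x = R *v (H *v x)" for x by (simp add: A_def matrix_vector_mul_assoc)
  have Mx: "M *v x = H *v (matrix_inv V *v (H *v x))" for x by (simp add: M_def matrix_vector_mul_assoc[symmetric])
  have AA: "(A *v x) \<bullet> (A *v y) = x \<bullet> (M *v y)" for x y
    by (simp add: Ax Mx sym_dot[OF R(1)] RR sym_dot[OF H(1)])
  have A\<theta>: "\<theta> \<bullet> (A *v x) = c * h * (\<theta> \<bullet> x)" for x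
    unfolding Ax sym_dot[OF R(1), symmetric] R\<theta> by (simp add: matrix_vector_scaleR sym_dot[OF H(1), symmetric] H(2))
  have tA: "x \<bullet> (A *v w) = (transpose A *v x) \<bullet> w" for x w
    by (metis dot_transpose inner_commute)
  define z where "z = zvec n W \<theta> M"
  have S\<theta>: "S_n n U V *v \<theta> = (c * h) *\<^sub>R (A *v z)"
  proof (rule vector_eq_ldot[THEN iffD1], rule allI)
    fix x
    have "x \<bullet> (S_n n U V *v \<theta>) = emean n (\<lambda>i. (x \<bullet> (A *v W i)) * (\<theta> \<bullet> (A *v W i)) / (norm (A *v W i))\<^sup>2)"
      using S_n_Smat[OF R(1)[unfolded R_def] U] Smat_form[of x n W A \<theta>] by (simp add: A_def R_def)
    also have "\<dots> = emean n (\<lambda>i. (c * h) * (((transpose A *v x) \<bullet> W i) * (\<theta> \<bullet> W i) / (W i \<bullet> (M *v W i))))"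
      unfolding A\<theta> power2_norm_eq_inner AA by (intro emean_cong) (simp only: tA mult_ac times_divide_eq_right)
    also have "\<dots> = (c * h) * ((transpose A *v x) \<bullet> z)"
      unfolding emean_cmult z_def zvec_inner ..
    also have "\<dots> = x \<bullet> ((c * h) *\<^sub>R (A *v z))" by (simp only: tA inner_scaleR_right)
    finally show "x \<bullet> (S_n n U V *v \<theta>) = x \<bullet> ((c * h) *\<^sub>R (A *v z))" .
  qed
  have P: "proj \<theta> (A *v z) = A *v proj \<theta> z"
  proof -
    have "A *v \<theta> = (c * h) *\<^sub>R \<theta>" by (simp add: Ax H(2) matrix_vector_scaleR R\<theta>)
    then show ?thesis
      by (simp add: proj_def matrix_vector_mult_diff_distrib matrix_vector_scaleR A\<theta>)
  qed
  have "proj \<theta> (S_n n U V *v \<theta>) = (c * h) *\<^sub>R (A *v proj \<theta> z)"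
    unfolding S\<theta> P[symmetric] by (simp add: proj_def scaleR_diff_right)
  then have "(norm (proj \<theta> (S_n n U V *v \<theta>)))\<^sup>2 = (c * h)\<^sup>2 * (proj \<theta> z \<bullet> (M *v proj \<theta> z))"
    by (simp add: power_mult_distrib power2_norm_eq_inner[of "A *v _"] AA)
  also have "(c * h)\<^sup>2 = h\<^sup>2 / v" by (simp add: power_mult_distrib c2)
  finally show ?thesis unfolding T_n_def proj_matrix z_def by simp
qed

lemma zvec_id:
  assumes "near_iso n W G" "\<And>x. M *v x = x"
  shows "u \<bullet> zvec n W \<theta> M = emean n (\<lambda>i. (u \<bullet> W i) * (\<theta> \<bullet> W i))"
proof -
  have "W i \<bullet> W i = 1" if "i < n" for i using near_isoD(2)[OF assms(1) that] by (simp add: norm_eq_1)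
  then show ?thesis unfolding zvec_inner assms(2) by (intro emean_cong) simp
qed

text \<open>Both vectors are orthogonal to \<theta>; pairing each with itself turns its norm into an
  empirical moment in which the isotropic part is zero.\<close>

lemma zvec_perturb:
  fixes W :: "nat \<Rightarrow> real^'p"
  assumes W: "near_iso n W G" and \<theta>: "norm \<theta> = 1" and I: "\<And>x. I *v x = x"
    and N: "symmetric_m N" "opb N \<eta>" "\<eta> \<le> 1/4" "N *v \<theta> = \<mu> *\<^sub>R \<theta>" and M: "\<And>x. M *v x = x + N *v x"
  shows "norm (proj \<theta> (zvec n W \<theta> I)) \<le> real CARD('p) * G"
    "norm (proj \<theta> (zvec n W \<theta> M) - proj \<theta> (zvec n W \<theta> I)) \<le> real CARD('p) * G * \<eta> + 2 * \<eta>\<^sup>2"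
proof -
  let ?p = "real CARD('p)"
  note n = near_isoD(1)[OF W] and Wn = near_isoD(2)[OF W]
  note e0 = opb_nonneg[OF N(2)]
  have red: "norm u \<le> b" if "u \<bullet> u \<le> b * norm u" "0 \<le> b" for u :: "real^'p" and b
  proof (cases "u = 0")
    case False
    have "norm u * norm u \<le> b * norm u" using that(1) by (simp add: power2_norm_eq_inner[symmetric] power2_eq_square)
    then show ?thesis using False by simp
  qed (use that in simp)
  have pG: "0 \<le> ?p * G" using near_iso_nonneg[OF W] by simp
  show "norm (proj \<theta> (zvec n W \<theta> I)) \<le> ?p * G"
  proof (rule red[OF _ pG])
    define u where "u = proj \<theta> (zvec n W \<theta> I)"
    have u: "u \<bullet> \<theta> = 0" using proj_inner(1)[OF \<theta>] by (simp add: u_def inner_commute)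
    have "u \<bullet> u = u \<bullet> zvec n W \<theta> I" using proj_inner(2)[OF \<theta> u] by (simp add: u_def)
    also have "\<dots> = emean n (\<lambda>i. (u \<bullet> W i) * (\<theta> \<bullet> W i))" by (rule zvec_id[OF W I])
    also have "\<dots> \<le> ?p * G * norm u" using near_iso_second_moment[OF W, of u \<theta>] u \<theta> by (simp add: abs_le_iff)
    finally show "u \<bullet> u \<le> ?p * G * norm u" .
  qed
  show "norm (proj \<theta> (zvec n W \<theta> M) - proj \<theta> (zvec n W \<theta> I)) \<le> ?p * G * \<eta> + 2 * \<eta>\<^sup>2"
  proof (rule red)
    define u where "u = proj \<theta> (zvec n W \<theta> M) - proj \<theta> (zvec n W \<theta> I)"
    have u: "u \<bullet> \<theta> = 0" using proj_inner(1)[OF \<theta>] by (simp add: u_def inner_commute inner_diff_right)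
    define \<nu> where "\<nu> i = W i \<bullet> (N *v W i)" for i
    have \<nu>: "\<bar>\<nu> i\<bar> \<le> \<eta>" if "i < n" for i using opb_inner[OF N(2), of "W i" "W i"] Wn[OF that] by (simp add: \<nu>_def)
    have "u \<bullet> u = u \<bullet> zvec n W \<theta> M - u \<bullet> zvec n W \<theta> I"
    proof -
      have "u \<bullet> u = u \<bullet> proj \<theta> (zvec n W \<theta> M) - u \<bullet> proj \<theta> (zvec n W \<theta> I)"
        by (subst (2) u_def) (simp add: inner_diff_right)
      then show ?thesis unfolding proj_inner(2)[OF \<theta> u] .
    qed
    also have "\<dots> = emean n (\<lambda>i. (u \<bullet> W i) * (\<theta> \<bullet> W i) * (\<nu> i)\<^sup>2 / (1 + \<nu> i) - (u \<bullet> W i) * (\<theta> \<bullet> W i) * \<nu> i)"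
      unfolding zvec_id[OF W I] unfolding zvec_inner emean_diff[symmetric]
    proof (rule emean_cong)
      fix i assume i: "i < n"
      have WM: "W i \<bullet> (M *v W i) = 1 + \<nu> i" using Wn[OF i] by (simp add: M inner_add_right \<nu>_def norm_eq_1)
      have nz: "1 + \<nu> i \<noteq> 0" using \<nu>[OF i] N(3) by linarith
      define a where "a = (u \<bullet> W i) * (\<theta> \<bullet> W i)"
      \<comment> \<open>The exact second-order expansion of the reciprocal. The linear term is
        handled by fourth moments, the quadratic one by absolute values with 1 + \<nu> \<ge>
        1/2.\<close>
      have "a / (1 + \<nu> i) - a = a * (\<nu> i)\<^sup>2 / (1 + \<nu> i) - a * \<nu> i"
        using nz by (simp add: field_simps power2_eq_square)
      then show "(u \<bullet> W i) * (\<theta> \<bullet> W i) / (W i \<bullet> (M *v W i)) - (u \<bullet> W i) * (\<theta> \<bullet> W i) = (u \<bullet> W i) * (\<theta> \<bullet> W i) * (\<nu> i)\<^sup>2 / (1 + \<nu> i) - (u \<bullet> W i) * (\<theta> \<bullet> W i) * \<nu> i"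
        unfolding WM a_def .
    qed
    also have "\<dots> = emean n (\<lambda>i. (u \<bullet> W i) * (\<theta> \<bullet> W i) * (\<nu> i)\<^sup>2 / (1 + \<nu> i)) - emean n (\<lambda>i. (u \<bullet> W i) * (\<theta> \<bullet> W i) * \<nu> i)"
      by (rule emean_diff)
    also have "\<dots> \<le> 2 * \<eta>\<^sup>2 * norm u + ?p * G * \<eta> * norm u"
    proof -
      have "\<bar>emean n (\<lambda>i. (u \<bullet> W i) * (\<theta> \<bullet> W i) * (\<nu> i)\<^sup>2 / (1 + \<nu> i))\<bar> \<le> 2 * \<eta>\<^sup>2 * norm u"
      proof (rule emean_abs_le[OF n])
        fix i assume i: "i < n"
        have "\<bar>u \<bullet> W i\<bar> \<le> norm u" "\<bar>\<theta> \<bullet> W i\<bar> \<le> 1"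
          using Cauchy_Schwarz_ineq2[of u "W i"] Cauchy_Schwarz_ineq2[of \<theta> "W i"] Wn[OF i] \<theta> by simp_all
        moreover have "(\<nu> i)\<^sup>2 \<le> \<eta>\<^sup>2" using \<nu>[OF i] e0 by (simp add: abs_le_square_iff[symmetric])
        moreover have d: "1 + \<nu> i \<ge> 1/2" using \<nu>[OF i] N(3) by linarith
        ultimately have "\<bar>u \<bullet> W i\<bar> * \<bar>\<theta> \<bullet> W i\<bar> * (\<nu> i)\<^sup>2 / (1 + \<nu> i) \<le> norm u * 1 * \<eta>\<^sup>2 / (1/2)"
          by (intro frac_le mult_mono) auto
        then show "\<bar>(u \<bullet> W i) * (\<theta> \<bullet> W i) * (\<nu> i)\<^sup>2 / (1 + \<nu> i)\<bar> \<le> 2 * \<eta>\<^sup>2 * norm u"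
          using d by (simp add: abs_mult abs_divide mult_ac)
      qed
      moreover have "\<bar>emean n (\<lambda>i. (u \<bullet> W i) * (\<theta> \<bullet> W i) * \<nu> i)\<bar> \<le> ?p * G * \<eta> * norm u"
        using near_iso_quadratic[OF W N(1,2), of u \<theta>] u \<theta> by (simp add: N(4) \<nu>_def)
      ultimately show ?thesis by (simp add: abs_le_iff)
    qed
    finally show "u \<bullet> u \<le> (?p * G * \<eta> + 2 * \<eta>\<^sup>2) * norm u" by (simp add: algebra_simps)
  qed (use pG e0 in auto)
qed

text \<open>The hypothesis says that I + D with D = H^(-1) V H^(-1) - I is near the identity as a
  form, hence in operator norm. M is its inverse, so w = M x satisfies D w = x - w; the bound |w|
  \<le> 2 |x| doubles \<delta>.\<close>

lemma form_close_imp_opb: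
  fixes H V :: "real^'p^'p"
  assumes H: "symmetric_m H" "posdef_m H" and V: "symmetric_m V" "posdef_m V"
    and close: "\<And>x. \<bar>x \<bullet> (V *v x) - (norm (H *v x))\<^sup>2\<bar> \<le> \<delta> * (norm (H *v x))\<^sup>2" and \<delta>: "\<delta> \<le> 1/2"
  shows "symmetric_m (H ** matrix_inv V ** H - mat 1)" "opb (H ** matrix_inv V ** H - mat 1) (2 * \<delta>)"
proof -
  define M where "M = H ** matrix_inv V ** H"
  have Mx: "M *v x = H *v (matrix_inv V *v (H *v x))" for x by (simp add: M_def matrix_vector_mul_assoc[symmetric])
  have Vi: "symmetric_m (matrix_inv V)" using V sym_matrix_inv posdef_invertible by auto
  have Nx: "(M - mat 1) *v x = M *v x - x" for x by (simp add: matrix_vector_mult_diff_rdistrib)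
  show "symmetric_m (H ** matrix_inv V ** H - mat 1)" unfolding M_def[symmetric]
    by (rule sym_from_dot) (simp add: Nx Mx inner_diff_left inner_diff_right sym_dot[OF H(1)] sym_dot[OF Vi])
  obtain Hi where Hi: "\<And>x. H *v (Hi *v x) = x" "\<And>x. Hi *v (H *v x) = x"
    using invertible_inverse_mult[OF posdef_invertible[OF H(2)]] by metis
  have Hs: "(Hi *v x) \<bullet> y = x \<bullet> (Hi *v y)" for x y
    by (metis Hi(1) sym_dot[OF H(1)])
  define D where "D = Hi ** V ** Hi - mat 1"
  have Dx: "D *v x = Hi *v (V *v (Hi *v x)) - x" for x
    by (simp add: D_def matrix_vector_mult_diff_rdistrib matrix_vector_mul_assoc[symmetric])
  have "symmetric_m D"
    by (rule sym_from_dot) (simp add: Dx inner_diff_left inner_diff_right Hs sym_dot[OF V(1)])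
  moreover have "\<bar>x \<bullet> (D *v x)\<bar> \<le> \<delta> * (norm x)\<^sup>2" for x
    using close[of "Hi *v x"] by (simp add: Dx inner_diff_right Hs[symmetric] Hi power2_norm_eq_inner)
  ultimately have Db: "norm (D *v x) \<le> \<delta> * norm x" for x by (rule sym_op_bound)
  have d0: "\<delta> \<ge> 0" using opb_nonneg[of D \<delta>] Db by (simp add: opb_def)
  show "opb (H ** matrix_inv V ** H - mat 1) (2 * \<delta>)" unfolding M_def[symmetric] opb_def
  proof
    fix x
    define w where "w = M *v x"
    have "D *v w = x - w"
      unfolding Dx w_def Mx by (simp add: Hi matrix_inv_mult(1)[OF posdef_invertible[OF V(2)]])
    then have xw: "norm (x - w) \<le> \<delta> * norm w" using Db[of w] by simp
    have "norm w \<le> norm x + norm (x - w)" by (metis add.commute diff_add_cancel norm_minus_commute norm_triangle_ineq)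
    moreover have "\<delta> * norm w \<le> 1/2 * norm w" using \<delta> by (rule mult_right_mono) simp
    ultimately have "norm w \<le> 2 * norm x" using xw by simp
    then have "\<delta> * norm w \<le> \<delta> * (2 * norm x)" using d0 by (rule mult_left_mono)
    then show "norm ((M - mat 1) *v x) \<le> 2 * \<delta> * norm x"
      using xw unfolding Nx w_def[symmetric] by (simp add: norm_minus_commute)
  qed
qed

text \<open>The first-order term of the difference vanishes because the isotropic fourth-moment tensor pairs
  trivially with \<open>\<theta>\<close>, its complement and any matrix having \<open>\<theta>\<close> as an eigenvector.\<close>
lemma T_n_difference:
  fixes \<theta> :: "real^'p"
  assumes W: "near_iso n W G" and \<theta>: "norm \<theta> = 1"
    and U: "\<And>i. i < n \<Longrightarrow> U i = k i *\<^sub>R (H *v W i) \<and> k i \<noteq> 0"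
    and H: "symmetric_m H" "posdef_m H" "H *v \<theta> = h *\<^sub>R \<theta>" "h > 0"
    and V0: "V0 = H ** H"
    and c: "c > 0"
    and V: "symmetric_m V" "posdef_m V" "V *v \<theta> = v *\<^sub>R \<theta>" "v > 0"
    and close: "\<And>x. \<bar>x \<bullet> (V *v x) - c * (norm (H *v x))\<^sup>2\<bar> \<le> \<delta> * (c * (norm (H *v x))\<^sup>2)"
    and \<delta>: "2 * \<delta> \<le> 1/4"
  defines "p \<equiv> real CARD('p)" and "\<eta> \<equiv> 2 * \<delta>"
  defines "d \<equiv> p * G * \<eta> + 2 * \<eta>\<^sup>2"
  shows "\<bar>T_n n \<theta> U V - T_n n \<theta> U V0\<bar> \<le> real n * p * (p + 2) * (3 * \<eta> * (p * G + d)\<^sup>2 + d * (2 * (p * G) + d))"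
proof -
  have HH: "(H ** H) *v x = H *v (H *v x)" for x by (simp add: matrix_vector_mul_assoc)
  have V0s: "symmetric_m V0" by (rule sym_from_dot) (simp add: V0 HH sym_dot[OF H(1)])
  have H0: "H *v x \<noteq> 0" if "x \<noteq> 0" for x using H(2) that unfolding posdef_m_def by (metis inner_zero_right less_irrefl)
  have V0p: "posdef_m V0"
  proof -
    have "x \<bullet> (V0 *v x) = (H *v x) \<bullet> (H *v x)" for x by (simp add: V0 HH sym_dot[OF H(1)])
    then show ?thesis using H0 by (simp add: posdef_m_def)
  qed
  have V0\<theta>: "V0 *v \<theta> = (h\<^sup>2) *\<^sub>R \<theta>" by (simp add: V0 HH H(3) matrix_vector_scaleR power2_eq_square)
  define I where "I = H ** matrix_inv V0 ** H"
  have I: "I *v x = x" for x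
  proof -
    obtain Hi where Hi: "\<And>x. H *v (Hi *v x) = x"
      using invertible_inverse_mult[OF posdef_invertible[OF H(2)]] by metis
    have "matrix_inv V0 *v (H *v x) = Hi *v x"
      using matrix_inv_mult(2)[OF posdef_invertible[OF V0p], of "Hi *v x"] by (simp add: V0 HH Hi)
    then show ?thesis by (simp add: I_def matrix_vector_mul_assoc[symmetric] Hi)
  qed
  define z0 where "z0 = proj \<theta> (zvec n W \<theta> I)"
  have T0: "T_n n \<theta> U V0 = real n * p * (p + 2) * (norm z0)\<^sup>2"
    using T_n_formula[where n = n and U = U and W = W and k = k, OF \<theta> U H(1,3) V0s V0p V0\<theta>] H(4)
    unfolding I_def[symmetric] z0_def[symmetric] I p_def by (simp add: power2_norm_eq_inner)
  \<comment> \<open>The scale c is absorbed into the root, with the factors \<open>k i\<close>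
    divided by sqrt c to compensate. The statistic does not change, and V can be compared with C C
    without a scale factor.\<close>
  define C where "C = sqrt c *\<^sub>R H"
  have Cx: "C *v x = sqrt c *\<^sub>R (H *v x)" for x by (simp add: C_def scaleR_matrix_vector)
  have C: "symmetric_m C" "posdef_m C" "C *v \<theta> = (sqrt c * h) *\<^sub>R \<theta>"
  proof -
    show "symmetric_m C" by (rule sym_from_dot) (simp add: Cx sym_dot[OF H(1)])
    show "posdef_m C" using H(2) c by (simp add: posdef_m_def Cx)
    show "C *v \<theta> = (sqrt c * h) *\<^sub>R \<theta>" by (simp add: Cx H(3))
  qed
  have UC: "U i = (k i / sqrt c) *\<^sub>R (C *v W i) \<and> k i / sqrt c \<noteq> 0" if "i < n" for i
    using U[OF that] c by (simp add: Cx)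
  have nC: "(norm (C *v x))\<^sup>2 = c * (norm (H *v x))\<^sup>2" for x
    using c by (simp add: Cx power_mult_distrib)
  define M where "M = C ** matrix_inv V ** C"
  define N where "N = M - mat 1"
  have N: "symmetric_m N" "opb N \<eta>"
  proof -
    have "\<bar>x \<bullet> (V *v x) - (norm (C *v x))\<^sup>2\<bar> \<le> \<delta> * (norm (C *v x))\<^sup>2" for x
      using close[of x] by (simp only: nC)
    moreover have "\<delta> \<le> 1/2" using \<delta> by linarith
    ultimately show "symmetric_m N" "opb N \<eta>"
      unfolding N_def M_def \<eta>_def by (rule form_close_imp_opb[OF C(1,2) V(1,2)])+
  qed
  have Mx: "M *v x = x + N *v x" for x by (simp add: N_def matrix_vector_mult_diff_rdistrib)
  define m where "m = (sqrt c * h)\<^sup>2 / v"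
  have M\<theta>: "M *v \<theta> = m *\<^sub>R \<theta>"
    using matrix_inv_eigen[OF posdef_invertible[OF V(2)] V(3)] V(4)
    by (simp add: M_def matrix_vector_mul_assoc[symmetric] C(3) matrix_vector_scaleR m_def power2_eq_square)
  have N\<theta>: "N *v \<theta> = (m - 1) *\<^sub>R \<theta>"
    by (simp add: N_def matrix_vector_mult_diff_rdistrib M\<theta> scaleR_diff_left)
  have m1: "\<bar>m - 1\<bar> \<le> \<eta>" using N(2)[unfolded opb_def, rule_format, of \<theta>] \<theta> by (simp add: N\<theta>)
  have \<eta>: "0 \<le> \<eta>" "\<eta> \<le> 1/4" using opb_nonneg[OF N(2)] \<delta> by (auto simp: \<eta>_def)
  define z where "z = proj \<theta> (zvec n W \<theta> M)"
  have T1: "T_n n \<theta> U V = real n * p * (p + 2) * (m * (z \<bullet> (M *v z)))"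
    using T_n_formula[where n = n and U = U and W = W and k = "\<lambda>i. k i / sqrt c", OF \<theta> UC C(1,3) V] unfolding M_def[symmetric] z_def[symmetric] m_def p_def .
  have b: "norm z0 \<le> p * G" "norm (z - z0) \<le> d"
    using zvec_perturb[OF W \<theta> I N \<eta>(2) N\<theta> Mx] by (simp_all add: z_def z0_def d_def p_def)
  have z: "norm z \<le> p * G + d" using b norm_triangle_sub[of z z0] by linarith
  have z2: "(norm z)\<^sup>2 \<le> (p * G + d)\<^sup>2" using z by (intro power_mono) auto
  have pG: "0 \<le> p * G" using near_iso_nonneg[OF W] by (simp add: p_def)
  have d0: "0 \<le> d" using pG \<eta> by (simp add: d_def)
  have zN: "\<bar>z \<bullet> (N *v z)\<bar> \<le> \<eta> * (norm z)\<^sup>2" using opb_inner[OF N(2), of z z] by (simp add: power2_eq_square mult_ac)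
  have dd: "\<bar>(norm z)\<^sup>2 - (norm z0)\<^sup>2\<bar> \<le> d * (2 * (p * G) + d)"
  proof -
    have e: "(norm z)\<^sup>2 - (norm z0)\<^sup>2 = (norm z - norm z0) * (norm z + norm z0)" by (simp add: power2_eq_square algebra_simps)
    have "\<bar>norm z - norm z0\<bar> \<le> d" using b(2) norm_triangle_ineq3[of z z0] by linarith
    moreover have "\<bar>norm z + norm z0\<bar> \<le> 2 * (p * G) + d" using z b(1) by simp
    ultimately show ?thesis unfolding e abs_mult using d0 by (intro mult_mono) auto
  qed
  have "m * (z \<bullet> (M *v z)) - (norm z0)\<^sup>2 = (m - 1) * ((norm z)\<^sup>2 + z \<bullet> (N *v z)) + z \<bullet> (N *v z) + ((norm z)\<^sup>2 - (norm z0)\<^sup>2)"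
    by (simp add: Mx inner_add_right power2_norm_eq_inner algebra_simps)
  moreover have "\<bar>(m - 1) * ((norm z)\<^sup>2 + z \<bullet> (N *v z))\<bar> \<le> \<eta> * (2 * (norm z)\<^sup>2)"
    unfolding abs_mult
  proof (intro mult_mono m1)
    have "\<eta> * (norm z)\<^sup>2 \<le> 1 * (norm z)\<^sup>2" using \<eta> by (intro mult_right_mono) auto
    then show "\<bar>(norm z)\<^sup>2 + z \<bullet> (N *v z)\<bar> \<le> 2 * (norm z)\<^sup>2" using zN by (simp add: abs_le_iff)
  qed (use \<eta> in auto)
  ultimately have "\<bar>m * (z \<bullet> (M *v z)) - (norm z0)\<^sup>2\<bar> \<le> 3 * \<eta> * (norm z)\<^sup>2 + d * (2 * (p * G) + d)"
    using zN dd by linarith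
  also have "3 * \<eta> * (norm z)\<^sup>2 \<le> 3 * \<eta> * (p * G + d)\<^sup>2"
    using \<eta> by (intro mult_left_mono z2) auto
  finally have key: "\<bar>m * (z \<bullet> (M *v z)) - (norm z0)\<^sup>2\<bar> \<le> 3 * \<eta> * (p * G + d)\<^sup>2 + d * (2 * (p * G) + d)" by simp
  have np: "0 \<le> real n * p * (p + 2)" by (simp add: p_def)
  have "T_n n \<theta> U V - T_n n \<theta> U V0 = real n * p * (p + 2) * (m * (z \<bullet> (M *v z)) - (norm z0)\<^sup>2)"
    unfolding T0 T1 by (simp only: right_diff_distrib)
  then show ?thesis using mult_left_mono[OF key np] np by (simp only: abs_mult[of "real n * p * (p + 2)"] abs_of_nonneg)
qed

section \<open>Misaligned leading eigenvectors\<close>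

text \<open>The identity x = J x + 2 B J x + B B J x for the inverse square J gives everything. Two
  uses of the lower bound 3/4 yield |J x| \<le> 16/9 |x| \<le> 2 |x|; then E has norm at most 4 r +
  2 r^2 \<le> 5 r, and substituting once more leaves a second-order error 10 r^2 + 2 r^2.\<close>

lemma inverse_square_perturbation:
  fixes B :: "real^'p^'p"
  assumes B: "symmetric_m B" "opb B r" "r \<le> 1/4"
  defines "R \<equiv> mat 1 + B"
  defines "E \<equiv> matrix_inv (R ** R) - mat 1"
  shows "symmetric_m R" "posdef_m R" "symmetric_m E" "opb E (5 * r)"
    "\<bar>x \<bullet> (E *v y) + 2 * (x \<bullet> (B *v y))\<bar> \<le> 12 * r\<^sup>2 * (norm x * norm y)"
proof -
  have Rx: "R *v x = x + B *v x" for x by (simp add: R_def matrix_vector_mult_add_rdistrib)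
  have r0: "0 \<le> r" using opb_nonneg[OF B(2)] .
  have Bx: "norm (B *v x) \<le> r * norm x" for x using B(2) by (simp add: opb_def)
  show R: "symmetric_m R" by (rule sym_from_dot) (simp add: Rx inner_add_left inner_add_right sym_dot[OF B(1)])
  have lower: "3/4 * norm x \<le> norm (R *v x)" for x
  proof -
    have "3/4 * norm x \<le> (1 - r) * norm x" using B(3) by (intro mult_right_mono) auto
    then show ?thesis using opb_perturb_norm[OF B(2), of x] by (simp add: R_def)
  qed
  have inv: "invertible (R ** R)"
  proof -
    have "\<forall>x. R *v x = 0 \<longrightarrow> x = 0" using lower by (metis mult_le_0_iff norm_le_zero_iff norm_zero not_numeral_le_zero zero_less_divide_iff zero_less_numeral linorder_not_le)
    then have "invertible R" by (metis invertible_left_inverse matrix_left_invertible_ker)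
    then show ?thesis by (intro invertible_mult)
  qed
  show "posdef_m R"
    unfolding posdef_m_def
  proof (intro allI impI)
    fix x :: "real^'p" assume "x \<noteq> 0"
    have "\<bar>x \<bullet> (B *v x)\<bar> \<le> r * norm x * norm x" by (rule opb_inner[OF B(2)])
    moreover have "r * norm x * norm x \<le> 1/4 * norm x * norm x" using B(3) by (intro mult_right_mono) auto
    moreover have "x \<bullet> x = norm x * norm x" by (simp add: power2_norm_eq_inner[symmetric] power2_eq_square)
    moreover have "norm x * norm x > 0" using \<open>x \<noteq> 0\<close> by simp
    ultimately show "0 < x \<bullet> (R *v x)" unfolding Rx inner_add_right by linarith
  qed
  define J where "J = matrix_inv (R ** R)"
  have RRJ: "R *v (R *v (J *v x)) = x" for x
    using matrix_inv_mult(1)[OF inv, of x] by (simp add: J_def matrix_vector_mul_assoc[symmetric])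
  have Ex: "E *v x = J *v x - x" for x by (simp add: E_def J_def matrix_vector_mult_diff_rdistrib)
  have "symmetric_m (R ** R)"
    by (rule sym_from_dot) (simp add: matrix_vector_mul_assoc[symmetric] sym_dot[OF R])
  then have Js: "symmetric_m J" unfolding J_def using inv by (rule sym_matrix_inv)
  show "symmetric_m E"
    by (rule sym_from_dot) (simp add: Ex inner_diff_left inner_diff_right sym_dot[OF Js])
  have Jb: "norm (J *v x) \<le> 2 * norm x" for x
    using lower[of "J *v x"] lower[of "R *v (J *v x)"] norm_ge_zero[of x] unfolding RRJ by linarith
  have E1: "E *v x = - (2 *\<^sub>R (B *v (J *v x)) + B *v (B *v (J *v x)))" for x
  proof -
    have "x = J *v x + 2 *\<^sub>R (B *v (J *v x)) + B *v (B *v (J *v x))"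
      using RRJ[of x] unfolding Rx by (simp add: matrix_vector_right_distrib scaleR_2 algebra_simps)
    then show ?thesis unfolding Ex by (metis (no_types, lifting) add.assoc add_diff_cancel_left' minus_diff_eq)
  qed
  have BBb: "norm (B *v (B *v (J *v x))) \<le> 2 * r\<^sup>2 * norm x" for x
  proof -
    have "norm (B *v (B *v (J *v x))) \<le> r * (r * norm (J *v x))"
      using Bx[of "B *v (J *v x)"] mult_left_mono[OF Bx[of "J *v x"] r0] by linarith
    also have "\<dots> \<le> r * (r * (2 * norm x))" using Jb r0 by (intro mult_left_mono) auto
    finally show ?thesis by (simp add: power2_eq_square mult_ac)
  qed
  have Eb: "norm (E *v x) \<le> 5 * r * norm x" for x
  proof -
    have "norm (E *v x) \<le> 2 * norm (B *v (J *v x)) + norm (B *v (B *v (J *v x)))"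
      unfolding E1 norm_minus_cancel by (rule order_trans[OF norm_triangle_ineq]) simp
    also have "norm (B *v (J *v x)) \<le> r * (2 * norm x)"
      using Bx[of "J *v x"] mult_left_mono[OF Jb[of x] r0] by linarith
    also have "norm (B *v (B *v (J *v x))) \<le> 2 * r\<^sup>2 * norm x" by (rule BBb)
    also have "2 * r\<^sup>2 * norm x \<le> r * norm x"
    proof (rule mult_right_mono)
      have "r * r \<le> r * (1/4)" using B(3) r0 by (rule mult_left_mono)
      then show "2 * r\<^sup>2 \<le> r" using r0 by (simp add: power2_eq_square)
    qed simp
    finally show ?thesis by (simp add: algebra_simps)
  qed
  then show "opb E (5 * r)" by (simp add: opb_def)
  have "E *v y + 2 *\<^sub>R (B *v y) = - (2 *\<^sub>R (B *v (J *v y)) + B *v (B *v (J *v y))) + 2 *\<^sub>R (B *v y)"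
    by (simp only: E1[of y])
  also have "\<dots> = - (2 *\<^sub>R (B *v (E *v y)) + B *v (B *v (J *v y)))"
    by (simp add: Ex matrix_vector_mult_diff_distrib scaleR_diff_right)
  also have "norm \<dots> \<le> 2 * norm (B *v (E *v y)) + norm (B *v (B *v (J *v y)))"
    unfolding norm_minus_cancel by (rule order_trans[OF norm_triangle_ineq]) simp
  also have "norm (B *v (E *v y)) \<le> r * (5 * r * norm y)"
    using Bx[of "E *v y"] mult_left_mono[OF Eb[of y] r0] by linarith
  also have "norm (B *v (B *v (J *v y))) \<le> 2 * r\<^sup>2 * norm y" by (rule BBb)
  finally have n: "norm (E *v y + 2 *\<^sub>R (B *v y)) \<le> 12 * r\<^sup>2 * norm y" by (simp add: power2_eq_square algebra_simps)
  have "\<bar>x \<bullet> (E *v y + 2 *\<^sub>R (B *v y))\<bar> \<le> norm x * norm (E *v y + 2 *\<^sub>R (B *v y))" by (rule Cauchy_Schwarz_ineq2)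
  also have "\<dots> \<le> norm x * (12 * r\<^sup>2 * norm y)" using n by (rule mult_left_mono) simp
  finally show "\<bar>x \<bullet> (E *v y) + 2 * (x \<bullet> (B *v y))\<bar> \<le> 12 * r\<^sup>2 * (norm x * norm y)"
    by (simp add: inner_add_right mult_ac)
qed

text \<open>The explicit first-order approximation I - 2 B of the standardised estimator. Unlike the
  estimator, its restriction to the complement of \<theta> depends only on the components of the
  observations orthogonal to \<theta>, and is therefore invariant under the flips.\<close>

definition Cform :: "nat \<Rightarrow> (nat \<Rightarrow> real^'p) \<Rightarrow> real^'p \<Rightarrow> real^'p \<Rightarrow> real" where
  "Cform n W x y = x \<bullet> y + (real CARD('p) + 2) / real CARD('p) * (real CARD('p) * emean n (\<lambda>i. (x \<bullet> W i) * (y \<bullet> W i)) - x \<bullet> y)"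

lemma Cform_diff_squares: "Cform n W x x - Cform n W y y = Cform n W (x - y) (x + y)"
proof -
  have "emean n (\<lambda>i. ((x - y) \<bullet> W i) * ((x + y) \<bullet> W i)) = emean n (\<lambda>i. (x \<bullet> W i) * (x \<bullet> W i)) - emean n (\<lambda>i. (y \<bullet> W i) * (y \<bullet> W i))"
    unfolding emean_diff[symmetric] by (intro emean_cong) (simp add: inner_diff_left inner_add_left algebra_simps)
  moreover have "(x - y) \<bullet> (x + y) = x \<bullet> x - y \<bullet> y" by (simp add: inner_diff_left inner_diff_right inner_add_left inner_add_right inner_commute[of y x])
  ultimately show ?thesis unfolding Cform_def by (simp add: right_diff_distrib)
qed

text \<open>If the leading eigenvector t of V is nearly orthogonal to \<open>\<theta>\<close>, then Cauchy--Schwarz for the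
  positive semidefinite matrix \<open>l - V\<close> makes the off-diagonal entry of V between \<open>\<theta>\<close> and any
  near-maximiser v of the Rayleigh quotient on the complement of \<open>\<theta>\<close> negligible.\<close>
lemma misaligned_eigenvector:
  fixes \<theta> :: "real^'p"
  assumes \<theta>: "norm \<theta> = 1" and H: "symmetric_m H" "H *v \<theta> = h *\<^sub>R \<theta>" "h > 0" "\<And>x. norm (H *v x) \<le> h * norm x"
    and E: "symmetric_m E" "opb E e" "e \<le> 1/8"
    and E2: "\<And>x y. \<bar>x \<bullet> y + x \<bullet> (E *v y) - Cform n W x y\<bar> \<le> \<epsilon> * (norm x * norm y)" and \<epsilon>: "0 \<le> \<epsilon>" "\<epsilon> \<le> 1/8"
    and V: "\<And>x y. x \<bullet> (V *v y) = (H *v x) \<bullet> (H *v y) + (H *v x) \<bullet> (E *v (H *v y))"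
    and t: "V *v t = l *\<^sub>R t" "norm t = 1" "\<And>x. x \<bullet> (V *v x) \<le> l * (norm x)\<^sup>2"
    and \<sigma>: "\<bar>t \<bullet> \<theta>\<bar> \<le> \<sigma>" "\<sigma> \<le> 1/2"
    and v: "norm v = 1" "v \<bullet> \<theta> = 0"
    and net: "\<And>u. norm u = 1 \<Longrightarrow> u \<bullet> \<theta> = 0 \<Longrightarrow> \<exists>v'. norm v' = 1 \<and> norm (u - v') \<le> m \<and> Cform n W (H *v v') (H *v v') \<le> Cform n W (H *v v) (H *v v)"
    and small: "4 * e * \<sigma>\<^sup>2 + 4 * m + 2 * \<epsilon> \<le> 1/4" and m: "m \<ge> 0"
  shows "(real CARD('p) + 2) * \<bar>emean n (\<lambda>i. (\<theta> \<bullet> W i) * ((H *v v) \<bullet> W i))\<bar> \<le> h * (sqrt (2 * e * (4 * e * \<sigma>\<^sup>2 + 4 * m + 2 * \<epsilon>)) + \<epsilon>)"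
    "h / 2 \<le> norm (H *v v)"
proof -
  let ?p = "real CARD('p)"
  \<comment> \<open>The three losses on the way from the eigenvector to v, in units of h^2: the tilt
    of the eigenvector towards \<theta>, the mesh of the net, and two exchanges of V with
    \<open>Cform\<close>.\<close>
  define K where "K = 4 * e * \<sigma>\<^sup>2 + 4 * m + 2 * \<epsilon>"
  note e0 = opb_nonneg[OF E(2)]
  have \<sigma>0: "0 \<le> \<sigma>" using \<sigma> by linarith
  have K0: "0 \<le> K" using e0 m \<epsilon> by (simp add: K_def)
  have \<theta>\<theta>: "\<theta> \<bullet> \<theta> = 1" using \<theta> by (simp add: norm_eq_1)
  have h2: "h\<^sup>2 > 0" using H(3) by simp
  have Vs: "symmetric_m V"
  proof (rule sym_from_dot)
    fix x y
    have "(V *v x) \<bullet> y = y \<bullet> (V *v x)" by (rule inner_commute)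
    then show "(V *v x) \<bullet> y = x \<bullet> (V *v y)"
      unfolding V using sym_dot[OF E(1), of "H *v y" "H *v x"] by (simp add: inner_commute)
  qed
  have Hsq: "(norm (H *v x))\<^sup>2 \<le> h\<^sup>2 * (norm x)\<^sup>2" for x
    using power_mono[OF H(4)[of x], of 2] by (simp add: power_mult_distrib)
  have Vq: "\<bar>x \<bullet> (V *v x) - (norm (H *v x))\<^sup>2\<bar> \<le> e * (norm (H *v x))\<^sup>2" for x
    using opb_inner[OF E(2), of "H *v x" "H *v x"] by (simp add: V power2_norm_eq_inner[symmetric] power2_eq_square mult_ac)
  have Hn: "norm (H *v \<theta>) = h" using H \<theta> by simp
  have tt: "t \<bullet> t = 1" using t(2) by (simp add: norm_eq_1)
  have lV: "l = t \<bullet> (V *v t)" using t(1) tt by simp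
  have l_up: "l \<le> (1 + e) * h\<^sup>2"
  proof -
    have "l \<le> (1 + e) * (norm (H *v t))\<^sup>2" using Vq[of t] lV by (simp add: abs_le_iff algebra_simps)
    also have "\<dots> \<le> (1 + e) * h\<^sup>2" using Hsq[of t] t(2) e0 by (intro mult_left_mono) auto
    finally show ?thesis .
  qed
  have a_low: "\<theta> \<bullet> (V *v \<theta>) \<ge> (1 - e) * h\<^sup>2" using Vq[of \<theta>] Hn by (simp add: abs_le_iff algebra_simps)
  have l_low: "l \<ge> (1 - e) * h\<^sup>2" using t(3)[of \<theta>] a_low \<theta> by simp
  define Q where "Q = l *\<^sub>R mat 1 - V"
  have Qx: "Q *v x = l *\<^sub>R x - V *v x" for x
    by (simp add: Q_def matrix_vector_mult_diff_rdistrib scaleR_matrix_vector)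
  have Qs: "symmetric_m Q" by (rule sym_from_dot) (simp add: Qx inner_diff_left inner_diff_right sym_dot[OF Vs])
  have Qp: "0 \<le> x \<bullet> (Q *v x)" for x using t(3)[of x] by (simp add: Qx inner_diff_right power2_norm_eq_inner)
  have Q\<theta>: "\<theta> \<bullet> (Q *v \<theta>) \<le> 2 * e * h\<^sup>2"
    using l_up a_low by (simp add: Qx inner_diff_right \<theta>\<theta> algebra_simps)
  define s where "s = t \<bullet> \<theta>"
  define w where "w = t - s *\<^sub>R \<theta>"
  have w\<theta>: "w \<bullet> \<theta> = 0" by (simp add: w_def inner_diff_left \<theta>\<theta> s_def)
  have s2: "s\<^sup>2 \<le> \<sigma>\<^sup>2" using \<sigma>(1) \<sigma>0 by (simp add: s_def abs_le_square_iff[symmetric])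
  have \<sigma>2: "\<sigma>\<^sup>2 \<le> 1/4" using power_mono[OF \<sigma>(2) \<sigma>0, of 2] by (simp add: power2_eq_square)
  have ww: "w \<bullet> w = 1 - s\<^sup>2"
    unfolding w_def by (simp add: inner_diff_left inner_diff_right tt \<theta>\<theta> s_def[symmetric] inner_commute[of \<theta> t] power2_eq_square algebra_simps)
  have wlow: "w \<bullet> w \<ge> 1/2" using ww s2 \<sigma>2 by linarith
  then have w0: "norm w > 0" by auto
  \<comment> \<open>The matrix Q annihilates t, so its form at w = t - s \<theta> is s^2 times its
    form at \<theta>.\<close>
  have Qw: "w \<bullet> (Q *v w) = s\<^sup>2 * (\<theta> \<bullet> (Q *v \<theta>))"
  proof -
    have Qt: "Q *v t = 0" by (simp add: Qx t(1))
    have "Q *v w = - (s *\<^sub>R (Q *v \<theta>))" by (simp add: w_def matrix_vector_mult_diff_distrib matrix_vector_scaleR Qt)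
    moreover have "w \<bullet> (Q *v \<theta>) = (Q *v w) \<bullet> \<theta>" by (simp add: sym_dot[OF Qs])
    ultimately show ?thesis by (simp add: inner_commute power2_eq_square)
  qed
  define u where "u = w /\<^sub>R norm w"
  have u: "norm u = 1" "u \<bullet> \<theta> = 0" using w0 w\<theta> by (simp_all add: u_def)
  have Qu: "u \<bullet> (Q *v u) \<le> 4 * e * \<sigma>\<^sup>2 * h\<^sup>2"
  proof -
    have "u \<bullet> (Q *v u) = (w \<bullet> (Q *v w)) / (w \<bullet> w)"
      by (simp add: u_def matrix_vector_scaleR power2_norm_eq_inner[symmetric] power2_eq_square divide_inverse mult_ac)
    also have "\<dots> \<le> (\<sigma>\<^sup>2 * (2 * e * h\<^sup>2)) / (1/2)"
      unfolding Qw using s2 Q\<theta> wlow Qp[of \<theta>] by (intro frac_le mult_mono) auto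
    finally show ?thesis by (simp add: mult_ac)
  qed
  obtain v' where v': "norm v' = 1" "norm (u - v') \<le> m" "Cform n W (H *v v') (H *v v') \<le> Cform n W (H *v v) (H *v v)"
    using net[OF u] by blast
  have VC: "\<bar>x \<bullet> (V *v y) - Cform n W (H *v x) (H *v y)\<bar> \<le> \<epsilon> * h\<^sup>2 * (norm x * norm y)" for x y
  proof -
    have "\<bar>x \<bullet> (V *v y) - Cform n W (H *v x) (H *v y)\<bar> \<le> \<epsilon> * (norm (H *v x) * norm (H *v y))"
      unfolding V by (rule E2)
    also have "\<dots> \<le> \<epsilon> * ((h * norm x) * (h * norm y))"
      using H(3,4) \<epsilon> by (intro mult_left_mono mult_mono) auto
    finally show ?thesis by (simp add: power2_eq_square mult_ac)
  qed
  have Cuv: "Cform n W (H *v u) (H *v u) - Cform n W (H *v v') (H *v v') \<le> 4 * m * h\<^sup>2"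
  proof -
    have "Cform n W (H *v u) (H *v u) - Cform n W (H *v v') (H *v v') = Cform n W (H *v (u - v')) (H *v (u + v'))"
      unfolding Cform_diff_squares by (simp add: matrix_vector_mult_diff_distrib matrix_vector_right_distrib)
    also have "\<dots> \<le> (u - v') \<bullet> (V *v (u + v')) + \<epsilon> * h\<^sup>2 * (norm (u - v') * norm (u + v'))"
      using VC[of "u - v'" "u + v'"] by (simp add: abs_le_iff)
    also have "(u - v') \<bullet> (V *v (u + v')) \<le> (1 + e) * h\<^sup>2 * (norm (u - v') * norm (u + v'))"
    proof -
      have "(u - v') \<bullet> (V *v (u + v')) \<le> norm (H *v (u - v')) * norm (H *v (u + v')) + e * norm (H *v (u - v')) * norm (H *v (u + v'))"
        unfolding V using Cauchy_Schwarz_ineq2[of "H *v (u - v')" "H *v (u + v')"] opb_inner[OF E(2), of "H *v (u - v')" "H *v (u + v')"]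
        by (simp add: abs_le_iff)
      also have "\<dots> = (1 + e) * (norm (H *v (u - v')) * norm (H *v (u + v')))" by (simp add: algebra_simps)
      also have "\<dots> \<le> (1 + e) * ((h * norm (u - v')) * (h * norm (u + v')))"
        using H(3,4) e0 by (intro mult_left_mono mult_mono) auto
      finally show ?thesis by (simp add: power2_eq_square mult_ac)
    qed
    also have "(1 + e) * h\<^sup>2 * (norm (u - v') * norm (u + v')) + \<epsilon> * h\<^sup>2 * (norm (u - v') * norm (u + v')) = (1 + e + \<epsilon>) * h\<^sup>2 * (norm (u - v') * norm (u + v'))"
      by (simp add: algebra_simps)
    also have "\<dots> \<le> 2 * h\<^sup>2 * (m * 2)"
    proof (intro mult_mono mult_right_mono)
      show "norm (u + v') \<le> 2" using norm_triangle_ineq[of u v'] u v' by simp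
    qed (use e0 E(3) \<epsilon> v' m h2 in auto)
    finally show ?thesis by (simp add: mult_ac)
  qed
  \<comment> \<open>V is exchanged for \<open>Cform\<close> at v, the maximality of v is used
    against the net point near u, and \<open>Cform\<close> is exchanged back for V at u.\<close>
  have Qv: "v \<bullet> (Q *v v) \<le> K * h\<^sup>2"
  proof -
    have "v \<bullet> (Q *v v) = l - v \<bullet> (V *v v)" using v(1) by (simp add: Qx inner_diff_right norm_eq_1)
    also have "\<dots> \<le> l - Cform n W (H *v v) (H *v v) + \<epsilon> * h\<^sup>2" using VC[of v v] v(1) by (simp add: abs_le_iff)
    also have "\<dots> \<le> l - Cform n W (H *v u) (H *v u) + 4 * m * h\<^sup>2 + \<epsilon> * h\<^sup>2" using v'(3) Cuv by linarith
    also have "\<dots> \<le> l - u \<bullet> (V *v u) + 4 * m * h\<^sup>2 + 2 * \<epsilon> * h\<^sup>2" using VC[of u u] u(1) by (simp add: abs_le_iff)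
    also have "l - u \<bullet> (V *v u) = u \<bullet> (Q *v u)" using u(1) by (simp add: Qx inner_diff_right norm_eq_1)
    also have "\<dots> \<le> 4 * e * \<sigma>\<^sup>2 * h\<^sup>2" by (rule Qu)
    finally show ?thesis by (simp add: K_def algebra_simps)
  qed
  have Q\<theta>v: "\<bar>\<theta> \<bullet> (Q *v v)\<bar> \<le> h\<^sup>2 * sqrt (2 * e * K)"
  proof -
    have "(\<theta> \<bullet> (Q *v v))\<^sup>2 \<le> (\<theta> \<bullet> (Q *v \<theta>)) * (v \<bullet> (Q *v v))" by (rule psd_Cauchy_Schwarz[OF Qs Qp])
    also have "\<dots> \<le> (2 * e * h\<^sup>2) * (K * h\<^sup>2)" using Q\<theta> Qv Qp e0 by (intro mult_mono) auto
    also have "\<dots> = (h\<^sup>2 * sqrt (2 * e * K))\<^sup>2" using e0 K0 by (simp add: power_mult_distrib power2_eq_square)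
    finally show ?thesis
      using e0 K0 by (simp add: abs_le_square_iff[symmetric] abs_mult)
  qed
  have \<theta>Hv: "\<theta> \<bullet> (H *v v) = 0" using sym_dot[OF H(1), of \<theta> v] v(2) by (simp add: H(2) inner_commute)
  have "\<theta> \<bullet> (Q *v v) = - (\<theta> \<bullet> (V *v v))" using v(2) by (simp add: Qx inner_diff_right inner_commute)
  then have \<theta>Vv: "\<bar>\<theta> \<bullet> (V *v v)\<bar> \<le> h\<^sup>2 * sqrt (2 * e * K)" using Q\<theta>v by simp
  \<comment> \<open>Because \<theta> is orthogonal to H v, the identity parts vanish and the pure
    linear statistic remains.\<close>
  have "Cform n W (H *v \<theta>) (H *v v) = h * ((?p + 2) * emean n (\<lambda>i. (\<theta> \<bullet> W i) * ((H *v v) \<bullet> W i)))"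
  proof -
    have "emean n (\<lambda>i. ((h *\<^sub>R \<theta>) \<bullet> W i) * ((H *v v) \<bullet> W i)) = h * emean n (\<lambda>i. (\<theta> \<bullet> W i) * ((H *v v) \<bullet> W i))"
      unfolding emean_cmult[symmetric] by (intro emean_cong) simp
    then show ?thesis unfolding Cform_def H(2) by (simp add: \<theta>Hv)
  qed
  then have "\<bar>h * ((?p + 2) * emean n (\<lambda>i. (\<theta> \<bullet> W i) * ((H *v v) \<bullet> W i)))\<bar> \<le> h\<^sup>2 * sqrt (2 * e * K) + \<epsilon> * h\<^sup>2"
    using VC[of \<theta> v] \<theta>Vv v(1) \<theta> by (simp add: abs_le_iff)
  also have "h\<^sup>2 * sqrt (2 * e * K) + \<epsilon> * h\<^sup>2 = h * (h * (sqrt (2 * e * K) + \<epsilon>))" by (simp add: power2_eq_square algebra_simps)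
  finally have "h * ((?p + 2) * \<bar>emean n (\<lambda>i. (\<theta> \<bullet> W i) * ((H *v v) \<bullet> W i))\<bar>) \<le> h * (h * (sqrt (2 * e * K) + \<epsilon>))"
    using H(3) by (simp add: abs_mult)
  then show "(?p + 2) * \<bar>emean n (\<lambda>i. (\<theta> \<bullet> W i) * ((H *v v) \<bullet> W i))\<bar> \<le> h * (sqrt (2 * e * (4 * e * \<sigma>\<^sup>2 + 4 * m + 2 * \<epsilon>)) + \<epsilon>)"
    using H(3) by (simp add: K_def[symmetric])
  show "h / 2 \<le> norm (H *v v)"
  proof (rule power2_le_imp_le)
    \<comment> \<open>With 1 - e \<ge> 7/8 and K \<le> 1/4 the form of V at v is at least 5/8 h^2.
      Dividing by 1 + e \<le> 9/8 leaves more than h^2 / 4.\<close>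
    have "K * h\<^sup>2 \<le> 1/4 * h\<^sup>2" using small h2 by (intro mult_right_mono) (auto simp: K_def)
    moreover have "v \<bullet> (Q *v v) = l - v \<bullet> (V *v v)" using v(1) by (simp add: Qx inner_diff_right norm_eq_1)
    moreover have "(1 - 1/8) * h\<^sup>2 \<le> (1 - e) * h\<^sup>2" using E(3) h2 by (intro mult_right_mono) auto
    ultimately have "v \<bullet> (V *v v) \<ge> 5/8 * h\<^sup>2" using Qv l_low by simp
    moreover have "v \<bullet> (V *v v) \<le> (1 + e) * (norm (H *v v))\<^sup>2" using Vq[of v] by (simp add: abs_le_iff algebra_simps)
    moreover have "(1 + e) * (norm (H *v v))\<^sup>2 \<le> 9/8 * (norm (H *v v))\<^sup>2" using E(3) by (intro mult_right_mono) auto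
    moreover have "0 \<le> (norm (H *v v))\<^sup>2" by simp
    ultimately have "h\<^sup>2 \<le> 4 * (norm (H *v v))\<^sup>2" by linarith
    then show "(h / 2)\<^sup>2 \<le> (norm (H *v v))\<^sup>2" by (simp add: power_divide)
  qed simp
qed

section \<open>A finite net and the probabilities of the exceptional events\<close>

lemma hyperplane_sphere_net:
  fixes \<theta> :: "real^'p"
  assumes "m > 0" "CARD('p) \<ge> 2"
  obtains N where "finite N" "N \<noteq> {}" "\<And>v. v \<in> N \<Longrightarrow> norm v = 1 \<and> v \<bullet> \<theta> = 0"
    "\<And>u. norm u = 1 \<Longrightarrow> u \<bullet> \<theta> = 0 \<Longrightarrow> \<exists>v\<in>N. norm (u - v) \<le> m"
proof -
  define K where "K = sphere 0 1 \<inter> {u. u \<bullet> \<theta> = 0}"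
  have "closed {u. u \<bullet> \<theta> = 0}" by (intro closed_Collect_eq continuous_intros)
  then have "compact K" unfolding K_def by (intro compact_Int_closed compact_sphere)
  then have "\<exists>N. finite N \<and> N \<subseteq> K \<and> K \<subseteq> (\<Union>x\<in>N. ball x m)"
    using seq_compact_imp_totally_bounded[OF compact_imp_seq_compact, of K] assms(1) by simp
  then obtain N where N: "finite N" "N \<subseteq> K" "K \<subseteq> (\<Union>x\<in>N. ball x m)" by blast
  obtain y where y: "y \<noteq> 0" "orthogonal \<theta> y"
    using orthogonal_to_vector_exists[of \<theta>] assms(2) by auto
  have "y /\<^sub>R norm y \<in> K" using y by (simp add: K_def orthogonal_def inner_commute)
  then have "N \<noteq> {}" using N(3) by auto
  show ?thesis
  proof (rule that[OF N(1) \<open>N \<noteq> {}\<close>])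
    show "norm v = 1 \<and> v \<bullet> \<theta> = 0" if "v \<in> N" for v using N(2) that by (auto simp: K_def)
    show "\<exists>v\<in>N. norm (u - v) \<le> m" if "norm u = 1" "u \<bullet> \<theta> = 0" for u
    proof -
      have "u \<in> K" using that by (simp add: K_def)
      then obtain v where "v \<in> N" "dist v u < m" using N(3) by auto
      then show ?thesis by (metis dist_commute dist_norm less_imp_le)
    qed
  qed
qed

text \<open>The coordinate version of \<open>near_iso\<close>. It consists of finitely many
  inequalities, so the corresponding event is measurable and open to a union bound.\<close>

definition moments_near :: "nat \<Rightarrow> (nat \<Rightarrow> real^'p) \<Rightarrow> real \<Rightarrow> bool" where
  "moments_near n W g \<longleftrightarrow> (\<forall>a b c d. \<bar>emean n (\<lambda>i. W i $ a * W i $ b * W i $ c * W i $ d) - iso4 a b c d\<bar> \<le> g)"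

lemma moments_near_iso:
  fixes W :: "nat \<Rightarrow> real^'p"
  assumes "n \<ge> 1" "\<forall>i<n. norm (W i) = 1" "g \<ge> 0" "moments_near n W g"
  shows "near_iso n W (g * real CARD('p) ^ 4)"
  using near_iso_of_components[OF assms(1-3)] assms(4) by (auto simp: moments_near_def)

lemma measurable_emean[measurable]:
  assumes "\<And>i. i < n \<Longrightarrow> F i \<in> borel_measurable M"
  shows "(\<lambda>\<omega>. emean n (\<lambda>i. F i \<omega>)) \<in> borel_measurable M"
  unfolding emean_def using assms by (intro borel_measurable_times borel_measurable_const borel_measurable_sum) auto

lemma measurable_unif_sample_coordinate[measurable]:
  "i < n \<Longrightarrow> (\<lambda>\<omega>. (\<omega> i :: real^'p) $ a) \<in> borel_measurable (unif_sample n)"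
proof -
  assume "i < n"
  moreover have "(\<lambda>x :: real^'p. x $ a) \<in> borel_measurable borel"
    by (intro borel_measurable_continuous_onI continuous_intros)
  ultimately show ?thesis using measurable_compose[OF measurable_unif_sample_component[of i n]] by blast
qed

lemma sets_moments_near:
  "{\<omega>\<in>space (unif_sample n :: (nat \<Rightarrow> real^'p) measure). moments_near n \<omega> g} \<in> sets (unif_sample n)"
proof -
  have [measurable]: "(\<lambda>\<omega>::nat \<Rightarrow> real^'p. emean n (\<lambda>i. \<omega> i $ a * \<omega> i $ b * \<omega> i $ c * \<omega> i $ d)) \<in> borel_measurable (unif_sample n)" for a b c d
    by (intro measurable_emean borel_measurable_times measurable_unif_sample_coordinate)
  show ?thesis unfolding moments_near_def by measurable
qed

text \<open>Hoeffding's inequality for each of the p^4 coordinate monomials.\<close>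

lemma prob_moments_far:
  assumes n: "n \<ge> 1" and M: "M \<ge> 0"
  shows "measure (unif_sample n) {\<omega>\<in>space (unif_sample n). \<not> moments_near n (\<omega> :: nat \<Rightarrow> real^'p) (M / sqrt (real n))}
    \<le> real CARD('p) ^ 4 * (2 * exp (- M\<^sup>2 / 2))"
proof -
  let ?M = "unif_sample n :: (nat \<Rightarrow> real^'p) measure"
  interpret prob_space ?M by (rule prob_space_unif_sample)
  define F where "F = (\<lambda>(a, b, c, d). {\<omega>\<in>space ?M. \<bar>(\<Sum>i<n. \<omega> i $ a * \<omega> i $ b * \<omega> i $ c * \<omega> i $ d) - real n * iso4 a b c d\<bar> \<ge> M * sqrt (real n)})"
  have Fs: "F k \<in> sets ?M" for k
  proof -
    obtain a b c d where k: "k = (a, b, c, d)" by (cases k)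
    have [measurable]: "(\<lambda>\<omega>::nat \<Rightarrow> real^'p. \<Sum>i<n. \<omega> i $ a * \<omega> i $ b * \<omega> i $ c * \<omega> i $ d) \<in> borel_measurable (unif_sample n)"
      by (intro borel_measurable_sum borel_measurable_times measurable_unif_sample_coordinate) auto
    show ?thesis unfolding F_def k by simp
  qed
  have "{\<omega>\<in>space ?M. \<not> moments_near n \<omega> (M / sqrt (real n))} \<subseteq> (\<Union>k\<in>UNIV. F k)"
  proof safe
    fix \<omega> assume w: "\<omega> \<in> space ?M" "\<not> moments_near n \<omega> (M / sqrt (real n))"
    then obtain a b c d where "M / sqrt (real n) < \<bar>emean n (\<lambda>i. \<omega> i $ a * \<omega> i $ b * \<omega> i $ c * \<omega> i $ d) - iso4 a b c d\<bar>"
      by (auto simp: moments_near_def not_le)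
    then have "real n * (M / sqrt (real n)) \<le> real n * \<bar>emean n (\<lambda>i. \<omega> i $ a * \<omega> i $ b * \<omega> i $ c * \<omega> i $ d) - iso4 a b c d\<bar>"
      by (intro mult_left_mono) auto
    also have "\<dots> = \<bar>real n * (emean n (\<lambda>i. \<omega> i $ a * \<omega> i $ b * \<omega> i $ c * \<omega> i $ d) - iso4 a b c d)\<bar>"
      by (simp add: abs_mult)
    also have "real n * (emean n (\<lambda>i. \<omega> i $ a * \<omega> i $ b * \<omega> i $ c * \<omega> i $ d) - iso4 a b c d) = (\<Sum>i<n. \<omega> i $ a * \<omega> i $ b * \<omega> i $ c * \<omega> i $ d) - real n * iso4 a b c d"
      using n by (simp add: emean_def right_diff_distrib)
    also have "real n * (M / sqrt (real n)) = M * (real n / sqrt (real n))" by simp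
    also have "\<dots> = M * sqrt (real n)" by (simp only: real_div_sqrt[OF of_nat_0_le_iff])
    finally have "\<omega> \<in> F (a, b, c, d)" using w by (simp add: F_def)
    then show "\<omega> \<in> (\<Union>k\<in>UNIV. F k)" by blast
  qed
  then have "prob {\<omega>\<in>space ?M. \<not> moments_near n \<omega> (M / sqrt (real n))} \<le> prob (\<Union>k\<in>UNIV. F k)"
    by (intro finite_measure_mono) (auto simp: Fs)
  also have "\<dots> \<le> (\<Sum>k\<in>UNIV. prob (F k))"
    by (rule finite_measure_subadditive_finite) (auto simp: Fs)
  also have "\<dots> \<le> (\<Sum>k\<in>(UNIV :: ('p \<times> 'p \<times> 'p \<times> 'p) set). 2 * exp (- M\<^sup>2 / 2))"
  proof (rule sum_mono)
    fix k :: "'p \<times> 'p \<times> 'p \<times> 'p"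
    obtain a b c d where k: "k = (a, b, c, d)" by (cases k)
    have "\<bar>x $ a * x $ b * x $ c * x $ d\<bar> \<le> 1" if "norm x = 1" for x :: "real^'p"
      using abs_prod4_le[OF component_le_1[OF that] component_le_1[OF that] component_le_1[OF that] component_le_1[OF that], of a b c d] by simp
    then show "prob (F k) \<le> 2 * exp (- M\<^sup>2 / 2)"
      using unif_sample_concentration[of "\<lambda>x. x $ a * x $ b * x $ c * x $ d" n M] n M
      unfolding fourth_moment k F_def by simp
  qed
  also have "\<dots> = real CARD('p) ^ 4 * (2 * exp (- M\<^sup>2 / 2))"
    by (simp add: card_cartesian_product UNIV_Times_UNIV[symmetric] power4_eq_xxxx del: UNIV_Times_UNIV)
  finally show ?thesis .
qed

text \<open>What misalignment forces upon the sample. Quantifying over all maximisers on the net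
  avoids breaking ties.\<close>

definition flat_maximizers :: "nat \<Rightarrow> (nat \<Rightarrow> real^'p) \<Rightarrow> real^'p \<Rightarrow> real^'p^'p \<Rightarrow> real \<Rightarrow> real \<Rightarrow> (real^'p) set \<Rightarrow> bool" where
  "flat_maximizers n W \<theta> H h T N \<longleftrightarrow>
     (\<forall>v\<in>N. (\<forall>v'\<in>N. Cform n W (H *v v') (H *v v') \<le> Cform n W (H *v v) (H *v v)) \<longrightarrow>
        h / 2 \<le> norm (H *v v) \<and> \<bar>\<Sum>i<n. (\<theta> \<bullet> W i) * ((H *v v) \<bullet> W i)\<bar> \<le> h * T)"

text \<open>The sum of squares demanded by the anticoncentration bound is n times an empirical
  fourth moment with isotropic value |x|^2 / (p (p + 2)), where |x| \<ge> 1/2. The condition on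
  \<open>g\<close> lets the moment error consume at most half of it, which leaves n / (8 p (p +
  2)).\<close>

lemma prob_flat_maximizers:
  fixes \<theta> :: "real^'p"
  assumes \<theta>: "norm \<theta> = 1" and H: "symmetric_m H" "H *v \<theta> = h *\<^sub>R \<theta>" "h > 0" "\<And>x. norm (H *v x) \<le> h * norm x"
    and N: "finite N" "N \<noteq> {}" "\<And>v. v \<in> N \<Longrightarrow> norm v = 1 \<and> v \<bullet> \<theta> = 0"
    and n: "n \<ge> 1" and g: "g \<ge> 0" "g * real CARD('p) ^ 4 * (2 * (real CARD('p) * (real CARD('p) + 2))) \<le> 1"
    and T: "T > 0" and A: "A > 0" "A * T\<^sup>2 * (8 * (real CARD('p) * (real CARD('p) + 2))) \<le> real n" and \<delta>: "\<delta> > 0"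
  defines "B \<equiv> {\<omega>\<in>space (unif_sample n). (\<forall>i<n. norm (\<omega> i) = 1) \<and> moments_near n \<omega> g \<and> flat_maximizers n \<omega> \<theta> H h T N}"
  shows "B \<in> sets (unif_sample n)" "measure (unif_sample n) B \<le> 2 * (\<delta> + 4 / (\<delta>\<^sup>2 * A) + 1 / T\<^sup>2)"
proof -
  have [measurable]: "(\<lambda>\<omega>::nat \<Rightarrow> real^'p. Cform n \<omega> x y) \<in> borel_measurable (unif_sample n)" for x y
  proof -
    have [measurable]: "(\<lambda>\<omega>::nat \<Rightarrow> real^'p. emean n (\<lambda>i. (x \<bullet> \<omega> i) * (y \<bullet> \<omega> i))) \<in> borel_measurable (unif_sample n)"
      by (rule measurable_emean) measurable
    show ?thesis unfolding Cform_def by measurable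
  qed
  have 1: "{\<omega>\<in>space (unif_sample n :: (nat \<Rightarrow> real^'p) measure). \<forall>i<n. norm (\<omega> i) = 1} \<in> sets (unif_sample n)"
    by measurable
  have 2: "{\<omega>\<in>space (unif_sample n :: (nat \<Rightarrow> real^'p) measure). flat_maximizers n \<omega> \<theta> H h T N} \<in> sets (unif_sample n)"
    unfolding flat_maximizers_def using N(1)
    by (intro sets.sets_Collect_finite_All' sets.sets_Collect_imp) (measurable, auto simp: N(2))
  have "B = {\<omega>\<in>space (unif_sample n). \<forall>i<n. norm (\<omega> i) = 1} \<inter> {\<omega>\<in>space (unif_sample n). moments_near n \<omega> g} \<inter> {\<omega>\<in>space (unif_sample n). flat_maximizers n \<omega> \<theta> H h T N}"
    by (auto simp: B_def)
  then show Bs: "B \<in> sets (unif_sample n)" using 1 2 sets_moments_near by (simp only:) (intro sets.Int)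
  show "measure (unif_sample n) B \<le> 2 * (\<delta> + 4 / (\<delta>\<^sup>2 * A) + 1 / T\<^sup>2)"
  proof (rule unif_sample_anticoncentration[OF \<theta> Bs T A(1) \<delta>])
    fix \<omega> :: "nat \<Rightarrow> real^'p" assume "\<omega> \<in> space (unif_sample n)"
    define C where "C v = Cform n \<omega> (H *v v) (H *v v)" for v
    \<comment> \<open>Here v is chosen from the unflipped sample. By the flip invariance of
      \<open>Cform\<close> on the net it remains a maximiser for every flipped sample, so one x
      serves the whole orbit.\<close>
    obtain v where v: "v \<in> N" "\<And>v'. v' \<in> N \<Longrightarrow> C v' \<le> C v"
    proof -
      have "Max (C ` N) \<in> C ` N" using N by (intro Max_in) auto
      then obtain v where "v \<in> N" "C v = Max (C ` N)" by auto
      then show ?thesis using that N(1) by (metis Max_ge finite_imageI imageI)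
    qed
    define x where "x = (1 / h) *\<^sub>R (H *v v)"
    have Hperp: "(H *v u) \<bullet> \<theta> = 0" if "u \<in> N" for u
      using N(3)[OF that] by (simp add: sym_dot[OF H(1)] H(2))
    have flipC: "Cform n (flip n \<theta> J \<omega>) (H *v u) (H *v u) = C u" if "u \<in> N" for u J
    proof -
      have "emean n (\<lambda>i. ((H *v u) \<bullet> flip n \<theta> J \<omega> i) * ((H *v u) \<bullet> flip n \<theta> J \<omega> i)) = emean n (\<lambda>i. ((H *v u) \<bullet> \<omega> i) * ((H *v u) \<bullet> \<omega> i))"
        using reflect_inner(2)[OF \<theta> Hperp[OF that]] by (intro emean_cong) (auto simp: flip_def)
      then show ?thesis by (simp add: C_def Cform_def)
    qed
    show "\<exists>x. x \<bullet> \<theta> = 0 \<and> norm x \<le> 1 \<and>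
        (\<forall>J. flip n \<theta> J \<omega> \<in> B \<longrightarrow> (\<forall>i<n. norm (flip n \<theta> J \<omega> i) = 1) \<and>
           A * T\<^sup>2 \<le> (\<Sum>i<n. ((\<theta> \<bullet> flip n \<theta> J \<omega> i) * (x \<bullet> flip n \<theta> J \<omega> i))\<^sup>2) \<and>
           \<bar>\<Sum>i<n. (\<theta> \<bullet> flip n \<theta> J \<omega> i) * (x \<bullet> flip n \<theta> J \<omega> i)\<bar> \<le> T)"
    proof (intro exI[of _ x] conjI allI impI)
      show x\<theta>: "x \<bullet> \<theta> = 0" using Hperp[OF v(1)] by (simp add: x_def)
      show x1: "norm x \<le> 1" using H(3) H(4)[of v] N(3)[OF v(1)] by (simp add: x_def)
      fix J assume J: "flip n \<theta> J \<omega> \<in> B"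
      define W where "W = flip n \<theta> J \<omega>"
      have W1: "\<forall>i<n. norm (W i) = 1" and mo: "moments_near n W g" and fm: "flat_maximizers n W \<theta> H h T N"
        using J by (auto simp: B_def W_def)
      show "norm (flip n \<theta> J \<omega> i) = 1" if "i < n" for i using W1 that by (simp add: W_def)
      have hv: "h / 2 \<le> norm (H *v v)" "\<bar>\<Sum>i<n. (\<theta> \<bullet> W i) * ((H *v v) \<bullet> W i)\<bar> \<le> h * T"
        using fm v flipC unfolding flat_maximizers_def W_def by auto
      have "(\<Sum>i<n. (\<theta> \<bullet> W i) * (x \<bullet> W i)) = (1 / h) * (\<Sum>i<n. (\<theta> \<bullet> W i) * ((H *v v) \<bullet> W i))"
        by (simp add: x_def sum_distrib_left mult_ac)
      then have "\<bar>\<Sum>i<n. (\<theta> \<bullet> W i) * (x \<bullet> W i)\<bar> = \<bar>\<Sum>i<n. (\<theta> \<bullet> W i) * ((H *v v) \<bullet> W i)\<bar> / h"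
        using H(3) by (simp add: abs_mult)
      also have "\<dots> \<le> T" using hv(2) H(3) by (simp add: field_simps)
      finally show "\<bar>\<Sum>i<n. (\<theta> \<bullet> flip n \<theta> J \<omega> i) * (x \<bullet> flip n \<theta> J \<omega> i)\<bar> \<le> T" by (simp add: W_def)
      let ?q = "real CARD('p) * (real CARD('p) + 2)"
      have q: "?q > 0" by (intro mult_pos_pos) auto
      have xh: "1/2 \<le> norm x" using hv(1) H(3) by (simp add: x_def field_simps)
      have x2: "1/4 \<le> x \<bullet> x" using power_mono[OF xh, of 2] unfolding power2_norm_eq_inner by (simp add: power2_eq_square)
      define G where "G = g * real CARD('p) ^ 4"
      have iso: "near_iso n W G" unfolding G_def by (rule moments_near_iso[OF n W1 g(1) mo])
      define Y where "Y = (x \<bullet> x) / ?q"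
      have "iso_form \<theta> \<theta> x x = Y"
        using \<theta> x\<theta> by (simp add: Y_def iso_form_def norm_eq_1 inner_commute[of \<theta> x])
      moreover have "\<bar>emean n (\<lambda>i. (\<theta> \<bullet> W i) * (\<theta> \<bullet> W i) * (x \<bullet> W i) * (x \<bullet> W i)) - iso_form \<theta> \<theta> x x\<bar> \<le> G * (x \<bullet> x)"
        using near_isoD(3)[OF iso, of \<theta> \<theta> x x] \<theta> by (simp add: power2_norm_eq_inner[symmetric] power2_eq_square)
      moreover have "G * (x \<bullet> x) \<le> Y / 2"
      proof -
        have "G \<le> 1 / (2 * ?q)" using g(2) q by (simp add: G_def field_simps)
        then have "G * (x \<bullet> x) \<le> 1 / (2 * ?q) * (x \<bullet> x)" by (rule mult_right_mono) simp
        then show ?thesis by (simp add: Y_def mult_ac)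
      qed
      ultimately have "emean n (\<lambda>i. (\<theta> \<bullet> W i) * (\<theta> \<bullet> W i) * (x \<bullet> W i) * (x \<bullet> W i)) \<ge> Y / 2"
        by linarith
      moreover have "Y / 2 \<ge> 1 / (8 * ?q)"
        using divide_right_mono[OF x2, of "2 * ?q"] q by (simp add: Y_def mult_ac)
      ultimately have "1 / (8 * ?q) \<le> emean n (\<lambda>i. (\<theta> \<bullet> W i) * (\<theta> \<bullet> W i) * (x \<bullet> W i) * (x \<bullet> W i))" by linarith
      then have "real n * (1 / (8 * ?q)) \<le> real n * emean n (\<lambda>i. (\<theta> \<bullet> W i) * (\<theta> \<bullet> W i) * (x \<bullet> W i) * (x \<bullet> W i))"
        by (rule mult_left_mono) simp
      also have "\<dots> = (\<Sum>i<n. ((\<theta> \<bullet> W i) * (x \<bullet> W i))\<^sup>2)"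
        using n by (simp add: emean_def power2_eq_square mult_ac)
      finally have "real n / (8 * ?q) \<le> (\<Sum>i<n. ((\<theta> \<bullet> W i) * (x \<bullet> W i))\<^sup>2)" by simp
      moreover have "A * T\<^sup>2 \<le> real n / (8 * ?q)" using A(2) q by (subst pos_le_divide_eq) auto
      ultimately show "A * T\<^sup>2 \<le> (\<Sum>i<n. ((\<theta> \<bullet> flip n \<theta> J \<omega> i) * (x \<bullet> flip n \<theta> J \<omega> i))\<^sup>2)"
        unfolding W_def by linarith
    qed
  qed
qed

text \<open>The deterministic half of the argument. In \<epsilon>, the 12 comes from inverting the
  square and 46 p is twice the 23 p of the solved equation; in \<eta>, the factor 4 of
  \<open>Vt_close\<close> is doubled by the inversion in \<open>T_n_difference\<close>.\<close>

lemma deviation_bound: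
  fixes \<theta> :: "real^'p"
  assumes p2: "CARD('p) \<ge> 2" and \<theta>: "norm \<theta> = 1"
    and H: "symmetric_m H" "posdef_m H" "H *v \<theta> = h *\<^sub>R \<theta>" "h > 0" "\<And>x. norm (H *v x) \<le> h * norm x"
    and V0: "V0 = H ** H" and U: "\<And>i. i < n \<Longrightarrow> U i = k i *\<^sub>R (H *v W i) \<and> k i \<noteq> 0"
    and W: "near_iso n W G"
    and N: "\<And>v. v \<in> N \<Longrightarrow> norm v = 1 \<and> v \<bullet> \<theta> = 0" "\<And>u. norm u = 1 \<Longrightarrow> u \<bullet> \<theta> = 0 \<Longrightarrow> \<exists>v\<in>N. norm (u - v) \<le> m"
    and m: "m \<ge> 0" and notflat: "\<not> flat_maximizers n W \<theta> H h T N"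
    and \<sigma>: "0 < \<sigma>" "\<sigma> \<le> 1/2"
  defines "p \<equiv> real CARD('p)"
  defines "r \<equiv> 4 * p ^ 4 * G"
  defines "e \<equiv> 5 * r" and "\<epsilon> \<equiv> (12 + 46 * p) * r\<^sup>2"
  assumes small: "200 * p ^ 7 * G \<le> 1" "e \<le> 1/8" "\<epsilon> \<le> 1/8" "4 * e * \<sigma>\<^sup>2 + 4 * m + 2 * \<epsilon> \<le> 1/4"
    and T: "real n * (sqrt (2 * e * (4 * e * \<sigma>\<^sup>2 + 4 * m + 2 * \<epsilon>)) + \<epsilon>) \<le> T"
  defines "\<eta> \<equiv> 8 * (9 * p * e / \<sigma> ^ 4)"
  defines "d \<equiv> p * G * \<eta> + 2 * \<eta>\<^sup>2"
  assumes \<eta>: "\<eta> \<le> 1/4"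
  shows "\<bar>T_n n \<theta> U (V_tilde n \<theta> U) - T_n n \<theta> U V0\<bar> \<le> real n * p * (p + 2) * (3 * \<eta> * (p * G + d)\<^sup>2 + d * (2 * (p * G) + d))"
proof -
  have pp: "p \<ge> 2" using p2 by (simp add: p_def)
  note G0 = near_iso_nonneg[OF W] and n1 = near_isoD(1)[OF W]
  have r0: "r \<ge> 0" using G0 pp by (simp add: r_def)
  have r4: "r \<le> 1/4" using small(2) r0 by (simp add: e_def)
  obtain B where B: "symmetric_m B" "opb B r" "Smat n W (mat 1 + B) = (1 / p) *\<^sub>R mat 1"
    "\<And>x y. \<bar>x \<bullet> (B *v y) + (p + 2) / (2 * p) * (p * emean n (\<lambda>i. (x \<bullet> W i) * (y \<bullet> W i)) - x \<bullet> y)\<bar> \<le> 23 * p * r\<^sup>2 * (norm x * norm y)"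
    by (rule tyler_equation_solution[OF W p2 small(1)[unfolded p_def], folded p_def, folded r_def]) (rule that)
  define R where "R = mat 1 + B"
  define J where "J = matrix_inv (R ** R)"
  define E where "E = J - mat 1"
  note pert = inverse_square_perturbation[OF B(1,2) r4, folded R_def, folded J_def, folded E_def]
  have R: "symmetric_m R" "posdef_m R" and E: "symmetric_m E" "opb E e"
    using pert(1-4) by (simp_all add: e_def)
  have Jx: "J *v x = x + E *v x" for x by (simp add: E_def matrix_vector_mult_diff_rdistrib)
  have E2: "\<bar>x \<bullet> y + x \<bullet> (E *v y) - Cform n W x y\<bar> \<le> \<epsilon> * (norm x * norm y)" for x y
  proof -
    define D where "D = (p + 2) / (2 * p) * (p * emean n (\<lambda>i. (x \<bullet> W i) * (y \<bullet> W i)) - x \<bullet> y)"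
    have "Cform n W x y = x \<bullet> y + 2 * D"
      using pp by (simp add: Cform_def p_def[symmetric] D_def)
    moreover have "\<bar>x \<bullet> (B *v y) + D\<bar> \<le> 23 * p * r\<^sup>2 * (norm x * norm y)"
      using B(4)[of x y] by (simp only: D_def)
    ultimately have "\<bar>x \<bullet> y + x \<bullet> (E *v y) - Cform n W x y\<bar> \<le> 12 * r\<^sup>2 * (norm x * norm y) + 2 * (23 * p * r\<^sup>2 * (norm x * norm y))"
      using pert(5)[of x y] by linarith
    then show ?thesis by (simp add: \<epsilon>_def algebra_simps)
  qed
  have Gq: "G * (p * (p + 2)) < 1"
  proof -
    have "p * (p + 2) \<le> p * (2 * p)" using pp by (intro mult_left_mono) auto
    also have "\<dots> = 2 * p ^ 2" by (simp add: power2_eq_square)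
    also have "\<dots> \<le> 2 * p ^ 7" using pp by (intro mult_left_mono power_increasing) auto
    finally have "G * (p * (p + 2)) \<le> G * (2 * p ^ 7)" using G0 by (rule mult_left_mono)
    then show ?thesis using small(1) by (simp add: mult_ac)
  qed
  obtain c where c: "c > 0" "tyler n U = c *\<^sub>R (H ** J ** H)"
    using tyler_representation[OF W Gq[unfolded p_def] R B(3)[folded R_def, unfolded p_def] H(1,2) U] unfolding J_def by metis
  define K where "K = H ** J ** H"
  define Vh where "Vh = tyler n U"
  have Kx: "K *v x = H *v (J *v (H *v x))" for x by (simp add: K_def matrix_vector_mul_assoc[symmetric])
  have Kf: "x \<bullet> (K *v y) = (H *v x) \<bullet> (H *v y) + (H *v x) \<bullet> (E *v (H *v y))" for x y
    by (simp add: Kx Jx sym_dot[OF H(1), symmetric] inner_add_right)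
  have Vhx: "Vh *v x = c *\<^sub>R (K *v x)" for x by (simp add: Vh_def c(2) K_def scaleR_matrix_vector)
  have Js: "(J *v x) \<bullet> y = x \<bullet> (J *v y)" for x y
    by (simp add: Jx inner_add_left inner_add_right sym_dot[OF E(1)])
  have "symmetric_m Vh"
    by (rule sym_from_dot) (simp add: Vhx Kx sym_dot[OF H(1)] Js)
  then have ex: "\<exists>lt. case lt of (l, t) \<Rightarrow> is_spectral_dec Vh l t" using spectral_dec_exists by auto
  obtain l t where lt: "spec_dec Vh = (l, t)" by (cases "spec_dec Vh") auto
  have sd: "is_spectral_dec Vh l t"
    using someI_ex[OF ex] lt unfolding spec_dec_def by simp
  then have on: "\<forall>j\<in>{1..CARD('p)}. \<forall>k\<in>{1..CARD('p)}. t j \<bullet> t k = (if j = k then 1 else 0)"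
    and ldec: "\<forall>j\<in>{1..<CARD('p)}. l j \<ge> l (Suc j)" and Vh: "Vh = (\<Sum>j=1..CARD('p). l j *\<^sub>R outer (t j) (t j))"
    by (auto simp: is_spectral_dec_def)
  have one: "1 \<in> {1..CARD('p)}" using p2 by simp
  have Vt1: "Vh *v t 1 = l 1 *\<^sub>R t 1" unfolding Vh by (rule spectral_eigen) (use on one in auto)
  have t1: "norm (t 1) = 1" using on one by (simp add: norm_eq_1)
  have lmax: "l j \<le> l 1" if "j \<in> {1..CARD('p)}" for j
    using that
  proof (induction j)
    case (Suc j)
    show ?case
    proof (cases "j = 0")
      case False
      then have "l (Suc j) \<le> l j" using ldec Suc.prems by auto
      then show ?thesis using Suc False by auto
    qed simp
  qed simp
  have Vmax: "x \<bullet> (Vh *v x) \<le> l 1 * (norm x)\<^sup>2" for x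
  proof -
    have "x \<bullet> (Vh *v x) = (\<Sum>j=1..CARD('p). l j * (t j \<bullet> x)\<^sup>2)" unfolding Vh spectral_quadratic ..
    also have "\<dots> \<le> (\<Sum>j=1..CARD('p). l 1 * (t j \<bullet> x)\<^sup>2)"
      by (intro sum_mono mult_right_mono lmax) auto
    also have "\<dots> = l 1 * (norm x)\<^sup>2"
    proof -
      have "(\<Sum>j=1..CARD('p). (t j \<bullet> x)\<^sup>2) = (norm x)\<^sup>2"
        unfolding power2_norm_eq_inner using orthonormal_norm[OF _ _ on, of x x] by (simp add: power2_eq_square)
      then show ?thesis by (simp only: sum_distrib_left[symmetric])
    qed
    finally show ?thesis .
  qed
  have \<epsilon>0: "0 \<le> \<epsilon>" using pp by (simp add: \<epsilon>_def)
  \<comment> \<open>Otherwise \<open>misaligned_eigenvector\<close> would apply to the very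
    maximiser that violates flatness.\<close>
  have aligned: "\<sigma> < \<bar>t 1 \<bullet> \<theta>\<bar>"
  proof (rule ccontr)
    assume "\<not> ?thesis"
    then have mis: "\<bar>t 1 \<bullet> \<theta>\<bar> \<le> \<sigma>" by simp
    obtain v where v: "v \<in> N" "\<forall>v'\<in>N. Cform n W (H *v v') (H *v v') \<le> Cform n W (H *v v) (H *v v)"
      and bad: "\<not> (h / 2 \<le> norm (H *v v) \<and> \<bar>\<Sum>i<n. (\<theta> \<bullet> W i) * ((H *v v) \<bullet> W i)\<bar> \<le> h * T)"
      using notflat unfolding flat_maximizers_def by blast
    have Kt: "K *v t 1 = (l 1 / c) *\<^sub>R t 1" using Vt1 c(1) unfolding Vhx by (metis divide_inverse_commute inverse_eq_divide less_irrefl real_vector_eq_affinity scaleR_scaleR vector_fraction_eq_iff add.right_neutral)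
    have Kmax: "x \<bullet> (K *v x) \<le> l 1 / c * (norm x)\<^sup>2" for x
      using Vmax[of x] c(1) unfolding Vhx by (simp add: field_simps)
    have net: "\<exists>v'. norm v' = 1 \<and> norm (u - v') \<le> m \<and> Cform n W (H *v v') (H *v v') \<le> Cform n W (H *v v) (H *v v)"
      if "norm u = 1" "u \<bullet> \<theta> = 0" for u
      using N(2)[OF that] N(1) v(2) by blast
    note me = misaligned_eigenvector[OF \<theta> H(1,3,4,5) E small(2) E2 \<epsilon>0 small(3) Kf Kt t1 Kmax mis \<sigma>(2) _ _ net small(4) m]
    define S where "S = emean n (\<lambda>i. (\<theta> \<bullet> W i) * ((H *v v) \<bullet> W i))"
    have "(p + 2) * \<bar>S\<bar> \<le> h * (sqrt (2 * e * (4 * e * \<sigma>\<^sup>2 + 4 * m + 2 * \<epsilon>)) + \<epsilon>)"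
      using me(1) N(1)[OF v(1)] unfolding S_def p_def by blast
    moreover have "1 * \<bar>S\<bar> \<le> (p + 2) * \<bar>S\<bar>" using pp by (intro mult_right_mono) auto
    ultimately have "\<bar>S\<bar> \<le> h * (sqrt (2 * e * (4 * e * \<sigma>\<^sup>2 + 4 * m + 2 * \<epsilon>)) + \<epsilon>)" by linarith
    then have "real n * \<bar>S\<bar> \<le> real n * (h * (sqrt (2 * e * (4 * e * \<sigma>\<^sup>2 + 4 * m + 2 * \<epsilon>)) + \<epsilon>))"
      by (rule mult_left_mono) simp
    also have "\<dots> = h * (real n * (sqrt (2 * e * (4 * e * \<sigma>\<^sup>2 + 4 * m + 2 * \<epsilon>)) + \<epsilon>))" by (simp only: mult_ac)
    also have "\<dots> \<le> h * T" using T H(4) by (intro mult_left_mono) auto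
    also have "real n * \<bar>S\<bar> = \<bar>\<Sum>i<n. (\<theta> \<bullet> W i) * ((H *v v) \<bullet> W i)\<bar>"
      using n1 by (simp add: S_def emean_def abs_mult)
    finally have "\<bar>\<Sum>i<n. (\<theta> \<bullet> W i) * ((H *v v) \<bullet> W i)\<bar> \<le> h * T" .
    moreover have "h / 2 \<le> norm (H *v v)" using me(2) N(1)[OF v(1)] by blast
    ultimately show False using bad by blast
  qed
  define C where "C = sqrt c *\<^sub>R H"
  have Cx: "C *v x = sqrt c *\<^sub>R (H *v x)" for x by (simp add: C_def scaleR_matrix_vector)
  note Hs = H
  \<comment> \<open>The scale c of the estimator goes into the root \<open>C\<close>, so that
    \<open>E\<close> remains the relative error.\<close>
  interpret frame_perturbed \<theta> t C E Vh l "sqrt c * h" e \<sigma>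
  proof
    show "norm \<theta> = 1" by (rule \<theta>)
    show "\<forall>j\<in>{1..CARD('p)}. \<forall>k\<in>{1..CARD('p)}. t j \<bullet> t k = (if j = k then 1 else 0)" by (rule on)
    show "t 1 \<bullet> \<theta> \<noteq> 0" using aligned \<sigma>(1) by auto
    show "symmetric_m C" by (rule sym_from_dot) (simp add: Cx sym_dot[OF H(1)])
    show "posdef_m C" using H(2) c(1) by (simp add: posdef_m_def Cx)
    show "C *v \<theta> = (sqrt c * h) *\<^sub>R \<theta>" by (simp add: Cx H(3))
    show "0 < sqrt c * h" using c(1) H(4) by simp
    show "norm (C *v x) \<le> sqrt c * h * norm x" for x
      using H(5)[of x] c(1) by (simp add: Cx mult.assoc)
    show "opb E e" by (rule E(2))
    show "e \<le> 1/8" by (rule small(2))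
    show "Vh = (\<Sum>j=1..CARD('p). l j *\<^sub>R outer (t j) (t j))" by (rule Vh)
    show "x \<bullet> (Vh *v y) = (C *v x) \<bullet> (C *v y) + (C *v x) \<bullet> (E *v (C *v y))" for x y
      using c(1) by (simp add: Vhx Cx Kf matrix_vector_scaleR distrib_left mult.assoc[symmetric])
    show "\<forall>j\<in>{1..<CARD('p)}. l (Suc j) \<le> l j" by (rule ldec)
    show "0 < \<sigma>" "\<sigma> \<le> \<bar>t 1 \<bullet> \<theta>\<bar>" using \<sigma> aligned by auto
  qed
  have Vtilde: "V_tilde n \<theta> U = Vt"
  proof -
    have "(\<Sum>j=2..CARD('p). l j *\<^sub>R outer (theta_tilde \<theta> t j) (theta_tilde \<theta> t j)) = (\<Sum>j=2..CARD('p). l j *\<^sub>R outer (f j) (f j))"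
      by (intro sum.cong refl) (simp add: theta_tilde_eq)
    then show ?thesis by (simp add: V_tilde_def Vh_def[symmetric] lt Vt_def)
  qed
  define \<rho> where "\<rho> = 9 * p * e / \<sigma> ^ 4"
  have \<rho>: "\<rho> \<le> 1/2" using \<eta> by (simp add: \<eta>_def \<rho>_def)
  have close: "\<bar>x \<bullet> (Vt *v x) - c * (norm (H *v x))\<^sup>2\<bar> \<le> (4 * \<rho>) * (c * (norm (H *v x))\<^sup>2)" for x
    using Vt_close[of x] \<rho> c(1) unfolding \<rho>_def p_def by (simp add: Cx power_mult_distrib)
  have "\<bar>T_n n \<theta> U Vt - T_n n \<theta> U V0\<bar> \<le> real n * real CARD('p) * (real CARD('p) + 2) *
     (3 * (2 * (4 * \<rho>)) * (real CARD('p) * G + (real CARD('p) * G * (2 * (4 * \<rho>)) + 2 * (2 * (4 * \<rho>))\<^sup>2))\<^sup>2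
      + (real CARD('p) * G * (2 * (4 * \<rho>)) + 2 * (2 * (4 * \<rho>))\<^sup>2) * (2 * (real CARD('p) * G) + (real CARD('p) * G * (2 * (4 * \<rho>)) + 2 * (2 * (4 * \<rho>))\<^sup>2)))"
    by (rule T_n_difference[OF W \<theta> U Hs(1-4) V0 c(1) Vt_symmetric Vt_posdef Vt_th0 _ close])
      (use l_bounds(2)[OF one] \<eta> in \<open>simp_all add: \<eta>_def \<rho>_def\<close>)
  moreover have "2 * (4 * \<rho>) = \<eta>" by (simp add: \<eta>_def \<rho>_def)
  ultimately show ?thesis unfolding Vtilde by (simp only: p_def[symmetric] d_def)
qed

section \<open>Convergence in probability\<close>

lemma outer_prob_le:
  assumes "B \<in> sets M" "A \<subseteq> B"
  shows "outer_prob M A \<le> measure M B"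
  unfolding outer_prob_def
  by (rule cInf_lower) (use assms in \<open>auto intro: bdd_belowI[of _ 0]\<close>)

text \<open>The inclusion provides a cover, so the infimum is taken over a nonempty set.\<close>

lemma outer_prob_nonneg:
  assumes "A \<subseteq> space M"
  shows "0 \<le> outer_prob M A"
  unfolding outer_prob_def
  by (rule cInf_greatest) (use assms in auto)

definition whiten :: "nat \<Rightarrow> real^'p^'p \<Rightarrow> (nat \<Rightarrow> real^'p) \<Rightarrow> (nat \<Rightarrow> real^'p)" where
  "whiten n V \<omega> = compose {..<n} (\<lambda>u. msqrt_inv V *v u /\<^sub>R norm (msqrt_inv V *v u)) \<omega>"

lemma measurable_whiten:
  "whiten n V \<in> measurable (sample_law n V) (unif_sample n)"
proof -
  have m: "(\<lambda>u. msqrt_inv V *v u /\<^sub>R norm (msqrt_inv V *v u)) \<in> measurable (ang_gauss V) unif_sphere"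
    by (simp add: measurable_cong_sets[OF sets_ang_gauss sets_unif_sphere])
  show ?thesis
    unfolding whiten_def[abs_def] compose_def sample_law_def unif_sample_def
    by (rule measurable_restrict, rule measurable_compose[OF _ m], rule measurable_component_singleton)
qed

lemma distr_whiten:
  assumes V: "symmetric_m V" "posdef_m V"
  shows "distr (sample_law n V) (unif_sample n) (whiten n V) = unif_sample n"
proof -
  let ?f = "\<lambda>u. msqrt_inv V *v u /\<^sub>R norm (msqrt_inv V *v u)"
  have m: "?f \<in> measurable (ang_gauss V) unif_sphere"
    by (simp add: measurable_cong_sets[OF sets_ang_gauss sets_unif_sphere])
  have "distr (sample_law n V) (unif_sample n) (whiten n V) = PiM {..<n} (\<lambda>_. distr (ang_gauss V) unif_sphere ?f)"
    unfolding sample_law_def unif_sample_def whiten_def[abs_def]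
    by (rule distr_PiM_finite_prob_space') (use prob_space_ang_gauss[OF V] prob_space_unif_sphere m in auto)
  also have "distr (ang_gauss V) unif_sphere ?f = distr (ang_gauss V) borel ?f"
    by (rule distr_cong) auto
  also have "\<dots> = unif_sphere" by (rule distr_ang_gauss[OF V])
  finally show ?thesis by (simp add: unif_sample_def)
qed

text \<open>The root is built as the inverse of \<open>msqrt_inv V\<close>, so that it undoes the
  whitening map literally.\<close>

lemma square_root_facts:
  fixes V :: "real^'p^'p"
  assumes V: "symmetric_m V" "posdef_m V"
  obtains H where "symmetric_m H" "posdef_m H" "H ** H = V" "\<And>x. H *v (msqrt_inv V *v x) = x"
proof -
  define R where "R = msqrt_inv V"
  note R = msqrt_inv_props[OF V, folded R_def]
  note invR = posdef_invertible[OF R(2)]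
  define H where "H = matrix_inv R"
  have H: "symmetric_m H" "posdef_m H" unfolding H_def
    using R sym_matrix_inv[OF R(1) invR] posdef_matrix_inv by auto
  have HR: "H *v (R *v x) = x" "R *v (H *v x) = x" for x unfolding H_def by (rule matrix_inv_mult[OF invR])+
  have "H ** H = V"
  proof (subst matrix_eq, rule)
    fix x
    have "matrix_inv V *v (H *v (H *v x)) = x"
      by (simp add: R(3)[symmetric] matrix_vector_mul_assoc[symmetric] HR)
    then have "V *v x = H *v (H *v x)"
      by (metis matrix_inv_mult(1)[OF posdef_invertible[OF V(2)]])
    then show "(H ** H) *v x = V *v x" by (simp add: matrix_vector_mul_assoc)
  qed
  then show ?thesis using that H HR(1) by (simp add: R_def)
qed

lemma inverse_sqrt_nat_tendsto: "(\<lambda>n. 1 / sqrt (real n)) \<longlonglongrightarrow> 0"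
  by (intro tendsto_divide_0[OF tendsto_const] filterlim_at_top_imp_at_infinity filterlim_compose[OF sqrt_at_top] filterlim_real_sequentially)

text \<open>Each smallness condition of the final limit is a continuous function of 1 / sqrt n, so
  its value at 0 decides.\<close>

lemma eventually_small_remainder:
  fixes F :: "real \<Rightarrow> real"
  assumes "isCont F 0" "F 0 < c"
  shows "\<forall>\<^sub>F n in sequentially. F (1 / sqrt (real n)) < c"
  using isCont_tendsto_compose[OF assms(1) inverse_sqrt_nat_tendsto] assms(2) by (rule order_tendstoD(2))

text \<open>The probability estimate at a single sample size; every constant is uniform in the shape matrix.\<close>
lemma outer_prob_bound:
  fixes \<theta> :: "real^'p" and V :: "real^'p^'p"
  assumes p2: "CARD('p) \<ge> 2" and \<theta>: "norm \<theta> = 1"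
    and V: "symmetric_m V" "posdef_m V" "V *v \<theta> = v *\<^sub>R \<theta>" "v > 0" "\<And>x. x \<bullet> (V *v x) \<le> v * (norm x)\<^sup>2"
    and n: "n \<ge> 1" and M: "M \<ge> 0" and \<sigma>: "0 < \<sigma>" "\<sigma> \<le> 1/2" and \<tau>: "\<tau> > 0" and \<delta>: "\<delta> > 0"
  defines "p \<equiv> real CARD('p)" and "x \<equiv> 1 / sqrt (real n)"
  defines "G \<equiv> p ^ 4 * M * x"
  defines "r \<equiv> 4 * p ^ 4 * G"
  defines "e \<equiv> 5 * r" and "\<epsilon> \<equiv> (12 + 46 * p) * r\<^sup>2"
  assumes small: "200 * p ^ 7 * G \<le> 1" "G * (2 * (p * (p + 2))) \<le> 1" "e \<le> 1/8" "\<epsilon> \<le> 1/8" "4 * e * \<sigma>\<^sup>2 + 4 * x\<^sup>2 + 2 * \<epsilon> \<le> 1/4"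
    and T: "sqrt (2 * e * (4 * e * \<sigma>\<^sup>2 + 4 * x\<^sup>2 + 2 * \<epsilon>)) + \<epsilon> \<le> \<tau> * x"
  defines "\<eta> \<equiv> 8 * (9 * p * e / \<sigma> ^ 4)"
  defines "d \<equiv> p * G * \<eta> + 2 * \<eta>\<^sup>2"
  assumes \<eta>: "\<eta> \<le> 1/4" and dev: "real n * p * (p + 2) * (3 * \<eta> * (p * G + d)\<^sup>2 + d * (2 * (p * G) + d)) \<le> \<epsilon>0"
  shows "outer_prob (sample_law n V) {\<omega>\<in>space (sample_law n V). \<bar>T_n n \<theta> \<omega> (V_tilde n \<theta> \<omega>) - T_n n \<theta> \<omega> V\<bar> > \<epsilon>0}
     \<le> p ^ 4 * (2 * exp (- M\<^sup>2 / 2)) + 2 * (\<delta> + 4 * (8 * (p * (p + 2)) * \<tau>\<^sup>2) / \<delta>\<^sup>2 + x\<^sup>2 / \<tau>\<^sup>2)"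
proof -
  let ?U = "unif_sample n :: (nat \<Rightarrow> real^'p) measure"
  interpret U: prob_space ?U by (rule prob_space_unif_sample)
  have xpos: "x > 0" using n by (simp add: x_def)
  have x2: "x\<^sup>2 = 1 / real n" using n by (simp add: x_def power_divide)
  have nx: "real n * x = sqrt (real n)" using n by (simp add: x_def real_div_sqrt)
  have pp: "p \<ge> 2" using p2 by (simp add: p_def)
  obtain H where H: "symmetric_m H" "posdef_m H" "H ** H = V" "\<And>x. H *v (msqrt_inv V *v x) = x"
    using square_root_facts[OF V(1,2)] by metis
  define h where "h = sqrt v"
  have h: "h > 0" "h\<^sup>2 = v" using V(4) by (simp_all add: h_def)
  have HH: "H *v (H *v y) = V *v y" for y by (simp add: H(3)[symmetric] matrix_vector_mul_assoc)
  have H\<theta>: "H *v \<theta> = h *\<^sub>R \<theta>"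
    by (rule sqrt_eigen[OF H(1,2) _ h(1)]) (simp add: HH V(3) h(2))
  have Hle: "norm (H *v y) \<le> h * norm y" for y
  proof (rule power2_le_imp_le)
    have "(norm (H *v y))\<^sup>2 = y \<bullet> (V *v y)" by (simp add: power2_norm_eq_inner HH[symmetric] sym_dot[OF H(1)])
    then show "(norm (H *v y))\<^sup>2 \<le> (h * norm y)\<^sup>2" using V(5)[of y] h by (simp add: power_mult_distrib)
  qed (use h in simp)
  \<comment> \<open>The mesh 1/n puts the net error at the order of \<epsilon>. The cardinality of
    the net enters no estimate, so the net may grow with n.\<close>
  obtain N where N: "finite N" "N \<noteq> {}" "\<And>v. v \<in> N \<Longrightarrow> norm v = 1 \<and> v \<bullet> \<theta> = 0"
    "\<And>u. norm u = 1 \<Longrightarrow> u \<bullet> \<theta> = 0 \<Longrightarrow> \<exists>v\<in>N. norm (u - v) \<le> x\<^sup>2"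
    using hyperplane_sphere_net[of "x\<^sup>2" \<theta>] xpos p2 by (metis zero_less_power)
  define T where "T = \<tau> * sqrt (real n)"
  have Tpos: "T > 0" using \<tau> n by (simp add: T_def)
  define q where "q = p * (p + 2)"
  have q: "q > 0" using pp by (simp add: q_def)
  \<comment> \<open>The largest constant for which A T^2 stays below the lower bound n / (8 q) for
    the sum of squares.\<close>
  define A where "A = 1 / (8 * q * \<tau>\<^sup>2)"
  have A: "A > 0" using q \<tau> by (simp add: A_def)
  have g: "M / sqrt (real n) \<ge> 0" using M by simp
  have gG: "M / sqrt (real n) * real CARD('p) ^ 4 = G" by (simp add: G_def x_def p_def)
  \<comment> \<open>The bad event has three parts: moments far from isotropic, flat maximisers, and
    the null event that some standardised observation is not of unit length.\<close>
  define B1 where "B1 = {\<omega>\<in>space ?U. \<not> moments_near n \<omega> (M / sqrt (real n))}"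
  define B2 where "B2 = {\<omega>\<in>space ?U. (\<forall>i<n. norm (\<omega> i) = 1) \<and> moments_near n \<omega> (M / sqrt (real n)) \<and> flat_maximizers n \<omega> \<theta> H h T N}"
  define B3 where "B3 = {\<omega>\<in>space ?U. \<not> (\<forall>i<n. norm (\<omega> i) = 1)}"
  have B1: "B1 \<in> sets ?U"
    using sets.compl_sets[OF sets_moments_near[of n "M / sqrt (real n)", where 'p='p]] by (auto simp: B1_def set_diff_eq cong: conj_cong)
  have P1: "U.prob B1 \<le> p ^ 4 * (2 * exp (- M\<^sup>2 / 2))"
    unfolding B1_def p_def by (rule prob_moments_far[OF n M])
  have B2: "B2 \<in> sets ?U" "U.prob B2 \<le> 2 * (\<delta> + 4 / (\<delta>\<^sup>2 * A) + 1 / T\<^sup>2)"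
  proof -
    have 1: "M / sqrt (real n) * real CARD('p) ^ 4 * (2 * (real CARD('p) * (real CARD('p) + 2))) \<le> 1"
      unfolding gG using small(2) by (simp add: p_def)
    have 2: "A * T\<^sup>2 * (8 * (real CARD('p) * (real CARD('p) + 2))) \<le> real n"
    proof -
      have "A * T\<^sup>2 * (8 * q) = real n" using q \<tau> by (simp add: A_def T_def power_mult_distrib)
      then show ?thesis by (simp add: q_def p_def)
    qed
    note * = prob_flat_maximizers[OF \<theta> H(1) H\<theta> h(1) Hle N(1-3) n g 1 Tpos A 2 \<delta>]
    show "B2 \<in> sets ?U" unfolding B2_def by (rule *(1))
    show "U.prob B2 \<le> 2 * (\<delta> + 4 / (\<delta>\<^sup>2 * A) + 1 / T\<^sup>2)" unfolding B2_def by (rule *(2))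
  qed
  have B3: "B3 \<in> sets ?U" unfolding B3_def by measurable
  have P3: "U.prob B3 = 0"
  proof -
    have "AE \<omega> in ?U. \<omega> \<notin> B3" using AE_unif_sample_norm[of n, where 'p='p] by eventually_elim (simp add: B3_def)
    then show ?thesis using B3 by (simp add: U.prob_eq_0)
  qed
  define Bad where "Bad = B1 \<union> B2 \<union> B3"
  have Bad: "Bad \<in> sets ?U" unfolding Bad_def using B1 B2 B3 by auto
  have PBad: "U.prob Bad \<le> p ^ 4 * (2 * exp (- M\<^sup>2 / 2)) + 2 * (\<delta> + 4 / (\<delta>\<^sup>2 * A) + 1 / T\<^sup>2)"
    unfolding Bad_def using measure_Un_le[of "B1 \<union> B2" ?U B3] measure_Un_le[of B1 ?U B2] B1 B2 B3 P1 P3 by auto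
  define S where "S = whiten n V -` Bad \<inter> space (sample_law n V)"
  have Ss: "S \<in> sets (sample_law n V)" unfolding S_def by (rule measurable_sets[OF measurable_whiten Bad])
  have PS: "measure (sample_law n V) S = U.prob Bad"
  proof -
    have "U.prob Bad = measure (distr (sample_law n V) ?U (whiten n V)) Bad" by (simp only: distr_whiten[OF V(1,2)])
    also have "\<dots> = measure (sample_law n V) S" unfolding S_def by (rule measure_distr[OF measurable_whiten Bad])
    finally show ?thesis by simp
  qed
  have sub: "{\<omega>\<in>space (sample_law n V). \<bar>T_n n \<theta> \<omega> (V_tilde n \<theta> \<omega>) - T_n n \<theta> \<omega> V\<bar> > \<epsilon>0} \<subseteq> S"
  proof (rule subsetI, rule ccontr)
    fix \<omega> assume w: "\<omega> \<in> {\<omega>\<in>space (sample_law n V). \<bar>T_n n \<theta> \<omega> (V_tilde n \<theta> \<omega>) - T_n n \<theta> \<omega> V\<bar> > \<epsilon>0}" and nS: "\<omega> \<notin> S"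
    define W where "W = whiten n V \<omega>"
    have "W \<in> space ?U" using w measurable_space[OF measurable_whiten] by (auto simp: W_def)
    then have W1: "\<forall>i<n. norm (W i) = 1" and mo: "moments_near n W (M / sqrt (real n))" and nf: "\<not> flat_maximizers n W \<theta> H h T N"
      using w nS by (auto simp: S_def Bad_def B1_def B2_def B3_def W_def[symmetric])
    have iso: "near_iso n W G" using moments_near_iso[OF n W1 g mo] unfolding gG .
    have Wi: "W i = msqrt_inv V *v \<omega> i /\<^sub>R norm (msqrt_inv V *v \<omega> i)" if "i < n" for i
      using that by (simp add: W_def whiten_def compose_def)
    have U: "\<omega> i = norm (msqrt_inv V *v \<omega> i) *\<^sub>R (H *v W i) \<and> norm (msqrt_inv V *v \<omega> i) \<noteq> 0" if "i < n" for i
    proof -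
      have nz: "norm (msqrt_inv V *v \<omega> i) \<noteq> 0"
      proof
        assume "norm (msqrt_inv V *v \<omega> i) = 0"
        then have "W i = 0" by (simp add: Wi[OF that])
        then show False using W1 that by auto
      qed
      then show ?thesis by (simp add: Wi[OF that] matrix_vector_scaleR H(4))
    qed
    have TT: "real n * (sqrt (2 * e * (4 * e * \<sigma>\<^sup>2 + 4 * x\<^sup>2 + 2 * \<epsilon>)) + \<epsilon>) \<le> T"
    proof -
      have "real n * (sqrt (2 * e * (4 * e * \<sigma>\<^sup>2 + 4 * x\<^sup>2 + 2 * \<epsilon>)) + \<epsilon>) \<le> real n * (\<tau> * x)" using T by (rule mult_left_mono) simp
      also have "\<dots> = \<tau> * (real n * x)" by simp
      finally show ?thesis by (simp only: T_def nx)
    qed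
    have "\<bar>T_n n \<theta> \<omega> (V_tilde n \<theta> \<omega>) - T_n n \<theta> \<omega> V\<bar> \<le> real n * p * (p + 2) * (3 * \<eta> * (p * G + d)\<^sup>2 + d * (2 * (p * G) + d))"
      unfolding p_def d_def \<eta>_def e_def r_def
      by (rule deviation_bound[where m = "x\<^sup>2" and T = T and N = N, OF p2 \<theta> H(1,2) H\<theta> h(1) Hle H(3)[symmetric] U iso N(3,4) _ nf \<sigma>])
        (use small TT \<eta> in \<open>simp_all add: p_def d_def \<eta>_def e_def r_def \<epsilon>_def\<close>)
    then show False using w dev by simp
  qed
  have "outer_prob (sample_law n V) {\<omega>\<in>space (sample_law n V). \<bar>T_n n \<theta> \<omega> (V_tilde n \<theta> \<omega>) - T_n n \<theta> \<omega> V\<bar> > \<epsilon>0} \<le> U.prob Bad"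
    unfolding PS[symmetric] by (rule outer_prob_le[OF Ss sub])
  also note PBad
  also have "4 / (\<delta>\<^sup>2 * A) = 4 * (8 * (p * (p + 2)) * \<tau>\<^sup>2) / \<delta>\<^sup>2" by (simp add: A_def q_def)
  also have "1 / T\<^sup>2 = x\<^sup>2 / \<tau>\<^sup>2" using n by (simp add: T_def x2 power_mult_distrib)
  finally show ?thesis .
qed

theorem theorem2:
  fixes \<theta>0 :: "real^'p"
    and lam :: "nat \<Rightarrow> nat \<Rightarrow> real"
    and th :: "nat \<Rightarrow> nat \<Rightarrow> real^'p"
    and V0 :: "nat \<Rightarrow> real^'p^'p"
  assumes p2: "CARD('p) \<ge> 2"
    and th0: "norm \<theta>0 = 1"
    and orth: "\<forall>n. \<forall>j\<in>{2..CARD('p)}. \<forall>k\<in>{2..CARD('p)}.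
                  th n j \<bullet> th n k = (if j = k then 1 else 0)"
    and perp: "\<forall>n. \<forall>j\<in>{2..CARD('p)}. th n j \<bullet> \<theta>0 = 0"
    and basis: "\<forall>n. span (th n ` {2..CARD('p)}) = {x. x \<bullet> \<theta>0 = 0}"
    and lam1: "\<forall>n. lam n 1 > lam n 2"
    and lamdec: "\<forall>n. \<forall>j\<in>{2..<CARD('p)}. lam n j \<ge> lam n (Suc j)"
    and lampos: "\<forall>n. lam n CARD('p) > 0"
    and V0_def: "\<forall>n. V0 n = lam n 1 *\<^sub>R outer \<theta>0 \<theta>0
                     + (\<Sum>j=2..CARD('p). lam n j *\<^sub>R outer (th n j) (th n j))"
    and V0_shape: "\<forall>n. shape_matrix (V0 n)"
  shows "\<forall>\<epsilon>>0. (\<lambda>n. outer_prob (sample_law n (V0 n))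
            {\<omega> \<in> space (sample_law n (V0 n)).
               \<bar>T_n n \<theta>0 \<omega> (V_tilde n \<theta>0 \<omega>) - T_n n \<theta>0 \<omega> (V0 n)\<bar> > \<epsilon>})
          \<longlonglongrightarrow> 0"
proof (intro allI impI)
  fix \<epsilon>0 :: real assume \<epsilon>0: "\<epsilon>0 > 0"
  define p where "p = real CARD('p)"
  have pp: "p \<ge> 2" using p2 by (simp add: p_def)
  have V: "symmetric_m (V0 n)" "posdef_m (V0 n)" "V0 n *v \<theta>0 = lam n 1 *\<^sub>R \<theta>0" "lam n 1 > 0"
    "\<And>x. x \<bullet> (V0 n *v x) \<le> lam n 1 * (norm x)\<^sup>2" for n
  proof -
    show "symmetric_m (V0 n)" and pd: "posdef_m (V0 n)" using V0_shape by (auto simp: shape_matrix_def)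
    define b where "b j = (if j = (1::nat) then \<theta>0 else th n j)" for j
    have on: "\<forall>j\<in>{1..CARD('p)}. \<forall>k\<in>{1..CARD('p)}. b j \<bullet> b k = (if j = k then 1 else 0)"
    proof (intro ballI)
      fix j k assume jk: "j \<in> {1..CARD('p)}" "k \<in> {1..CARD('p)}"
      have "\<theta>0 \<bullet> \<theta>0 = 1" using th0 by (simp add: norm_eq_1)
      then show "b j \<bullet> b k = (if j = k then 1 else 0)"
        using jk orth perp by (auto simp: b_def inner_commute)
    qed
    have "{1..CARD('p)} = insert 1 {2..CARD('p)}" using p2 by auto
    moreover have "(\<Sum>j=2..CARD('p). lam n j *\<^sub>R outer (th n j) (th n j)) = (\<Sum>j=2..CARD('p). lam n j *\<^sub>R outer (b j) (b j))"
      by (intro sum.cong) (auto simp: b_def)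
    ultimately have Vb: "V0 n = (\<Sum>j=1..CARD('p). lam n j *\<^sub>R outer (b j) (b j))"
      using V0_def by (simp add: b_def)
    have one: "1 \<in> {1..CARD('p)}" using p2 by simp
    have "V0 n *v b 1 = lam n 1 *\<^sub>R b 1" unfolding Vb by (rule spectral_eigen) (use on one in auto)
    then show e: "V0 n *v \<theta>0 = lam n 1 *\<^sub>R \<theta>0" by (simp add: b_def)
    have "\<theta>0 \<noteq> 0" using th0 by auto
    then have "\<theta>0 \<bullet> (V0 n *v \<theta>0) > 0" using pd by (simp add: posdef_m_def)
    then show "lam n 1 > 0" unfolding e using th0 by (simp add: norm_eq_1)
    have le: "lam n j \<le> lam n 1" if "j \<in> {1..CARD('p)}" for j
    proof (cases "j = 1")
      case False
      then have "2 \<le> j" "j \<le> CARD('p)" using that by auto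
      then have "lam n j \<le> lam n 2"
      proof (induction j rule: dec_induct)
        case (step j)
        then have "lam n (Suc j) \<le> lam n j" using lamdec by auto
        then show ?case using step by simp
      qed simp
      then show ?thesis using lam1 by (meson less_imp_le order_trans)
    qed simp
    show "x \<bullet> (V0 n *v x) \<le> lam n 1 * (norm x)\<^sup>2" for x
    proof -
      have "x \<bullet> (V0 n *v x) = (\<Sum>j=1..CARD('p). lam n j * (b j \<bullet> x)\<^sup>2)" unfolding Vb spectral_quadratic ..
      also have "\<dots> \<le> (\<Sum>j=1..CARD('p). lam n 1 * (b j \<bullet> x)\<^sup>2)"
        by (intro sum_mono mult_right_mono le) auto
      also have "\<dots> = lam n 1 * (norm x)\<^sup>2"
      proof -
        have "(\<Sum>j=1..CARD('p). (b j \<bullet> x)\<^sup>2) = (norm x)\<^sup>2"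
          unfolding power2_norm_eq_inner using orthonormal_norm[OF _ _ on, of x x] by (simp add: power2_eq_square)
        then show ?thesis by (simp only: sum_distrib_left[symmetric])
      qed
      finally show ?thesis .
    qed
  qed
  show "(\<lambda>n. outer_prob (sample_law n (V0 n)) {\<omega> \<in> space (sample_law n (V0 n)).
       \<bar>T_n n \<theta>0 \<omega> (V_tilde n \<theta>0 \<omega>) - T_n n \<theta>0 \<omega> (V0 n)\<bar> > \<epsilon>0}) \<longlonglongrightarrow> 0" (is "?P \<longlonglongrightarrow> 0")
  proof (rule tendstoI)
    fix \<kappa> :: real assume \<kappa>: "\<kappa> > 0"
    \<comment> \<open>The constants are fixed in the order \<open>M\<close>, \<delta>, \<tau>,
      \<sigma>, and only then does n grow. \<open>M\<close> makes the moment event likely.\<close>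
    have "((\<lambda>M. p ^ 4 * (2 * exp (- M\<^sup>2 / 2))) \<longlongrightarrow> 0) at_top" by real_asymp
    then have "\<forall>\<^sub>F M in at_top. p ^ 4 * (2 * exp (- M\<^sup>2 / 2)) < \<kappa> / 2" using \<kappa> by (intro order_tendstoD(2)) auto
    then have "\<forall>\<^sub>F M in at_top. p ^ 4 * (2 * exp (- M\<^sup>2 / 2)) < \<kappa> / 2 \<and> M \<ge> 1"
      using eventually_ge_at_top[of "1::real"] by eventually_elim simp
    then obtain M where M: "p ^ 4 * (2 * exp (- M\<^sup>2 / 2)) < \<kappa> / 2" "M \<ge> 1"
      using eventually_happens' trivial_limit_at_top_linorder by blast
    \<comment> \<open>The three anticoncentration terms are each made at most \<delta>; doubled,
      they contribute 6 \<kappa> / 16 < \<kappa> / 2.\<close>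
    define \<delta> where "\<delta> = \<kappa> / 16"
    have \<delta>: "\<delta> > 0" using \<kappa> by (simp add: \<delta>_def)
    define q where "q = p * (p + 2)"
    have q: "q > 0" using pp by (simp add: q_def)
    \<comment> \<open>The solution of 32 q \<tau>^2 / \<delta>^2 = \<delta>, which balances the
      second anticoncentration term with the first.\<close>
    define \<tau> where "\<tau> = \<delta> * sqrt (\<delta> / (32 * q))"
    have \<tau>: "\<tau> > 0" using \<delta> q by (simp add: \<tau>_def)
    have \<tau>q: "4 * (8 * q * \<tau>\<^sup>2) / \<delta>\<^sup>2 = \<delta>" using \<delta> q by (simp add: \<tau>_def power_mult_distrib)
    define a where "a = 5 * (4 * p ^ 4 * (p ^ 4 * M))"
    have a: "a > 0" using pp M by (simp add: a_def)
    define b where "b = (12 + 46 * p) * (4 * p ^ 4 * (p ^ 4 * M))\<^sup>2"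
    \<comment> \<open>In the limit the linear statistic of a misaligned sample is confined to sqrt 8
      a \<sigma> in units of sqrt n. The choice a \<sigma> \<le> \<tau> / 4 puts this strictly below
      \<tau>.\<close>
    define \<sigma> where "\<sigma> = min (1/2) (\<tau> / (4 * a))"
    have \<sigma>: "0 < \<sigma>" "\<sigma> \<le> 1/2" using \<tau> a by (auto simp: \<sigma>_def)
    have a\<sigma>: "8 * (a * \<sigma>)\<^sup>2 < \<tau>\<^sup>2"
    proof -
      have "\<sigma> \<le> \<tau> / (4 * a)" by (simp add: \<sigma>_def)
      then have "a * \<sigma> \<le> \<tau> / 4" using a by (simp add: field_simps)
      then have "(a * \<sigma>)\<^sup>2 \<le> (\<tau> / 4)\<^sup>2" using a \<sigma> by (intro power_mono) auto
      then have "8 * (a * \<sigma>)\<^sup>2 \<le> \<tau>\<^sup>2 / 2" by (simp add: power_divide)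
      also have "\<dots> < \<tau>\<^sup>2" using \<tau> by simp
      finally show ?thesis .
    qed
    define G where "G x = p ^ 4 * M * x" for x
    define r where "r x = 4 * p ^ 4 * G x" for x
    define e where "e x = 5 * r x" for x
    define \<epsilon> where "\<epsilon> x = (12 + 46 * p) * (r x)\<^sup>2" for x
    define \<eta> where "\<eta> x = 8 * (9 * p * e x / \<sigma> ^ 4)" for x
    define d where "d x = p * G x * \<eta> x + 2 * (\<eta> x)\<^sup>2" for x
    note defs = G_def r_def e_def \<epsilon>_def \<eta>_def d_def
    have ea: "e x = a * x" and \<epsilon>b: "\<epsilon> x = b * x\<^sup>2" for x
      by (simp_all add: defs a_def b_def power_mult_distrib)
    define x where "x n = 1 / sqrt (real n)" for n
    \<comment> \<open>As functions of x = 1 / sqrt n, G, e and \<eta> are linear while \<epsilon>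
      and d are quadratic, so every condition becomes a continuous expression in x.\<close>
    define c1 c2 where "c1 = 8 * (9 * p * a / \<sigma> ^ 4)" and "c2 = p * (p ^ 4 * M) * c1 + 2 * c1\<^sup>2"
    have \<eta>c: "\<eta> x = c1 * x" for x by (simp add: \<eta>_def ea c1_def)
    have dc: "d x = c2 * x\<^sup>2" for x by (simp add: d_def \<eta>c G_def c2_def power_mult_distrib power2_eq_square algebra_simps)
    have "\<forall>\<^sub>F n in sequentially. 200 * p ^ 7 * G (x n) < 1"
      unfolding x_def G_def by (rule eventually_small_remainder) (auto intro!: continuous_intros)
    moreover have "\<forall>\<^sub>F n in sequentially. G (x n) * (2 * (p * (p + 2))) < 1"
      unfolding x_def G_def by (rule eventually_small_remainder) (auto intro!: continuous_intros)
    moreover have "\<forall>\<^sub>F n in sequentially. e (x n) < 1/8"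
      unfolding x_def ea by (rule eventually_small_remainder) (auto intro!: continuous_intros)
    moreover have "\<forall>\<^sub>F n in sequentially. \<epsilon> (x n) < 1/8"
      unfolding x_def \<epsilon>b by (rule eventually_small_remainder) (auto intro!: continuous_intros)
    moreover have "\<forall>\<^sub>F n in sequentially. 4 * e (x n) * \<sigma>\<^sup>2 + 4 * (x n)\<^sup>2 + 2 * \<epsilon> (x n) < 1/4"
      unfolding x_def ea \<epsilon>b by (rule eventually_small_remainder) (auto intro!: continuous_intros)
    \<comment> \<open>The window condition after division by x: the expression under the root is x^2
      times 8 (a \<sigma>)^2 plus a term of order x.\<close>
    moreover have "\<forall>\<^sub>F n in sequentially. sqrt (8 * (a * \<sigma>)\<^sup>2 + (8 * a + 4 * a * b) * x n) + b * x n < \<tau>"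
      unfolding x_def
    proof (rule eventually_small_remainder)
      show "isCont (\<lambda>x. sqrt (8 * (a * \<sigma>)\<^sup>2 + (8 * a + 4 * a * b) * x) + b * x) 0" by (intro continuous_intros)
      show "sqrt (8 * (a * \<sigma>)\<^sup>2 + (8 * a + 4 * a * b) * 0) + b * 0 < \<tau>"
        using a\<sigma> \<tau> by (simp add: real_less_lsqrt)
    qed
    moreover have "\<forall>\<^sub>F n in sequentially. \<eta> (x n) < 1/4"
      unfolding x_def \<eta>c by (rule eventually_small_remainder) (auto intro!: continuous_intros)
    \<comment> \<open>The deviation of the statistic after cancelling n against x^2. What is left
      has order x, which is where the vanishing first-order term of \<open>zvec_perturb\<close> pays
      off.\<close>
    moreover have "\<forall>\<^sub>F n in sequentially. p * (p + 2) * (3 * c1 * x n * (p * (p ^ 4 * M) + c2 * x n)\<^sup>2 + c2 * (2 * (p * (p ^ 4 * M)) * x n + c2 * (x n)\<^sup>2)) < \<epsilon>0"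
      unfolding x_def by (rule eventually_small_remainder) (auto intro!: continuous_intros simp: \<epsilon>0)
    moreover have "\<forall>\<^sub>F n in sequentially. (x n)\<^sup>2 / \<tau>\<^sup>2 < \<delta>"
      unfolding x_def by (rule eventually_small_remainder) (use \<delta> \<tau> in \<open>auto intro!: continuous_intros\<close>)
    moreover have "\<forall>\<^sub>F n in sequentially. n \<ge> 1" by (rule eventually_ge_at_top)
    ultimately show "\<forall>\<^sub>F n in sequentially. dist (?P n) 0 < \<kappa>"
    proof eventually_elim
      case (elim n)
      note s = elim
      have xpos: "x n > 0" using s(10) by (simp add: x_def)
      have nx2: "real n * (x n)\<^sup>2 = 1" using s(10) by (simp add: x_def power_divide)
      have T: "sqrt (2 * e (x n) * (4 * e (x n) * \<sigma>\<^sup>2 + 4 * (x n)\<^sup>2 + 2 * \<epsilon> (x n))) + \<epsilon> (x n) \<le> \<tau> * x n"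
      proof -
        have "2 * e (x n) * (4 * e (x n) * \<sigma>\<^sup>2 + 4 * (x n)\<^sup>2 + 2 * \<epsilon> (x n)) = (8 * (a * \<sigma>)\<^sup>2 + (8 * a + 4 * a * b) * x n) * (x n)\<^sup>2"
          unfolding ea \<epsilon>b by (simp add: power2_eq_square algebra_simps)
        then have "sqrt (2 * e (x n) * (4 * e (x n) * \<sigma>\<^sup>2 + 4 * (x n)\<^sup>2 + 2 * \<epsilon> (x n)))
            = sqrt (8 * (a * \<sigma>)\<^sup>2 + (8 * a + 4 * a * b) * x n) * x n"
          using xpos by (simp only: real_sqrt_mult real_sqrt_abs abs_of_pos)
        then have "sqrt (2 * e (x n) * (4 * e (x n) * \<sigma>\<^sup>2 + 4 * (x n)\<^sup>2 + 2 * \<epsilon> (x n))) + \<epsilon> (x n)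
            = (sqrt (8 * (a * \<sigma>)\<^sup>2 + (8 * a + 4 * a * b) * x n) + b * x n) * x n"
          unfolding \<epsilon>b by (simp only: distrib_right power2_eq_square mult.assoc)
        also have "\<dots> \<le> \<tau> * x n" using s(6) xpos by (intro mult_right_mono) auto
        finally show ?thesis .
      qed
      have dev: "real n * p * (p + 2) * (3 * \<eta> (x n) * (p * G (x n) + d (x n))\<^sup>2 + d (x n) * (2 * (p * G (x n)) + d (x n))) \<le> \<epsilon>0"
      proof -
        have "3 * \<eta> (x n) * (p * G (x n) + d (x n))\<^sup>2 + d (x n) * (2 * (p * G (x n)) + d (x n))
          = (x n)\<^sup>2 * (3 * c1 * x n * (p * (p ^ 4 * M) + c2 * x n)\<^sup>2 + c2 * (2 * (p * (p ^ 4 * M)) * x n + c2 * (x n)\<^sup>2))"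
          unfolding \<eta>c dc G_def by (simp add: power2_eq_square algebra_simps)
        then have "real n * p * (p + 2) * (3 * \<eta> (x n) * (p * G (x n) + d (x n))\<^sup>2 + d (x n) * (2 * (p * G (x n)) + d (x n)))
          = (real n * (x n)\<^sup>2) * (p * (p + 2) * (3 * c1 * x n * (p * (p ^ 4 * M) + c2 * x n)\<^sup>2 + c2 * (2 * (p * (p ^ 4 * M)) * x n + c2 * (x n)\<^sup>2)))"
          by (simp only: mult_ac)
        then show ?thesis using s(8) unfolding nx2 by linarith
      qed
      have "?P n \<le> p ^ 4 * (2 * exp (- M\<^sup>2 / 2)) + 2 * (\<delta> + 4 * (8 * (p * (p + 2)) * \<tau>\<^sup>2) / \<delta>\<^sup>2 + (x n)\<^sup>2 / \<tau>\<^sup>2)"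
        unfolding p_def x_def
        by (rule outer_prob_bound[OF p2 th0 V s(10) _ \<sigma> \<tau> \<delta>, where ?\<epsilon>0.0 = \<epsilon>0 and M = M],
            fold p_def x_def, fold G_def, fold r_def, fold e_def \<epsilon>_def, fold \<eta>_def, fold d_def)
          (use M s T dev in \<open>linarith\<close>)+
      also have "\<dots> < \<kappa> / 2 + 2 * (\<delta> + \<delta> + \<delta>)"
        using M(1) s(9) \<tau>q unfolding q_def by (intro add_less_le_mono) auto
      also have "\<dots> < \<kappa>" using \<kappa> by (simp add: \<delta>_def)
      finally show "dist (?P n) 0 < \<kappa>"
        using outer_prob_nonneg[of "{\<omega> \<in> space (sample_law n (V0 n)). \<bar>T_n n \<theta>0 \<omega> (V_tilde n \<theta>0 \<omega>) - T_n n \<theta>0 \<omega> (V0 n)\<bar> > \<epsilon>0}" "sample_law n (V0 n)"]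
        by (simp add: dist_real_def)
    qed
  qed
qed

end
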